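(* Let $d\ge 1$ be an integer and $\alpha\in(0,2)$ with $d>\alpha$. Let $\{w_{x,y}\}$ be random conductances on $\mathbb Z^d$ satisfying Assumption (H1) described in the context. Let $\lambda>0$ and $\gamma>0$. Then there is a $[1,\infty]$-valued random variable $k_0$, finite $\mathbb P$-almost surely and depending only on $\gamma,\alpha,\lambda$ (not on $f$), such that for every $f\in\mathscr S_0^\lambda$ there is a constant $C_0>0$ (depending on $f,\gamma,\alpha,\lambda$) such that for $\mathbb P$-a.e. $\omega$ and all integers $k>k_0(\omega)$, $$ \|R_\lambda^{k,\omega}f-\bar R_\lambda f\|_{L^2(\mathbb R^d;dx)}\le C_0\begin{cases}\min\Big\{k^{-\alpha/2}\log^{\frac{\alpha(1+\gamma)}{(4(d-\alpha))\wedge(2d)}}k,\ k^{-((1-\alpha)\wedge(d/2))}\log^{1/2}k\Big\}, & \alpha\in(0,1),\\[1mm] k^{-1/2}\log^{1+\frac{1+\gamma}{(4(d-1))\wedge(2d)}}k, & \alpha=1,\\[1mm] k^{-(2-\alpha)/2}\log^{\frac{\alpha(1+\gamma)}{(4(d-\alpha))\wedge(2d)}}k, & \alpha\in(1,2).\end{cases} $$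
   Context: Assumption (H1): on a probability space $(\Omega,\mathcal F,\mathbb P)$, $\{w_{x,y}:\{x,y\}\subset\mathbb Z^d,\ x\neq y\}$ is a family, indexed by unordered pairs of distinct points of $\mathbb Z^d$, of i.i.d. non-negative random variables with $w_{x,y}=w_{y,x}$, $\mathbb E[w_{x,y}]=1$, and $w_{x,y}\le M$ for all $x\ne y$ for some constant $M>0$. $|\cdot|$ is the Euclidean norm. For $k\in\{1,2,\dots\}$, $\mu^k$ is the measure on $k^{-1}\mathbb Z^d$ giving mass $k^{-d}$ to each point. The scaled operator is $\mathcal L^{k,\omega}g(x)=k^{-d}\sum_{y\in k^{-1}\mathbb Z^d,\,y\neq x}(g(y)-g(x))\frac{w_{kx,ky}(\omega)}{|x-y|^{d+\alpha}}$ for $x\in k^{-1}\mathbb Z^d$, $g\in L^2(k^{-1}\mathbb Z^d;\mu^k)$. For $f$ bounded continuous and in $L^2(k^{-1}\mathbb Z^d;\mu^k)$ (restricted to $k^{-1}\mathbb Z^d$), $R^{k,\omega}_\lambda f$ denotes the unique $u\in L^2(k^{-1}\mathbb Z^d;\mu^k)$ with $(\lambda-\mathcal L^{k,\omega})u=f$ on $k^{-1}\mathbb Z^d$, extended to $\mathbb R^d$ by $u(x)=u(z)$ for $x\in\prod_{i=1}^d(z_i,z_i+k^{-1}]$, $z\in k^{-1}\mathbb Z^d$. The limit operator is $\bar{\mathcal L}g(x)=\lim_{\varepsilon\to0}\int_{\{|y-x|\ge\varepsilon\}}(g(y)-g(x))|x-y|^{-d-\alpha}\,dy$ for $g\in C^2_c(\mathbb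 R^d)$ (a constant multiple of the fractional Laplacian $-(-\Delta)^{\alpha/2}$), and $\bar R_\lambda=(\lambda-\bar{\mathcal L})^{-1}$ is its resolvent on $L^2(\mathbb R^d;dx)$. Finally $\mathscr S_0^\lambda=\{(\lambda-\bar{\mathcal L})g:\ g\in C_c^\infty(\mathbb R^d)\}$. *)

theory Defs
  imports "HOL-Probability.Probability"
begin

text \<open>A point z of Z^d (type int^'n, d = CARD('n)) represents the point z/k of k^{-1} Z^d.
  Functions on k^{-1} Z^d are encoded as functions g on Z^d with g z = value at z/k.\<close>

definition lat_pt :: "nat \<Rightarrow> int ^ 'n \<Rightarrow> real ^ 'n" where
  "lat_pt k z = (\<chi> i. real_of_int (z $ i) / real k)"

text \<open>Membership in L^2(k^{-1} Z^d; mu^k) (the constant weight k^{-d} is irrelevant).\<close>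
definition lat_L2 :: "(int ^ 'n \<Rightarrow> real) \<Rightarrow> bool" where
  "lat_L2 g \<longleftrightarrow> (\<lambda>z. (g z)\<^sup>2) summable_on UNIV"

definition lat_edges :: "(int ^ 'n) set set" where
  "lat_edges = {{x, y} | x y. x \<noteq> y}"

definition Lk :: "((int ^ 'n) set \<Rightarrow> 'w \<Rightarrow> real) \<Rightarrow> nat \<Rightarrow> real \<Rightarrow> 'w
     \<Rightarrow> (int ^ 'n \<Rightarrow> real) \<Rightarrow> int ^ 'n \<Rightarrow> real" where
  "Lk w k \<alpha> \<omega> g z = (1 / real k ^ CARD('n)) *
     (\<Sum>\<^sub>\<infinity> y \<in> UNIV - {z}. (g y - g z) * w {z, y} \<omega> /
        norm (lat_pt k z - lat_pt k y) powr (real CARD('n) + \<alpha>))"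

text \<open>Discrete resolvent: the unique L^2 solution u of (lambda - L^{k,omega}) u = f on the
  lattice, where f is restricted to k^{-1} Z^d; then extended to R^d as a step function:
  u(x) = u(z) for x in prod_i (z_i, z_i + 1/k], i.e. z_i = ceiling(k x_i) - 1.\<close>
definition Rk_lat :: "((int ^ 'n) set \<Rightarrow> 'w \<Rightarrow> real) \<Rightarrow> nat \<Rightarrow> real \<Rightarrow> 'w \<Rightarrow> real
     \<Rightarrow> (real ^ 'n \<Rightarrow> real) \<Rightarrow> int ^ 'n \<Rightarrow> real" where
  "Rk_lat w k \<alpha> \<omega> lam f = (THE u. lat_L2 u \<and>
      (\<forall>z. lam * u z - Lk w k \<alpha> \<omega> u z = f (lat_pt k z)))"

definition Rk :: "((int ^ 'n) set \<Rightarrow> 'w \<Rightarrow> real) \<Rightarrow> nat \<Rightarrow> real \<Rightarrow> 'w \<Rightarrow> real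
     \<Rightarrow> (real ^ 'n \<Rightarrow> real) \<Rightarrow> real ^ 'n \<Rightarrow> real" where
  "Rk w k \<alpha> \<omega> lam f x = Rk_lat w k \<alpha> \<omega> lam f (\<chi> i. \<lceil>real k * x $ i\<rceil> - 1)"

definition Lbar :: "real \<Rightarrow> (real ^ 'n \<Rightarrow> real) \<Rightarrow> real ^ 'n \<Rightarrow> real" where
  "Lbar \<alpha> g x = Lim (at_right 0) (\<lambda>\<epsilon>.
      LINT y : {y. \<epsilon> \<le> dist y x} | lborel. (g y - g x) / dist x y powr (real CARD('n) + \<alpha>))"

fun iter_pd :: "'n list \<Rightarrow> (real ^ 'n \<Rightarrow> real) \<Rightarrow> real ^ 'n \<Rightarrow> real" where
  "iter_pd [] f = f"
| "iter_pd (i # is) f = (\<lambda>x. deriv (\<lambda>t. iter_pd is f (x + t *\<^sub>R axis i 1)) 0)"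

definition smooth_fun :: "(real ^ 'n \<Rightarrow> real) \<Rightarrow> bool" where
  "smooth_fun f \<longleftrightarrow> (\<forall>is. continuous_on UNIV (iter_pd is f) \<and>
      (\<forall>i x. (\<lambda>t. iter_pd is f (x + t *\<^sub>R axis i 1)) differentiable (at 0)))"

definition Cc_inf :: "(real ^ 'n \<Rightarrow> real) set" where
  "Cc_inf = {g. smooth_fun g \<and> compact (closure {x. g x \<noteq> 0})}"

definition S0 :: "real \<Rightarrow> real \<Rightarrow> (real ^ 'n \<Rightarrow> real) set" where
  "S0 \<alpha> lam = {(\<lambda>x. lam * g x - Lbar \<alpha> g x) | g. g \<in> Cc_inf}"

text \<open>The resolvent (lambda - Lbar)^{-1}, evaluated on S_0^lambda: for f = (lambda - Lbar) g with
  g in C_c^infinity, it is the (unique) such g.\<close>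
definition Rbar :: "real \<Rightarrow> real \<Rightarrow> (real ^ 'n \<Rightarrow> real) \<Rightarrow> real ^ 'n \<Rightarrow> real" where
  "Rbar \<alpha> lam f = (THE g. g \<in> Cc_inf \<and> (\<forall>x. lam * g x - Lbar \<alpha> g x = f x))"

definition L2_dist_sq :: "(real ^ 'n \<Rightarrow> real) \<Rightarrow> (real ^ 'n \<Rightarrow> real) \<Rightarrow> ennreal" where
  "L2_dist_sq u v = (\<integral>\<^sup>+ x. ennreal ((u x - v x)\<^sup>2) \<partial>lborel)"

definition rate :: "nat \<Rightarrow> real \<Rightarrow> real \<Rightarrow> nat \<Rightarrow> real" where
  "rate d \<alpha> \<gamma> k =
     (if \<alpha> < 1 then
        min (real k powr (-\<alpha>/2) * ln (real k) powr (\<alpha> * (1 + \<gamma>) / min (4 * (real d - \<alpha>)) (2 * real d)))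
            (real k powr (- min (1 - \<alpha>) (real d / 2)) * ln (real k) powr (1/2))
      else if \<alpha> = 1 then
        real k powr (-1/2) * ln (real k) powr (1 + (1 + \<gamma>) / min (4 * (real d - 1)) (2 * real d))
      else
        real k powr (-(2 - \<alpha>)/2) * ln (real k) powr (\<alpha> * (1 + \<gamma>) / min (4 * (real d - \<alpha>)) (2 * real d)))"

end

theory Submission
  imports Defs
begin

text \<open>
  Let u be the discrete resolvent of f = (lam - Lbar) g. On the lattice the error h = u - g solves
  (lam - Lk) h = F + psi, where F is the centred random part of Lk g and psi is the deterministic quadrature
  error of its mean. By the energy identity it suffices to bound the pairing of F with h on a box of side about
  k^2. With P_J the averaging over dyadic cubes of side 2^J,
  (F, h) = (F, h - P_{J0} h) + sum_{J0 <= J < m} (P_J F, h - P_{J+1} h) + (P_m F, h).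
  The differences h - P_J h are controlled by the energy through a Poincare inequality on cubes, which holds once
  any two points of a cube of side at least 2^{J0}, about (log k)^((1 + gamma)/d), are joined by many two-step paths
  of positive conductance; the averages P_J F are small by Hoeffding's inequality. The exceptional events
  do not depend on f because g is expanded into a fixed finite family of Lipschitz atoms with absolutely bounded
  coefficient sum. Their probabilities are O(k^(-2)), so the Borel-Cantelli lemma yields k0, and the
  finitely many k below a threshold depending on g are absorbed into C0.
\<close>

section \<open>Lattice sums\<close>

text \<open>Conductances may vanish, so the energy need not see single edges, and for \<alpha> \<ge>
  1 the fluctuation F is too large for a direct Cauchy-Schwarz estimate against h. Two powers of the
  scale compete: on cubes of side 2^J the Poincare inequality costs 2^(J \<alpha> / 2), while
  centring gains 2^(-J d / 2) in the averages of F. As \<alpha> < d, the scales sum geometrically,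
  the finest one dominates, and 2^(J0 \<alpha> / 2) is the logarithm in the rate. At J0 nothing is
  averaged: F is bounded through the Lipschitz constant of g if \<alpha> > 1, where |z|^(1 - d -
  \<alpha>) is summable, and by concentration at single sites, at the price of log k, if \<alpha>
  \<le> 1. The box is wide enough for its top averages to gain k^(-d) and for F outside it to be
  negligible. The logarithmic exponent obtained, \<alpha> (1 + \<gamma>) / (2 d), is at most the
  stated one; the extra log k is covered by a smaller power of k for \<alpha> < 1 and by the
  additional logarithm of the rate for \<alpha> = 1.\<close>

definition lnorm :: "int ^ 'n \<Rightarrow> real" where
  "lnorm z = norm (lat_pt 1 z)"

lemma lat_pt_nth [simp]: "lat_pt k z $ i = real_of_int (z $ i) / real k"
  by (simp add: lat_pt_def)

lemma lat_pt_diff: "lat_pt k x - lat_pt k y = lat_pt k (x - y)"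
  by (simp add: vec_eq_iff diff_divide_distrib)

lemma lat_pt_add: "lat_pt k x + lat_pt k y = lat_pt k (x + y)"
  by (simp add: vec_eq_iff add_divide_distrib)

lemma norm_lat_pt: "norm (lat_pt k z) = lnorm z / real k"
proof -
  have "lat_pt k z = (1 / real k) *\<^sub>R lat_pt 1 z"
    by (simp add: vec_eq_iff)
  then show ?thesis
    by (simp add: lnorm_def)
qed

lemma lnorm_nonneg [simp]: "0 \<le> lnorm z"
  by (simp add: lnorm_def)

lemma lnorm_0 [simp]: "lnorm 0 = 0"
  by (simp add: lnorm_def lat_pt_def zero_vec_def[symmetric])

lemma lnorm_minus [simp]: "lnorm (- z) = lnorm z"
proof -
  have "lat_pt 1 (- z) = - lat_pt 1 z"
    by (simp add: vec_eq_iff)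
  then show ?thesis by (simp add: lnorm_def)
qed

lemma lnorm_commute: "lnorm (x - y) = lnorm (y - x)"
  by (metis lnorm_minus minus_diff_eq)

lemma lnorm_triangle: "lnorm (x + y) \<le> lnorm x + lnorm y"
  by (metis lat_pt_add lnorm_def norm_triangle_ineq)

lemma component_le_lnorm: "\<bar>real_of_int (z $ i)\<bar> \<le> lnorm z"
  using component_le_norm_cart[of "lat_pt 1 z" i] by (simp add: lnorm_def)

lemma lnorm_ge_1: "z \<noteq> 0 \<Longrightarrow> 1 \<le> lnorm z"
proof -
  assume "z \<noteq> 0"
  then obtain i where "z $ i \<noteq> 0"
    by (auto simp: vec_eq_iff)
  then have "1 \<le> \<bar>real_of_int (z $ i)\<bar>"
    by linarith
  with component_le_lnorm[of z i] show ?thesis by linarith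
qed

lemma lnorm_le_card:
  fixes z :: "int ^ 'n"
  assumes "\<And>i. \<bar>real_of_int (z $ i)\<bar> \<le> r"
  shows "lnorm z \<le> real CARD('n) * r"
proof -
  have "lnorm z \<le> (\<Sum>i\<in>UNIV. \<bar>lat_pt 1 z $ i\<bar>)"
    unfolding lnorm_def by (rule norm_le_l1_cart)
  also have "\<dots> \<le> (\<Sum>i\<in>(UNIV :: 'n set). r)"
    by (rule sum_mono) (use assms in simp)
  finally show ?thesis by simp
qed

definition lbox :: "int \<Rightarrow> int \<Rightarrow> (int ^ 'n) set" where
  "lbox a b = {z. \<forall>i. a \<le> z $ i \<and> z $ i \<le> b}"

lemma bij_betw_lbox: "bij_betw (\<lambda>f. \<chi> i. f i) (PiE UNIV (\<lambda>_. {a..b})) (lbox a b :: (int ^ 'n) set)"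
  by (rule bij_betwI[where g = "\<lambda>z. ($) z"]) (auto simp: lbox_def vec_eq_iff)

lemma finite_lbox [simp]: "finite (lbox a b)"
  using bij_betw_finite[OF bij_betw_lbox, of a b] by (simp add: finite_PiE)

lemma card_lbox: "card (lbox a b :: (int ^ 'n) set) = nat (b - a + 1) ^ CARD('n)"
proof -
  have "card (PiE (UNIV :: 'n set) (\<lambda>_. {a..b})) = card (lbox a b :: (int ^ 'n) set)"
    by (rule bij_betw_same_card[OF bij_betw_lbox])
  then show ?thesis by (simp add: card_PiE algebra_simps)
qed

lemma lnorm_ball_subset_lbox: "{z. lnorm z \<le> r} \<subseteq> lbox (- \<lfloor>r\<rfloor>) \<lfloor>r\<rfloor>"
proof
  fix z :: "int ^ 'n" assume "z \<in> {z. lnorm z \<le> r}"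
  then have "\<bar>real_of_int (z $ i)\<bar> \<le> r" for i
    using component_le_lnorm[of z i] by simp
  then have "\<bar>z $ i\<bar> \<le> \<lfloor>r\<rfloor>" for i
    by (metis le_floor_iff of_int_abs)
  then show "z \<in> lbox (- \<lfloor>r\<rfloor>) \<lfloor>r\<rfloor>"
    unfolding lbox_def by (simp add: abs_le_iff) (metis minus_le_iff)
qed

lemma finite_lnorm_ball [simp]: "finite {z. lnorm z \<le> r}"
  using lnorm_ball_subset_lbox finite_lbox finite_subset by metis

lemma card_lnorm_ball:
  assumes "1 \<le> r"
  shows "real (card {z :: int ^ 'n. lnorm z \<le> r}) \<le> (3 * r) ^ CARD('n)"
proof -
  have "card {z :: int ^ 'n. lnorm z \<le> r} \<le> card (lbox (- \<lfloor>r\<rfloor>) \<lfloor>r\<rfloor> :: (int ^ 'n) set)"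
    by (rule card_mono[OF finite_lbox lnorm_ball_subset_lbox])
  then have "real (card {z :: int ^ 'n. lnorm z \<le> r}) \<le> real (nat (2 * \<lfloor>r\<rfloor> + 1)) ^ CARD('n)"
    by (simp add: card_lbox of_nat_mono flip: of_nat_power)
  also have "real (nat (2 * \<lfloor>r\<rfloor> + 1)) \<le> 3 * r"
    using assms by linarith
  then have "real (nat (2 * \<lfloor>r\<rfloor> + 1)) ^ CARD('n) \<le> (3 * r) ^ CARD('n)"
    by (rule power_mono) simp
  finally show ?thesis .
qed

lemma sum_int_powr_bounded:
  fixes q :: real
  assumes "1 < q"
  shows "\<exists>C. \<forall>n::nat. (\<Sum>j\<in>{- int n..int n}. max 1 \<bar>real_of_int j\<bar> powr (- q)) \<le> C"
proof -
  have S: "summable (\<lambda>i::nat. real i powr (- q))"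
    using assms by (simp add: summable_real_powr_iff)
  define C where "C = (\<Sum>i. real i powr (- q))"
  have "(\<Sum>j\<in>{- int n..int n}. max 1 \<bar>real_of_int j\<bar> powr (- q)) \<le> 2 * C + 1" for n :: nat
  proof -
    have un: "{- int n..int n} = (\<lambda>i. - int i) ` {1..n} \<union> {0} \<union> int ` {1..n}"
    proof -
      have "x \<in> (\<lambda>i. - int i) ` {1..n} \<union> {0} \<union> int ` {1..n}" if "x \<in> {- int n..int n}" for x
      proof -
        consider "x < 0" | "x = 0" | "x > 0" by linarith
        then show ?thesis
        proof cases
          case 1
          then have "x = - int (nat (- x))" "nat (- x) \<in> {1..n}" using that by auto
          then show ?thesis by blast
        next
          case 3
          then have "x = int (nat x)" "nat x \<in> {1..n}" using that by auto
          then show ?thesis by blast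
        qed simp
      qed
      then have "{- int n..int n} \<subseteq> (\<lambda>i. - int i) ` {1..n} \<union> {0} \<union> int ` {1..n}" by blast
      moreover have "(\<lambda>i. - int i) ` {1..n} \<union> {0} \<union> int ` {1..n} \<subseteq> {- int n..int n}" by auto
      ultimately show ?thesis by (rule subset_antisym)
    qed
    have p: "(\<Sum>i\<in>{1..n}. real i powr (- q)) \<le> C"
      unfolding C_def by (rule sum_le_suminf[OF S]) auto
    have "(\<Sum>j\<in>{- int n..int n}. max 1 \<bar>real_of_int j\<bar> powr (- q))
        = (\<Sum>j\<in>(\<lambda>i. - int i) ` {1..n}. max 1 \<bar>real_of_int j\<bar> powr (- q)) + 1
          + (\<Sum>j\<in>int ` {1..n}. max 1 \<bar>real_of_int j\<bar> powr (- q))"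
      unfolding un by (subst sum.union_disjoint; (subst sum.union_disjoint)?; force?)
    also have "(\<Sum>j\<in>(\<lambda>i. - int i) ` {1..n}. max 1 \<bar>real_of_int j\<bar> powr (- q))
        = (\<Sum>i\<in>{1..n}. real i powr (- q))"
      by (subst sum.reindex) (auto simp: inj_on_def intro!: sum.cong)
    also have "(\<Sum>j\<in>int ` {1..n}. max 1 \<bar>real_of_int j\<bar> powr (- q)) = (\<Sum>i\<in>{1..n}. real i powr (- q))"
      by (subst sum.reindex) (auto simp: inj_on_def intro!: sum.cong)
    finally show ?thesis using p by linarith
  qed
  then show ?thesis by blast
qed

text \<open>Each factor max 1 |z_i| is at most the norm once z is nonzero, so splitting the exponent
  evenly over the coordinates reduces lattice sums to one-dimensional ones. At the origin the
  left-hand side is 0 by the convention \<open>0 powr r = 0\<close>; the same convention removes the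
  diagonal from every kernel sum below.\<close>

lemma lnorm_powr_le_prod:
  fixes z :: "int ^ 'n"
  assumes "0 < p"
  shows "lnorm z powr (- p) \<le> (\<Prod>i\<in>UNIV. max 1 \<bar>real_of_int (z $ i)\<bar> powr (- (p / real CARD('n))))"
proof (cases "z = 0")
  case True
  then show ?thesis by (simp add: prod_nonneg)
next
  case False
  have "(\<Prod>i\<in>(UNIV :: 'n set). lnorm z powr (- (p / real CARD('n))))
      \<le> (\<Prod>i\<in>UNIV. max 1 \<bar>real_of_int (z $ i)\<bar> powr (- (p / real CARD('n))))"
  proof (rule prod_mono, intro conjI)
    fix i :: 'n
    have "max 1 \<bar>real_of_int (z $ i)\<bar> \<le> lnorm z"
      using lnorm_ge_1[OF False] component_le_lnorm[of z i] by simp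
    then show "lnorm z powr (- (p / real CARD('n))) \<le> max 1 \<bar>real_of_int (z $ i)\<bar> powr (- (p / real CARD('n)))"
      using assms by (intro powr_mono2') auto
  qed simp
  moreover have "(\<Prod>i\<in>(UNIV :: 'n set). lnorm z powr (- (p / real CARD('n)))) = lnorm z powr (- p)"
    using lnorm_ge_1[OF False] powr_realpow[of "lnorm z powr (- (p / real CARD('n)))" "CARD('n)"]
    by (simp add: powr_powr False)
  ultimately show ?thesis by simp
qed

text \<open>The exponent per coordinate, p divided by the dimension, exceeds 1 exactly when p
  exceeds the dimension. Finite sums are enlarged to boxes, where the sum of products over all
  points factors into a product of sums.\<close>

lemma summable_lnorm_powr:
  fixes p :: real
  assumes "real CARD('n) < p"
  shows "(\<lambda>z :: int ^ 'n. lnorm z powr (- p)) summable_on UNIV"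
proof -
  define q where "q = p / real CARD('n)"
  have q: "1 < q" using assms by (simp add: q_def)
  obtain C where C: "\<And>n::nat. (\<Sum>j\<in>{- int n..int n}. max 1 \<bar>real_of_int j\<bar> powr (- q)) \<le> C"
    using sum_int_powr_bounded[OF q] by blast
  have "sum (\<lambda>z :: int ^ 'n. lnorm z powr (- p)) X \<le> C ^ CARD('n)" if X: "finite X" for X
  proof -
    define r where "r = Max (insert 0 (lnorm ` X))"
    have r: "lnorm z \<le> r" if "z \<in> X" for z
      unfolding r_def using X that by (intro Max_ge) auto
    define n where "n = nat \<lfloor>r\<rfloor>"
    have r0: "0 \<le> r" unfolding r_def using X by (intro Max_ge) auto
    have sub: "X \<subseteq> lbox (- int n) (int n)"
      using r lnorm_ball_subset_lbox[of r] r0 by (auto simp: n_def)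
    have "sum (\<lambda>z :: int ^ 'n. lnorm z powr (- p)) X
        \<le> sum (\<lambda>z :: int ^ 'n. lnorm z powr (- p)) (lbox (- int n) (int n))"
      by (rule sum_mono2[OF finite_lbox sub]) simp
    also have "\<dots> \<le> (\<Sum>z\<in>lbox (- int n) (int n). \<Prod>i\<in>(UNIV :: 'n set). max 1 \<bar>real_of_int (z $ i)\<bar> powr (- q))"
      unfolding q_def by (intro sum_mono lnorm_powr_le_prod) (use assms less_trans in fastforce)
    also have "\<dots> = (\<Sum>f\<in>PiE UNIV (\<lambda>_. {- int n..int n}). \<Prod>i\<in>(UNIV :: 'n set). max 1 \<bar>real_of_int (f i)\<bar> powr (- q))"
      by (subst sum.reindex_bij_betw[OF bij_betw_lbox, symmetric]) simp
    also have "\<dots> = (\<Prod>i\<in>(UNIV :: 'n set). \<Sum>j\<in>{- int n..int n}. max 1 \<bar>real_of_int j\<bar> powr (- q))"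
      by (rule prod_sum_PiE[symmetric]) auto
    also have "\<dots> \<le> C ^ CARD('n)"
      using C[of n] by (simp add: power_mono sum_nonneg)
    finally show ?thesis .
  qed
  then show ?thesis
    by (intro nonneg_bdd_above_summable_on) (auto simp: bdd_above_def)
qed

section \<open>Nonlocal operators with dominated kernels\<close>

lemma
  fixes f g :: "'a \<Rightarrow> real"
  assumes "f summable_on A" "g summable_on A"
  shows summable_on_diff_real: "(\<lambda>x. f x - g x) summable_on A"
    and infsum_diff_real: "(\<Sum>\<^sub>\<infinity>x\<in>A. f x - g x) = infsum f A - infsum g A"
proof -
  have "((\<lambda>x. f x + (-1) * g x) has_sum infsum f A + (-1) * infsum g A) A"
    by (intro has_sum_add has_sum_cmult_right has_sum_infsum assms)
  then have "((\<lambda>x. f x - g x) has_sum infsum f A - infsum g A) A"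
    by simp
  then show "(\<lambda>x. f x - g x) summable_on A" "(\<Sum>\<^sub>\<infinity>x\<in>A. f x - g x) = infsum f A - infsum g A"
    by (auto simp: summable_on_def infsumI)
qed

lemma four_mult_le_square_sum: "4 * (x * y) \<le> (x + y)\<^sup>2" for x y :: real
  using zero_le_power2[of "x - y"] unfolding power2_diff power2_sum by simp

lemma abs_mult_le_squares: "\<bar>a * b\<bar> \<le> a\<^sup>2 + b\<^sup>2" for a b :: real
proof -
  have "0 \<le> \<bar>a\<bar> * \<bar>b\<bar>" by simp
  moreover have "2 * (\<bar>a\<bar> * \<bar>b\<bar>) \<le> a\<^sup>2 + b\<^sup>2"
    using sum_squares_bound[of "\<bar>a\<bar>" "\<bar>b\<bar>"] by simp
  ultimately show ?thesis unfolding abs_mult by linarith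
qed

lemma infsum_shift:
  fixes \<rho> :: "'a :: ab_group_add \<Rightarrow> real"
  shows "(\<lambda>y. \<rho> (x - y)) summable_on UNIV \<longleftrightarrow> \<rho> summable_on UNIV"
    and "infsum (\<lambda>y. \<rho> (x - y)) UNIV = infsum \<rho> UNIV"
proof -
  have b: "bij_betw (\<lambda>y. x - y) UNIV UNIV"
    by (rule bij_betwI[where g = "\<lambda>y. x - y"]) auto
  show "(\<lambda>y. \<rho> (x - y)) summable_on UNIV \<longleftrightarrow> \<rho> summable_on UNIV"
    by (rule summable_on_reindex_bij_betw[OF b])
  show "infsum (\<lambda>y. \<rho> (x - y)) UNIV = infsum \<rho> UNIV"
    by (rule infsum_reindex_bij_betw[OF b])
qed

lemma infsum_shift':
  fixes \<rho> :: "'a :: ab_group_add \<Rightarrow> real"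
  shows "(\<lambda>x. \<rho> (x - y)) summable_on UNIV \<longleftrightarrow> \<rho> summable_on UNIV"
    and "infsum (\<lambda>x. \<rho> (x - y)) UNIV = infsum \<rho> UNIV"
proof -
  have b: "bij_betw (\<lambda>x. x - y) UNIV UNIV"
    by (rule bij_betwI[where g = "\<lambda>x. x + y"]) auto
  show "(\<lambda>x. \<rho> (x - y)) summable_on UNIV \<longleftrightarrow> \<rho> summable_on UNIV"
    by (rule summable_on_reindex_bij_betw[OF b])
  show "infsum (\<lambda>x. \<rho> (x - y)) UNIV = infsum \<rho> UNIV"
    by (rule infsum_reindex_bij_betw[OF b])
qed

lemma summable_on_abs_comparison:
  fixes f g :: "'a \<Rightarrow> real"
  assumes "g summable_on A" "\<And>x. x \<in> A \<Longrightarrow> \<bar>f x\<bar> \<le> g x"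
  shows "f summable_on A" "(\<lambda>x. \<bar>f x\<bar>) summable_on A"
proof -
  show "(\<lambda>x. \<bar>f x\<bar>) summable_on A"
    by (rule summable_on_comparison_test[OF assms(1)]) (use assms(2) in auto)
  then show "f summable_on A"
    using summable_on_iff_abs_summable_on_real by fastforce
qed

lemma abs_infsum_le:
  fixes f g :: "'a \<Rightarrow> real"
  assumes "g summable_on A" "\<And>x. x \<in> A \<Longrightarrow> \<bar>f x\<bar> \<le> g x"
  shows "\<bar>infsum f A\<bar> \<le> infsum g A"
proof -
  note s = summable_on_abs_comparison[OF assms]
  have "\<bar>infsum f A\<bar> \<le> infsum (\<lambda>x. \<bar>f x\<bar>) A"
    using norm_infsum_bound[of f A] s(2) by simp
  also have "\<dots> \<le> infsum g A"
    by (rule infsum_mono[OF s(2) assms(1)]) (use assms(2) in auto)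
  finally show ?thesis .
qed

lemma square_summable_bounded:
  fixes u :: "'a \<Rightarrow> real"
  assumes "(\<lambda>x. (u x)\<^sup>2) summable_on UNIV"
  shows "\<bar>u x\<bar> \<le> sqrt (\<Sum>\<^sub>\<infinity>x. (u x)\<^sup>2)"
proof -
  have "(u x)\<^sup>2 \<le> (\<Sum>\<^sub>\<infinity>x. (u x)\<^sup>2)"
    using finite_sum_le_infsum[OF assms, of "{x}"] by simp
  then show ?thesis
    using real_le_rsqrt real_sqrt_abs real_sqrt_le_mono by metis
qed

lemma square_summable_mult:
  fixes u v :: "'a \<Rightarrow> real"
  assumes "(\<lambda>x. (u x)\<^sup>2) summable_on A" "(\<lambda>x. (v x)\<^sup>2) summable_on A"
  shows "(\<lambda>x. u x * v x) summable_on A"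
proof (rule summable_on_abs_comparison(1))
  show "(\<lambda>x. (u x)\<^sup>2 + (v x)\<^sup>2) summable_on A"
    by (intro summable_on_add assms)
  show "\<bar>u x * v x\<bar> \<le> (u x)\<^sup>2 + (v x)\<^sup>2" for x
    by (rule abs_mult_le_squares)
qed

lemma square_summable_add:
  fixes u v :: "'a \<Rightarrow> real"
  assumes "(\<lambda>x. (u x)\<^sup>2) summable_on A" "(\<lambda>x. (v x)\<^sup>2) summable_on A"
  shows "(\<lambda>x. (u x + v x)\<^sup>2) summable_on A"
proof -
  have "(\<lambda>x. (u x)\<^sup>2 + (v x)\<^sup>2 + 2 * (u x * v x)) summable_on A"
    by (intro summable_on_add summable_on_cmult_right square_summable_mult assms)
  then show ?thesis by (simp add: power2_sum mult.assoc)
qed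

text \<open>On a lattice of fixed mesh the jump kernel has no singularity, and a summable
  translation-invariant majorant bounds all row sums at once. The generator is then a bounded
  operator and its resolvent is elementary. Symmetry makes the column sums equal to the row
  sums.\<close>

locale dominated_kernel =
  fixes a :: "'a :: ab_group_add \<Rightarrow> 'a \<Rightarrow> real" and \<rho> :: "'a \<Rightarrow> real"
  assumes nonneg: "0 \<le> a x y" and sym: "a x y = a y x"
    and dom: "a x y \<le> \<rho> (x - y)" and summ: "\<rho> summable_on UNIV"
begin

definition tot :: real where "tot = infsum \<rho> UNIV"

definition deg :: "'a \<Rightarrow> real" where "deg x = infsum (a x) UNIV"

definition gen :: "('a \<Rightarrow> real) \<Rightarrow> 'a \<Rightarrow> real" where
  "gen u x = (\<Sum>\<^sub>\<infinity>y. a x y * (u y - u x))"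

text \<open>The generator is lazy minus tot times the identity, and lazy has nonnegative
  weights of constant total mass tot, so the resolvent equation is a fixed point problem for a contraction.\<close>

definition lazy :: "('a \<Rightarrow> real) \<Rightarrow> 'a \<Rightarrow> real" where
  "lazy u x = (\<Sum>\<^sub>\<infinity>y. a x y * u y) + (tot - deg x) * u x"

lemma rho_nonneg: "0 \<le> \<rho> z"
  using nonneg[of z 0] dom[of z 0] by simp

lemma tot_nonneg: "0 \<le> tot"
  unfolding tot_def by (rule infsum_nonneg) (rule rho_nonneg)

lemma row_summable: "a x summable_on UNIV"
  by (rule summable_on_comparison_test[OF infsum_shift(1)[of \<rho> x, THEN iffD2, OF summ]]) (auto simp: dom nonneg)

lemma deg_bounds: "0 \<le> deg x" "deg x \<le> tot"
proof -
  show "0 \<le> deg x" unfolding deg_def by (rule infsum_nonneg) (rule nonneg)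
  have "deg x \<le> infsum (\<lambda>y. \<rho> (x - y)) UNIV" unfolding deg_def
    by (rule infsum_mono[OF row_summable infsum_shift(1)[THEN iffD2, OF summ]]) (rule dom)
  then show "deg x \<le> tot" by (simp add: tot_def infsum_shift(2))
qed

lemma bounded_row_summable:
  assumes "\<And>y. \<bar>u y\<bar> \<le> K"
  shows "(\<lambda>y. a x y * u y) summable_on UNIV"
  by (rule summable_on_abs_comparison(1)[OF summable_on_cmult_left[OF row_summable[of x], of K]])
    (use assms nonneg in \<open>auto simp: abs_mult intro: mult_left_mono\<close>)

lemma bounded_row_bound:
  assumes "\<And>y. \<bar>u y\<bar> \<le> K"
  shows "\<bar>\<Sum>\<^sub>\<infinity>y. a x y * u y\<bar> \<le> deg x * K"
proof -
  have "\<bar>\<Sum>\<^sub>\<infinity>y. a x y * u y\<bar> \<le> (\<Sum>\<^sub>\<infinity>y. a x y * K)"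
    by (rule abs_infsum_le[OF summable_on_cmult_left[OF row_summable[of x], of K]])
      (use assms nonneg in \<open>auto simp: abs_mult intro: mult_left_mono\<close>)
  then show ?thesis by (simp add: deg_def infsum_cmult_left')
qed

lemma gen_eq_lazy:
  assumes "\<And>y. \<bar>u y\<bar> \<le> K"
  shows "gen u x = lazy u x - tot * u x"
proof -
  have "gen u x = (\<Sum>\<^sub>\<infinity>y. a x y * u y - a x y * u x)"
    by (simp add: gen_def algebra_simps)
  also have "\<dots> = (\<Sum>\<^sub>\<infinity>y. a x y * u y) - (\<Sum>\<^sub>\<infinity>y. a x y * u x)"
    by (intro infsum_diff_real bounded_row_summable[OF assms] summable_on_cmult_left row_summable)
  also have "(\<Sum>\<^sub>\<infinity>y. a x y * u x) = deg x * u x"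
    by (simp add: deg_def infsum_cmult_left')
  finally show ?thesis by (simp add: lazy_def algebra_simps)
qed

lemma lazy_bound:
  assumes "\<And>y. \<bar>u y\<bar> \<le> K"
  shows "\<bar>lazy u x\<bar> \<le> tot * K"
proof -
  have "\<bar>lazy u x\<bar> \<le> \<bar>\<Sum>\<^sub>\<infinity>y. a x y * u y\<bar> + \<bar>(tot - deg x) * u x\<bar>"
    unfolding lazy_def by (rule abs_triangle_ineq)
  also have "\<dots> \<le> deg x * K + (tot - deg x) * K"
    using bounded_row_bound[OF assms] assms[of x] deg_bounds[of x]
    by (intro add_mono) (auto simp: abs_mult intro!: mult_left_mono)
  finally show ?thesis by (simp add: algebra_simps)
qed

lemma lazy_diff:
  assumes "\<And>y. \<bar>u y\<bar> \<le> K" "\<And>y. \<bar>v y\<bar> \<le> K'"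
  shows "lazy (\<lambda>y. u y - v y) x = lazy u x - lazy v x"
proof -
  have "(\<Sum>\<^sub>\<infinity>y. a x y * u y - a x y * v y) = (\<Sum>\<^sub>\<infinity>y. a x y * u y) - (\<Sum>\<^sub>\<infinity>y. a x y * v y)"
    by (intro infsum_diff_real bounded_row_summable[OF assms(1)] bounded_row_summable[OF assms(2)])
  then show ?thesis by (simp add: lazy_def algebra_simps)
qed

section \<open>Square summable functions and the Schur test\<close>

lemma square_row:
  assumes "(\<lambda>x. (u x)\<^sup>2) summable_on UNIV"
  shows "(\<lambda>y. a x y * (u y)\<^sup>2) summable_on UNIV"
  using finite_sum_le_infsum[OF assms, of "{_}"] by (intro bounded_row_summable) simp

text \<open>Fubini for double series needs summability over pairs. The first family follows from the
  row masses being at most \<open>tot\<close>, the second by exchanging the variables, and the mixed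
  one from |a b| \<le> a^2 + b^2.\<close>

lemma square_pairs:
  assumes u: "(\<lambda>x. (u x)\<^sup>2) summable_on UNIV"
  shows "(\<lambda>(x, y). a x y * (u x)\<^sup>2) summable_on UNIV \<times> UNIV"
    "(\<lambda>(x, y). a x y * (u y)\<^sup>2) summable_on UNIV \<times> UNIV"
    "(\<lambda>(x, y). a x y * (u x * u y)) summable_on UNIV \<times> UNIV"
proof -
  have "(\<lambda>x. deg x * (u x)\<^sup>2) summable_on UNIV"
    by (rule summable_on_comparison_test[OF summable_on_cmult_right[OF u, of tot]])
      (auto simp: deg_bounds intro: mult_right_mono)
  moreover have "((\<lambda>y. a x y * (u x)\<^sup>2) has_sum deg x * (u x)\<^sup>2) UNIV" for x
    unfolding deg_def by (intro has_sum_cmult_left has_sum_infsum row_summable)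
  ultimately show 1: "(\<lambda>(x, y). a x y * (u x)\<^sup>2) summable_on UNIV \<times> UNIV"
    by (intro summable_on_SigmaI[where g = "\<lambda>x. deg x * (u x)\<^sup>2"]) (auto simp: nonneg)
  have b: "bij_betw prod.swap (UNIV \<times> UNIV) (UNIV \<times> UNIV :: ('a \<times> 'a) set)"
    by (rule bij_betwI[where g = prod.swap]) auto
  have "(\<lambda>p. case prod.swap p of (x, y) \<Rightarrow> a x y * (u x)\<^sup>2) summable_on UNIV \<times> UNIV"
    using 1 by (subst summable_on_reindex_bij_betw[OF b])
  then show 2: "(\<lambda>(x, y). a x y * (u y)\<^sup>2) summable_on UNIV \<times> UNIV"
    by (simp add: case_prod_unfold sym)
  have 3: "(\<lambda>p. (case p of (x, y) \<Rightarrow> a x y * (u x)\<^sup>2) + (case p of (x, y) \<Rightarrow> a x y * (u y)\<^sup>2)) summable_on UNIV \<times> UNIV"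
    by (rule summable_on_add[OF 1 2])
  show "(\<lambda>(x, y). a x y * (u x * u y)) summable_on UNIV \<times> UNIV"
  proof (rule summable_on_abs_comparison(1)[OF 3], clarsimp)
    fix x y
    have "\<bar>u x * u y\<bar> \<le> (u x)\<^sup>2 + (u y)\<^sup>2"
      by (rule abs_mult_le_squares)
    then have "a x y * \<bar>u x * u y\<bar> \<le> a x y * ((u x)\<^sup>2 + (u y)\<^sup>2)"
      by (rule mult_left_mono) (rule nonneg)
    then show "\<bar>a x y * (u x * u y)\<bar> \<le> a x y * (u x)\<^sup>2 + a x y * (u y)\<^sup>2"
      using nonneg[of x y] by (simp add: abs_mult algebra_simps)
  qed
qed

lemma infsum_swap_sym:
  assumes u: "(\<lambda>x. (u x)\<^sup>2) summable_on UNIV"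
  shows "(\<Sum>\<^sub>\<infinity>(x, y)\<in>UNIV \<times> UNIV. a x y * (u y)\<^sup>2) = (\<Sum>\<^sub>\<infinity>(x, y)\<in>UNIV \<times> UNIV. a x y * (u x)\<^sup>2)"
proof -
  have b: "bij_betw prod.swap (UNIV \<times> UNIV) (UNIV \<times> UNIV :: ('a \<times> 'a) set)"
    by (rule bij_betwI[where g = prod.swap]) auto
  have "(\<Sum>\<^sub>\<infinity>p\<in>UNIV \<times> UNIV. case prod.swap p of (x, y) \<Rightarrow> a x y * (u x)\<^sup>2) = (\<Sum>\<^sub>\<infinity>(x, y)\<in>UNIV \<times> UNIV. a x y * (u x)\<^sup>2)"
    by (rule infsum_reindex_bij_betw[OF b])
  then show ?thesis
    by (simp add: case_prod_unfold sym)
qed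

text \<open>The weights of \<open>lazy\<close> applied to the square of u: the larger side of
  Jensen's inequality for these weights.\<close>

definition schur :: "('a \<Rightarrow> real) \<Rightarrow> 'a \<Rightarrow> real" where
  "schur u x = (\<Sum>\<^sub>\<infinity>y. a x y * (u y)\<^sup>2) + (tot - deg x) * (u x)\<^sup>2"

lemma schur_nonneg: "0 \<le> schur u x"
  unfolding schur_def using deg_bounds[of x] by (intro add_nonneg_nonneg infsum_nonneg) (auto simp: nonneg)

text \<open>Jensen's inequality for weights of total mass \<open>tot\<close>: the weighted variance
  of u about its weighted mean m is nonnegative. The case \<open>tot = 0\<close> is separate because
  m divides by \<open>tot\<close>.\<close>

lemma lazy_square_le:
  assumes u: "(\<lambda>x. (u x)\<^sup>2) summable_on UNIV"
  shows "(lazy u x)\<^sup>2 \<le> tot * schur u x"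
proof (cases "tot = 0")
  case True
  have "\<bar>lazy u x\<bar> \<le> tot * sqrt (\<Sum>\<^sub>\<infinity>x. (u x)\<^sup>2)"
    by (rule lazy_bound) (rule square_summable_bounded[OF u])
  then show ?thesis using True by simp
next
  case False
  then have t: "0 < tot" using tot_nonneg by linarith
  define m where "m = lazy u x / tot"
  have s1: "(\<lambda>y. a x y * u y) summable_on UNIV"
    by (rule bounded_row_summable) (rule square_summable_bounded[OF u])
  have "0 \<le> (\<Sum>\<^sub>\<infinity>y. a x y * (u y - m)\<^sup>2) + (tot - deg x) * (u x - m)\<^sup>2"
    using deg_bounds[of x] by (intro add_nonneg_nonneg infsum_nonneg) (auto simp: nonneg)
  also have "(\<Sum>\<^sub>\<infinity>y. a x y * (u y - m)\<^sup>2) = (\<Sum>\<^sub>\<infinity>y. (a x y * (u y)\<^sup>2 + a x y * m\<^sup>2) - a x y * u y * (2 * m))"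
    by (simp add: power2_eq_square algebra_simps)
  also have "\<dots> = (\<Sum>\<^sub>\<infinity>y. a x y * (u y)\<^sup>2) + deg x * m\<^sup>2 - (\<Sum>\<^sub>\<infinity>y. a x y * u y) * (2 * m)"
    by (subst infsum_diff_real; (subst infsum_add)?)
      (auto intro!: summable_on_add summable_on_cmult_left square_row[OF u] row_summable s1
        simp: deg_def infsum_cmult_left')
  finally have "0 \<le> schur u x + tot * m\<^sup>2 - 2 * m * lazy u x"
    by (simp add: schur_def lazy_def power2_eq_square algebra_simps)
  moreover have "tot * m\<^sup>2 = m * lazy u x" "m * lazy u x = (lazy u x)\<^sup>2 / tot"
    using t by (simp_all add: m_def power2_eq_square)
  ultimately have "(lazy u x)\<^sup>2 / tot \<le> schur u x" by linarith
  then show ?thesis using t by (simp add: field_simps)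
qed

text \<open>The weights are symmetric, so every column also has mass \<open>tot\<close>. Together
  with \<open>lazy_square_le\<close> this is the Schur test: \<open>lazy\<close> has operator norm
  at most \<open>tot\<close> on l^2.\<close>

lemma schur_sum:
  assumes u: "(\<lambda>x. (u x)\<^sup>2) summable_on UNIV"
  shows "schur u summable_on UNIV" "infsum (schur u) UNIV = tot * (\<Sum>\<^sub>\<infinity>x. (u x)\<^sup>2)"
proof -
  have s1: "(\<lambda>x. \<Sum>\<^sub>\<infinity>y. a x y * (u y)\<^sup>2) summable_on UNIV"
    using summable_on_Sigma_banach[of "\<lambda>x y. a x y * (u y)\<^sup>2" UNIV "\<lambda>_. UNIV"] square_pairs(2)[OF u] by simp
  have s2: "(\<lambda>x. deg x * (u x)\<^sup>2) summable_on UNIV"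
    by (rule summable_on_comparison_test[OF summable_on_cmult_right[OF u, of tot]])
      (auto simp: deg_bounds intro: mult_right_mono)
  have s3: "(\<lambda>x. (tot - deg x) * (u x)\<^sup>2) summable_on UNIV"
    using summable_on_diff_real[OF summable_on_cmult_right[OF u, of tot] s2] by (simp add: algebra_simps)
  show "schur u summable_on UNIV"
    unfolding schur_def[abs_def] by (rule summable_on_add[OF s1 s3])
  have "(\<Sum>\<^sub>\<infinity>x. \<Sum>\<^sub>\<infinity>y. a x y * (u y)\<^sup>2) = (\<Sum>\<^sub>\<infinity>(x, y)\<in>UNIV \<times> UNIV. a x y * (u y)\<^sup>2)"
    by (rule infsum_Sigma'_banach[OF square_pairs(2)[OF u]])
  also have "\<dots> = (\<Sum>\<^sub>\<infinity>(x, y)\<in>UNIV \<times> UNIV. a x y * (u x)\<^sup>2)"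
    by (rule infsum_swap_sym[OF u])
  also have "\<dots> = (\<Sum>\<^sub>\<infinity>x. \<Sum>\<^sub>\<infinity>y. a x y * (u x)\<^sup>2)"
    by (rule infsum_Sigma'_banach[OF square_pairs(1)[OF u], symmetric])
  also have "\<dots> = (\<Sum>\<^sub>\<infinity>x. deg x * (u x)\<^sup>2)"
    by (simp add: deg_def infsum_cmult_left')
  finally have e: "(\<Sum>\<^sub>\<infinity>x. \<Sum>\<^sub>\<infinity>y. a x y * (u y)\<^sup>2) = (\<Sum>\<^sub>\<infinity>x. deg x * (u x)\<^sup>2)" .
  have "infsum (schur u) UNIV = (\<Sum>\<^sub>\<infinity>x. deg x * (u x)\<^sup>2) + (\<Sum>\<^sub>\<infinity>x. (tot - deg x) * (u x)\<^sup>2)"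
    unfolding schur_def[abs_def] by (subst infsum_add[OF s1 s3]) (simp add: e)
  also have "\<dots> = (\<Sum>\<^sub>\<infinity>x. deg x * (u x)\<^sup>2 + (tot - deg x) * (u x)\<^sup>2)"
    by (rule infsum_add[OF s2 s3, symmetric])
  also have "\<dots> = tot * (\<Sum>\<^sub>\<infinity>x. (u x)\<^sup>2)"
    by (simp add: algebra_simps flip: infsum_cmult_right')
  finally show "infsum (schur u) UNIV = tot * (\<Sum>\<^sub>\<infinity>x. (u x)\<^sup>2)" .
qed

text \<open>Square summable functions are bounded, and (lam + tot) (u - v) equals
  \<open>lazy\<close> of u - v. In the sup norm this is a contraction with factor q = tot / (lam +
  tot) < 1, and iterating it from the bound K forces the difference to 0.\<close>

lemma resolvent_unique:
  assumes lam: "0 < lam"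
    and u: "(\<lambda>x. (u x)\<^sup>2) summable_on UNIV" "\<And>x. lam * u x - gen u x = \<Phi> x"
    and v: "(\<lambda>x. (v x)\<^sup>2) summable_on UNIV" "\<And>x. lam * v x - gen v x = \<Phi> x"
  shows "u = v"
proof -
  define K where "K = sqrt (\<Sum>\<^sub>\<infinity>x. (u x)\<^sup>2) + sqrt (\<Sum>\<^sub>\<infinity>x. (v x)\<^sup>2)"
  note bu = square_summable_bounded[OF u(1)] and bv = square_summable_bounded[OF v(1)]
  define q where "q = tot / (lam + tot)"
  have q: "0 \<le> q" "q < 1" using lam tot_nonneg by (auto simp: q_def field_simps)
  have eq: "(lam + tot) * (u x - v x) = lazy (\<lambda>y. u y - v y) x" for x
    using u(2)[of x] v(2)[of x] gen_eq_lazy[OF bu] gen_eq_lazy[OF bv]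
    by (simp add: lazy_diff[OF bu bv] algebra_simps)
  have step: "\<bar>u x - v x\<bar> \<le> q * B" if "\<And>y. \<bar>u y - v y\<bar> \<le> B" for B x
  proof -
    have "(lam + tot) * \<bar>u x - v x\<bar> \<le> tot * B"
      using lazy_bound[of "\<lambda>y. u y - v y" B x, OF that] lam tot_nonneg
      unfolding eq[symmetric] abs_mult by simp
    then show ?thesis using lam tot_nonneg by (simp add: q_def field_simps)
  qed
  have pw: "\<bar>u x - v x\<bar> \<le> q ^ n * K" for n x
  proof (induction n arbitrary: x)
    case 0
    show ?case using bu[of x] bv[of x] by (simp add: K_def)
  next
    case (Suc n)
    show ?case using step[OF Suc.IH] by (simp add: mult.assoc)
  qed
  have "u x = v x" for x
  proof -
    have "(\<lambda>n. q ^ n * K) \<longlonglongrightarrow> 0 * K"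
      by (intro tendsto_mult tendsto_const LIMSEQ_realpow_zero q)
    then have "\<bar>u x - v x\<bar> \<le> 0 * K"
      by (rule LIMSEQ_le_const) (use pw in auto)
    then show ?thesis by simp
  qed
  then show ?thesis by blast
qed

text \<open>The iterates of \<open>T\<close> started at 0 converge geometrically in the sup norm, so
  completeness of the reals is enough. The l^2 bound R is an invariant of \<open>T\<close> and
  reaches the limit through finite partial sums.\<close>

lemma resolvent_exists:
  assumes lam: "0 < lam" and \<Phi>: "(\<lambda>x. (\<Phi> x)\<^sup>2) summable_on UNIV"
  shows "\<exists>u. (\<lambda>x. (u x)\<^sup>2) summable_on UNIV \<and> (\<Sum>\<^sub>\<infinity>x. (u x)\<^sup>2) \<le> (\<Sum>\<^sub>\<infinity>x. (\<Phi> x)\<^sup>2) / lam\<^sup>2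
    \<and> (\<forall>x. lam * u x - gen u x = \<Phi> x)"
proof -
  define R where "R = (\<Sum>\<^sub>\<infinity>x. (\<Phi> x)\<^sup>2) / lam\<^sup>2"
  define T where "T u x = (\<Phi> x + lazy u x) / (lam + tot)" for u x
  define U where "U n = (T ^^ n) (\<lambda>_. 0)" for n
  have pos: "0 < lam + tot" using lam tot_nonneg by linarith
  have R0: "0 \<le> R" unfolding R_def by (intro divide_nonneg_nonneg infsum_nonneg) auto
  define q where "q = tot / (lam + tot)"
  have q: "0 \<le> q" "q < 1" using lam tot_nonneg by (auto simp: q_def field_simps)
  have Tinv: "(\<lambda>x. (T u x)\<^sup>2) summable_on UNIV \<and> (\<Sum>\<^sub>\<infinity>x. (T u x)\<^sup>2) \<le> R"
    if u: "(\<lambda>x. (u x)\<^sup>2) summable_on UNIV" "(\<Sum>\<^sub>\<infinity>x. (u x)\<^sup>2) \<le> R" for u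
  proof -
    define G where "G x = ((\<Phi> x)\<^sup>2 * (1 / lam) + schur u x) * (1 / (lam + tot))" for x
    have le: "(T u x)\<^sup>2 \<le> G x" for x
    proof -
      define b Q where "b = lazy u x" and "Q = schur u x"
      have bQ: "b\<^sup>2 \<le> tot * Q" "0 \<le> Q"
        unfolding b_def Q_def by (rule lazy_square_le[OF u(1)], rule schur_nonneg)
      \<comment> \<open>Cauchy-Schwarz with weights lam and \<open>tot\<close>, arranged so that
        nothing is divided by \<open>tot\<close>, which may be 0.\<close>
      have "(\<Phi> x + b)\<^sup>2 \<le> (lam + tot) * ((\<Phi> x)\<^sup>2 / lam + Q)"
      proof -
        have "(2 * (\<Phi> x * b))\<^sup>2 \<le> 4 * (\<Phi> x)\<^sup>2 * (tot * Q)"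
          using bQ by (simp add: power_mult_distrib mult_left_mono)
        also have "\<dots> = 4 * ((lam * Q) * (tot * (\<Phi> x)\<^sup>2 / lam))"
          using lam by simp
        also have "\<dots> \<le> (lam * Q + tot * (\<Phi> x)\<^sup>2 / lam)\<^sup>2"
          by (rule four_mult_le_square_sum)
        finally have "2 * (\<Phi> x * b) \<le> lam * Q + tot * (\<Phi> x)\<^sup>2 / lam"
          by (rule power2_le_imp_le) (use lam bQ tot_nonneg in simp)
        moreover have "(lam + tot) * ((\<Phi> x)\<^sup>2 / lam + Q) = (\<Phi> x)\<^sup>2 + lam * Q + tot * (\<Phi> x)\<^sup>2 / lam + tot * Q"
          using lam by (simp add: distrib_left distrib_right add_divide_distrib)
        ultimately show ?thesis using bQ(1) by (simp add: power2_sum)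
      qed
      then have "(\<Phi> x + b)\<^sup>2 / (lam + tot)\<^sup>2 \<le> (lam + tot) * ((\<Phi> x)\<^sup>2 / lam + Q) / (lam + tot)\<^sup>2"
        by (rule divide_right_mono) simp
      then show ?thesis
        using pos by (simp add: T_def G_def b_def Q_def power_divide power2_eq_square)
    qed
    have sG: "G summable_on UNIV" unfolding G_def[abs_def]
      by (intro summable_on_cmult_left summable_on_add \<Phi> schur_sum(1)[OF u(1)])
    have 1: "(\<lambda>x. (T u x)\<^sup>2) summable_on UNIV"
      by (rule summable_on_comparison_test[OF sG]) (auto simp: le)
    have "(\<Sum>\<^sub>\<infinity>x. (T u x)\<^sup>2) \<le> infsum G UNIV"
      by (rule infsum_mono[OF 1 sG]) (rule le)
    also have "infsum G UNIV = ((\<Sum>\<^sub>\<infinity>x. (\<Phi> x)\<^sup>2) * (1 / lam) + tot * (\<Sum>\<^sub>\<infinity>x. (u x)\<^sup>2)) * (1 / (lam + tot))"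
      unfolding G_def[abs_def] infsum_cmult_left'
      by (subst infsum_add) (auto intro!: summable_on_cmult_left \<Phi> schur_sum[OF u(1)]
          simp del: times_divide_eq_right simp: infsum_cmult_left' schur_sum(2)[OF u(1)])
    also have "\<dots> \<le> (lam * R + tot * R) * (1 / (lam + tot))"
      using u(2) lam tot_nonneg
      by (intro mult_right_mono add_mono mult_left_mono) (auto simp: R_def power2_eq_square)
    also have "\<dots> = R" using pos by (simp add: field_simps)
    finally show ?thesis using 1 by simp
  qed
  have Us: "(\<lambda>x. (U n x)\<^sup>2) summable_on UNIV \<and> (\<Sum>\<^sub>\<infinity>x. (U n x)\<^sup>2) \<le> R" for n
  proof (induction n)
    case 0
    then show ?case using R0 by (simp add: U_def)
  next
    case (Suc n)
    then show ?case using Tinv[of "U n"] by (simp add: U_def)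
  qed
  have Ub: "\<bar>U n x\<bar> \<le> sqrt R" for n x
    using square_summable_bounded[of "U n" x] Us[of n] real_sqrt_le_mono order_trans by blast
  have USuc: "U (Suc n) = T (U n)" for n by (simp add: U_def)
  have contr: "\<bar>T u x - T v x\<bar> \<le> q * B"
    if "\<And>y. \<bar>u y - v y\<bar> \<le> B" "\<And>y. \<bar>u y\<bar> \<le> K" "\<And>y. \<bar>v y\<bar> \<le> K'" for u v B K K' x
  proof -
    have "T u x - T v x = lazy (\<lambda>y. u y - v y) x / (lam + tot)"
      by (simp add: T_def lazy_diff[OF that(2,3)] diff_divide_distrib add_divide_distrib)
    then have "\<bar>T u x - T v x\<bar> = \<bar>lazy (\<lambda>y. u y - v y) x\<bar> / (lam + tot)"
      using pos by simp
    also have "\<dots> \<le> (tot * B) / (lam + tot)"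
      using lazy_bound[of "\<lambda>y. u y - v y" B x, OF that(1)] pos by (intro divide_right_mono) auto
    finally show ?thesis by (simp add: q_def)
  qed
  have Ud: "\<bar>U (Suc n) x - U n x\<bar> \<le> q ^ n * (2 * sqrt R)" for n x
  proof (induction n arbitrary: x)
    case 0
    show ?case using Ub[of 1 x] Ub[of 0 x] by simp
  next
    case (Suc n)
    show ?case using contr[of "U (Suc n)" "U n" "q ^ n * (2 * sqrt R)" "sqrt R" "sqrt R" x, OF Suc.IH Ub Ub] unfolding USuc by (simp add: mult.assoc)
  qed
  have conv: "convergent (\<lambda>n. U n x)" for x
  proof -
    have "summable (\<lambda>n. U (Suc n) x - U n x)"
    proof (rule summable_comparison_test')
      show "summable (\<lambda>n. q ^ n * (2 * sqrt R))"
        using q by (intro summable_mult2 summable_geometric) simp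
      show "norm (U (Suc n) x - U n x) \<le> q ^ n * (2 * sqrt R)" if "n \<ge> 0" for n
        using Ud[of n x] by simp
    qed
    then have "convergent (\<lambda>n. \<Sum>i<n. U (Suc i) x - U i x)"
      by (simp add: summable_iff_convergent)
    then have "convergent (\<lambda>n. U n x - U 0 x)"
      unfolding sum_lessThan_telescope[of "\<lambda>n. U n x"] .
    then show ?thesis by (simp add: convergent_diff_const_right_iff)
  qed
  define u where "u x = lim (\<lambda>n. U n x)" for x
  have lim: "(\<lambda>n. U n x) \<longlonglongrightarrow> u x" for x
    unfolding u_def using conv[of x] by (simp add: convergent_LIMSEQ_iff)
  have ub: "\<bar>u x\<bar> \<le> sqrt R" for x
    by (rule LIMSEQ_le_const2[OF tendsto_rabs[OF lim]]) (use Ub in auto)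
  have tail: "\<bar>u x - U n x\<bar> \<le> q ^ n * (2 * sqrt R) / (1 - q)" for n x
  proof -
    have fin: "\<bar>U (n + m) x - U n x\<bar> \<le> q ^ n * (2 * sqrt R) / (1 - q)" for m
    proof -
      have "\<bar>U (n + m) x - U n x\<bar> \<le> q ^ n * (2 * sqrt R) * (\<Sum>i<m. q ^ i)"
      proof (induction m)
        case (Suc m)
        have "\<bar>U (n + Suc m) x - U n x\<bar> \<le> \<bar>U (n + m) x - U n x\<bar> + q ^ (n + m) * (2 * sqrt R)"
          using Ud[of "n + m" x] by simp
        then show ?case using Suc by (simp add: algebra_simps power_add)
      qed simp
      also have "\<dots> \<le> q ^ n * (2 * sqrt R) * (1 / (1 - q))"
      proof (rule mult_left_mono)
        have "(\<Sum>i<m. q ^ i) = (1 - q ^ m) / (1 - q)" using q by (simp add: sum_gp_strict)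
        also have "\<dots> \<le> 1 / (1 - q)" using q by (intro divide_right_mono) auto
        finally show "(\<Sum>i<m. q ^ i) \<le> 1 / (1 - q)" .
      qed (use q R0 in auto)
      finally show ?thesis by simp
    qed
    have "(\<lambda>m. \<bar>U (n + m) x - U n x\<bar>) \<longlonglongrightarrow> \<bar>u x - U n x\<bar>"
      using LIMSEQ_ignore_initial_segment[OF lim[of x], of n]
      by (intro tendsto_intros) (simp add: add.commute)
    then show ?thesis by (rule LIMSEQ_le_const2) (use fin in auto)
  qed
  have fixpt: "T u x = u x" for x
  proof -
    have "(\<lambda>n. U (Suc n) x) \<longlonglongrightarrow> T u x"
    proof (rule LIMSEQ_I, goal_cases)
      case (1 r)
      have "(\<lambda>n. q * (q ^ n * (2 * sqrt R) / (1 - q))) \<longlonglongrightarrow> q * (0 * (2 * sqrt R) / (1 - q))"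
        using q by (intro tendsto_intros LIMSEQ_realpow_zero) auto
      then have "eventually (\<lambda>n. q * (q ^ n * (2 * sqrt R) / (1 - q)) < r) sequentially"
        using \<open>0 < r\<close> by (intro order_tendstoD) auto
      then obtain N where N: "\<And>n. n \<ge> N \<Longrightarrow> q * (q ^ n * (2 * sqrt R) / (1 - q)) < r"
        by (auto simp: eventually_sequentially)
      have "norm (U (Suc n) x - T u x) < r" if "n \<ge> N" for n
        using contr[of u "U n" "q ^ n * (2 * sqrt R) / (1 - q)" "sqrt R" "sqrt R" x, OF tail ub Ub] N[OF that] unfolding USuc by (simp add: abs_minus_commute)
      then show ?case by blast
    qed
    moreover have "(\<lambda>n. U (Suc n) x) \<longlonglongrightarrow> u x" by (rule LIMSEQ_Suc[OF lim])
    ultimately show ?thesis by (rule LIMSEQ_unique)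
  qed
  have fin: "(\<Sum>x\<in>X. (u x)\<^sup>2) \<le> R" if "finite X" for X
  proof (rule LIMSEQ_le_const2)
    show "(\<lambda>n. \<Sum>x\<in>X. (U n x)\<^sup>2) \<longlonglongrightarrow> (\<Sum>x\<in>X. (u x)\<^sup>2)"
      by (intro tendsto_intros lim)
    have "(\<Sum>x\<in>X. (U n x)\<^sup>2) \<le> R" for n
      using finite_sum_le_infsum[of "\<lambda>x. (U n x)\<^sup>2" UNIV X] Us[of n] that by auto
    then show "\<exists>N. \<forall>n\<ge>N. (\<Sum>x\<in>X. (U n x)\<^sup>2) \<le> R" by blast
  qed
  have us: "(\<lambda>x. (u x)\<^sup>2) summable_on UNIV"
    by (rule nonneg_bdd_above_summable_on) (use fin in \<open>auto simp: bdd_above_def\<close>)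
  have "(\<Sum>\<^sub>\<infinity>x. (u x)\<^sup>2) \<le> R"
    by (rule infsum_le_finite_sums[OF us]) (use fin in auto)
  moreover have "lam * u x - gen u x = \<Phi> x" for x
    using fixpt[of x] gen_eq_lazy[of u "sqrt R" x, OF ub] pos by (simp add: T_def field_simps)
  ultimately show ?thesis using us unfolding R_def by blast
qed

text \<open>Summation by parts: \<open>E\<close> and \<open>E'\<close> are the two halves of a x y
  (u x - u y)^2, they have equal sums by symmetry, and the inner sum of \<open>E\<close> is - u x
  times the generator at x. Nonnegative terms outside X are discarded, since only pairs inside the
  box enter the Poincare inequality.\<close>

lemma energy_bound:
  assumes u: "(\<lambda>x. (u x)\<^sup>2) summable_on UNIV" and \<Phi>: "(\<lambda>x. (\<Phi> x)\<^sup>2) summable_on UNIV"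
    and eq: "\<And>x. lam * u x - gen u x = \<Phi> x" and X: "finite X"
  shows "lam * (\<Sum>\<^sub>\<infinity>x. (u x)\<^sup>2) + (\<Sum>x\<in>X. \<Sum>y\<in>X. a x y * (u x - u y)\<^sup>2) / 2 \<le> (\<Sum>\<^sub>\<infinity>x. \<Phi> x * u x)"
proof -
  note sq = square_pairs[OF u]
  define E where "E = (\<lambda>(x, y). a x y * (u x)\<^sup>2 - a x y * (u x * u y))"
  define E' where "E' = (\<lambda>(x, y). a x y * (u y)\<^sup>2 - a x y * (u x * u y))"
  have sE: "E summable_on UNIV \<times> UNIV" and sE': "E' summable_on UNIV \<times> UNIV"
    using summable_on_diff_real[OF sq(1) sq(3)] summable_on_diff_real[OF sq(2) sq(3)]
    by (simp_all add: E_def E'_def case_prod_unfold)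
  have "infsum E (UNIV \<times> UNIV) = (\<Sum>\<^sub>\<infinity>(x, y)\<in>UNIV \<times> UNIV. a x y * (u x)\<^sup>2) - (\<Sum>\<^sub>\<infinity>(x, y)\<in>UNIV \<times> UNIV. a x y * (u x * u y))"
    using infsum_diff_real[OF sq(1) sq(3)] by (simp add: E_def case_prod_unfold)
  moreover have "infsum E' (UNIV \<times> UNIV) = (\<Sum>\<^sub>\<infinity>(x, y)\<in>UNIV \<times> UNIV. a x y * (u y)\<^sup>2) - (\<Sum>\<^sub>\<infinity>(x, y)\<in>UNIV \<times> UNIV. a x y * (u x * u y))"
    using infsum_diff_real[OF sq(2) sq(3)] by (simp add: E'_def case_prod_unfold)
  ultimately have EE: "infsum E (UNIV \<times> UNIV) = infsum E' (UNIV \<times> UNIV)"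
    using infsum_swap_sym[OF u] by simp
  have "(\<Sum>x\<in>X. \<Sum>y\<in>X. a x y * (u x - u y)\<^sup>2) = (\<Sum>p\<in>X \<times> X. E p + E' p)"
    by (simp add: sum.cartesian_product E_def E'_def case_prod_unfold power2_eq_square algebra_simps)
  also have "\<dots> \<le> (\<Sum>\<^sub>\<infinity>p\<in>UNIV \<times> UNIV. E p + E' p)"
  proof (rule finite_sum_le_infsum)
    have "E p + E' p = a (fst p) (snd p) * (u (fst p) - u (snd p))\<^sup>2" for p
      by (simp add: E_def E'_def case_prod_unfold power2_eq_square algebra_simps)
    then show "0 \<le> E p + E' p" for p by (simp add: nonneg)
  qed (use summable_on_add[OF sE sE'] X in auto)
  also have "\<dots> = infsum E (UNIV \<times> UNIV) + infsum E' (UNIV \<times> UNIV)"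
    by (rule infsum_add[OF sE sE'])
  also have "\<dots> = 2 * infsum E (UNIV \<times> UNIV)"
    unfolding EE by (rule mult_2[symmetric])
  finally have le: "(\<Sum>x\<in>X. \<Sum>y\<in>X. a x y * (u x - u y)\<^sup>2) / 2 \<le> infsum E (UNIV \<times> UNIV)" by simp
  have "infsum E (UNIV \<times> UNIV) = (\<Sum>\<^sub>\<infinity>x. \<Sum>\<^sub>\<infinity>y. E (x, y))"
    using infsum_Sigma'_banach[of "\<lambda>x y. E (x, y)" UNIV "\<lambda>_. UNIV"] sE by simp
  also have "\<dots> = (\<Sum>\<^sub>\<infinity>x. - (u x * gen u x))"
  proof (rule infsum_cong)
    fix x
    have "(\<Sum>\<^sub>\<infinity>y. E (x, y)) = (\<Sum>\<^sub>\<infinity>y. - u x * (a x y * (u y - u x)))"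
      by (simp add: E_def power2_eq_square algebra_simps)
    also have "\<dots> = - u x * gen u x"
      unfolding gen_def by (rule infsum_cmult_right')
    finally show "(\<Sum>\<^sub>\<infinity>y. E (x, y)) = - (u x * gen u x)" by simp
  qed
  also have "(\<lambda>x. - (u x * gen u x)) = (\<lambda>x. \<Phi> x * u x - lam * (u x)\<^sup>2)"
    by (simp add: eq[symmetric] fun_eq_iff power2_eq_square algebra_simps)
  also have "infsum \<dots> UNIV = (\<Sum>\<^sub>\<infinity>x. \<Phi> x * u x) - lam * (\<Sum>\<^sub>\<infinity>x. (u x)\<^sup>2)"
    unfolding infsum_diff_real[OF square_summable_mult[OF \<Phi> u] summable_on_cmult_right[OF u]]
    by (simp only: infsum_cmult_right')
  finally show ?thesis using le by linarith
qed

end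

section \<open>Lattice cells\<close>

text \<open>Offset c = 1 gives the half-open cells (z_i / k, (z_i + 1) / k] of the extension in
  \<open>Rk\<close>; c = 1/2 gives cells centred at the lattice points, which suit a symmetric
  quadrature.\<close>

definition cell_idx :: "real \<Rightarrow> nat \<Rightarrow> real ^ 'n \<Rightarrow> int ^ 'n" where
  "cell_idx c k x = (\<chi> i. \<lceil>real k * x $ i - c\<rceil>)"

lemma cell_idx_eq_iff:
  assumes "0 < k"
  shows "cell_idx c k x = z \<longleftrightarrow>
    (\<forall>i. (real_of_int (z $ i) + c - 1) / real k < x $ i \<and> x $ i \<le> (real_of_int (z $ i) + c) / real k)"
  using assms by (simp add: cell_idx_def vec_eq_iff ceiling_eq_iff field_simps)

lemma cell_measurable:
  assumes "0 < k"
  shows "cell_idx c k \<in> borel \<rightarrow>\<^sub>M (count_space UNIV :: (int ^ 'n) measure)"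
proof (subst measurable_count_space_eq2_countable, intro conjI ballI)
  fix z :: "int ^ 'n"
  have "cell_idx c k -` {z} \<inter> space borel =
    {x. \<forall>i. (real_of_int (z $ i) + c - 1) / real k < x $ i \<and> x $ i \<le> (real_of_int (z $ i) + c) / real k}"
    using cell_idx_eq_iff[OF assms] by auto
  also have "\<dots> = (\<Inter>i. {x. (real_of_int (z $ i) + c - 1) / real k < x $ i} \<inter> {x. x $ i \<le> (real_of_int (z $ i) + c) / real k})"
    by auto
  also have "\<dots> \<in> sets borel"
    by (intro sets.countable_INT'' sets.Int borel_open borel_closed open_halfspace_component_gt_cart
        closed_halfspace_component_le_cart) auto
  finally show "cell_idx c k -` {z} \<inter> space borel \<in> sets borel" .
qed auto

lemma emeasure_cell:
  assumes "0 < k"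
  shows "emeasure lborel (cell_idx c k -` {z} :: (real ^ 'n) set) = ennreal (1 / real k ^ CARD('n))"
proof -
  define l u :: "real ^ 'n" where "l = (\<chi> i. (real_of_int (z $ i) + c - 1) / real k)"
    and "u = (\<chi> i. (real_of_int (z $ i) + c) / real k)"
  have d: "(u - l) \<bullet> b = 1 / real k" if "b \<in> Basis" for b
    using that assms by (auto simp: Basis_vec_def inner_axis u_def l_def divide_simps)
  then have d': "l \<bullet> b \<le> u \<bullet> b" if "b \<in> Basis" for b
    using that assms by (smt (verit) divide_nonneg_nonneg inner_diff_left of_nat_0_le_iff)
  have p: "(\<Prod>b\<in>(Basis :: (real ^ 'n) set). (u - l) \<bullet> b) = 1 / real k ^ CARD('n)"
    using d by (simp add: power_divide)
  have iff: "x \<in> cell_idx c k -` {z} \<longleftrightarrow> (\<forall>i. l $ i < x $ i \<and> x $ i \<le> u $ i)" for x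
    by (simp add: cell_idx_eq_iff[OF assms] l_def u_def)
  have "box l u \<subseteq> cell_idx c k -` {z}" "cell_idx c k -` {z} \<subseteq> cbox l u"
    unfolding subset_iff iff by (auto simp: mem_box_cart less_imp_le)
  moreover have "cell_idx c k -` {z} \<in> sets lborel"
    using measurable_sets[OF cell_measurable[OF assms], of "{z}" c] by simp
  ultimately have "emeasure lborel (box l u) \<le> emeasure lborel (cell_idx c k -` {z})"
    "emeasure lborel (cell_idx c k -` {z}) \<le> emeasure lborel (cbox l u)"
    by (auto intro!: emeasure_mono)
  then show ?thesis
    using emeasure_lborel_box[OF d'] emeasure_lborel_cbox[OF d'] p by (simp add: antisym)
qed

text \<open>Every comparison between lattice sums and integrals is a change of variables along the
  cell map, whose image measure is the normalised counting measure.\<close>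

lemma distr_cell:
  assumes "0 < k"
  shows "distr lborel (count_space UNIV) (cell_idx c k) =
    density (count_space (UNIV :: (int ^ 'n) set)) (\<lambda>_. ennreal (1 / real k ^ CARD('n)))"
proof (rule measure_eqI_countable[where A = UNIV])
  fix z :: "int ^ 'n"
  have m: "cell_idx c k \<in> lborel \<rightarrow>\<^sub>M (count_space UNIV :: (int ^ 'n) measure)"
    using cell_measurable[OF assms] by simp
  show "emeasure (distr lborel (count_space UNIV) (cell_idx c k)) {z} =
    emeasure (density (count_space UNIV) (\<lambda>_. ennreal (1 / real k ^ CARD('n)))) {z}"
    using emeasure_cell[OF assms, of c z] by (simp add: emeasure_distr[OF m] emeasure_density)
qed auto

section \<open>Lattice sums as integrals of step functions\<close>

lemma nn_integral_count_space_summable: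
  fixes \<phi> :: "'a \<Rightarrow> real"
  assumes "\<phi> summable_on UNIV" "\<And>z. 0 \<le> \<phi> z"
  shows "(\<integral>\<^sup>+ z. ennreal (\<phi> z) \<partial>count_space UNIV) = ennreal (infsum \<phi> UNIV)"
proof -
  have a: "Infinite_Sum.abs_summable_on \<phi> UNIV"
    using assms by simp
  then have b: "Infinite_Set_Sum.abs_summable_on \<phi> UNIV"
    using abs_summable_equivalent by blast
  show ?thesis
    using nn_integral_conv_infsetsum[OF b] assms(2) infsetsum_infsum[OF b] by simp
qed

lemma nn_integral_cell:
  fixes \<phi> :: "int ^ 'n \<Rightarrow> real"
  assumes "0 < k" "\<phi> summable_on UNIV" "\<And>z. 0 \<le> \<phi> z"
  shows "(\<integral>\<^sup>+ x. ennreal (\<phi> (cell_idx c k x)) \<partial>lborel) = ennreal (infsum \<phi> UNIV / real k ^ CARD('n))"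
proof -
  have m: "cell_idx c k \<in> lborel \<rightarrow>\<^sub>M (count_space UNIV :: (int ^ 'n) measure)"
    using cell_measurable[OF assms(1)] by simp
  have "(\<integral>\<^sup>+ x. ennreal (\<phi> (cell_idx c k x)) \<partial>lborel)
      = (\<integral>\<^sup>+ z. ennreal (\<phi> z) \<partial>distr lborel (count_space UNIV) (cell_idx c k))"
    by (rule nn_integral_distr[OF m, symmetric]) simp
  also have "\<dots> = (\<integral>\<^sup>+ z. ennreal (1 / real k ^ CARD('n)) * ennreal (\<phi> z) \<partial>count_space UNIV)"
    unfolding distr_cell[OF assms(1)] by (subst nn_integral_density) auto
  also have "\<dots> = ennreal (1 / real k ^ CARD('n)) * ennreal (infsum \<phi> UNIV)"
    by (subst nn_integral_cmult) (auto simp: nn_integral_count_space_summable[OF assms(2,3)])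
  also have "\<dots> = ennreal (infsum \<phi> UNIV / real k ^ CARD('n))"
    using assms by (subst ennreal_mult[symmetric]) (auto intro: infsum_nonneg)
  finally show ?thesis .
qed

lemma integral_cell:
  fixes \<phi> :: "int ^ 'n \<Rightarrow> real"
  assumes "0 < k" "\<phi> summable_on UNIV"
  shows "integrable lborel (\<lambda>x. \<phi> (cell_idx c k x))"
    "(LINT x|lborel. \<phi> (cell_idx c k x)) = infsum \<phi> UNIV / real k ^ CARD('n)"
proof -
  have m: "cell_idx c k \<in> lborel \<rightarrow>\<^sub>M (count_space UNIV :: (int ^ 'n) measure)"
    using cell_measurable[OF assms(1)] by simp
  have a: "Infinite_Sum.abs_summable_on \<phi> UNIV"
    using assms(2) summable_on_iff_abs_summable_on_real by blast
  then have b: "Infinite_Set_Sum.abs_summable_on \<phi> UNIV"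
    using abs_summable_equivalent by blast
  then have i: "integrable (count_space UNIV) \<phi>"
    by (simp add: Infinite_Set_Sum.abs_summable_on_def)
  have "integrable (distr lborel (count_space UNIV) (cell_idx c k)) \<phi>"
    unfolding distr_cell[OF assms(1)] by (subst integrable_density) (use i in auto)
  then show "integrable lborel (\<lambda>x. \<phi> (cell_idx c k x))"
    by (subst (asm) integrable_distr_eq[OF m]) auto
  have "(LINT x|lborel. \<phi> (cell_idx c k x)) = (LINT z|distr lborel (count_space UNIV) (cell_idx c k). \<phi> z)"
    by (rule integral_distr[OF m, symmetric]) auto
  also have "\<dots> = (LINT z|count_space UNIV. (1 / real k ^ CARD('n)) * \<phi> z)"
    unfolding distr_cell[OF assms(1)] by (subst integral_density) auto
  also have "\<dots> = (1 / real k ^ CARD('n)) * (LINT z|count_space UNIV. \<phi> z)"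
    by simp
  also have "(LINT z|count_space UNIV. \<phi> z) = infsum \<phi> UNIV"
    using infsetsum_infsum[OF b] by (simp add: infsetsum_def)
  finally show "(LINT x|lborel. \<phi> (cell_idx c k x)) = infsum \<phi> UNIV / real k ^ CARD('n)"
    by simp
qed

text \<open>Dyadic shells take the place of polar coordinates. Halving the radius multiplies the
  contribution of a shell by q = 2^(-(d + s)), and q < 1 is the hypothesis on s.\<close>

lemma nn_integral_cball_powr:
  fixes s :: real
  assumes s: "- real CARD('n) < s"
  shows "\<exists>C>0. \<forall>r>0. (\<integral>\<^sup>+ u. ennreal (norm u powr s) * indicator (cball 0 r) u \<partial>(lborel :: (real ^ 'n) measure))
      \<le> ennreal (C * r powr (real CARD('n) + s))"
proof -
  define d where "d = real CARD('n)"
  define v where "v = unit_ball_vol d"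
  \<comment> \<open>On the shell between the radii R (j + 1) and R j the power |u|^s exceeds (R j)^s
    by at most the factor 2^|s|, whatever the sign of s.\<close>
  define c where "c = 2 powr \<bar>s\<bar>"
  have v: "0 \<le> v" unfolding v_def d_def by simp
  have c: "0 < c" by (simp add: c_def)
  define q where "q = 2 powr (- (d + s))"
  have q: "0 < q" "q < 1" using s by (auto simp: q_def d_def powr_less_one)
  define C where "C = c * v / (1 - q) + 1"
  have "(\<integral>\<^sup>+ u. ennreal (norm u powr s) * indicator (cball 0 r) u \<partial>(lborel :: (real ^ 'n) measure))
      \<le> ennreal (C * r powr (d + s))" if r: "0 < r" for r
  proof -
    define R where "R j = r / 2 ^ j" for j :: nat
    have R: "0 < R j" for j using r by (simp add: R_def)
    have shell: "ennreal (norm u powr s) * indicator (cball 0 r) u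
        \<le> (\<Sum>j. ennreal (c * R j powr s) * indicator (cball 0 (R j)) u)" (is "_ \<le> suminf ?f") for u :: "real ^ 'n"
    proof (cases "u = 0 \<or> r < norm u")
      case True
      then show ?thesis by (auto simp: indicator_def)
    next
      case False
      then have u: "0 < norm u" "norm u \<le> r" by auto
      define j where "j = (LEAST j. R (Suc j) < norm u)"
      have "\<exists>j. R (Suc j) < norm u"
      proof -
        obtain n where "r / norm u < 2 ^ n"
          using real_arch_pow[of 2] by auto
        then have "r < norm u * 2 ^ n" using u by (simp add: field_simps)
        also have "\<dots> \<le> norm u * 2 ^ Suc n" by simp
        finally have "R (Suc n) < norm u" by (simp add: R_def field_simps)
        then show ?thesis by blast
      qed
      then have j1: "R (Suc j) < norm u" unfolding j_def by (rule LeastI_ex)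
      have j2: "norm u \<le> R j"
      proof (cases j)
        case 0
        then show ?thesis using u by (simp add: R_def)
      next
        case (Suc i)
        then have "\<not> R (Suc i) < norm u" unfolding j_def by (metis not_less_Least lessI)
        then show ?thesis using Suc by simp
      qed
      have "norm u powr s \<le> c * R j powr s"
      proof (cases "0 \<le> s")
        case True
        have "norm u powr s \<le> R j powr s" using True j2 by (intro powr_mono2) auto
        also have "\<dots> \<le> c * R j powr s"
          using mult_right_mono[of 1 c "R j powr s"] True by (simp add: c_def ge_one_powr_ge_zero)
        finally show ?thesis .
      next
        case False
        have "norm u powr s \<le> R (Suc j) powr s" using False j1 R[of "Suc j"] by (intro powr_mono2') auto
        also have "R (Suc j) = R j * (1/2)" by (simp add: R_def)
        also have "(R j * (1/2)) powr s = R j powr s * (1/2) powr s"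
          by (rule powr_mult)
        also have "(1/2) powr s = c" using False by (simp add: c_def powr_divide powr_minus_divide)
        finally show ?thesis by (simp add: mult.commute)
      qed
      then have "ennreal (norm u powr s) * indicator (cball 0 r) u \<le> ?f j"
        using u j2 by (simp add: indicator_def ennreal_leI)
      also have "\<dots> \<le> suminf ?f"
      proof -
        define f where "f = ?f"
        have "sum f {j} \<le> suminf f" by (rule sum_le_suminf) (auto intro: summableI)
        then have "f j \<le> suminf f" by simp
        then show ?thesis by (simp only: f_def)
      qed
      finally show ?thesis .
    qed
    have sq: "summable (\<lambda>j. c * v * r powr (d + s) * q ^ j)"
      using q by (intro summable_mult summable_geometric) simp
    have "(\<integral>\<^sup>+ u. ennreal (norm u powr s) * indicator (cball 0 r) u \<partial>(lborel :: (real ^ 'n) measure))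
      \<le> (\<integral>\<^sup>+ u. (\<Sum>j. ennreal (c * R j powr s) * indicator (cball 0 (R j)) u) \<partial>(lborel :: (real ^ 'n) measure))"
      by (rule nn_integral_mono) (rule shell)
    also have "\<dots> = (\<Sum>j. \<integral>\<^sup>+ u. ennreal (c * R j powr s) * indicator (cball 0 (R j)) u \<partial>(lborel :: (real ^ 'n) measure))"
    proof -
      have "(\<lambda>u :: real ^ 'n. ennreal (c * R j powr s) * indicator (cball 0 (R j)) u) \<in> borel_measurable lborel" for j
        by (intro borel_measurable_times_ennreal borel_measurable_indicator) auto
      then show ?thesis
        by (intro nn_integral_suminf[of "\<lambda>j (u :: real ^ 'n). ennreal (c * R j powr s) * indicator (cball 0 (R j)) u" lborel])
    qed
    also have "\<dots> = (\<Sum>j. ennreal (c * v * r powr (d + s) * q ^ j))"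
    proof (rule suminf_cong)
      fix j
      have "(\<integral>\<^sup>+ u. ennreal (c * R j powr s) * indicator (cball 0 (R j)) u \<partial>(lborel :: (real ^ 'n) measure))
          = ennreal (c * R j powr s) * emeasure lborel (cball 0 (R j) :: (real ^ 'n) set)"
        by (rule nn_integral_cmult_indicator) simp
      also have "emeasure lborel (cball 0 (R j) :: (real ^ 'n) set) = ennreal (v * R j ^ CARD('n))"
        using emeasure_cball[of "R j" "0 :: real ^ 'n"] R[of j] by (simp add: v_def d_def less_imp_le)
      also have "ennreal (c * R j powr s) * \<dots> = ennreal (c * R j powr s * (v * R j ^ CARD('n)))"
        using c v R[of j] by (intro ennreal_mult[symmetric]) auto
      also have "R j ^ CARD('n) = R j powr d" using R[of j] by (simp add: d_def powr_realpow)
      also have "c * R j powr s * (v * R j powr d) = c * v * R j powr (d + s)"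
        by (simp add: powr_add)
      also have "R j powr (d + s) = r powr (d + s) * q ^ j"
      proof -
        have "R j = r * 2 powr (- real j)" by (simp add: R_def powr_minus powr_realpow divide_inverse)
        then have "R j powr (d + s) = r powr (d + s) * (2 powr (- real j)) powr (d + s)"
          using r by (simp add: powr_mult)
        also have "(2 powr (- real j)) powr (d + s) = q powr (real j)"
          by (simp add: q_def powr_powr algebra_simps)
        also have "\<dots> = q ^ j" using q by (simp add: powr_realpow)
        finally show ?thesis .
      qed
      finally show "(\<integral>\<^sup>+ u. ennreal (c * R j powr s) * indicator (cball 0 (R j)) u \<partial>(lborel :: (real ^ 'n) measure))
        = ennreal (c * v * r powr (d + s) * q ^ j)" by (simp add: mult.assoc)
    qed
    also have "\<dots> = ennreal (\<Sum>j. c * v * r powr (d + s) * q ^ j)"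
      using c v q by (intro suminf_ennreal2 sq) auto
    also have "(\<Sum>j. c * v * r powr (d + s) * q ^ j) = c * v / (1 - q) * r powr (d + s)"
      using q by (subst suminf_mult) (auto simp: suminf_geometric summable_geometric)
    also have "ennreal \<dots> \<le> ennreal (C * r powr (d + s))"
      by (intro ennreal_leI mult_right_mono) (auto simp: C_def)
    finally show ?thesis .
  qed
  moreover have "0 < C" using c v q by (auto simp: C_def intro!: add_nonneg_pos divide_nonneg_nonneg)
  ultimately show ?thesis unfolding d_def by blast
qed

section \<open>Smooth compactly supported functions\<close>

declare iter_pd.simps(2) [simp del]

lemma iter_pd_append: "iter_pd (is @ js) g = iter_pd is (iter_pd js g)"
  by (induction "is") (auto simp: iter_pd.simps)

text \<open>\<open>smooth_fun\<close> speaks of the derivative at parameter 0 for every base point;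
  moving the base point along the axis gives it at every parameter.\<close>

lemma smooth_fun_has_derivative:
  assumes "smooth_fun g"
  shows "((\<lambda>t. iter_pd is g (x + t *\<^sub>R axis i 1)) has_real_derivative
      iter_pd (i # is) g (x + t *\<^sub>R axis i 1)) (at t)"
proof -
  define y where "y = x + t *\<^sub>R axis i 1"
  have "(\<lambda>s. iter_pd is g (y + s *\<^sub>R axis i 1)) differentiable (at 0)"
    using assms by (auto simp: smooth_fun_def)
  then have "((\<lambda>s. iter_pd is g (y + s *\<^sub>R axis i 1)) has_real_derivative iter_pd (i # is) g y) (at 0)"
    by (simp add: DERIV_deriv_iff_real_differentiable iter_pd.simps)
  then have "((\<lambda>s. iter_pd is g (y + (s - t) *\<^sub>R axis i 1)) has_real_derivative iter_pd (i # is) g y) (at t)"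
    using DERIV_shift[of "\<lambda>s. iter_pd is g (y + (s - t) *\<^sub>R axis i 1)" "iter_pd (i # is) g y" 0 t] by simp
  moreover have "y + (s - t) *\<^sub>R axis i 1 = x + s *\<^sub>R axis i 1" for s
    by (simp add: y_def scaleR_left_diff_distrib)
  ultimately have "((\<lambda>s. iter_pd is g (x + s *\<^sub>R axis i 1)) has_real_derivative iter_pd (i # is) g y) (at t)"
    by simp
  then show ?thesis by (simp only: y_def)
qed

lemma iter_pd_support:
  fixes g :: "real ^ 'n \<Rightarrow> real"
  assumes "closed K" "\<And>x. x \<notin> K \<Longrightarrow> g x = 0" "x \<notin> K"
  shows "iter_pd is g x = 0"
  using assms(3)
proof (induction "is" arbitrary: x)
  case Nil
  then show ?case using assms(2) by simp
next
  case (Cons i "is")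
  have "open (- K)" using assms(1) by auto
  then obtain e where e: "0 < e" "ball x e \<subseteq> - K"
    using Cons.prems open_contains_ball by (metis ComplI)
  have "\<forall>\<^sub>F t in nhds 0. iter_pd is g (x + t *\<^sub>R axis i 1) = 0"
  proof (rule eventually_nhds_metric[THEN iffD2], intro exI conjI allI impI)
    fix t :: real assume "dist t 0 < e"
    then have "x + t *\<^sub>R axis i 1 \<in> ball x e" by (simp add: dist_norm norm_axis_1)
    then show "iter_pd is g (x + t *\<^sub>R axis i 1) = 0" using e Cons.IH by blast
  qed (rule e)
  then have "((\<lambda>t. iter_pd is g (x + t *\<^sub>R axis i 1)) has_real_derivative 0) (at 0)"
    by (subst DERIV_cong_ev[OF refl _ refl]) auto
  then show ?case by (simp add: DERIV_imp_deriv iter_pd.simps)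
qed

lemma Cc_inf_iter_pd:
  assumes "g \<in> Cc_inf"
  shows "iter_pd is g \<in> Cc_inf"
proof -
  have sm: "smooth_fun g" and K: "compact (closure {x. g x \<noteq> 0})"
    using assms by (auto simp: Cc_inf_def)
  have "smooth_fun (iter_pd is g)"
    using sm unfolding smooth_fun_def by (metis iter_pd_append)
  moreover have "{x. iter_pd is g x \<noteq> 0} \<subseteq> closure {x. g x \<noteq> 0}"
    using iter_pd_support[of "closure {x. g x \<noteq> 0}" g _ "is"] closure_subset[of "{x. g x \<noteq> 0}"] by blast
  then have "compact (closure {x. iter_pd is g x \<noteq> 0})"
    using K by (metis bounded_subset closure_minimal compact_closure compact_imp_bounded compact_imp_closed)
  ultimately show ?thesis by (simp add: Cc_inf_def)
qed

lemma Cc_inf_continuous: "g \<in> Cc_inf \<Longrightarrow> continuous_on UNIV g"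
  unfolding Cc_inf_def smooth_fun_def by (auto dest: spec[of _ "[]"])

lemma Cc_inf_bounded:
  assumes "g \<in> Cc_inf"
  shows "\<exists>B. \<forall>x. \<bar>g x\<bar> \<le> B"
proof -
  define K where "K = closure {x. g x \<noteq> 0}"
  have "compact K" using assms by (simp add: Cc_inf_def K_def)
  then have "bounded (g ` K)"
    using Cc_inf_continuous[OF assms] continuous_on_subset compact_continuous_image compact_imp_bounded
    by (metis top_greatest)
  then obtain B where B: "\<And>x. x \<in> K \<Longrightarrow> \<bar>g x\<bar> \<le> B"
    by (auto simp: bounded_iff)
  have "\<bar>g x\<bar> \<le> \<bar>B\<bar>" for x
  proof (cases "x \<in> K")
    case True
    then show ?thesis using B[of x] by linarith
  next
    case False
    then have "x \<notin> {x. g x \<noteq> 0}" unfolding K_def by (rule contra_subsetD[OF closure_subset])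
    then show ?thesis by simp
  qed
  then show ?thesis by blast
qed

text \<open>The definition of smoothness provides partial derivatives only, so v is moved to u one
  coordinate at a time. All intermediate points have coordinates between those of v and u, which is
  why \<open>bound\<close> is required on that box alone.\<close>

lemma coordinate_mvt:
  fixes \<Gamma> :: "real ^ 'n \<Rightarrow> real"
  assumes der: "\<And>i p t. ((\<lambda>t. \<Gamma> (p + t *\<^sub>R axis i 1)) has_real_derivative \<Gamma>' i (p + t *\<^sub>R axis i 1)) (at t)"
    and bound: "\<And>i p. (\<And>j. p $ j \<in> closed_segment (v $ j) (u $ j)) \<Longrightarrow> \<bar>\<Gamma>' i p\<bar> \<le> B"
  shows "\<bar>\<Gamma> u - \<Gamma> v\<bar> \<le> B * (\<Sum>i\<in>UNIV. \<bar>u $ i - v $ i\<bar>)"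
proof -
  define p where "p S = (\<chi> j. if j \<in> S then u $ j else v $ j)" for S
  have "\<bar>\<Gamma> (p S) - \<Gamma> v\<bar> \<le> B * (\<Sum>i\<in>S. \<bar>u $ i - v $ i\<bar>)" for S
  proof (induction S rule: finite_induct[OF finite])
    case 1
    have "p {} = v" by (simp add: p_def vec_eq_iff)
    then show ?case by simp
  next
    case (2 i S)
    define h where "h = u $ i - v $ i"
    have seg: "(p S + t *\<^sub>R axis i 1) $ j \<in> closed_segment (v $ j) (u $ j)"
      if "t \<in> closed_segment 0 h" for t j
    proof (cases "j = i")
      case True
      then have "(p S + t *\<^sub>R axis i 1) $ j = v $ i + t" using 2 by (simp add: p_def axis_def)
      moreover have "v $ i + t \<in> closed_segment (v $ i) (u $ i)"
        using that by (auto simp: h_def closed_segment_eq_real_ivl split: if_splits)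
      ultimately show ?thesis using True by simp
    qed (simp add: p_def axis_def)
    have "norm (\<Gamma> (p S + h *\<^sub>R axis i 1) - \<Gamma> (p S + 0 *\<^sub>R axis i 1)) \<le> B * norm (h - 0)"
    proof (rule field_differentiable_bound[where S = "closed_segment 0 h" and f' = "\<lambda>t. \<Gamma>' i (p S + t *\<^sub>R axis i 1)"])
      show "norm (\<Gamma>' i (p S + t *\<^sub>R axis i 1)) \<le> B" if "t \<in> closed_segment 0 h" for t
        using bound[OF seg[OF that]] by simp
    qed (auto intro: has_field_derivative_at_within der)
    moreover have "p S + h *\<^sub>R axis i 1 = p (insert i S)"
      using 2 by (auto simp: p_def vec_eq_iff axis_def h_def)
    ultimately have "\<bar>\<Gamma> (p (insert i S)) - \<Gamma> (p S)\<bar> \<le> B * \<bar>u $ i - v $ i\<bar>"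
      by (simp add: h_def)
    then show ?case using 2 by (simp add: distrib_left)
  qed
  from this[of UNIV] show ?thesis by (simp add: p_def)
qed

lemma sum_component_le_norm:
  fixes u :: "real ^ 'n"
  shows "(\<Sum>i\<in>UNIV. \<bar>u $ i\<bar>) \<le> real CARD('n) * norm u"
  using sum_bounded_above[of "UNIV :: 'n set" "\<lambda>i. \<bar>u $ i\<bar>" "norm u"] component_le_norm_cart[of u] by simp

lemma Cc_inf_lipschitz:
  fixes g :: "real ^ 'n \<Rightarrow> real"
  assumes "g \<in> Cc_inf"
  shows "\<exists>C\<ge>0. \<forall>x y. \<bar>g x - g y\<bar> \<le> C * norm (x - y)"
proof -
  have "\<forall>i. \<exists>B. \<forall>x. \<bar>iter_pd [i] g x\<bar> \<le> B"
    using Cc_inf_bounded[OF Cc_inf_iter_pd[OF assms]] by blast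
  then obtain b where b: "\<And>i x. \<bar>iter_pd [i] g x\<bar> \<le> b i"
    by metis
  define B where "B = Max (insert 0 (range b))"
  have B: "b i \<le> B" "0 \<le> B" for i
    unfolding B_def by (rule Max_ge; simp)+
  have sm: "smooth_fun g" using assms by (simp add: Cc_inf_def)
  have "\<bar>g x - g y\<bar> \<le> B * real CARD('n) * norm (x - y)" for x y
  proof -
    have "\<bar>g x - g y\<bar> \<le> B * (\<Sum>i\<in>UNIV. \<bar>x $ i - y $ i\<bar>)"
    proof (rule coordinate_mvt)
      show "((\<lambda>t. g (p + t *\<^sub>R axis i 1)) has_real_derivative iter_pd [i] g (p + t *\<^sub>R axis i 1)) (at t)" for i p t
        using smooth_fun_has_derivative[OF sm, of "[]"] by simp
      show "\<bar>iter_pd [i] g p\<bar> \<le> B" for i p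
        using b[of i p] B(1)[of i] by linarith
    qed
    also have "\<dots> \<le> B * (real CARD('n) * norm (x - y))"
      using sum_component_le_norm[of "x - y"] B(2) by (intro mult_left_mono) auto
    finally show ?thesis by simp
  qed
  moreover have "0 \<le> B * real CARD('n)" using B by simp
  ultimately show ?thesis by blast
qed

text \<open>The increment of g averaged over u and -u. The kernel is even, so integrals and lattice
  sums against it do not change, while the first-order term cancels; the principal value becomes an
  absolutely convergent integral for all \<alpha> < 2.\<close>

definition sdiff :: "(real ^ 'n \<Rightarrow> real) \<Rightarrow> real ^ 'n \<Rightarrow> real ^ 'n \<Rightarrow> real" where
  "sdiff g x u = (g (x + u) + g (x - u)) / 2 - g x"

text \<open>As a function of u, \<open>sdiff\<close> has partial derivatives that are
  half-differences of those of g at x + u and x - u, hence of size |u|. For v = 0 this gives the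
  quadratic bound at the origin; for v near u it controls the quadrature on one cell.\<close>

lemma Cc_inf_sdiff:
  fixes g :: "real ^ 'n \<Rightarrow> real"
  assumes "g \<in> Cc_inf"
  shows "\<exists>C\<ge>0. \<forall>x u v. \<bar>sdiff g x u - sdiff g x v\<bar> \<le> C * norm (u - v) * (norm u + norm v)"
proof -
  have "\<forall>i. \<exists>B\<ge>0. \<forall>x y. \<bar>iter_pd [i] g x - iter_pd [i] g y\<bar> \<le> B * norm (x - y)"
    using Cc_inf_lipschitz[OF Cc_inf_iter_pd[OF assms]] by blast
  then obtain b where b: "\<And>i x y. \<bar>iter_pd [i] g x - iter_pd [i] g y\<bar> \<le> b i * norm (x - y)" and b0: "\<And>i. 0 \<le> b i"
    by metis
  define B where "B = Max (insert 0 (range b))"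
  have B: "b i \<le> B" "0 \<le> B" for i
    unfolding B_def by (rule Max_ge; simp)+
  have sm: "smooth_fun g" using assms by (simp add: Cc_inf_def)
  have "\<bar>sdiff g x u - sdiff g x v\<bar> \<le> B * real CARD('n) * norm (u - v) * (norm u + norm v)" for x u v
  proof -
    define \<Gamma> where "\<Gamma> u = (g (x + u) + g (x - u)) / 2" for u
    have "\<bar>\<Gamma> u - \<Gamma> v\<bar> \<le> (B * (norm u + norm v)) * (\<Sum>i\<in>UNIV. \<bar>u $ i - v $ i\<bar>)"
    proof (rule coordinate_mvt[where \<Gamma>' = "\<lambda>i p. (iter_pd [i] g (x + p) - iter_pd [i] g (x - p)) / 2"])
      fix i p t
      have "((\<lambda>t. g ((x + p) + t *\<^sub>R axis i 1)) has_real_derivative iter_pd [i] g ((x + p) + t *\<^sub>R axis i 1)) (at t)"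
        using smooth_fun_has_derivative[OF sm, of "[]"] by simp
      moreover have "((\<lambda>t. g ((x - p) + t *\<^sub>R axis i 1)) has_real_derivative iter_pd [i] g ((x - p) + (- t) *\<^sub>R axis i 1)) (at (- t))"
        using smooth_fun_has_derivative[OF sm, of "[]" "x - p" i "- t"] by simp
      then have "((\<lambda>t. g ((x - p) + (- t) *\<^sub>R axis i 1)) has_real_derivative - iter_pd [i] g ((x - p) + (- t) *\<^sub>R axis i 1)) (at t)"
        by (subst (asm) DERIV_mirror)
      ultimately have "((\<lambda>t. (g ((x + p) + t *\<^sub>R axis i 1) + g ((x - p) + (- t) *\<^sub>R axis i 1)) / 2) has_real_derivative
          (iter_pd [i] g ((x + p) + t *\<^sub>R axis i 1) + - iter_pd [i] g ((x - p) + (- t) *\<^sub>R axis i 1)) / 2) (at t)"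
        by (intro DERIV_cdivide DERIV_add)
      then show "((\<lambda>t. \<Gamma> (p + t *\<^sub>R axis i 1)) has_real_derivative
          (iter_pd [i] g (x + (p + t *\<^sub>R axis i 1)) - iter_pd [i] g (x - (p + t *\<^sub>R axis i 1))) / 2) (at t)"
        by (simp add: \<Gamma>_def algebra_simps)
    next
      fix i p assume p: "\<And>j. p $ j \<in> closed_segment (v $ j) (u $ j)"
      have "norm p \<le> norm ((\<chi> j. \<bar>u $ j\<bar>) + (\<chi> j. \<bar>v $ j\<bar>) :: real ^ 'n)"
      proof (rule norm_le_componentwise_cart)
        show "norm (p $ j) \<le> norm (((\<chi> j. \<bar>u $ j\<bar>) + (\<chi> j. \<bar>v $ j\<bar>) :: real ^ 'n) $ j)" for j
          using p[of j] by (auto simp: closed_segment_eq_real_ivl split: if_splits)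
      qed
      also have "\<dots> \<le> norm ((\<chi> j. \<bar>u $ j\<bar>) :: real ^ 'n) + norm ((\<chi> j. \<bar>v $ j\<bar>) :: real ^ 'n)"
        by (rule norm_triangle_ineq)
      also have "\<dots> = norm u + norm v" by (simp add: norm_vec_def)
      finally have np: "norm p \<le> norm u + norm v" .
      have "\<bar>iter_pd [i] g (x + p) - iter_pd [i] g (x - p)\<bar> \<le> b i * norm ((x + p) - (x - p))"
        by (rule b)
      also have "(x + p) - (x - p) = 2 *\<^sub>R p" by (simp add: scaleR_2)
      also have "b i * norm (2 *\<^sub>R p) \<le> B * (2 * (norm u + norm v))"
        using np B(1)[of i] B(2) by (intro mult_mono) auto
      finally show "\<bar>(iter_pd [i] g (x + p) - iter_pd [i] g (x - p)) / 2\<bar> \<le> B * (norm u + norm v)"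
        by (simp add: algebra_simps)
    qed
    also have "\<dots> \<le> (B * (norm u + norm v)) * (real CARD('n) * norm (u - v))"
      using sum_component_le_norm[of "u - v"] B(2) by (intro mult_left_mono) auto
    finally show ?thesis by (simp add: sdiff_def \<Gamma>_def algebra_simps)
  qed
  moreover have "0 \<le> B * real CARD('n)" using B by simp
  ultimately show ?thesis by blast
qed

lemma Cc_inf_support:
  assumes "g \<in> Cc_inf"
  shows "\<exists>L::nat. 1 \<le> L \<and> (\<forall>x. real L < norm x \<longrightarrow> g x = 0)"
proof -
  have "bounded {x. g x \<noteq> 0}"
    using assms by (auto simp: Cc_inf_def compact_closure)
  then obtain b where b: "\<And>x. g x \<noteq> 0 \<Longrightarrow> norm x \<le> b"
    by (auto simp: bounded_iff)
  define L where "L = nat \<lceil>\<bar>b\<bar>\<rceil> + 1"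
  have "b \<le> real L" unfolding L_def by linarith
  then have "\<forall>x. real L < norm x \<longrightarrow> g x = 0" using b by force
  moreover have "1 \<le> L" by (simp add: L_def)
  ultimately show ?thesis by blast
qed

text \<open>Backward differences evaluate g only at points with smaller coordinates, so vanishing
  for very negative coordinates is inherited (\<open>nabla_vanish\<close>) and summation from below
  has no boundary term.\<close>

fun nabla :: "real \<Rightarrow> 'n list \<Rightarrow> (real ^ 'n \<Rightarrow> real) \<Rightarrow> real ^ 'n \<Rightarrow> real" where
  "nabla h [] g = g"
| "nabla h (i # is) g = (\<lambda>x. nabla h is g x - nabla h is g (x - h *\<^sub>R axis i 1))"

lemma nabla_has_derivative:
  assumes "smooth_fun g"
  shows "((\<lambda>t. nabla h is g (x + t *\<^sub>R axis i 1)) has_real_derivative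
      nabla h is (iter_pd [i] g) (x + t *\<^sub>R axis i 1)) (at t)"
proof (induction "is" arbitrary: x)
  case Nil
  show ?case using smooth_fun_has_derivative[OF assms, of "[]"] by simp
next
  case (Cons j "is")
  have "((\<lambda>t. nabla h is g (x + t *\<^sub>R axis i 1) - nabla h is g ((x - h *\<^sub>R axis j 1) + t *\<^sub>R axis i 1)) has_real_derivative
      nabla h is (iter_pd [i] g) (x + t *\<^sub>R axis i 1) - nabla h is (iter_pd [i] g) ((x - h *\<^sub>R axis j 1) + t *\<^sub>R axis i 1)) (at t)"
    by (intro DERIV_diff Cons.IH)
  then show ?case by (simp add: algebra_simps)
qed

text \<open>Differences commute with partial derivatives, so the mean value theorem trades each
  difference for a factor h and one more derivative.\<close>

lemma nabla_bound:
  fixes g :: "real ^ 'n \<Rightarrow> real"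
  assumes "g \<in> Cc_inf"
  shows "\<exists>B\<ge>0. \<forall>h\<ge>0. \<forall>x. \<bar>nabla h is g x\<bar> \<le> B * h ^ length is"
  using assms
proof (induction "is" arbitrary: g)
  case Nil
  then obtain B where "\<And>x. \<bar>g x\<bar> \<le> B" using Cc_inf_bounded by blast
  moreover from this have "0 \<le> B" by (meson abs_ge_zero order_trans)
  ultimately show ?case by auto
next
  case (Cons i "is")
  have sm: "smooth_fun g" using Cons.prems by (simp add: Cc_inf_def)
  obtain B where B: "0 \<le> B" "\<And>h x. 0 \<le> h \<Longrightarrow> \<bar>nabla h is (iter_pd [i] g) x\<bar> \<le> B * h ^ length is"
    using Cons.IH[OF Cc_inf_iter_pd[OF Cons.prems]] by metis
  have "\<bar>nabla h (i # is) g x\<bar> \<le> B * h ^ length (i # is)" if h: "0 \<le> h" for h x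
  proof -
    have "norm (nabla h is g (x + 0 *\<^sub>R axis i 1) - nabla h is g (x + (- h) *\<^sub>R axis i 1))
        \<le> (B * h ^ length is) * norm (0 - (- h))"
      by (rule field_differentiable_bound[where S = UNIV and f' = "\<lambda>t. nabla h is (iter_pd [i] g) (x + t *\<^sub>R axis i 1)"])
        (use B(2)[OF h] nabla_has_derivative[OF sm, of h "is" x i] in auto)
    then show ?thesis using h by (simp add: mult_ac)
  qed
  then show ?case using B(1) by blast
qed

section \<open>The limit resolvent\<close>

lemma integral_lborel_translate:
  fixes f :: "'a :: euclidean_space \<Rightarrow> real"
  assumes "f \<in> borel_measurable borel"
  shows "(LINT y|lborel. f y) = (LINT u|lborel. f (x + u))"
  by (subst lborel_distr_plus[of x, symmetric]) (use assms in \<open>simp add: integral_distr\<close>)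

lemma lborel_reflect: "distr lborel borel uminus = (lborel :: 'a :: euclidean_space measure)"
  using lborel_affine[of "-1" "0 :: 'a"] by (simp add: density_1 fun_eq_iff[symmetric])

lemma integral_lborel_reflect:
  fixes f :: "'a :: euclidean_space \<Rightarrow> real"
  assumes "f \<in> borel_measurable borel"
  shows "(LINT u|lborel. f u) = (LINT u|lborel. f (- u))"
  by (subst lborel_reflect[symmetric]) (use assms in \<open>simp add: integral_distr\<close>)

text \<open>Off the central cell some coordinate of z is nonzero, so |u| \<ge> 1 / (2 k), while u is
  within d / (2 k) of its lattice point. That distance is therefore at most d |u|, and likewise at
  most d |z| / k; both comparisons then hold with the factor 1 + d.\<close>

lemma cell_half:
  fixes u :: "real ^ 'n"
  assumes "0 < k" and z: "z = cell_idx (1/2) k u"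
  shows "norm (u - lat_pt k z) \<le> real CARD('n) / (2 * real k)"
    and "z = 0 \<Longrightarrow> norm u \<le> real CARD('n) / (2 * real k)"
    and "z \<noteq> 0 \<Longrightarrow> lnorm z / real k \<le> (1 + real CARD('n)) * norm u"
    and "z \<noteq> 0 \<Longrightarrow> norm u \<le> (1 + real CARD('n)) * (lnorm z / real k)"
proof -
  have c: "\<bar>u $ i - real_of_int (z $ i) / real k\<bar> \<le> 1 / (2 * real k)" for i
  proof -
    have "z $ i = \<lceil>real k * u $ i - 1/2\<rceil>" by (simp add: z cell_idx_def)
    then have "\<bar>real k * u $ i - real_of_int (z $ i)\<bar> \<le> 1/2"
      using ceiling_correct[of "real k * u $ i - 1/2"] by linarith
    then have "\<bar>real k * u $ i - real_of_int (z $ i)\<bar> / real k \<le> (1/2) / real k"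
      by (rule divide_right_mono) simp
    moreover have "u $ i - real_of_int (z $ i) / real k = (real k * u $ i - real_of_int (z $ i)) / real k"
      using assms(1) by (simp add: field_simps)
    ultimately show ?thesis by (simp add: abs_divide)
  qed
  show 1: "norm (u - lat_pt k z) \<le> real CARD('n) / (2 * real k)"
  proof -
    have "norm (u - lat_pt k z) \<le> (\<Sum>i\<in>UNIV. \<bar>(u - lat_pt k z) $ i\<bar>)" by (rule norm_le_l1_cart)
    also have "\<dots> \<le> (\<Sum>i\<in>(UNIV :: 'n set). 1 / (2 * real k))"
      by (rule sum_mono) (use c in simp)
    finally show ?thesis by simp
  qed
  show "z = 0 \<Longrightarrow> norm u \<le> real CARD('n) / (2 * real k)"
    using 1 by (simp add: lat_pt_def zero_vec_def[symmetric])
  assume "z \<noteq> 0"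
  then have l1: "1 \<le> lnorm z" by (rule lnorm_ge_1)
  obtain i where i: "z $ i \<noteq> 0" using \<open>z \<noteq> 0\<close> by (auto simp: vec_eq_iff)
  then have "1 \<le> \<bar>real_of_int (z $ i)\<bar>" by linarith
  then have "1 / real k \<le> \<bar>real_of_int (z $ i) / real k\<bar>"
    by (simp add: abs_divide divide_right_mono)
  moreover have "1 / real k = 2 * (1 / (2 * real k))" by simp
  ultimately have "1 / (2 * real k) \<le> \<bar>u $ i\<bar>" using c[of i] by linarith
  then have u: "1 / (2 * real k) \<le> norm u" using component_le_norm_cart[of u i] by simp
  have dk: "real CARD('n) / (2 * real k) = real CARD('n) * (1 / (2 * real k))" by simp
  have "norm (lat_pt k z) \<le> norm u + norm (u - lat_pt k z)"
    by (metis norm_minus_commute norm_triangle_sub)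
  also have "\<dots> \<le> norm u + real CARD('n) * norm u"
    using 1 mult_left_mono[OF u, of "real CARD('n)"] unfolding dk by simp
  finally show "lnorm z / real k \<le> (1 + real CARD('n)) * norm u"
    by (simp add: norm_lat_pt algebra_simps)
  have "norm u \<le> norm (lat_pt k z) + norm (u - lat_pt k z)"
    by (metis add.commute norm_triangle_sub)
  also have "\<dots> \<le> lnorm z / real k + real CARD('n) * (lnorm z / real k)"
  proof -
    have "1 / (2 * real k) \<le> lnorm z / real k" using l1 assms(1) by (simp add: field_simps)
    from mult_left_mono[OF this, of "real CARD('n)"] show ?thesis
      using 1 unfolding dk by (simp add: norm_lat_pt)
  qed
  finally show "norm u \<le> (1 + real CARD('n)) * (lnorm z / real k)"
    by (simp only: distrib_right mult_1)
qed

text \<open>Compared with a lattice sum on a mesh with d / \<epsilon> < k: the central cell then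
  lies inside the ball of radius \<epsilon>, and every remaining point is comparable with the
  lattice point of its cell.\<close>

lemma integrable_far:
  fixes p \<epsilon> :: real
  assumes "real CARD('n) < p" "0 < \<epsilon>"
  shows "integrable lborel (\<lambda>u :: real ^ 'n. indicator {u. \<epsilon> \<le> norm u} u * norm u powr (- p))"
proof -
  define d where "d = real CARD('n)"
  obtain k :: nat where k: "d / \<epsilon> < real k" using reals_Archimedean2 by blast
  have d0: "0 < d" by (simp add: d_def)
  have k0: "0 < k" using k d0 assms(2) by (metis divide_pos_pos less_trans of_nat_0_less_iff)
  define \<phi> where "\<phi> z = (lnorm z / (real k * (1 + d))) powr (- p)" for z :: "int ^ 'n"
  have \<phi>: "\<phi> summable_on UNIV"
    using summable_on_cmult_left[OF summable_lnorm_powr[OF assms(1)], of "(real k * (1 + d)) powr p"] k0 d0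
    by (simp add: \<phi>_def[abs_def] powr_divide powr_minus_divide)
  show ?thesis
  proof (rule Bochner_Integration.integrable_bound[OF integral_cell(1)[OF k0 \<phi>, of "1/2"]])
    show "(\<lambda>u :: real ^ 'n. indicator {u. \<epsilon> \<le> norm u} u * norm u powr (- p)) \<in> borel_measurable lborel"
      by measurable
    show "AE u in lborel. norm (indicator {u. \<epsilon> \<le> norm u} u * norm u powr (- p)) \<le> norm (\<phi> (cell_idx (1/2) k u))"
    proof (rule AE_I2)
      fix u :: "real ^ 'n"
      show "norm (indicator {u. \<epsilon> \<le> norm u} u * norm u powr (- p)) \<le> norm (\<phi> (cell_idx (1/2) k u))"
      proof (cases "\<epsilon> \<le> norm u")
        case True
        define z where "z = cell_idx (1/2) k u"
        have "z \<noteq> 0"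
        proof
          assume "z = 0"
          then have "norm u \<le> d / (2 * real k)" unfolding d_def using cell_half(2)[OF k0 z_def] by simp
          also have "\<dots> < \<epsilon>"
            using k k0 assms(2) d0 by (simp add: field_simps)
          finally show False using True by simp
        qed
        then have "lnorm z / real k \<le> (1 + d) * norm u" unfolding d_def using cell_half(3)[OF k0 z_def] by simp
        then have "lnorm z / real k / (1 + d) \<le> (1 + d) * norm u / (1 + d)"
          using d0 by (intro divide_right_mono) auto
        then have "lnorm z / (real k * (1 + d)) \<le> norm u" using d0 by (simp only: divide_divide_eq_left) simp
        moreover have "0 < lnorm z / (real k * (1 + d))"
          using lnorm_ge_1[OF \<open>z \<noteq> 0\<close>] k0 d0 by (intro divide_pos_pos mult_pos_pos) auto
        ultimately have "norm u powr (- p) \<le> \<phi> z" unfolding \<phi>_def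
          using assms(1) by (intro powr_mono2') auto
        then show ?thesis using True by (simp add: z_def)
      qed simp
    qed
  qed
qed

lemma integral_cball_powr:
  fixes s :: real
  assumes "- real CARD('n) < s"
  shows "\<exists>C>0. \<forall>r>0. integrable lborel (\<lambda>u :: real ^ 'n. norm u powr s * indicator (cball 0 r) u) \<and>
    (LINT u|lborel. norm (u :: real ^ 'n) powr s * indicator (cball 0 r) u) \<le> C * r powr (real CARD('n) + s)"
proof -
  obtain C where C: "0 < C" "\<And>r. 0 < r \<Longrightarrow> (\<integral>\<^sup>+ u. ennreal (norm u powr s) * indicator (cball 0 r) u \<partial>(lborel :: (real ^ 'n) measure))
      \<le> ennreal (C * r powr (real CARD('n) + s))"
    using nn_integral_cball_powr[OF assms] by blast
  have "integrable lborel (\<lambda>u :: real ^ 'n. norm u powr s * indicator (cball 0 r) u) \<and>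
    (LINT u|lborel. norm (u :: real ^ 'n) powr s * indicator (cball 0 r) u) \<le> C * r powr (real CARD('n) + s)"
    if "0 < r" for r
  proof -
    define f where "f u = norm u powr s * indicator (cball 0 r) u" for u :: "real ^ 'n"
    have m: "f \<in> borel_measurable lborel" unfolding f_def
      by (intro borel_measurable_times borel_measurable_indicator) auto
    have e: "(\<integral>\<^sup>+ u. ennreal (f u) \<partial>lborel) \<le> ennreal (C * r powr (real CARD('n) + s))"
      using C(2)[OF that] by (simp add: f_def ennreal_mult' ennreal_indicator)
    have "integrable lborel f"
      using m e by (intro integrableI_nonneg) (auto simp: f_def top_unique order_le_less_trans)
    moreover have "(LINT u|lborel. f u) \<le> C * r powr (real CARD('n) + s)"
      using e C(1) by (intro integral_real_bounded) (auto simp: f_def)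
    ultimately show ?thesis by (simp add: f_def[abs_def])
  qed
  then show ?thesis using C(1) by blast
qed

lemma sdiff_0 [simp]: "sdiff g x 0 = 0"
  by (simp add: sdiff_def)

lemma sdiff_bound:
  assumes "\<And>x. \<bar>g x\<bar> \<le> B"
  shows "\<bar>sdiff g x u\<bar> \<le> 2 * B"
  using assms[of "x + u"] assms[of "x - u"] assms[of x]
  by (intro abs_leI) (simp_all add: sdiff_def abs_le_iff field_simps)

lemma Cc_inf_sdiff_square:
  assumes "\<And>x u v. \<bar>sdiff g x u - sdiff g x v\<bar> \<le> C * norm (u - v) * (norm u + norm v)"
  shows "\<bar>sdiff g x u\<bar> \<le> C * (norm u)\<^sup>2"
  using assms[of x u 0] by (simp add: power2_eq_square mult.assoc)

lemma sdiff_measurable [measurable]: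
  assumes "g \<in> Cc_inf"
  shows "sdiff g x \<in> borel_measurable borel"
proof -
  have g: "g \<in> borel_measurable borel"
    using Cc_inf_continuous[OF assms] by (rule borel_measurable_continuous_onI)
  have "(\<lambda>u. g (x + u)) \<in> borel_measurable borel" "(\<lambda>u. g (x - u)) \<in> borel_measurable borel"
    by (rule measurable_compose[OF _ g]; simp)+
  then show ?thesis unfolding sdiff_def[abs_def] by simp
qed

lemma norm_power2_powr: "(norm u)\<^sup>2 * norm u powr (- p) = norm u powr (2 - p)" for u :: "'a :: real_normed_vector"
  by (cases "u = 0") (simp_all add: powr_diff powr_minus divide_inverse)

text \<open>Inside the unit ball the quadratic bound leaves |u|^(2 - p), integrable because \<alpha>
  < 2; outside, boundedness of g and \<alpha> > 0 suffice.\<close>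

lemma integrable_sdiff:
  fixes g :: "real ^ 'n \<Rightarrow> real"
  assumes g: "g \<in> Cc_inf" and \<alpha>: "0 < \<alpha>" "\<alpha> < 2"
  shows "integrable lborel (\<lambda>u. sdiff g x u * norm u powr (- (real CARD('n) + \<alpha>)))"
proof -
  define p where "p = real CARD('n) + \<alpha>"
  obtain C where C: "0 \<le> C" "\<And>x u v. \<bar>sdiff g x u - sdiff g x v\<bar> \<le> C * norm (u - v) * (norm u + norm v)"
    using Cc_inf_sdiff[OF g] by blast
  obtain B where B: "\<And>x. \<bar>g x\<bar> \<le> B" using Cc_inf_bounded[OF g] by blast
  have i1: "integrable lborel (\<lambda>u :: real ^ 'n. norm u powr (2 - p) * indicator (cball 0 1) u)"
    using integral_cball_powr[of "2 - p", where 'n = 'n] \<alpha> by (auto simp: p_def)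
  have i2: "integrable lborel (\<lambda>u :: real ^ 'n. indicator {u. 1 \<le> norm u} u * norm u powr (- p))"
    by (rule integrable_far) (use \<alpha> in \<open>auto simp: p_def\<close>)
  have "integrable lborel (\<lambda>u. sdiff g x u * norm u powr (- p))"
  proof (rule Bochner_Integration.integrable_bound)
    show "integrable lborel (\<lambda>u :: real ^ 'n. C * (norm u powr (2 - p) * indicator (cball 0 1) u)
        + (2 * B) * (indicator {u. 1 \<le> norm u} u * norm u powr (- p)))"
      by (intro Bochner_Integration.integrable_add integrable_mult_right i1 i2)
    show "(\<lambda>u. sdiff g x u * norm u powr (- p)) \<in> borel_measurable lborel"
      using sdiff_measurable[OF g, of x] by simp
    have B0: "0 \<le> B" using B[of 0] by linarith
    have "\<bar>sdiff g x u * norm u powr (- p)\<bar> \<le> C * (norm u powr (2 - p) * indicator (cball 0 1) u)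
        + (2 * B) * (indicator {u. 1 \<le> norm u} u * norm u powr (- p))" for u
    proof (cases "norm u < 1")
      case True
      have "\<bar>sdiff g x u\<bar> * norm u powr (- p) \<le> (C * (norm u)\<^sup>2) * norm u powr (- p)"
        by (intro mult_right_mono Cc_inf_sdiff_square C(2)) simp
      then show ?thesis using True B0 by (simp add: abs_mult mult.assoc norm_power2_powr)
    next
      case False
      have "\<bar>sdiff g x u\<bar> \<le> 2 * B" by (rule sdiff_bound[OF B])
      then have "\<bar>sdiff g x u\<bar> * norm u powr (- p) \<le> (2 * B) * norm u powr (- p)"
        by (rule mult_right_mono) simp
      moreover have "0 \<le> C * (norm u powr (2 - p) * indicator (cball 0 1) u)" using C(1) by simp
      ultimately show ?thesis using False by (simp add: abs_mult)
    qed
    then show "AE u in lborel. norm (sdiff g x u * norm u powr (- p)) \<le> norm (C * (norm u powr (2 - p) * indicator (cball 0 1) u)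
        + (2 * B) * (indicator {u. 1 \<le> norm u} u * norm u powr (- p)))"
      by (intro AE_I2) (simp only: real_norm_def, meson abs_ge_self order_trans)
  qed
  then show ?thesis by (simp add: p_def)
qed

text \<open>For a fixed truncation the reflection of u to -u preserves the kernel, so the increment
  may be replaced by its symmetrisation. The truncated integrals then converge by dominated
  convergence, because the symmetrised integrand is integrable up to the origin.\<close>

lemma Lbar_eq_integral:
  fixes g :: "real ^ 'n \<Rightarrow> real"
  assumes g: "g \<in> Cc_inf" and \<alpha>: "0 < \<alpha>" "\<alpha> < 2"
  shows "Lbar \<alpha> g x = (LINT u|lborel. sdiff g x u * norm u powr (- (real CARD('n) + \<alpha>)))"
proof -
  define p where "p = real CARD('n) + \<alpha>"
  have p: "real CARD('n) < p" using \<alpha> by (simp add: p_def)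
  obtain B where B: "\<And>x. \<bar>g x\<bar> \<le> B" using Cc_inf_bounded[OF g] by blast
  have gm [measurable]: "g \<in> borel_measurable borel"
    using Cc_inf_continuous[OF g] by (rule borel_measurable_continuous_onI)
  define S where "S u = sdiff g x u * norm u powr (- p)" for u
  have Si: "integrable lborel S" unfolding S_def p_def by (rule integrable_sdiff[OF g \<alpha>])
  have trunc: "(LINT y : {y. \<epsilon> \<le> dist y x} | lborel. (g y - g x) / dist x y powr p)
      = (LINT u|lborel. indicator {u. \<epsilon> \<le> norm u} u * S u)" if e: "0 < \<epsilon>" for \<epsilon>
  proof -
    define K where "K u = indicator {u. \<epsilon> \<le> norm u} u * norm u powr (- p)" for u :: "real ^ 'n"
    have Ki: "integrable lborel K" unfolding K_def by (rule integrable_far[OF p e])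
    have gi: "integrable lborel (\<lambda>u. (g (h u) - g x) * K u)" if h: "h \<in> borel_measurable borel" for h
    proof (rule Bochner_Integration.integrable_bound[OF integrable_mult_right[OF Ki, of "2 * B"]])
      have "(\<lambda>u. g (h u)) \<in> borel_measurable borel" by (rule measurable_compose[OF h gm])
      then show "(\<lambda>u. (g (h u) - g x) * K u) \<in> borel_measurable lborel"
        using borel_measurable_integrable[OF Ki] by simp
      have "\<bar>g (h u) - g x\<bar> \<le> \<bar>2 * B\<bar>" for u using B[of "h u"] B[of x] by linarith
      then show "AE u in lborel. norm ((g (h u) - g x) * K u) \<le> norm (2 * B * K u)"
        by (intro AE_I2) (simp only: real_norm_def abs_mult, rule mult_right_mono, auto)
    qed
    have "(LINT y : {y. \<epsilon> \<le> dist y x} | lborel. (g y - g x) / dist x y powr p)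
      = (LINT y|lborel. indicator {y. \<epsilon> \<le> dist y x} y * ((g y - g x) / dist x y powr p))"
      by (simp add: set_lebesgue_integral_def)
    also have "\<dots> = (LINT u|lborel. indicator {y. \<epsilon> \<le> dist y x} (x + u) * ((g (x + u) - g x) / dist x (x + u) powr p))"
      by (rule integral_lborel_translate) measurable
    also have "\<dots> = (LINT u|lborel. (g (x + u) - g x) * K u)"
      by (rule Bochner_Integration.integral_cong)
        (auto simp: K_def indicator_def dist_norm powr_minus divide_inverse)
    finally have 1: "(LINT y : {y. \<epsilon> \<le> dist y x} | lborel. (g y - g x) / dist x y powr p)
      = (LINT u|lborel. (g (x + u) - g x) * K u)" .
    have 2: "(LINT u|lborel. (g (x + u) - g x) * K u) = (LINT u|lborel. (g (x - u) - g x) * K u)"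
    proof -
      have "(\<lambda>u. (g (x + u) - g x) * K u) \<in> borel_measurable lborel"
        using gi[of "\<lambda>u. x + u"] by (intro borel_measurable_integrable) simp
      then have "(LINT u|lborel. (g (x + u) - g x) * K u) = (LINT u|lborel. (g (x + - u) - g x) * K (- u))"
        by (intro integral_lborel_reflect) simp
      also have "\<dots> = (LINT u|lborel. (g (x - u) - g x) * K u)"
        by (simp add: K_def indicator_def)
      finally show ?thesis .
    qed
    have "(LINT u|lborel. (g (x + u) - g x) * K u)
        = ((LINT u|lborel. (g (x + u) - g x) * K u) + (LINT u|lborel. (g (x - u) - g x) * K u)) / 2"
      using 2 by simp
    also have "\<dots> = (LINT u|lborel. ((g (x + u) - g x) * K u + (g (x - u) - g x) * K u) / 2)"
      using gi[of "\<lambda>u. x + u"] gi[of "\<lambda>u. x - u"] by simp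
    also have "\<dots> = (LINT u|lborel. indicator {u. \<epsilon> \<le> norm u} u * S u)"
      by (rule Bochner_Integration.integral_cong) (auto simp: K_def S_def sdiff_def indicator_def field_simps)
    finally show ?thesis using 1 by simp
  qed
  have Sm: "S \<in> borel_measurable lborel" by (rule borel_measurable_integrable[OF Si])
  have lim: "((\<lambda>\<epsilon>. LINT y : {y. \<epsilon> \<le> dist y x} | lborel. (g y - g x) / dist x y powr p) \<longlongrightarrow> (LINT u|lborel. S u)) (at_right 0)"
  proof (rule tendsto_at_right_sequentially[of 0 1])
    fix e :: "nat \<Rightarrow> real" assume e: "\<And>n. 0 < e n" "\<And>n. e n < 1" "decseq e" "e \<longlonglongrightarrow> 0"
    have "(\<lambda>n. LINT u|lborel. indicator {u. e n \<le> norm u} u * S u) \<longlonglongrightarrow> (LINT u|lborel. S u)"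
    proof (rule integral_dominated_convergence[where w = "\<lambda>u. \<bar>S u\<bar>"])
      show "integrable lborel (\<lambda>u. \<bar>S u\<bar>)" using Si by simp
      show "AE u in lborel. (\<lambda>n. indicator {u. e n \<le> norm u} u * S u) \<longlonglongrightarrow> S u"
      proof (rule AE_I2)
        fix u
        show "(\<lambda>n. indicator {u. e n \<le> norm u} u * S u) \<longlonglongrightarrow> S u"
        proof (cases "u = 0")
          case True
          then show ?thesis by (simp add: S_def)
        next
          case False
          then have "\<forall>\<^sub>F n in sequentially. e n < norm u" using e(4) by (intro order_tendstoD) auto
          then have "\<forall>\<^sub>F n in sequentially. indicator {u. e n \<le> norm u} u * S u = S u"
            by eventually_elim simp
          then show ?thesis by (rule tendsto_eventually)
        qed
      qed
      show "AE u in lborel. norm (indicator {u. e n \<le> norm u} u * S u) \<le> \<bar>S u\<bar>" for n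
        by (intro AE_I2) (auto simp: indicator_def)
      show "(\<lambda>u. indicator {u. e n \<le> norm u} u * S u) \<in> borel_measurable lborel" for n
        using Sm by measurable
    qed (rule Sm)
    then show "(\<lambda>n. LINT y : {y. e n \<le> dist y x} | lborel. (g y - g x) / dist x y powr p) \<longlonglongrightarrow> (LINT u|lborel. S u)"
      using trunc[OF e(1)] by simp
  qed simp
  have "Lbar \<alpha> g x = (LINT u|lborel. S u)"
    unfolding Lbar_def p_def[symmetric] by (rule tendsto_Lim[OF _ lim]) simp
  then show ?thesis by (simp add: S_def p_def)
qed

text \<open>At a positive maximum of the difference of two solutions the limit operator is nonpositive.\<close>

lemma resolvent_eq_le:
  fixes g h :: "real ^ 'n \<Rightarrow> real"
  assumes g: "g \<in> Cc_inf" and h: "h \<in> Cc_inf" and \<alpha>: "0 < \<alpha>" "\<alpha> < 2" and lam: "0 < lam"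
    and eq: "\<And>x. lam * g x - Lbar \<alpha> g x = lam * h x - Lbar \<alpha> h x"
  shows "g x \<le> h x"
proof -
  define f where "f x = g x - h x" for x
  obtain Lg Lh :: nat where L: "\<And>x. real Lg < norm x \<Longrightarrow> g x = 0" "\<And>x. real Lh < norm x \<Longrightarrow> h x = 0"
    using Cc_inf_support[OF g] Cc_inf_support[OF h] by metis
  \<comment> \<open>Including |x| puts the given x into the ball; both functions vanish outside it,
    so a positive maximum over the ball is a global one.\<close>
  define R where "R = real Lg + real Lh + norm x"
  have "continuous_on (cball 0 R) f" unfolding f_def
    using Cc_inf_continuous[OF g] Cc_inf_continuous[OF h]
    by (intro continuous_on_diff) (auto intro: continuous_on_subset)
  moreover have "0 \<le> R" by (simp add: R_def)
  then have "compact (cball 0 R :: (real ^ 'n) set)" "cball 0 R \<noteq> ({} :: (real ^ 'n) set)"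
    by auto
  ultimately obtain m where m: "m \<in> cball 0 R" "\<And>y. y \<in> cball 0 R \<Longrightarrow> f y \<le> f m"
    using continuous_attains_sup by metis
  have x: "f x \<le> f m" using m(2)[of x] by (simp add: R_def)
  show ?thesis
  proof (rule ccontr)
    assume "\<not> g x \<le> h x"
    then have pos: "0 < f m" using x by (simp add: f_def)
    have max: "f y \<le> f m" for y
    proof (cases "y \<in> cball 0 R")
      case False
      then have "R < norm y" by simp
      then have "real Lg < norm y" "real Lh < norm y" unfolding R_def using norm_ge_zero[of x] by linarith+
      then have "f y = 0" using L[of y] by (simp add: f_def)
      then show ?thesis using pos by simp
    qed (rule m(2))
    have "Lbar \<alpha> g m - Lbar \<alpha> h m = (LINT u|lborel. sdiff g m u * norm u powr (- (real CARD('n) + \<alpha>))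
        - sdiff h m u * norm u powr (- (real CARD('n) + \<alpha>)))"
      unfolding Lbar_eq_integral[OF g \<alpha>] Lbar_eq_integral[OF h \<alpha>]
      by (rule Bochner_Integration.integral_diff[symmetric]; rule integrable_sdiff) (use g h \<alpha> in auto)
    also have "\<dots> \<le> 0"
    proof -
      have "sdiff g m u * norm u powr (- (real CARD('n) + \<alpha>)) - sdiff h m u * norm u powr (- (real CARD('n) + \<alpha>)) \<le> 0" for u
      proof -
        have "sdiff g m u - sdiff h m u \<le> 0"
          using max[of "m + u"] max[of "m - u"] by (simp add: sdiff_def f_def field_simps)
        then have "(sdiff g m u - sdiff h m u) * norm u powr (- (real CARD('n) + \<alpha>)) \<le> 0"
          by (intro mult_nonpos_nonneg) auto
        then show ?thesis by (simp add: algebra_simps)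
      qed
      then have "0 \<le> (LINT u|lborel. - (sdiff g m u * norm u powr (- (real CARD('n) + \<alpha>)) - sdiff h m u * norm u powr (- (real CARD('n) + \<alpha>))))"
        by (intro Bochner_Integration.integral_nonneg) (simp only: neg_0_le_iff_le)
      then show ?thesis by (simp only: Bochner_Integration.integral_minus neg_0_le_iff_le)
    qed
    finally have "lam * f m \<le> 0" using eq[of m] by (simp add: f_def algebra_simps)
    then show False using pos lam by (simp add: mult_le_0_iff)
  qed
qed

text \<open>Uniqueness is the comparison \<open>resolvent_eq_le\<close> in both directions; it makes
  the definite description in \<open>Rbar\<close> denote g.\<close>

lemma Rbar_eq:
  fixes g :: "real ^ 'n \<Rightarrow> real"
  assumes "g \<in> Cc_inf" "0 < \<alpha>" "\<alpha> < 2" "0 < lam"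
  shows "Rbar \<alpha> lam (\<lambda>x. lam * g x - Lbar \<alpha> g x) = g"
  unfolding Rbar_def
proof (rule the_equality)
  fix h assume "h \<in> Cc_inf \<and> (\<forall>x. lam * h x - Lbar \<alpha> h x = lam * g x - Lbar \<alpha> g x)"
  then have "h x \<le> g x" "g x \<le> h x" for x
    using resolvent_eq_le[of h g \<alpha> lam x] resolvent_eq_le[of g h \<alpha> lam x] assms by auto
  then show "h = g" by (simp add: fun_eq_iff antisym)
qed (use assms in auto)

section \<open>The quadrature error\<close>

lemma has_sum_sum_real:
  fixes f :: "'b \<Rightarrow> 'a \<Rightarrow> real"
  assumes "finite F" "\<And>i. i \<in> F \<Longrightarrow> (f i has_sum S i) A"
  shows "((\<lambda>x. \<Sum>i\<in>F. f i x) has_sum (\<Sum>i\<in>F. S i)) A"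
  using assms by (induction F rule: finite_induct) (auto intro!: has_sum_add)

text \<open>Dominates the sum over y of rho (x - y) (1_B x + 1_B y), the shape of a nonlocal operator applied to a
  function supported in B.\<close>

definition band :: "(int ^ 'n) set \<Rightarrow> (int ^ 'n \<Rightarrow> real) \<Rightarrow> int ^ 'n \<Rightarrow> real" where
  "band B \<rho> x = indicator B x * (infsum \<rho> UNIV + 1) + (\<Sum>y\<in>B. \<rho> (x - y))"

context
  fixes B :: "(int ^ 'n) set" and \<rho> :: "int ^ 'n \<Rightarrow> real"
  assumes B: "finite B" and \<rho>: "\<rho> summable_on UNIV" "\<And>z. 0 \<le> \<rho> z"
begin

lemma infsum_rho_nonneg: "0 \<le> infsum \<rho> UNIV"
  by (rule infsum_nonneg) (rule \<rho>(2))

lemma band_nonneg: "0 \<le> band B \<rho> x"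
  unfolding band_def using infsum_rho_nonneg \<rho>(2) by (intro add_nonneg_nonneg sum_nonneg) auto

lemma band_le: "band B \<rho> x \<le> 2 * infsum \<rho> UNIV + 1"
proof -
  have "(\<Sum>y\<in>B. \<rho> (x - y)) \<le> infsum (\<lambda>y. \<rho> (x - y)) UNIV"
    by (rule finite_sum_le_infsum) (use B \<rho> infsum_shift(1)[of \<rho> x] in auto)
  then have "(\<Sum>y\<in>B. \<rho> (x - y)) \<le> infsum \<rho> UNIV" by (simp only: infsum_shift(2))
  moreover have "indicator B x * (infsum \<rho> UNIV + 1) \<le> infsum \<rho> UNIV + 1"
    using infsum_rho_nonneg by (simp add: indicator_def)
  ultimately show ?thesis unfolding band_def by linarith
qed

lemma band_has_sum: "(band B \<rho> has_sum real (card B) * (2 * infsum \<rho> UNIV + 1)) UNIV"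
proof -
  have "((\<lambda>x. indicator B x * (infsum \<rho> UNIV + 1)) has_sum real (card B) * (infsum \<rho> UNIV + 1)) UNIV"
    by (rule has_sum_finite_neutralI[of B]) (use B in auto)
  moreover have "((\<lambda>x. \<Sum>y\<in>B. \<rho> (x - y)) has_sum (\<Sum>y\<in>B. infsum \<rho> UNIV)) UNIV"
  proof (rule has_sum_sum_real[OF B])
    fix y
    have "((\<lambda>x. \<rho> (x - y)) has_sum infsum (\<lambda>x. \<rho> (x - y)) UNIV) UNIV"
      by (rule has_sum_infsum) (use \<rho> infsum_shift'(1) in blast)
    then show "((\<lambda>x. \<rho> (x - y)) has_sum infsum \<rho> UNIV) UNIV"
      by (simp only: infsum_shift'(2))
  qed
  ultimately have "((\<lambda>x. indicator B x * (infsum \<rho> UNIV + 1) + (\<Sum>y\<in>B. \<rho> (x - y))) has_sum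
      real (card B) * (infsum \<rho> UNIV + 1) + (\<Sum>y\<in>B. infsum \<rho> UNIV)) UNIV"
    by (rule has_sum_add)
  then show ?thesis by (simp add: band_def[abs_def] algebra_simps)
qed

text \<open>One factor \<open>band\<close> is bounded by its supremum and the other is summed, so
  the square sum is of the order of the cardinality of B.\<close>

lemma band_square_sum:
  assumes T: "\<And>x. \<bar>T x\<bar> \<le> c * band B \<rho> x" and c: "0 \<le> c"
  shows "(\<lambda>x. (T x)\<^sup>2) summable_on UNIV"
    "(\<Sum>\<^sub>\<infinity>x. (T x)\<^sup>2) \<le> c\<^sup>2 * (real (card B) * (2 * infsum \<rho> UNIV + 1)\<^sup>2)"
proof -
  define S where "S = 2 * infsum \<rho> UNIV + 1"
  have S0: "0 \<le> S" using infsum_rho_nonneg by (simp add: S_def)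
  have le: "(T x)\<^sup>2 \<le> c\<^sup>2 * S * band B \<rho> x" for x
  proof -
    have "(T x)\<^sup>2 \<le> (c * band B \<rho> x)\<^sup>2" using T[of x] by (metis abs_ge_zero power2_abs power_mono)
    also have "\<dots> = c\<^sup>2 * (band B \<rho> x * band B \<rho> x)" by (simp add: power2_eq_square)
    also have "\<dots> \<le> c\<^sup>2 * (S * band B \<rho> x)"
      using band_nonneg[of x] band_le[of x] by (intro mult_left_mono mult_right_mono) (auto simp: S_def)
    finally show ?thesis by (simp add: mult.assoc)
  qed
  have hs: "((\<lambda>x. c\<^sup>2 * S * band B \<rho> x) has_sum c\<^sup>2 * S * (real (card B) * S)) UNIV"
    unfolding S_def by (rule has_sum_cmult_right[OF band_has_sum])
  then have s: "(\<lambda>x. c\<^sup>2 * S * band B \<rho> x) summable_on UNIV" by (auto simp: summable_on_def)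
  show 1: "(\<lambda>x. (T x)\<^sup>2) summable_on UNIV"
    by (rule summable_on_comparison_test[OF s le]) auto
  have "(\<Sum>\<^sub>\<infinity>x. (T x)\<^sup>2) \<le> (\<Sum>\<^sub>\<infinity>x. c\<^sup>2 * S * band B \<rho> x)"
    by (rule infsum_mono[OF 1 s le])
  also have "\<dots> = c\<^sup>2 * S * (real (card B) * S)" using hs by (rule infsumI)
  finally show "(\<Sum>\<^sub>\<infinity>x. (T x)\<^sup>2) \<le> c\<^sup>2 * (real (card B) * (2 * infsum \<rho> UNIV + 1)\<^sup>2)"
    by (simp add: S_def power2_eq_square mult_ac)
qed

end

lemma has_sum_indicator_shift:
  fixes \<rho> :: "'a :: ab_group_add \<Rightarrow> real"
  assumes "finite B"
  shows "((\<lambda>z. \<rho> z * indicator B (x - z)) has_sum (\<Sum>y\<in>B. \<rho> (x - y))) UNIV"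
    "((\<lambda>z. \<rho> z * indicator B (x + z)) has_sum (\<Sum>y\<in>B. \<rho> (y - x))) UNIV"
proof -
  have b: "bij_betw (\<lambda>y. x - y) UNIV UNIV"
    by (rule bij_betwI[where g = "\<lambda>y. x - y"]) auto
  have "((\<lambda>y. \<rho> (x - y) * indicator B (x - (x - y))) has_sum (\<Sum>y\<in>B. \<rho> (x - y))) UNIV"
    by (rule has_sum_finite_neutralI[of B]) (use assms in auto)
  then show "((\<lambda>z. \<rho> z * indicator B (x - z)) has_sum (\<Sum>y\<in>B. \<rho> (x - y))) UNIV"
    using has_sum_reindex_bij_betw[OF b, of "\<lambda>z. \<rho> z * indicator B (x - z)"] by simp
  have b: "bij_betw (\<lambda>y. y - x) UNIV UNIV"
    by (rule bij_betwI[where g = "\<lambda>y. y + x"]) auto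
  have "((\<lambda>y. \<rho> (y - x) * indicator B (x + (y - x))) has_sum (\<Sum>y\<in>B. \<rho> (y - x))) UNIV"
    by (rule has_sum_finite_neutralI[of B]) (use assms in auto)
  then show "((\<lambda>z. \<rho> z * indicator B (x + z)) has_sum (\<Sum>y\<in>B. \<rho> (y - x))) UNIV"
    using has_sum_reindex_bij_betw[OF b, of "\<lambda>z. \<rho> z * indicator B (x + z)"] by simp
qed

text \<open>Interpolates between a bounded quantity and one vanishing to order n at 0. The free
  exponent s trades decay of the kernel at infinity for powers of the mesh.\<close>

lemma min_power_le_powr:
  fixes r s :: real
  assumes "0 < r" "0 \<le> s" "s \<le> real n"
  shows "min 1 (r ^ n) \<le> r powr s"
proof (cases "r \<le> 1")
  case True
  have "r ^ n = r powr real n" using assms(1) by (simp add: powr_realpow)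
  also have "\<dots> \<le> r powr s" using assms True by (intro powr_mono') auto
  finally show ?thesis by simp
next
  case False
  then have "1 \<le> r powr s" using assms by (intro ge_one_powr_ge_zero) auto
  then show ?thesis by simp
qed

text \<open>The substitutions y = x + v and y = x - v give the same sum; their mean is a lattice sum
  of exactly the integrand in \<open>Lbar_eq_integral\<close>, so the two can be compared cell by
  cell.\<close>

lemma mean_sum_eq_sdiff:
  fixes g :: "real ^ 'n \<Rightarrow> real"
  assumes B: "\<And>x. \<bar>g x\<bar> \<le> B" and p: "real CARD('n) < p"
  shows "(\<lambda>v. sdiff g (lat_pt k x) (lat_pt k v) * lnorm v powr (- p)) summable_on UNIV"
    "(\<Sum>\<^sub>\<infinity>y. (g (lat_pt k y) - g (lat_pt k x)) * lnorm (x - y) powr (- p))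
      = (\<Sum>\<^sub>\<infinity>v. sdiff g (lat_pt k x) (lat_pt k v) * lnorm v powr (- p))"
proof -
  define f where "f y = (g (lat_pt k y) - g (lat_pt k x)) * lnorm (x - y) powr (- p)" for y
  have b1: "bij_betw (\<lambda>v. x + v) UNIV UNIV" by (rule bij_betwI[where g = "\<lambda>v. v - x"]) auto
  have b2: "bij_betw (\<lambda>v. x - v) UNIV UNIV" by (rule bij_betwI[where g = "\<lambda>v. x - v"]) auto
  have "(\<lambda>v :: int ^ 'n. 2 * B * lnorm v powr (- p)) summable_on UNIV"
    by (intro summable_on_cmult_right summable_lnorm_powr p)
  then have "(\<lambda>y. 2 * B * lnorm (x - y) powr (- p)) summable_on UNIV"
    using infsum_shift(1)[of "\<lambda>v. 2 * B * lnorm v powr (- p)" x] by simp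
  then have fs: "f summable_on UNIV"
  proof (rule summable_on_abs_comparison(1))
    fix y
    have "\<bar>g (lat_pt k y) - g (lat_pt k x)\<bar> \<le> 2 * B" using B[of "lat_pt k y"] B[of "lat_pt k x"] by linarith
    then show "\<bar>f y\<bar> \<le> 2 * B * lnorm (x - y) powr (- p)" by (simp add: f_def abs_mult mult_right_mono)
  qed
  have s1: "(\<lambda>v. f (x + v)) summable_on UNIV" and i1: "infsum (\<lambda>v. f (x + v)) UNIV = infsum f UNIV"
    using summable_on_reindex_bij_betw[OF b1, of f] infsum_reindex_bij_betw[OF b1, of f] fs by auto
  have s2: "(\<lambda>v. f (x - v)) summable_on UNIV" and i2: "infsum (\<lambda>v. f (x - v)) UNIV = infsum f UNIV"
    using summable_on_reindex_bij_betw[OF b2, of f] infsum_reindex_bij_betw[OF b2, of f] fs by auto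
  have e: "sdiff g (lat_pt k x) (lat_pt k v) * lnorm v powr (- p) = (f (x + v) + f (x - v)) * (1/2)" for v
    by (simp add: f_def sdiff_def lat_pt_add lat_pt_diff field_simps)
  show "(\<lambda>v. sdiff g (lat_pt k x) (lat_pt k v) * lnorm v powr (- p)) summable_on UNIV"
    unfolding e by (intro summable_on_cmult_left summable_on_add s1 s2)
  have "infsum f UNIV = (infsum (\<lambda>v. f (x + v)) UNIV + infsum (\<lambda>v. f (x - v)) UNIV) * (1/2)"
    using i1 i2 by simp
  also have "\<dots> = (\<Sum>\<^sub>\<infinity>v. (f (x + v) + f (x - v)) * (1/2))"
    by (simp only: infsum_cmult_left' infsum_add[OF s1 s2])
  finally show "(\<Sum>\<^sub>\<infinity>y. (g (lat_pt k y) - g (lat_pt k x)) * lnorm (x - y) powr (- p))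
      = (\<Sum>\<^sub>\<infinity>v. sdiff g (lat_pt k x) (lat_pt k v) * lnorm v powr (- p))"
    unfolding e by (simp only: f_def[abs_def])
qed

text \<open>Mean value theorem on the half-line from r / K, which contains both points and on which
  the derivative is largest at the left end.\<close>

lemma powr_diff_bound:
  fixes r a K p :: real
  assumes "0 < r" "1 \<le> K" "r \<le> K * a" "0 \<le> p"
  shows "\<bar>r powr (- p) - a powr (- p)\<bar> \<le> p * (K powr (p + 1) * r powr (- p - 1)) * \<bar>r - a\<bar>"
proof -
  have m: "0 < r / K" "r / K \<le> r" "r / K \<le> a"
    using assms by (auto simp: field_simps)
  have "norm (r powr (- p) - a powr (- p)) \<le> (p * (r / K) powr (- p - 1)) * norm (r - a)"
  proof (rule field_differentiable_bound[where S = "{r / K..}" and f' = "\<lambda>t. - p * t powr (- p - 1)"])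
    fix t assume t: "t \<in> {r / K..}"
    then have t0: "0 < t" using m by auto
    show "((\<lambda>t. t powr (- p)) has_real_derivative - p * t powr (- p - 1)) (at t within {r / K..})"
      using has_field_derivative_at_within[OF has_real_derivative_powr[OF t0, of "- p"]] by simp
    show "norm (- p * t powr (- p - 1)) \<le> p * (r / K) powr (- p - 1)"
      using t m assms(4) by (auto simp: abs_mult intro!: mult_left_mono powr_mono2')
  qed (use m in auto)
  also have "(r / K) powr (- p - 1) = K powr (p + 1) * r powr (- p - 1)"
  proof -
    have "K powr (- p - 1) = inverse (K powr (p + 1))"
      using powr_minus[of K "p + 1"] by simp
    moreover have "(r / K) powr (- p - 1) = r powr (- p - 1) / K powr (- p - 1)"
      using assms(1,2) by (simp add: powr_divide)
    ultimately show ?thesis by (simp add: divide_inverse)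
  qed
  finally show ?thesis by simp
qed

text \<open>Outside the central cell, with r the distance of the lattice point from 0,
  \<open>sdiff\<close> changes over the cell by O(min 1 r / k) and is itself O(min 1 r^2), while the
  kernel r^(-p) changes by O(r^(-p-1) / k). Interpolating the minima to r^\<theta> and
  r^(1+\<theta>) makes both errors O(r^(\<theta>-p) / k). In the central cell the lattice term is 0
  and the singular integrand is kept, bounded by |u|^(2-p). The indicators record that x, x + z or x
  - z must be near the support of g.\<close>

lemma cell_pointwise:
  fixes g :: "real ^ 'n \<Rightarrow> real"
  assumes g: "g \<in> Cc_inf" and L: "\<And>x. real L < norm x \<Longrightarrow> g x = 0"
    and p: "0 < p" and \<theta>: "0 \<le> \<theta>" "\<theta> \<le> 1"
  shows "\<exists>C>0. \<forall>k\<ge>1. \<forall>x u z. z = cell_idx (1/2) k u \<longrightarrow>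
    \<bar>sdiff g (lat_pt k x) (lat_pt k z) * norm (lat_pt k z) powr (- p) - sdiff g (lat_pt k x) u * norm u powr (- p)\<bar>
    \<le> C / real k * ((lnorm z / real k) powr (\<theta> - p) *
        (indicator {x. lnorm x \<le> real (L + CARD('n)) * real k} x
         + indicator {x. lnorm x \<le> real (L + CARD('n)) * real k} (x + z)
         + indicator {x. lnorm x \<le> real (L + CARD('n)) * real k} (x - z)))
      + C * indicator {x. lnorm x \<le> real (L + CARD('n)) * real k} x
        * (norm u powr (2 - p) * indicator (cball 0 (real CARD('n) / (2 * real k))) u)"
proof -
  obtain C1 where C1: "0 \<le> C1" "\<And>x u v. \<bar>sdiff g x u - sdiff g x v\<bar> \<le> C1 * norm (u - v) * (norm u + norm v)"
    using Cc_inf_sdiff[OF g] by blast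
  obtain C2 where C2: "0 \<le> C2" "\<And>x y. \<bar>g x - g y\<bar> \<le> C2 * norm (x - y)"
    using Cc_inf_lipschitz[OF g] by blast
  obtain C0 where C0: "\<And>x. \<bar>g x\<bar> \<le> C0" using Cc_inf_bounded[OF g] by blast
  have C00: "0 \<le> C0" using C0[of 0] by linarith
  define d where "d = real CARD('n)"
  define K where "K = 1 + d"
  have d: "0 < d" "1 \<le> K" by (auto simp: K_def d_def)
  define C3 where "C3 = C1 * K * (1 + K) + C2 * K"
  define C4 where "C4 = C1 * K\<^sup>2 + 2 * C0"
  define C5 where "C5 = C3 + C4 * p * K powr (p + 1) * K"
  define C where "C = C5 + C1 + 1"
  have nn: "0 \<le> C3" "0 \<le> C4" "0 \<le> C5"
    unfolding C3_def C4_def C5_def using C1 C2 C00 d p by (auto intro!: add_nonneg_nonneg mult_nonneg_nonneg)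
  have Cpos: "0 < C" using nn C1 by (simp add: C_def)
  have main: "\<bar>sdiff g (lat_pt k x) (lat_pt k z) * norm (lat_pt k z) powr (- p) - sdiff g (lat_pt k x) u * norm u powr (- p)\<bar>
    \<le> C / real k * ((lnorm z / real k) powr (\<theta> - p) *
        (indicator {x. lnorm x \<le> real (L + CARD('n)) * real k} x
         + indicator {x. lnorm x \<le> real (L + CARD('n)) * real k} (x + z)
         + indicator {x. lnorm x \<le> real (L + CARD('n)) * real k} (x - z)))
      + C * indicator {x. lnorm x \<le> real (L + CARD('n)) * real k} x
        * (norm u powr (2 - p) * indicator (cball 0 (real CARD('n) / (2 * real k))) u)"
    (is "?lhs \<le> C / real k * (?w * ?I) + C * ?J * ?N")
    if k: "1 \<le> k" and z: "z = cell_idx (1/2) k u" for k x u and z :: "int ^ 'n"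
  proof -
    have k0: "0 < k" using k by simp
    define X where "X = lat_pt k x"
    define v where "v = lat_pt k z"
    note ch = cell_half[OF k0 z]
    have \<delta>: "norm (u - v) \<le> d / (2 * real k)" using ch(1) by (simp add: v_def d_def)
    have \<delta>d: "norm (u - v) \<le> d"
    proof -
      have "d / (2 * real k) \<le> d / 1" using k d by (intro divide_left_mono) auto
      then show ?thesis using \<delta> by simp
    qed
    \<comment> \<open>Points of a cell lie within d of its lattice point, so the radius L of the
      support is enlarged by d: if x, x + z and x - z are all outside the larger ball, g vanishes at
      every point involved.\<close>
    have out: "real L + d < norm (X + lat_pt k y)" if "\<not> lnorm (x + y) \<le> real (L + CARD('n)) * real k" for y
      using that k0 by (simp add: X_def lat_pt_add norm_lat_pt d_def field_simps)
    have I0: "0 \<le> ?I" by simp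
    have J0: "0 \<le> ?J * ?N" by simp
    have cnn: "0 \<le> C / real k * (?w * ?I)" "0 \<le> C * ?J * ?N" using Cpos by auto
    show ?thesis
    proof (cases "z = 0")
      case True
      have nu: "norm u \<le> d / (2 * real k)" using ch(2)[OF True] by (simp add: d_def)
      have lhs: "?lhs = \<bar>sdiff g X u\<bar> * norm u powr (- p)"
        using True by (simp add: X_def abs_mult norm_lat_pt)
      show ?thesis
      proof (cases "lnorm x \<le> real (L + CARD('n)) * real k")
        case True
        have "\<bar>sdiff g X u\<bar> * norm u powr (- p) \<le> (C1 * (norm u)\<^sup>2) * norm u powr (- p)"
          by (intro mult_right_mono Cc_inf_sdiff_square C1(2)) simp
        also have "\<dots> = C1 * norm u powr (2 - p)" by (simp add: mult.assoc norm_power2_powr)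
        also have "\<dots> \<le> C * norm u powr (2 - p)"
          using nn by (intro mult_right_mono) (auto simp: C_def)
        also have "\<dots> = C * ?J * ?N" using True nu by (simp add: d_def)
        finally show ?thesis using lhs cnn(1) by linarith
      next
        case False
        have "norm (0 :: real ^ 'n) = 0" by simp
        have nX: "real L + d < norm X" using out[of 0] False
          by (simp add: lat_pt_def zero_vec_def[symmetric])
        have nud: "norm u \<le> d" using \<delta>d True
          by (simp add: v_def lat_pt_def zero_vec_def[symmetric])
        have "real L < norm (X + u)" "real L < norm (X - u)" "real L < norm X"
          using nX nud d norm_triangle_ineq2[of X "- u"] norm_triangle_ineq2[of X u] by auto
        then have "sdiff g X u = 0" by (simp add: sdiff_def L)
        then show ?thesis using lhs cnn by simp
      qed
    next
      case False
      define r where "r = lnorm z / real k"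
      have r0: "0 < r" using lnorm_ge_1[OF False] k0 by (simp add: r_def)
      have nv: "norm v = r" by (simp add: v_def r_def norm_lat_pt)
      have ra: "r \<le> K * norm u" "norm u \<le> K * r"
        using ch(3,4)[OF False] by (auto simp: r_def K_def d_def)
      show ?thesis
      proof (cases "lnorm x \<le> real (L + CARD('n)) * real k \<or> lnorm (x + z) \<le> real (L + CARD('n)) * real k
          \<or> lnorm (x - z) \<le> real (L + CARD('n)) * real k")
        case True
        then have I1: "1 \<le> ?I" by (auto simp: indicator_def)
        have \<delta>k: "norm (v - u) \<le> K / real k"
        proof -
          have "d / (2 * real k) \<le> K / real k" using k0 d by (simp add: K_def field_simps)
          then show ?thesis using \<delta> by (simp add: norm_minus_commute)
        qed
        have A: "\<bar>sdiff g X v - sdiff g X u\<bar> \<le> C3 / real k * r powr \<theta>"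
        proof -
          have a1: "\<bar>sdiff g X v - sdiff g X u\<bar> \<le> C3 / real k * r"
          proof -
            have "\<bar>sdiff g X v - sdiff g X u\<bar> \<le> C1 * norm (v - u) * (norm v + norm u)" by (rule C1(2))
            also have "\<dots> \<le> C1 * (K / real k) * ((1 + K) * r)"
              using \<delta>k ra nv C1(1) d r0 k0 by (intro mult_mono) (auto simp: algebra_simps)
            also have "\<dots> = C1 * K * (1 + K) / real k * r" by simp
            also have "\<dots> \<le> C3 / real k * r"
              using r0 k0 C2(1) d by (intro mult_right_mono divide_right_mono) (auto simp: C3_def)
            finally show ?thesis .
          qed
          have a2: "\<bar>sdiff g X v - sdiff g X u\<bar> \<le> C3 / real k"
          proof -
            have "\<bar>g (X + v) - g (X + u)\<bar> \<le> C2 * norm (v - u)" "\<bar>g (X - v) - g (X - u)\<bar> \<le> C2 * norm (v - u)"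
              using C2(2)[of "X + v" "X + u"] C2(2)[of "X - v" "X - u"] by (auto simp: norm_minus_commute)
            then have "\<bar>sdiff g X v - sdiff g X u\<bar> \<le> C2 * norm (v - u)"
              unfolding sdiff_def by (simp add: abs_le_iff field_simps)
            also have "\<dots> \<le> C2 * (K / real k)" using \<delta>k C2(1) by (rule mult_left_mono)
            also have "\<dots> \<le> C3 / real k"
              using k0 C1(1) d by (simp add: C3_def divide_right_mono)
            finally show ?thesis .
          qed
          have "\<bar>sdiff g X v - sdiff g X u\<bar> \<le> C3 / real k * min 1 (r ^ 1)"
            using a1 a2 by (simp add: min_def)
          also have "\<dots> \<le> C3 / real k * r powr \<theta>"
            using nn \<theta> by (intro mult_left_mono min_power_le_powr r0) auto
          finally show ?thesis .
        qed
        have Bd: "\<bar>sdiff g X u\<bar> \<le> C4 * r powr (1 + \<theta>)"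
        proof -
          have "\<bar>sdiff g X u\<bar> \<le> C1 * (norm u)\<^sup>2" by (rule Cc_inf_sdiff_square[OF C1(2)])
          also have "\<dots> \<le> C1 * (K * r)\<^sup>2" using ra C1(1) by (intro mult_left_mono power_mono) auto
          also have "\<dots> \<le> C4 * r\<^sup>2" using C00 by (simp add: C4_def power_mult_distrib distrib_right)
          finally have b1: "\<bar>sdiff g X u\<bar> \<le> C4 * r\<^sup>2" .
          have "\<bar>sdiff g X u\<bar> \<le> 2 * C0" by (rule sdiff_bound[OF C0])
          also have "\<dots> \<le> C4" using C1(1) by (simp add: C4_def)
          finally have b2: "\<bar>sdiff g X u\<bar> \<le> C4" .
          have "\<bar>sdiff g X u\<bar> \<le> C4 * min 1 (r ^ 2)" using b1 b2 by (simp add: min_def)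
          also have "\<dots> \<le> C4 * r powr (1 + \<theta>)"
            using nn \<theta> by (intro mult_left_mono min_power_le_powr r0) auto
          finally show ?thesis .
        qed
        have D: "\<bar>r powr (- p) - norm u powr (- p)\<bar> \<le> p * (K powr (p + 1) * r powr (- p - 1)) * (K / real k)"
        proof -
          have "\<bar>r powr (- p) - norm u powr (- p)\<bar> \<le> p * (K powr (p + 1) * r powr (- p - 1)) * \<bar>r - norm u\<bar>"
            by (rule powr_diff_bound) (use r0 d ra p in auto)
          also have "\<bar>r - norm u\<bar> \<le> K / real k"
            using \<delta>k norm_triangle_ineq3[of v u] nv by linarith
          finally show ?thesis using p by (simp add: mult_left_mono)
        qed
        have "?lhs = \<bar>(sdiff g X v - sdiff g X u) * r powr (- p) + sdiff g X u * (r powr (- p) - norm u powr (- p))\<bar>"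
          by (simp add: X_def[symmetric] v_def[symmetric] nv algebra_simps)
        also have "\<dots> \<le> \<bar>sdiff g X v - sdiff g X u\<bar> * r powr (- p) + \<bar>sdiff g X u\<bar> * \<bar>r powr (- p) - norm u powr (- p)\<bar>"
          by (rule order_trans[OF abs_triangle_ineq]) (simp add: abs_mult)
        also have "\<dots> \<le> (C3 / real k * r powr \<theta>) * r powr (- p)
            + (C4 * r powr (1 + \<theta>)) * (p * (K powr (p + 1) * r powr (- p - 1)) * (K / real k))"
          using A Bd D nn by (intro add_mono mult_mono) auto
        also have "\<dots> = C5 / real k * r powr (\<theta> - p)"
        proof -
          have e1: "r powr \<theta> * r powr (- p) = r powr (\<theta> - p)"
            by (simp flip: powr_add)
          have e2: "r powr (1 + \<theta>) * r powr (- p - 1) = r powr (\<theta> - p)"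
            by (simp flip: powr_add)
          have "(C3 / real k * r powr \<theta>) * r powr (- p)
            + (C4 * r powr (1 + \<theta>)) * (p * (K powr (p + 1) * r powr (- p - 1)) * (K / real k))
            = C3 / real k * (r powr \<theta> * r powr (- p))
            + C4 * p * K powr (p + 1) * K / real k * (r powr (1 + \<theta>) * r powr (- p - 1))"
            by (simp add: mult_ac)
          also have "\<dots> = C5 / real k * r powr (\<theta> - p)"
            unfolding e1 e2 C5_def by (simp add: add_divide_distrib distrib_right)
          finally show ?thesis .
        qed
        also have "\<dots> \<le> C / real k * (r powr (\<theta> - p) * ?I)"
        proof -
          have "C5 / real k * r powr (\<theta> - p) \<le> C / real k * r powr (\<theta> - p)"
            using C1(1) k0 by (intro mult_right_mono divide_right_mono) (auto simp: C_def)
          also have "\<dots> \<le> C / real k * (r powr (\<theta> - p) * ?I)"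
            using I1 Cpos k0 by (intro mult_left_mono) (auto intro: mult_le_cancel_left1[THEN iffD2])
          finally show ?thesis .
        qed
        finally show ?thesis using cnn(2) unfolding r_def by linarith
      next
        case False
        have l0: "lat_pt k (- z) = - v" by (simp add: v_def vec_eq_iff)
        have "real L + d < norm (X + v)" "real L + d < norm (X - v)" "real L + d < norm X"
          using out[of z] out[of "- z"] out[of 0] False
          by (auto simp: l0 v_def[symmetric] lat_pt_def[of k 0] zero_vec_def[symmetric])
        moreover have "norm (X + v) \<le> norm (X + u) + norm (u - v)" "norm (X - v) \<le> norm (X - u) + norm (u - v)"
          using norm_triangle_ineq[of "X + u" "v - u"] norm_triangle_ineq[of "X - u" "u - v"]
          by (simp_all add: norm_minus_commute algebra_simps)
        ultimately have "real L < norm (X + u)" "real L < norm (X - u)" "real L < norm X"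
          "real L < norm (X + v)" "real L < norm (X - v)" using \<delta>d d by linarith+
        then have "sdiff g X u = 0" "sdiff g X v = 0" by (simp_all add: sdiff_def L)
        then show ?thesis using cnn by (simp add: X_def v_def)
      qed
    qed
  qed
  show ?thesis using Cpos main by blast
qed

text \<open>The lattice mean is exactly the integral of the step function that freezes the
  symmetrised integrand at the cell centres, so the error is the integral of the pointwise bound.
  Rescaling gives k^(-1) k^(p - \<theta>) k^(-d) = k^(\<alpha> - \<theta> - 1); the central cell
  contributes k^(\<alpha> - 2), which is no larger as \<theta> \<le> 1. The condition \<theta> <
  \<alpha> keeps the dominating kernel summable.\<close>

lemma psi_bound:
  fixes g :: "real ^ 'n \<Rightarrow> real"
  assumes g: "g \<in> Cc_inf" and \<alpha>: "0 < \<alpha>" "\<alpha> < 2" and \<theta>: "0 \<le> \<theta>" "\<theta> \<le> 1" "\<theta> < \<alpha>"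
  shows "\<exists>C>0. \<exists>R\<ge>1. \<forall>k\<ge>1. \<forall>x.
    \<bar>real k powr \<alpha> * (\<Sum>\<^sub>\<infinity>y. (g (lat_pt k y) - g (lat_pt k x)) * lnorm (x - y) powr (- (real CARD('n) + \<alpha>)))
      - Lbar \<alpha> g (lat_pt k x)\<bar>
    \<le> C * real k powr (\<alpha> - \<theta> - 1)
      * band {z. lnorm z \<le> real R * real k} (\<lambda>z. lnorm z powr (- (real CARD('n) + \<alpha> - \<theta>))) x"
proof -
  define d where "d = real CARD('n)"
  define p where "p = d + \<alpha>"
  have p: "0 < p" "d < p" "d < p - \<theta>" using \<alpha> \<theta> by (auto simp: p_def d_def add_nonneg_pos)
  obtain L :: nat where L: "\<And>x. real L < norm x \<Longrightarrow> g x = 0" using Cc_inf_support[OF g] by blast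
  obtain B0 where B0: "\<And>x. \<bar>g x\<bar> \<le> B0" using Cc_inf_bounded[OF g] by blast
  define R where "R = L + CARD('n)"
  have R: "1 \<le> R" by (simp add: R_def Suc_leI)
  obtain C where C: "0 < C" "\<And>k x u z. 1 \<le> k \<Longrightarrow> z = cell_idx (1/2) k u \<Longrightarrow>
    \<bar>sdiff g (lat_pt k x) (lat_pt k z) * norm (lat_pt k z) powr (- p) - sdiff g (lat_pt k x) u * norm u powr (- p)\<bar>
    \<le> C / real k * ((lnorm z / real k) powr (\<theta> - p) *
        (indicator {x. lnorm x \<le> real R * real k} x
         + indicator {x. lnorm x \<le> real R * real k} (x + z)
         + indicator {x. lnorm x \<le> real R * real k} (x - z)))
      + C * indicator {x. lnorm x \<le> real R * real k} x
        * (norm u powr (2 - p) * indicator (cball 0 (d / (2 * real k))) u)"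
    using cell_pointwise[OF g L p(1) \<theta>(1,2)] unfolding R_def d_def by metis
  obtain C' where C': "0 < C'" "\<And>r. 0 < r \<Longrightarrow> integrable lborel (\<lambda>u :: real ^ 'n. norm u powr (2 - p) * indicator (cball 0 r) u)"
    "\<And>r. 0 < r \<Longrightarrow> (LINT u|lborel. norm (u :: real ^ 'n) powr (2 - p) * indicator (cball 0 r) u) \<le> C' * r powr (d + (2 - p))"
    using integral_cball_powr[of "2 - p", where 'n = 'n] \<alpha> by (auto simp: p_def d_def)
  define c2 where "c2 = (d / 2) powr (2 - \<alpha>)"
  define D where "D = 2 * C + C * C' * c2"
  define \<rho> where "\<rho> z = lnorm z powr (- (p - \<theta>))" for z :: "int ^ 'n"
  have \<rho>: "\<rho> summable_on UNIV" "\<And>z. 0 \<le> \<rho> z"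
    unfolding \<rho>_def[abs_def] using summable_lnorm_powr[of "p - \<theta>", where 'n = 'n] p by (auto simp: d_def)
  have Dpos: "0 < D" using C(1) C'(1) by (auto simp: D_def c2_def intro!: add_pos_nonneg mult_nonneg_nonneg)
  have "\<bar>real k powr \<alpha> * (\<Sum>\<^sub>\<infinity>y. (g (lat_pt k y) - g (lat_pt k x)) * lnorm (x - y) powr (- p)) - Lbar \<alpha> g (lat_pt k x)\<bar>
    \<le> D * real k powr (\<alpha> - \<theta> - 1) * band {z. lnorm z \<le> real R * real k} \<rho> x" if k: "1 \<le> k" for k x
  proof -
    have k0: "0 < k" using k by simp
    define Bs where "Bs = {z :: int ^ 'n. lnorm z \<le> real R * real k}"
    have fB: "finite Bs" by (simp add: Bs_def)
    define X where "X = lat_pt k x"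
    define \<phi> where "\<phi> v = sdiff g X (lat_pt k v) * norm (lat_pt k v) powr (- p)" for v
    define I where "I z = indicator Bs x + indicator Bs (x + z) + (indicator Bs (x - z) :: real)" for z
    have scale: "(lnorm v / real k) powr (- q) = real k powr q * lnorm v powr (- q)" for v :: "int ^ 'n" and q
    proof -
      have "(lnorm v / real k) powr (- q) = lnorm v powr (- q) / real k powr (- q)"
        by (simp add: powr_divide)
      then show ?thesis using powr_minus[of "real k" q] by (simp add: divide_inverse)
    qed
    have \<phi>_eq: "\<phi> v = real k powr p * (sdiff g X (lat_pt k v) * lnorm v powr (- p))" for v
      by (simp add: \<phi>_def norm_lat_pt scale)
    note ms = mean_sum_eq_sdiff[of g B0 p k x, OF B0 p(2)[unfolded d_def]]
    have \<phi>s: "\<phi> summable_on UNIV"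
      unfolding \<phi>_eq[abs_def] X_def by (intro summable_on_cmult_right ms(1))
    have kd: "real k ^ CARD('n) = real k powr d" using k0 by (simp add: d_def powr_realpow)
    have "infsum \<phi> UNIV / real k ^ CARD('n) = real k powr \<alpha> * (\<Sum>\<^sub>\<infinity>y. (g (lat_pt k y) - g (lat_pt k x)) * lnorm (x - y) powr (- p))"
    proof -
      have "infsum \<phi> UNIV = real k powr p * (\<Sum>\<^sub>\<infinity>y. (g (lat_pt k y) - g (lat_pt k x)) * lnorm (x - y) powr (- p))"
        unfolding \<phi>_eq[abs_def] X_def ms(2) by (rule infsum_cmult_right')
      moreover have "real k powr p / real k powr d = real k powr \<alpha>"
        by (simp add: p_def powr_add k0)
      ultimately show ?thesis unfolding kd by (simp only: times_divide_eq_left[symmetric])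
    qed
    then have e1: "real k powr \<alpha> * (\<Sum>\<^sub>\<infinity>y. (g (lat_pt k y) - g (lat_pt k x)) * lnorm (x - y) powr (- p))
        = (LINT u|lborel. \<phi> (cell_idx (1/2) k u))"
      using integral_cell(2)[OF k0 \<phi>s, of "1/2"] by simp
    have e2: "Lbar \<alpha> g X = (LINT u|lborel. sdiff g X u * norm u powr (- p))"
      using Lbar_eq_integral[OF g \<alpha>, of X] by (simp add: p_def d_def)
    define W where "W z = (lnorm z / real k) powr (\<theta> - p) * I z" for z
    have hsI: "((\<lambda>z. \<rho> z * I z) has_sum (infsum \<rho> UNIV * indicator Bs x + (\<Sum>y\<in>Bs. \<rho> (y - x)) + (\<Sum>y\<in>Bs. \<rho> (x - y)))) UNIV"
      unfolding I_def distrib_left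
      by (intro has_sum_add has_sum_cmult_left has_sum_infsum \<rho>(1) has_sum_indicator_shift fB)
    have sym: "(\<Sum>y\<in>Bs. \<rho> (y - x)) = (\<Sum>y\<in>Bs. \<rho> (x - y))"
      by (rule sum.cong) (auto simp: \<rho>_def lnorm_commute)
    have W_eq: "W z = real k powr (p - \<theta>) * (\<rho> z * I z)" for z
      unfolding W_def \<rho>_def using scale[of z "p - \<theta>"] by simp
    have Ws: "W summable_on UNIV"
      unfolding W_eq[abs_def] using hsI by (intro summable_on_cmult_right) (auto simp: summable_on_def)
    have Wsum: "infsum W UNIV \<le> real k powr (p - \<theta>) * (2 * band Bs \<rho> x)"
    proof -
      have "infsum W UNIV = real k powr (p - \<theta>) * (infsum \<rho> UNIV * indicator Bs x + (\<Sum>y\<in>Bs. \<rho> (y - x)) + (\<Sum>y\<in>Bs. \<rho> (x - y)))"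
        unfolding W_eq[abs_def] using hsI by (simp add: infsum_cmult_right' infsumI)
      also have "\<dots> \<le> real k powr (p - \<theta>) * (2 * band Bs \<rho> x)"
      proof (rule mult_left_mono)
        have "0 \<le> infsum \<rho> UNIV" by (rule infsum_nonneg) (rule \<rho>(2))
        then have "infsum \<rho> UNIV * indicator Bs x \<le> 2 * (indicator Bs x * (infsum \<rho> UNIV + 1))"
          by (simp add: indicator_def)
        then show "infsum \<rho> UNIV * indicator Bs x + (\<Sum>y\<in>Bs. \<rho> (y - x)) + (\<Sum>y\<in>Bs. \<rho> (x - y)) \<le> 2 * band Bs \<rho> x"
          unfolding band_def sym by (simp add: algebra_simps)
      qed simp
      finally show ?thesis .
    qed
    define N where "N u = norm u powr (2 - p) * indicator (cball 0 (d / (2 * real k))) u" for u :: "real ^ 'n"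
    have rpos: "0 < d / (2 * real k)" using k0 by (simp add: d_def)
    have Ni: "integrable lborel N" unfolding N_def by (rule C'(2)[OF rpos])
    have Nle: "(LINT u|lborel. N u) \<le> C' * c2 * real k powr (\<alpha> - 2)"
    proof -
      have "(d / (2 * real k)) powr (2 - \<alpha>) = ((d / 2) / real k) powr (2 - \<alpha>)" by simp
      also have "\<dots> = c2 * real k powr (\<alpha> - 2)"
      proof -
        have "((d / 2) / real k) powr (2 - \<alpha>) = c2 / real k powr (2 - \<alpha>)"
          unfolding c2_def by (rule powr_divide)
        moreover have "real k powr (\<alpha> - 2) = inverse (real k powr (2 - \<alpha>))"
          using powr_minus[of "real k" "2 - \<alpha>"] by (simp only: minus_diff_eq)
        ultimately show ?thesis by (simp only: divide_inverse)
      qed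
      finally show ?thesis
        using C'(3)[OF rpos] by (simp add: N_def p_def mult.assoc)
    qed
    have pw: "\<bar>\<phi> (cell_idx (1/2) k u) - sdiff g X u * norm u powr (- p)\<bar>
      \<le> C / real k * W (cell_idx (1/2) k u) + C * indicator Bs x * N u" for u
      using C(2)[OF k refl, of x u] unfolding \<phi>_def W_def I_def N_def Bs_def X_def by simp
    have Si: "integrable lborel (\<lambda>u. sdiff g X u * norm u powr (- p))"
      using integrable_sdiff[OF g \<alpha>, of X] by (simp add: p_def d_def)
    note fi = integral_cell(1)[OF k0 \<phi>s, of "1/2"] and Wi = integral_cell(1)[OF k0 Ws, of "1/2"]
    have "\<bar>(LINT u|lborel. \<phi> (cell_idx (1/2) k u)) - (LINT u|lborel. sdiff g X u * norm u powr (- p))\<bar>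
      = \<bar>LINT u|lborel. \<phi> (cell_idx (1/2) k u) - sdiff g X u * norm u powr (- p)\<bar>"
      by (subst Bochner_Integration.integral_diff[OF fi Si]) (rule refl)
    also have "\<dots> \<le> (LINT u|lborel. \<bar>\<phi> (cell_idx (1/2) k u) - sdiff g X u * norm u powr (- p)\<bar>)"
      by (rule integral_abs_bound)
    also have "\<dots> \<le> (LINT u|lborel. C / real k * W (cell_idx (1/2) k u) + C * indicator Bs x * N u)"
      by (intro integral_mono pw Bochner_Integration.integrable_add integrable_mult_right integrable_abs
          Bochner_Integration.integrable_diff fi Si Wi Ni)
    also have "\<dots> = C / real k * (infsum W UNIV / real k powr d) + C * indicator Bs x * (LINT u|lborel. N u)"
      using integral_cell(2)[OF k0 Ws, of "1/2"] unfolding kd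
      by (subst Bochner_Integration.integral_add) (auto intro!: integrable_mult_right Wi Ni)
    also have "\<dots> \<le> C / real k * (real k powr (p - \<theta>) * (2 * band Bs \<rho> x) / real k powr d)
        + C * indicator Bs x * (C' * c2 * real k powr (\<alpha> - 2))"
      using Wsum Nle C(1) k0 by (intro add_mono mult_left_mono divide_right_mono) auto
    also have "\<dots> \<le> D * real k powr (\<alpha> - \<theta> - 1) * band Bs \<rho> x"
    proof -
      have b: "0 \<le> band Bs \<rho> x" by (rule band_nonneg[OF fB \<rho>])
      have e: "1 / real k * (real k powr (p - \<theta>) / real k powr d) = real k powr (\<alpha> - \<theta> - 1)"
      proof -
        have "real k powr (p - \<theta>) / real k powr d = real k powr (\<alpha> - \<theta>)"
          by (simp add: p_def flip: powr_diff)
        moreover have "real k powr (\<alpha> - \<theta> - 1) = real k powr (\<alpha> - \<theta>) / real k"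
          using k0 by (simp add: powr_diff)
        ultimately show ?thesis by simp
      qed
      have "C / real k * (real k powr (p - \<theta>) * (2 * band Bs \<rho> x) / real k powr d)
          = 2 * C * (1 / real k * (real k powr (p - \<theta>) / real k powr d)) * band Bs \<rho> x" by simp
      then have t1: "C / real k * (real k powr (p - \<theta>) * (2 * band Bs \<rho> x) / real k powr d)
          = 2 * C * real k powr (\<alpha> - \<theta> - 1) * band Bs \<rho> x" unfolding e .
      have "real k powr (\<alpha> - 2) \<le> real k powr (\<alpha> - \<theta> - 1)"
        using k \<theta> by (intro powr_mono) auto
      \<comment> \<open>The summand 1 in \<open>band\<close> makes this hold whatever the total mass
        of \<rho> is.\<close>
      moreover have "indicator Bs x \<le> band Bs \<rho> x"
      proof -
        have "0 \<le> infsum \<rho> UNIV" by (rule infsum_nonneg) (rule \<rho>(2))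
        then have "indicator Bs x \<le> indicator Bs x * (infsum \<rho> UNIV + 1)" by (simp add: indicator_def)
        moreover have "0 \<le> (\<Sum>y\<in>Bs. \<rho> (x - y))" by (intro sum_nonneg \<rho>(2))
        ultimately show ?thesis unfolding band_def by linarith
      qed
      ultimately have "indicator Bs x * real k powr (\<alpha> - 2) \<le> band Bs \<rho> x * real k powr (\<alpha> - \<theta> - 1)"
        using b by (intro mult_mono) auto
      then have "C * C' * c2 * (indicator Bs x * real k powr (\<alpha> - 2)) \<le> C * C' * c2 * (band Bs \<rho> x * real k powr (\<alpha> - \<theta> - 1))"
        using C(1) C'(1) by (intro mult_left_mono) (auto simp: c2_def)
      then show ?thesis unfolding t1 D_def by (simp add: algebra_simps)
    qed
    finally show ?thesis unfolding e1 e2[unfolded X_def] X_def Bs_def .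
  qed
  then show ?thesis
    using Dpos R unfolding \<rho>_def p_def d_def by blast
qed

section \<open>Concentration\<close>

locale conductances = prob_space P for P :: "'w measure" +
  fixes w :: "(int ^ 'n) set \<Rightarrow> 'w \<Rightarrow> real" and M :: real
  assumes w_indep: "indep_vars (\<lambda>_. borel) w lat_edges"
    and w_mean: "e \<in> lat_edges \<Longrightarrow> expectation (w e) = 1"
    and M_pos: "0 < M"
    and w_bound: "e \<in> lat_edges \<Longrightarrow> \<omega> \<in> space P \<Longrightarrow> 0 \<le> w e \<omega> \<and> w e \<omega> \<le> M"
begin

lemma edge: "x \<noteq> y \<Longrightarrow> {x, y} \<in> lat_edges"
  by (auto simp: lat_edges_def)

lemma w_measurable: "e \<in> lat_edges \<Longrightarrow> w e \<in> borel_measurable P"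
  using w_indep by (auto simp: indep_vars_def)

lemma w_integrable: "e \<in> lat_edges \<Longrightarrow> integrable P (w e)"
  by (rule integrable_const_bound[where B = M]) (use w_bound w_measurable in auto)

text \<open>Injectivity of the map to edges makes the summands independent, each ranging over an
  interval of length |c p| M. Hoeffding at deviation M sqrt (t V) gives 2 exp (- 2 t), which is
  weakened to 2 exp (- t). V is only an upper bound for the square sum, so the same V can serve both
  halves of a double sum.\<close>

lemma hoeffding_pairs:
  fixes A :: "((int ^ 'n) \<times> (int ^ 'n)) set" and c :: "(int ^ 'n) \<times> (int ^ 'n) \<Rightarrow> real"
  assumes A: "finite A" "inj_on (\<lambda>(x, y). {x, y}) A" "\<And>x y. (x, y) \<in> A \<Longrightarrow> x \<noteq> y"
    and V: "(\<Sum>p\<in>A. (c p)\<^sup>2) \<le> V" "0 < V" and t: "0 \<le> t"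
  shows "prob {\<omega> \<in> space P. M * sqrt (t * V) \<le> \<bar>\<Sum>p\<in>A. c p * (w {fst p, snd p} \<omega> - 1)\<bar>} \<le> 2 * exp (- t)"
\<comment> \<open>If all coefficients vanish, Hoeffding's denominator is 0, so this case is treated
  directly.\<close>
proof (cases "(\<Sum>p\<in>A. (c p)\<^sup>2) = 0")
  case True
  then have "c p = 0" if "p \<in> A" for p
    using sum_nonneg_eq_0_iff[OF A(1), of "\<lambda>p. (c p)\<^sup>2"] that by simp
  then have z: "(\<Sum>p\<in>A. c p * (w {fst p, snd p} \<omega> - 1)) = 0" for \<omega> by simp
  show ?thesis
  proof (cases "t = 0")
    case True
    then show ?thesis by (intro order_trans[OF prob_le_1]) simp
  next
    case False
    then have "0 < M * sqrt (t * V)" using t V M_pos by (intro mult_pos_pos real_sqrt_gt_zero) auto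
    then have "{\<omega> \<in> space P. M * sqrt (t * V) \<le> \<bar>\<Sum>p\<in>A. c p * (w {fst p, snd p} \<omega> - 1)\<bar>} = {}"
      by (simp add: z)
    then show ?thesis by (simp only: measure_empty) simp
  qed
next
  case False
  define E where "E p = {fst p, snd p}" for p :: "(int ^ 'n) \<times> (int ^ 'n)"
  have injE: "inj_on E A" using A(2) by (simp add: E_def[abs_def] case_prod_unfold)
  have EA: "E p \<in> lat_edges" if "p \<in> A" for p
    using A(3)[of "fst p" "snd p"] that edge by (simp add: E_def)
  define I where "I = E ` A"
  define c' where "c' e = c (the_inv_into A E e)" for e
  have c': "c' (E p) = c p" if "p \<in> A" for p
    using the_inv_into_f_f[OF injE that] by (simp add: c'_def)
  have re: "(\<Sum>e\<in>I. f e (c' e)) = (\<Sum>p\<in>A. f (E p) (c p))" for f :: "(int ^ 'n) set \<Rightarrow> real \<Rightarrow> real"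
    unfolding I_def by (subst sum.reindex[OF injE]) (simp add: c')
  have fI: "finite I" using A(1) by (simp add: I_def)
  have IE: "e \<in> lat_edges" if "e \<in> I" for e using EA that by (auto simp: I_def)
  define X where "X e \<omega> = c' e * (w e \<omega> - 1)" for e \<omega>
  \<comment> \<open>End points of the range of c' e (w - 1) for 0 \<le> w \<le> M; minimum and
    maximum cover both signs of the coefficient.\<close>
  define a where "a e = min (- c' e) (c' e * (M - 1))" for e
  define b where "b e = max (- c' e) (c' e * (M - 1))" for e
  have ba: "(b e - a e)\<^sup>2 = (c' e)\<^sup>2 * M\<^sup>2" for e
  proof -
    have "b e - a e = \<bar>c' e * (M - 1) - (- c' e)\<bar>" by (simp add: a_def b_def max_def min_def)
    also have "c' e * (M - 1) - (- c' e) = c' e * M" by (simp add: algebra_simps)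
    finally show ?thesis by (simp add: power_mult_distrib)
  qed
  have ind: "indep_vars (\<lambda>_. borel) X I"
  proof -
    have "indep_vars (\<lambda>_. borel) w I"
      by (rule indep_vars_subset[OF w_indep]) (use IE in auto)
    then show ?thesis unfolding X_def[abs_def]
      by (rule indep_vars_compose2[where Y = "\<lambda>e x. c' e * (x - 1)"]) simp
  qed
  have range: "X e \<omega> \<in> {a e..b e}" if "e \<in> I" "\<omega> \<in> space P" for e \<omega>
  proof -
    have w: "0 \<le> w e \<omega>" "w e \<omega> \<le> M" using w_bound[OF IE[OF that(1)] that(2)] by auto
    show ?thesis
    proof (cases "0 \<le> c' e")
      case True
      have "c' e * (0 - 1) \<le> c' e * (w e \<omega> - 1)" "c' e * (w e \<omega> - 1) \<le> c' e * (M - 1)"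
        using True w by (intro mult_left_mono; simp)+
      then show ?thesis by (simp add: X_def a_def b_def)
    next
      case False
      have "c' e * (w e \<omega> - 1) \<le> c' e * (0 - 1)" "c' e * (M - 1) \<le> c' e * (w e \<omega> - 1)"
        using False w by (intro mult_left_mono_neg; simp)+
      then show ?thesis by (simp add: X_def a_def b_def)
    qed
  qed
  interpret H: Hoeffding_ineq P I X a b "\<Sum>e\<in>I. expectation (X e)"
    by unfold_locales (use fI ind range in auto)
  have "expectation (X e) = 0" if "e \<in> I" for e
    unfolding X_def using w_integrable[OF IE[OF that]] w_mean[OF IE[OF that]] by (simp add: prob_space)
  then have \<mu>: "(\<Sum>e\<in>I. expectation (X e)) = 0" by simp
  define S where "S = (\<Sum>e\<in>I. (b e - a e)\<^sup>2)"
  have S: "S = (\<Sum>p\<in>A. (c p)\<^sup>2) * M\<^sup>2"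
    using re[of "\<lambda>_ x. x\<^sup>2 * M\<^sup>2"] by (simp add: S_def ba sum_distrib_right)
  have cpos: "0 < (\<Sum>p\<in>A. (c p)\<^sup>2)" using False by (simp add: sum_nonneg order_less_le)
  then have S0: "0 < S" using M_pos by (simp add: S)
  have S1: "S \<le> V * M\<^sup>2" unfolding S using V(1) by (rule mult_right_mono) simp
  have "prob {\<omega> \<in> space P. M * sqrt (t * V) \<le> \<bar>(\<Sum>e\<in>I. X e \<omega>) - (\<Sum>e\<in>I. expectation (X e))\<bar>}
      \<le> 2 * exp (- 2 * (M * sqrt (t * V))\<^sup>2 / S)"
    unfolding S_def by (rule H.Hoeffding_ineq_abs_ge) (use t V M_pos S0 in \<open>auto simp: S_def\<close>)
  also have "exp (- 2 * (M * sqrt (t * V))\<^sup>2 / S) \<le> exp (- t)"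
  proof -
    have "(M * sqrt (t * V))\<^sup>2 = t * (V * M\<^sup>2)" using t V by (simp add: power_mult_distrib)
    moreover have "t * S \<le> t * (V * M\<^sup>2)" by (rule mult_left_mono[OF S1 t])
    moreover have "0 \<le> t * (V * M\<^sup>2)" using t V by simp
    ultimately have "t * S \<le> 2 * (M * sqrt (t * V))\<^sup>2" by linarith
    then have "t \<le> 2 * (M * sqrt (t * V))\<^sup>2 / S" using S0 by (simp add: pos_le_divide_eq)
    then show ?thesis by simp
  qed
  finally have "prob {\<omega> \<in> space P. M * sqrt (t * V) \<le> \<bar>\<Sum>e\<in>I. X e \<omega>\<bar>} \<le> 2 * exp (- t)"
    unfolding \<mu> by simp
  moreover have "(\<Sum>e\<in>I. X e \<omega>) = (\<Sum>p\<in>A. c p * (w {fst p, snd p} \<omega> - 1))" for \<omega>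
    using re[of "\<lambda>e x. x * (w e \<omega> - 1)"] by (simp add: X_def E_def)
  ultimately show ?thesis by simp
qed

lemma summable_tail_small:
  fixes f :: "'b \<Rightarrow> real"
  assumes "f summable_on UNIV" "\<And>y. 0 \<le> f y" "0 < \<delta>"
  shows "\<exists>F. finite F \<and> infsum f (- F) \<le> \<delta>"
proof -
  obtain F where F: "finite F" "dist (sum f F) (infsum f UNIV) \<le> \<delta>"
    using has_sum_finite_approximation[OF has_sum_infsum[OF assms(1)] assms(3)] by auto
  have "infsum f (F \<union> - F) = infsum f F + infsum f (- F)"
    by (rule infsum_Un_disjoint) (use F summable_on_subset_banach[OF assms(1)] in auto)
  then have "infsum f UNIV = sum f F + infsum f (- F)" using F by simp
  then show ?thesis using F by (auto simp: dist_real_def)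
qed

text \<open>An edge with both end points in Q occurs twice in the double sum, as (x, y) and as (y,
  x), which destroys independence. Enumerating the lattice by \<open>to_nat\<close> splits the pairs
  into two families, each injective into edges. The inner series are first truncated to finite sets
  with total error at most \<epsilon> = M sqrt (t V); one \<epsilon> for the tails and one for each
  family give the factor 3, and the two Hoeffding bounds give 4 exp (- t).\<close>

lemma fluctuation_tail:
  fixes Q :: "(int ^ 'n) set" and c :: "int ^ 'n \<Rightarrow> int ^ 'n \<Rightarrow> real"
  assumes Q: "finite Q" and c: "\<And>x. x \<in> Q \<Longrightarrow> (\<lambda>y. \<bar>c x y\<bar>) summable_on UNIV" "\<And>x. c x x = 0"
    and c2: "\<And>x. x \<in> Q \<Longrightarrow> (\<lambda>y. (c x y)\<^sup>2) summable_on UNIV"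
    and t: "0 < t"
  shows "\<exists>A\<in>events. prob A \<le> 4 * exp (- t) \<and> (\<forall>\<omega>\<in>space P - A.
    \<bar>\<Sum>x\<in>Q. \<Sum>\<^sub>\<infinity>y. c x y * (w {x, y} \<omega> - 1)\<bar> \<le> 3 * M * sqrt (t * (\<Sum>x\<in>Q. \<Sum>\<^sub>\<infinity>y. (c x y)\<^sup>2)))"
proof -
  define V where "V = (\<Sum>x\<in>Q. \<Sum>\<^sub>\<infinity>y. (c x y)\<^sup>2)"
  have V0: "0 \<le> V" unfolding V_def by (intro sum_nonneg infsum_nonneg) auto
  have xb: "\<bar>c x y * (w {x, y} \<omega> - 1)\<bar> \<le> \<bar>c x y\<bar> * (M + 1)" if "\<omega> \<in> space P" for x y \<omega>
  proof (cases "x = y")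
    case True
    then show ?thesis using c(2) by simp
  next
    case False
    have "\<bar>w {x, y} \<omega> - 1\<bar> \<le> M + 1" using w_bound[OF edge[OF False] that] by linarith
    then show ?thesis unfolding abs_mult by (rule mult_left_mono) simp
  qed
  show ?thesis
  proof (cases "V = 0")
    case True
    have "c x y = 0" if "x \<in> Q" for x y
    proof -
      have "(\<Sum>\<^sub>\<infinity>y. (c x y)\<^sup>2) = 0"
        using True that Q unfolding V_def by (subst (asm) sum_nonneg_eq_0_iff) (auto intro: infsum_nonneg)
      then have "(c x y)\<^sup>2 \<le> 0" using finite_sum_le_infsum[OF c2[OF that], of "{y}"] by simp
      then show ?thesis by simp
    qed
    then have "(\<Sum>x\<in>Q. \<Sum>\<^sub>\<infinity>y. c x y * (w {x, y} \<omega> - 1)) = 0" for \<omega> by simp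
    then show ?thesis using M_pos V0 t by (intro bexI[of _ "{}"]) (auto simp: V_def)
  next
    case False
    then have Vp: "0 < V" using V0 by simp
    define \<epsilon> where "\<epsilon> = M * sqrt (t * V)"
    have e0: "0 < \<epsilon>" using M_pos t Vp by (simp add: \<epsilon>_def)
    have "\<exists>F. finite F \<and> infsum (\<lambda>y. \<bar>c x y\<bar> * (M + 1)) (- F) \<le> \<epsilon> / real (card Q)" if "x \<in> Q" for x
    proof (rule summable_tail_small)
      show "(\<lambda>y. \<bar>c x y\<bar> * (M + 1)) summable_on UNIV" by (intro summable_on_cmult_left c that)
      show "0 < \<epsilon> / real (card Q)" using e0 Q that by (intro divide_pos_pos) (auto simp: card_gt_0_iff)
    qed (use M_pos in auto)
    then obtain F where F: "\<And>x. x \<in> Q \<Longrightarrow> finite (F x)"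
      "\<And>x. x \<in> Q \<Longrightarrow> infsum (\<lambda>y. \<bar>c x y\<bar> * (M + 1)) (- F x) \<le> \<epsilon> / real (card Q)"
      by metis
    define G where "G = Sigma Q F"
    have fG: "finite G" unfolding G_def using Q F(1) by auto
    define A1 where "A1 = {p \<in> G. to_nat (fst p) < to_nat (snd p)}"
    define A2 where "A2 = {p \<in> G. to_nat (snd p) < to_nat (fst p)}"
    define s where "s A \<omega> = (\<Sum>p\<in>A. c (fst p) (snd p) * (w {fst p, snd p} \<omega> - 1))" for A \<omega>
    have sq: "(\<Sum>p\<in>A. (c (fst p) (snd p))\<^sup>2) \<le> V" if "A \<subseteq> G" for A
    proof -
      have "(\<Sum>p\<in>A. (c (fst p) (snd p))\<^sup>2) \<le> (\<Sum>p\<in>G. (c (fst p) (snd p))\<^sup>2)"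
        by (rule sum_mono2[OF fG that]) auto
      also have "\<dots> = (\<Sum>x\<in>Q. \<Sum>y\<in>F x. (c x y)\<^sup>2)"
        unfolding G_def using Q F(1) by (subst sum.Sigma) (auto simp: case_prod_unfold)
      also have "\<dots> \<le> V" unfolding V_def
        by (intro sum_mono finite_sum_le_infsum c2 F) auto
      finally show ?thesis .
    qed
    have inj1: "inj_on (\<lambda>(x, y). {x, y}) A1" and inj2: "inj_on (\<lambda>(x, y). {x, y}) A2"
      by (auto simp: inj_on_def A1_def A2_def doubleton_eq_iff)
    have sub: "A1 \<subseteq> G" "A2 \<subseteq> G" by (auto simp: A1_def A2_def)
    define B where "B A = {\<omega> \<in> space P. \<epsilon> \<le> \<bar>s A \<omega>\<bar>}" for A
    have p: "prob (B A1) \<le> 2 * exp (- t)" "prob (B A2) \<le> 2 * exp (- t)"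
      unfolding B_def s_def \<epsilon>_def
      by (rule hoeffding_pairs; use fG sub sq inj1 inj2 Vp t finite_subset in \<open>auto simp: A1_def A2_def\<close>)+
    have ne: "{fst p, snd p} \<in> lat_edges" if "p \<in> A1 \<union> A2" for p
      using that by (intro edge) (auto simp: A1_def A2_def)
    have ev: "B A1 \<in> events" "B A2 \<in> events"
    proof -
      have "s A \<in> borel_measurable P" if "A \<subseteq> A1 \<union> A2" for A
        unfolding s_def[abs_def] using that w_measurable[OF ne]
        by (intro borel_measurable_sum borel_measurable_times borel_measurable_diff borel_measurable_const) auto
      then have "s A1 \<in> borel_measurable P" "s A2 \<in> borel_measurable P" by auto
      then show "B A1 \<in> events" "B A2 \<in> events" unfolding B_def by measurable
    qed
    have "\<bar>\<Sum>x\<in>Q. \<Sum>\<^sub>\<infinity>y. c x y * (w {x, y} \<omega> - 1)\<bar> \<le> 3 * \<epsilon>" if \<omega>: "\<omega> \<in> space P - (B A1 \<union> B A2)" for \<omega>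
    proof -
      have wsp: "\<omega> \<in> space P" using \<omega> by auto
      have tail: "\<bar>(\<Sum>\<^sub>\<infinity>y. c x y * (w {x, y} \<omega> - 1)) - (\<Sum>y\<in>F x. c x y * (w {x, y} \<omega> - 1))\<bar> \<le> \<epsilon> / real (card Q)"
        if x: "x \<in> Q" for x
      proof -
        define f where "f y = c x y * (w {x, y} \<omega> - 1)" for y
        have ss: "(\<lambda>y. \<bar>c x y\<bar> * (M + 1)) summable_on UNIV" by (intro summable_on_cmult_left c x)
        have fs: "f summable_on UNIV"
          by (rule summable_on_abs_comparison(1)[OF ss]) (simp only: f_def xb[OF wsp])
        have "infsum f (F x \<union> - F x) = infsum f (F x) + infsum f (- F x)"
          by (rule infsum_Un_disjoint) (use F(1)[OF x] summable_on_subset_banach[OF fs] in auto)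
        then have "infsum f UNIV - sum f (F x) = infsum f (- F x)" using F(1)[OF x] by simp
        also have "\<bar>\<dots>\<bar> \<le> infsum (\<lambda>y. \<bar>c x y\<bar> * (M + 1)) (- F x)"
          by (rule abs_infsum_le) (use summable_on_subset_banach[OF ss] xb[OF wsp] in \<open>auto simp: f_def\<close>)
        also have "\<dots> \<le> \<epsilon> / real (card Q)" by (rule F(2)[OF x])
        finally show ?thesis by (simp add: f_def[abs_def])
      qed
      have split: "(\<Sum>x\<in>Q. \<Sum>y\<in>F x. c x y * (w {x, y} \<omega> - 1)) = s A1 \<omega> + s A2 \<omega>"
      proof -
        have "(\<Sum>x\<in>Q. \<Sum>y\<in>F x. c x y * (w {x, y} \<omega> - 1)) = s G \<omega>"
          unfolding G_def s_def using Q F(1) by (subst sum.Sigma) (auto simp: case_prod_unfold)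
        also have "\<dots> = s (A1 \<union> A2) \<omega>" unfolding s_def
        proof (rule sum.mono_neutral_right[OF fG])
          show "\<forall>p\<in>G - (A1 \<union> A2). c (fst p) (snd p) * (w {fst p, snd p} \<omega> - 1) = 0"
          proof
            fix p assume "p \<in> G - (A1 \<union> A2)"
            then have "to_nat (fst p) = to_nat (snd p)" by (auto simp: A1_def A2_def)
            then have "fst p = snd p" by simp
            then show "c (fst p) (snd p) * (w {fst p, snd p} \<omega> - 1) = 0" using c(2) by simp
          qed
        qed (use sub in auto)
        also have "\<dots> = s A1 \<omega> + s A2 \<omega>" unfolding s_def
          by (rule sum.union_disjoint) (use fG sub finite_subset in \<open>auto simp: A1_def A2_def\<close>)
        finally show ?thesis .
      qed
      have "\<bar>(\<Sum>x\<in>Q. \<Sum>\<^sub>\<infinity>y. c x y * (w {x, y} \<omega> - 1)) - (\<Sum>x\<in>Q. \<Sum>y\<in>F x. c x y * (w {x, y} \<omega> - 1))\<bar>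
          \<le> (\<Sum>x\<in>Q. \<epsilon> / real (card Q))"
        unfolding sum_subtractf[symmetric] by (rule order_trans[OF sum_abs sum_mono]) (rule tail)
      also have "\<dots> \<le> \<epsilon>" using e0 by (cases "card Q = 0") auto
      finally have "\<bar>(\<Sum>x\<in>Q. \<Sum>\<^sub>\<infinity>y. c x y * (w {x, y} \<omega> - 1)) - (s A1 \<omega> + s A2 \<omega>)\<bar> \<le> \<epsilon>"
        unfolding split .
      moreover have "\<bar>s A1 \<omega>\<bar> < \<epsilon>" "\<bar>s A2 \<omega>\<bar> < \<epsilon>" using \<omega> by (auto simp: B_def)
      ultimately show ?thesis by linarith
    qed
    moreover have "prob (B A1 \<union> B A2) \<le> 4 * exp (- t)"
      using measure_Un_le[OF ev] p by linarith
    ultimately show ?thesis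
      using ev unfolding V_def[symmetric] \<epsilon>_def by (intro bexI[of _ "B A1 \<union> B A2"]) (auto simp: mult.assoc)
  qed
qed

text \<open>For distinct midpoints v the edge pairs {x, v}, {y, v} are disjoint, so the products are
  independent, with mean 1 and values in [0, M^2]; the mean provides connectivity even though
  conductances may be 0. The sum has expectation N - 2 and is allowed to drop by N / 4; the
  remainder N - 2 - N / 4 is at least N / 4 once N \<ge> 4.\<close>

lemma two_path_tail:
  fixes Q :: "(int ^ 'n) set"
  assumes Q: "finite Q" "4 \<le> card Q" and xy: "x \<in> Q" "y \<in> Q" "x \<noteq> y"
  shows "\<exists>A\<in>events. prob A \<le> exp (- real (card Q) / (8 * M ^ 4)) \<and> (\<forall>\<omega>\<in>space P - A.
    real (card Q) / 4 \<le> (\<Sum>v\<in>Q - {x, y}. w {x, v} \<omega> * w {y, v} \<omega>))"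
proof -
  define I where "I = Q - {x, y}"
  define N where "N = real (card Q)"
  have fI: "finite I" using Q by (simp add: I_def)
  have cI: "real (card I) = N - 2"
  proof -
    have "card I = card Q - card {x, y}" unfolding I_def using xy Q by (intro card_Diff_subset) auto
    then show ?thesis using xy Q by (simp add: N_def of_nat_diff)
  qed
  define K where "K v = {{x, v}, {y, v}}" for v
  have KE: "K v \<subseteq> lat_edges" if "v \<in> I" for v
    using that edge[of x v] edge[of y v] by (auto simp: K_def I_def)
  have Kd: "disjoint_family_on K I"
    by (auto simp: disjoint_family_on_def K_def I_def doubleton_eq_iff)
  define X where "X v \<omega> = w {x, v} \<omega> * w {y, v} \<omega>" for v \<omega>
  have "indep_vars (\<lambda>v. PiM (K v) (\<lambda>_. borel)) (\<lambda>v \<omega>. restrict (\<lambda>i. w i \<omega>) (K v)) I"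
    by (rule indep_vars_restrict[OF w_indep KE Kd])
  then have "indep_vars (\<lambda>_. borel) (\<lambda>v \<omega>. restrict (\<lambda>i. w i \<omega>) (K v) {x, v} * restrict (\<lambda>i. w i \<omega>) (K v) {y, v}) I"
    by (rule indep_vars_compose2[where Y = "\<lambda>v f. f {x, v} * f {y, v}"])
      (intro borel_measurable_times measurable_component_singleton; simp add: K_def)
  then have ind: "indep_vars (\<lambda>_. borel) X I"
    by (simp add: X_def[abs_def] K_def)
  have ex: "expectation (X v) = 1" if v: "v \<in> I" for v
  proof -
    have ne: "{x, v} \<noteq> {y, v}" using xy by (auto simp: doubleton_eq_iff)
    have fK: "finite (K v)" by (simp add: K_def)
    have "(\<integral>\<omega>. (\<Prod>i\<in>K v. w i \<omega>) \<partial>P) = (\<Prod>i\<in>K v. \<integral>\<omega>. w i \<omega> \<partial>P)"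
      by (rule indep_vars_lebesgue_integral[OF fK indep_vars_subset[OF w_indep KE[OF v]]])
        (use KE[OF v] w_integrable in auto)
    also have "\<dots> = 1" using KE[OF v] w_mean by (intro prod.neutral) auto
    finally show ?thesis using ne by (simp add: K_def X_def[abs_def])
  qed
  have range: "X v \<omega> \<in> {0..M\<^sup>2}" if "v \<in> I" "\<omega> \<in> space P" for v \<omega>
  proof -
    have "{x, v} \<in> lat_edges" "{y, v} \<in> lat_edges" using KE[OF that(1)] by (auto simp: K_def)
    then have "0 \<le> w {x, v} \<omega>" "w {x, v} \<omega> \<le> M" "0 \<le> w {y, v} \<omega>" "w {y, v} \<omega> \<le> M"
      using w_bound that(2) by blast+
    then show ?thesis using M_pos by (auto simp: X_def power2_eq_square intro: mult_mono)
  qed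
  interpret H: Hoeffding_ineq P I X "\<lambda>_. 0" "\<lambda>_. M\<^sup>2" "\<Sum>v\<in>I. expectation (X v)"
    by unfold_locales (use fI ind range in auto)
  have \<mu>: "(\<Sum>v\<in>I. expectation (X v)) = N - 2" using ex cI by simp
  have N4: "4 \<le> N" using Q by (simp add: N_def)
  define S where "S = (\<Sum>v\<in>I. (M\<^sup>2 - 0)\<^sup>2)"
  have S: "S = (N - 2) * M ^ 4" by (simp add: S_def cI power2_eq_square power4_eq_xxxx)
  define A where "A = {\<omega> \<in> space P. (\<Sum>v\<in>I. X v \<omega>) \<le> (N - 2) - N / 4}"
  have "prob A \<le> exp (- 2 * (N / 4)\<^sup>2 / S)"
    unfolding A_def S_def \<mu>[symmetric]
    by (rule H.Hoeffding_ineq_le) (use N4 M_pos S in \<open>auto simp: S_def[symmetric] cI\<close>)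
  also have "\<dots> \<le> exp (- N / (8 * M ^ 4))"
  proof -
    have M4: "0 < M ^ 4" using M_pos by simp
    have S0: "0 < S" using N4 M4 by (simp add: S)
    have "N * S \<le> N * (N * M ^ 4)" using N4 M4 by (intro mult_left_mono) (auto simp: S)
    then have "N / (8 * M ^ 4) \<le> 2 * (N / 4)\<^sup>2 / S"
      using S0 M4 by (simp add: divide_simps power2_eq_square) (simp add: algebra_simps)?
    then show ?thesis by simp
  qed
  finally have "prob A \<le> exp (- N / (8 * M ^ 4))" .
  moreover have "A \<in> events"
  proof -
    have "X v \<in> borel_measurable P" if "v \<in> I" for v using H.random_variable[OF that] .
    then have "(\<lambda>\<omega>. \<Sum>v\<in>I. X v \<omega>) \<in> borel_measurable P" by (rule borel_measurable_sum)
    then show ?thesis unfolding A_def by measurable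
  qed
  moreover have "N / 4 \<le> (\<Sum>v\<in>Q - {x, y}. w {x, v} \<omega> * w {y, v} \<omega>)" if "\<omega> \<in> space P - A" for \<omega>
    using that N4 by (auto simp: A_def I_def[symmetric] X_def[symmetric])
  ultimately show ?thesis unfolding N_def by blast
qed

end

section \<open>Dyadic cubes and the Poincare inequality\<close>

text \<open>Integer division rounds downwards, so the cubes tile the lattice uniformly across the
  origin as well.\<close>

definition cube :: "nat \<Rightarrow> int ^ 'n \<Rightarrow> (int ^ 'n) set" where
  "cube J z = {y. \<forall>i. y $ i div 2 ^ J = z $ i div 2 ^ J}"

text \<open>Asymmetric by one site, so that the box is a union of 2^d dyadic cubes of level m and
  hence of cubes of every level J \<le> m.\<close>

definition lam_box :: "nat \<Rightarrow> (int ^ 'n) set" where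
  "lam_box m = lbox (- (2 ^ m)) (2 ^ m - 1)"

definition avg :: "nat \<Rightarrow> (int ^ 'n \<Rightarrow> real) \<Rightarrow> int ^ 'n \<Rightarrow> real" where
  "avg J h z = (\<Sum>y\<in>cube J z. h y) / 2 ^ (J * CARD('n))"

lemma cube_refl [simp]: "z \<in> cube J z"
  by (simp add: cube_def)

lemma cube_eq: "y \<in> cube J z \<Longrightarrow> cube J y = cube J z"
  by (simp add: cube_def)

lemma cube_sym: "y \<in> cube J z \<longleftrightarrow> z \<in> cube J y"
  by (auto simp: cube_def)

lemma div_pow2_iff: "(a :: int) div 2 ^ J = b \<longleftrightarrow> 2 ^ J * b \<le> a \<and> a \<le> 2 ^ J * b + (2 ^ J - 1)"
proof -
  have p: "(0 :: int) < 2 ^ J" by simp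
  show ?thesis
  proof
    assume b: "a div 2 ^ J = b"
    show "2 ^ J * b \<le> a \<and> a \<le> 2 ^ J * b + (2 ^ J - 1)"
      using mult_div_mod_eq[of "2 ^ J" a] pos_mod_bound[OF p, of a] pos_mod_sign[OF p, of a] unfolding b by linarith
  next
    assume "2 ^ J * b \<le> a \<and> a \<le> 2 ^ J * b + (2 ^ J - 1)"
    then show "a div 2 ^ J = b"
      by (intro int_div_pos_eq[of a "2 ^ J" b "a - 2 ^ J * b"]) auto
  qed
qed

lemma bij_betw_cube:
  "bij_betw (\<lambda>f. \<chi> i. f i) (PiE UNIV (\<lambda>i. {2 ^ J * (z $ i div 2 ^ J)..2 ^ J * (z $ i div 2 ^ J) + (2 ^ J - 1)}))
    (cube J z :: (int ^ 'n) set)"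
  by (rule bij_betwI[where g = "\<lambda>z. ($) z"]) (auto simp: cube_def div_pow2_iff vec_eq_iff)

lemma finite_cube [simp]: "finite (cube J z)"
  using bij_betw_finite[OF bij_betw_cube, of J z] by (simp add: finite_PiE)

lemma card_cube: "card (cube J z :: (int ^ 'n) set) = 2 ^ (J * CARD('n))"
proof -
  have "card (PiE (UNIV :: 'n set) (\<lambda>i. {2 ^ J * (z $ i div 2 ^ J)..2 ^ J * (z $ i div 2 ^ J) + (2 ^ J - 1)})) = card (cube J z)"
    by (rule bij_betw_same_card[OF bij_betw_cube])
  then show ?thesis by (simp add: card_PiE power_mult nat_power_eq)
qed

lemma cube_mono:
  assumes "J \<le> K"
  shows "cube J z \<subseteq> cube K z"
proof
  fix y assume y: "y \<in> cube J z"
  have e: "a div 2 ^ K = (a div 2 ^ J) div 2 ^ (K - J)" for a :: int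
  proof -
    have "(2 :: int) ^ K = 2 ^ J * 2 ^ (K - J)" using assms by (simp flip: power_add)
    then show ?thesis by (simp add: zdiv_zmult2_eq)
  qed
  show "y \<in> cube K z" using y unfolding cube_def mem_Collect_eq e[of "y $ _"] e[of "z $ _"] by simp
qed

lemma cube_subset_lam_box:
  assumes "J \<le> m" "z \<in> lam_box m"
  shows "cube J z \<subseteq> lam_box m"
proof
  fix y assume "y \<in> cube J z"
  then have y: "y \<in> cube m z" using cube_mono[OF assms(1)] by auto
  have iff: "- (2 ^ m) \<le> a \<and> a \<le> 2 ^ m - 1 \<longleftrightarrow> a div 2 ^ m = - 1 \<or> a div 2 ^ m = 0" for a :: int
    unfolding div_pow2_iff by auto
  show "y \<in> lam_box m" using y assms(2) unfolding lam_box_def lbox_def cube_def mem_Collect_eq iff by simp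
qed

lemma lnorm_cube:
  fixes z :: "int ^ 'n"
  assumes "y \<in> cube J z"
  shows "lnorm (z - y) \<le> real CARD('n) * 2 ^ J"
proof (rule lnorm_le_card)
  fix i
  have "y $ i div 2 ^ J = z $ i div 2 ^ J" using assms by (simp add: cube_def)
  then have "2 ^ J * (z $ i div 2 ^ J) \<le> y $ i" "y $ i \<le> 2 ^ J * (z $ i div 2 ^ J) + (2 ^ J - 1)"
    "2 ^ J * (z $ i div 2 ^ J) \<le> z $ i" "z $ i \<le> 2 ^ J * (z $ i div 2 ^ J) + (2 ^ J - 1)"
    using div_pow2_iff[of "y $ i" J "z $ i div 2 ^ J"] div_pow2_iff[of "z $ i" J "z $ i div 2 ^ J"] by auto
  then have "\<bar>(z - y) $ i\<bar> \<le> 2 ^ J" by (simp add: abs_le_iff)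
  then have "real_of_int \<bar>(z - y) $ i\<bar> \<le> real_of_int (2 ^ J)" by (simp only: of_int_le_iff)
  then show "\<bar>real_of_int ((z - y) $ i)\<bar> \<le> 2 ^ J" by simp
qed

lemma finite_lam_box [simp]: "finite (lam_box m)"
  by (simp add: lam_box_def)

lemma sum_cube_swap:
  fixes f :: "int ^ 'n \<Rightarrow> int ^ 'n \<Rightarrow> real"
  assumes "J \<le> m"
  shows "(\<Sum>z\<in>lam_box m. \<Sum>y\<in>cube J z. f z y) = (\<Sum>y\<in>lam_box m. \<Sum>z\<in>cube J y. f z y)"
proof -
  have e: "(\<Sum>y\<in>cube J z. h y) = (\<Sum>y\<in>lam_box m. if y \<in> cube J z then h y else 0)" if "z \<in> lam_box m" for z and h :: "int ^ 'n \<Rightarrow> real"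
    using cube_subset_lam_box[OF assms that] by (intro sum.mono_neutral_cong_left) auto
  have "(\<Sum>z\<in>lam_box m. \<Sum>y\<in>cube J z. f z y) = (\<Sum>z\<in>lam_box m. \<Sum>y\<in>lam_box m. if y \<in> cube J z then f z y else 0)"
    by (rule sum.cong) (auto simp: e)
  also have "\<dots> = (\<Sum>y\<in>lam_box m. \<Sum>z\<in>lam_box m. if y \<in> cube J z then f z y else 0)"
    by (rule sum.swap)
  also have "\<dots> = (\<Sum>y\<in>lam_box m. \<Sum>z\<in>cube J y. f z y)"
    by (rule sum.cong) (auto simp: e cube_sym intro!: sum.cong)
  finally show ?thesis .
qed

lemma avg_self_adjoint:
  assumes "J \<le> m"
  shows "(\<Sum>z\<in>lam_box m. f z * avg J h z) = (\<Sum>z\<in>lam_box m. avg J f z * h z)"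
proof -
  define N where "N = (2 :: real) ^ (J * CARD('a))"
  have "(\<Sum>z\<in>lam_box m. f z * avg J h z) = (\<Sum>z\<in>lam_box m. \<Sum>y\<in>cube J z. f z * h y) / N"
    unfolding avg_def N_def by (simp add: sum_divide_distrib sum_distrib_left)
  also have "\<dots> = (\<Sum>y\<in>lam_box m. \<Sum>z\<in>cube J y. f z * h y) / N"
    by (simp only: sum_cube_swap[OF assms, of "\<lambda>z y. f z * h y"])
  also have "\<dots> = (\<Sum>z\<in>lam_box m. avg J f z * h z)"
    unfolding avg_def N_def by (simp add: sum_divide_distrib sum_distrib_right)
  finally show ?thesis .
qed

lemma avg_avg:
  fixes h :: "int ^ 'n \<Rightarrow> real"
  assumes "J \<le> K"
  shows "avg J (avg K h) z = avg K h z"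
proof -
  have "avg K h y = avg K h z" if "y \<in> cube J z" for y
  proof -
    have "y \<in> cube K z" using cube_mono[OF assms] that by blast
    then show ?thesis by (simp only: avg_def cube_eq)
  qed
  then have "(\<Sum>y\<in>cube J z. avg K h y) = (\<Sum>y\<in>cube J z. avg K h z)"
    by (intro sum.cong refl)
  then have "avg J (avg K h) z = real (card (cube J z)) * avg K h z / 2 ^ (J * CARD('n))"
    by (simp only: avg_def[of J "avg K h"] sum_constant)
  then show ?thesis by (simp add: card_cube)
qed

lemma avg_diff: "avg J (\<lambda>x. f x - h x) z = avg J f z - avg J h z"
  by (simp add: avg_def sum_subtractf diff_divide_distrib)

lemma sum_mult_le_L2_set: "(\<Sum>z\<in>A. f z * h z) \<le> L2_set f A * L2_set h A"
proof -
  have "(\<Sum>z\<in>A. f z * h z) \<le> (\<Sum>z\<in>A. \<bar>f z\<bar> * \<bar>h z\<bar>)"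
    by (intro sum_mono) (metis abs_ge_self abs_mult)
  then show ?thesis using L2_set_mult_ineq[of f h A] by linarith
qed

text \<open>Cubes are nested, so \<open>avg J h\<close> minus \<open>avg (Suc J) h\<close> is the
  level J average of h - avg (Suc J) h. Self-adjointness moves this average onto F, where the
  cancellation is, and Cauchy-Schwarz is applied at each scale separately.\<close>

lemma multiscale_chain:
  assumes "J0 \<le> m"
  shows "(\<Sum>z\<in>lam_box m. F z * h z) \<le> L2_set F (lam_box m) * L2_set (\<lambda>z. h z - avg J0 h z) (lam_box m)
    + (\<Sum>J\<in>{J0..<m}. L2_set (avg J F) (lam_box m) * L2_set (\<lambda>z. h z - avg (Suc J) h z) (lam_box m))
    + L2_set (avg m F) (lam_box m) * L2_set h (lam_box m)"
proof -
  define ip where "ip f h = (\<Sum>z\<in>lam_box m. f z * h z)" for f h :: "int ^ 'a \<Rightarrow> real"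
  have ip_diff: "ip f (\<lambda>z. u z - v z) = ip f u - ip f v" for f u v
    by (simp add: ip_def right_diff_distrib sum_subtractf)
  have tele: "(\<Sum>J\<in>{J0..<n}. ip F (avg J h) - ip F (avg (Suc J) h)) = ip F (avg J0 h) - ip F (avg n h)" if "J0 \<le> n" for n
    using that by (induction n rule: dec_induct) auto
  have "ip F h = ip F (\<lambda>z. h z - avg J0 h z) + (\<Sum>J\<in>{J0..<m}. ip F (avg J h) - ip F (avg (Suc J) h)) + ip F (avg m h)"
    using tele[OF assms] by (simp add: ip_diff)
  also have "(\<Sum>J\<in>{J0..<m}. ip F (avg J h) - ip F (avg (Suc J) h)) = (\<Sum>J\<in>{J0..<m}. ip (avg J F) (\<lambda>z. h z - avg (Suc J) h z))"
  proof (rule sum.cong)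
    fix J assume J: "J \<in> {J0..<m}"
    have "ip F (avg J h) - ip F (avg (Suc J) h) = ip F (avg J (\<lambda>z. h z - avg (Suc J) h z))"
      by (simp add: avg_diff avg_avg ip_def right_diff_distrib sum_subtractf)
    also have "\<dots> = ip (avg J F) (\<lambda>z. h z - avg (Suc J) h z)"
      unfolding ip_def using J by (intro avg_self_adjoint) auto
    finally show "ip F (avg J h) - ip F (avg (Suc J) h) = ip (avg J F) (\<lambda>z. h z - avg (Suc J) h z)" .
  qed simp
  also have "ip F (avg m h) = ip (avg m F) h"
    unfolding ip_def by (rule avg_self_adjoint) simp
  finally have "ip F h = ip F (\<lambda>z. h z - avg J0 h z) + (\<Sum>J\<in>{J0..<m}. ip (avg J F) (\<lambda>z. h z - avg (Suc J) h z)) + ip (avg m F) h" .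
  also have "\<dots> \<le> L2_set F (lam_box m) * L2_set (\<lambda>z. h z - avg J0 h z) (lam_box m)
    + (\<Sum>J\<in>{J0..<m}. L2_set (avg J F) (lam_box m) * L2_set (\<lambda>z. h z - avg (Suc J) h z) (lam_box m))
    + L2_set (avg m F) (lam_box m) * L2_set h (lam_box m)"
    unfolding ip_def by (intro add_mono sum_mono sum_mult_le_L2_set)
  finally show ?thesis by (simp add: ip_def)
qed

text \<open>The step from x to y is split at v with weight W x v times W y v; one factor of the
  weight stays with its squared difference and the other is bounded by M. The hypothesis
  \<open>sum\<close> replaces a lower bound on individual conductances.\<close>

lemma two_path_bound:
  fixes W :: "'a \<Rightarrow> 'a \<Rightarrow> real"
  assumes Q: "finite Q" and W: "\<And>x y. x \<noteq> y \<Longrightarrow> 0 \<le> W x y \<and> W x y \<le> M"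
    and sum: "N \<le> (\<Sum>v\<in>Q - {x, y}. W x v * W y v)" and M: "0 \<le> M"
  shows "N * (h x - h y)\<^sup>2 \<le> 2 * M * ((\<Sum>v\<in>Q. W x v * (h x - h v)\<^sup>2) + (\<Sum>v\<in>Q. W y v * (h y - h v)\<^sup>2))"
proof -
  have nn: "0 \<le> W a v * (h a - h v)\<^sup>2" for a v
    using W[of a v] by (cases "a = v") auto
  have "N * (h x - h y)\<^sup>2 \<le> (\<Sum>v\<in>Q - {x, y}. W x v * W y v) * (h x - h y)\<^sup>2"
    using sum by (rule mult_right_mono) simp
  also have "\<dots> = (\<Sum>v\<in>Q - {x, y}. W x v * W y v * (h x - h y)\<^sup>2)"
    by (simp add: sum_distrib_right)
  also have "\<dots> \<le> (\<Sum>v\<in>Q - {x, y}. 2 * M * (W x v * (h x - h v)\<^sup>2 + W y v * (h y - h v)\<^sup>2))"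
  proof (rule sum_mono)
    fix v assume v: "v \<in> Q - {x, y}"
    have wx: "0 \<le> W x v" "W x v \<le> M" "0 \<le> W y v" "W y v \<le> M" using W[of x v] W[of y v] v by auto
    have "(h x - h y)\<^sup>2 \<le> 2 * ((h x - h v)\<^sup>2 + (h y - h v)\<^sup>2)"
    proof -
      have "0 \<le> ((h x - h v) + (h y - h v))\<^sup>2" by simp
      then show ?thesis by (simp add: power2_eq_square algebra_simps)
    qed
    then have "W x v * W y v * (h x - h y)\<^sup>2 \<le> W x v * W y v * (2 * ((h x - h v)\<^sup>2 + (h y - h v)\<^sup>2))"
      using wx by (intro mult_left_mono) auto
    also have "\<dots> = 2 * ((W x v * (h x - h v)\<^sup>2) * W y v + (W y v * (h y - h v)\<^sup>2) * W x v)"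
      by (simp add: algebra_simps)
    also have "\<dots> \<le> 2 * ((W x v * (h x - h v)\<^sup>2) * M + (W y v * (h y - h v)\<^sup>2) * M)"
      using wx nn by (intro mult_left_mono add_mono) auto
    finally show "W x v * W y v * (h x - h y)\<^sup>2 \<le> 2 * M * (W x v * (h x - h v)\<^sup>2 + W y v * (h y - h v)\<^sup>2)"
      by (simp add: algebra_simps)
  qed
  also have "\<dots> \<le> (\<Sum>v\<in>Q. 2 * M * (W x v * (h x - h v)\<^sup>2 + W y v * (h y - h v)\<^sup>2))"
    using nn M by (intro sum_mono2 Q) auto
  also have "\<dots> = 2 * M * ((\<Sum>v\<in>Q. W x v * (h x - h v)\<^sup>2) + (\<Sum>v\<in>Q. W y v * (h y - h v)\<^sup>2))"
    by (simp add: sum_distrib_left sum.distrib distrib_left)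
  finally show ?thesis .
qed

text \<open>The squared deviation from the cube average is at most the mean of the squared
  differences, and each of these is bounded through two-step paths by the local energies
  \<open>D\<close> of both end points. The end points contribute equally after
  \<open>sum_cube_swap\<close>, which doubles 8 M to 16 M.\<close>

lemma poincare_cubes:
  fixes W :: "int ^ 'n \<Rightarrow> int ^ 'n \<Rightarrow> real"
  assumes J: "J \<le> m" and W: "\<And>x y. x \<noteq> y \<Longrightarrow> 0 \<le> W x y \<and> W x y \<le> M" and M: "0 \<le> M"
    and tp: "\<And>z x y. z \<in> lam_box m \<Longrightarrow> x \<in> cube J z \<Longrightarrow> y \<in> cube J z \<Longrightarrow> x \<noteq> y \<Longrightarrow>
      2 ^ (J * CARD('n)) / 4 \<le> (\<Sum>v\<in>cube J z - {x, y}. W x v * W y v)"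
  shows "(\<Sum>z\<in>lam_box m. (h z - avg J h z)\<^sup>2) \<le> 16 * M / 2 ^ (J * CARD('n))
    * (\<Sum>z\<in>lam_box m. \<Sum>y\<in>cube J z. W z y * (h z - h y)\<^sup>2)"
proof -
  define N where "N = (2 :: real) ^ (J * CARD('n))"
  have N0: "0 < N" by (simp add: N_def)
  have cN: "real (card (cube J z)) = N" for z :: "int ^ 'n" by (simp add: card_cube N_def)
  define D where "D z = (\<Sum>v\<in>cube J z. W z v * (h z - h v)\<^sup>2)" for z
  have D0: "0 \<le> D z" for z unfolding D_def
  proof (rule sum_nonneg)
    show "0 \<le> W z v * (h z - h v)\<^sup>2" for v using W[of z v] by (cases "z = v") auto
  qed
  have var: "(h z - avg J h z)\<^sup>2 \<le> (\<Sum>y\<in>cube J z. (h z - h y)\<^sup>2) / N" for z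
  proof -
    have "h z - avg J h z = (\<Sum>y\<in>cube J z. h z - h y) / N"
      using cN[of z] N0 by (simp add: avg_def N_def[symmetric] sum_subtractf diff_divide_distrib)
    then have "(h z - avg J h z)\<^sup>2 = (\<Sum>y\<in>cube J z. h z - h y)\<^sup>2 / N\<^sup>2" by (simp add: power_divide)
    also have "\<dots> \<le> (N * (\<Sum>y\<in>cube J z. (h z - h y)\<^sup>2)) / N\<^sup>2"
      using sum_squared_le_sum_of_squares[of "\<lambda>y. h z - h y" "cube J z"] unfolding cN
      by (intro divide_right_mono) (auto simp: mult.commute)
    also have "\<dots> = (\<Sum>y\<in>cube J z. (h z - h y)\<^sup>2) / N" using N0 by (simp add: power2_eq_square)
    finally show ?thesis .
  qed
  have pair: "(h z - h y)\<^sup>2 \<le> 8 * M / N * (D z + D y)" if z: "z \<in> lam_box m" and y: "y \<in> cube J z" for z y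
  proof (cases "z = y")
    case True
    then show ?thesis using D0 M N0 by simp
  next
    case False
    have "N / 4 * (h z - h y)\<^sup>2 \<le> 2 * M * (D z + D y)"
      using two_path_bound[of "cube J z" W M "N / 4" z y h] W tp[OF z cube_refl y False] M cube_eq[OF y]
      by (simp add: D_def N_def)
    then show ?thesis using N0 by (simp add: field_simps)
  qed
  have "(\<Sum>z\<in>lam_box m. (h z - avg J h z)\<^sup>2) \<le> (\<Sum>z\<in>lam_box m. (\<Sum>y\<in>cube J z. 8 * M / N * (D z + D y)) / N)"
    by (intro sum_mono order_trans[OF var] divide_right_mono pair) (use N0 in auto)
  also have "\<dots> = 8 * M / N\<^sup>2 * ((\<Sum>z\<in>lam_box m. \<Sum>y\<in>cube J z. D z) + (\<Sum>z\<in>lam_box m. \<Sum>y\<in>cube J z. D y))"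
    by (simp add: sum_distrib_left[symmetric] sum_divide_distrib[symmetric] sum.distrib power2_eq_square)
  also have "(\<Sum>z\<in>lam_box m. \<Sum>y\<in>cube J z. D y) = (\<Sum>z\<in>lam_box m. \<Sum>y\<in>cube J z. D z)"
    by (simp only: sum_cube_swap[OF J, of "\<lambda>z y. D y"])
  also have "(\<Sum>z\<in>lam_box m. \<Sum>y\<in>cube J z. D z) = N * (\<Sum>z\<in>lam_box m. D z)"
    by (simp add: cN sum_distrib_left)
  also have "8 * M / N\<^sup>2 * (N * (\<Sum>z\<in>lam_box m. D z) + N * (\<Sum>z\<in>lam_box m. D z)) = 16 * M / N * (\<Sum>z\<in>lam_box m. D z)"
    using N0 by (simp add: power2_eq_square field_simps)
  finally show ?thesis by (simp add: N_def D_def)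
qed

section \<open>Decomposition into atoms\<close>

text \<open>Discrete Taylor formula: max 0 (n - \<tau> + 1) is the Green function of the second
  backward difference, and vanishing below -K removes the boundary terms. The sum may run up to K
  because the weight is 0 for \<tau> > n.\<close>

lemma second_difference_sum:
  fixes \<eta> :: "int \<Rightarrow> real"
  assumes \<eta>: "\<And>j. j < - K \<Longrightarrow> \<eta> j = 0" and n: "n \<le> K"
  shows "\<eta> n = (\<Sum>\<tau>\<in>{- K..K}. max 0 (real_of_int (n - \<tau> + 1)) * (\<eta> \<tau> - 2 * \<eta> (\<tau> - 1) + \<eta> (\<tau> - 2)))"
proof -
  define D where "D \<tau> = \<eta> \<tau> - 2 * \<eta> (\<tau> - 1) + \<eta> (\<tau> - 2)" for \<tau>
  \<comment> \<open>The induction starts at -K - 1, where the sum is empty and both values on the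
    right are 0.\<close>
  have one: "(\<Sum>\<tau>\<in>{- K..n}. D \<tau>) = \<eta> n - \<eta> (n - 1)" if "- K - 1 \<le> n" for n
    using that
  proof (induction n rule: int_ge_induct)
    case base
    show ?case using \<eta> by simp
  next
    case (step n)
    have "{- K..n + 1} = insert (n + 1) {- K..n}" using step.hyps by auto
    then show ?case using step.IH by (simp add: D_def)
  qed
  define A where "A n = (\<Sum>\<tau>\<in>{- K..K}. max 0 (real_of_int (n - \<tau> + 1)) * D \<tau>)" for n
  have small: "A n = 0" if "n < - K" for n
    unfolding A_def by (rule sum.neutral) (use that in auto)
  have diff: "A n - A (n - 1) = \<eta> n - \<eta> (n - 1)" if "- K \<le> n" "n \<le> K" for n
  proof -
    have "A n - A (n - 1) = (\<Sum>\<tau>\<in>{- K..K}. if \<tau> \<le> n then D \<tau> else 0)"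
      unfolding A_def sum_subtractf[symmetric]
      by (rule sum.cong) (auto simp: max_def algebra_simps)
    also have "\<dots> = (\<Sum>\<tau>\<in>{- K..n}. D \<tau>)"
      using that by (intro sum.mono_neutral_cong_right) auto
    also have "\<dots> = \<eta> n - \<eta> (n - 1)" using one[of n] that by simp
    finally show ?thesis .
  qed
  have "n \<le> K \<longrightarrow> A n = \<eta> n" if "- K - 1 \<le> n" for n
    using that
  proof (induction n rule: int_ge_induct)
    case base
    show ?case using small \<eta> by simp
  next
    case (step n)
    show ?case using step diff[of "n + 1"] by auto
  qed
  moreover have "A n = \<eta> n" if "n < - K - 1" using that small \<eta> by simp
  ultimately have "A n = \<eta> n" using n by (cases "n < - K - 1") auto
  then show ?thesis by (simp add: A_def D_def)
qed

text \<open>Each direction is taken twice, so for a list of all d directions the mixed difference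
  has order 2 d.\<close>

fun dbl :: "'a list \<Rightarrow> 'a list" where
  "dbl [] = []"
| "dbl (i # is) = i # i # dbl is"

lemma length_dbl: "length (dbl is) = 2 * length is"
  by (induction "is") auto

definition vupd :: "int ^ 'n \<Rightarrow> 'n \<Rightarrow> int \<Rightarrow> int ^ 'n" where
  "vupd t i \<tau> = (\<chi> j. if j = i then \<tau> else t $ j)"

lemma vupd_nth [simp]: "vupd t i \<tau> $ j = (if j = i then \<tau> else t $ j)"
  by (simp add: vupd_def)

lemma lat_pt_vupd:
  assumes "0 < k"
  shows "lat_pt k (vupd t i \<tau>) - (1 / real k) *\<^sub>R axis i 1 = lat_pt k (vupd t i (\<tau> - 1))"
  using assms by (auto simp: vec_eq_iff axis_def diff_divide_distrib)

lemma nabla_vanish: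
  assumes "0 < k" and g: "\<And>z j. z $ j < - K \<Longrightarrow> g (lat_pt k z) = 0" and "z $ j < - K"
  shows "nabla (1 / real k) is g (lat_pt k z) = 0"
  using assms(3)
proof (induction "is" arbitrary: z)
  case Nil
  then show ?case using g by simp
next
  case (Cons i "is")
  have e: "lat_pt k z - (1 / real k) *\<^sub>R axis i 1 = lat_pt k (vupd z i (z $ i - 1))"
    using assms(1) by (auto simp: vec_eq_iff axis_def diff_divide_distrib)
  have "vupd z i (z $ i - 1) $ j < - K" using Cons.prems by auto
  then show ?case using Cons by (simp add: e)
qed

text \<open>Tensorised second summation: the induction frees one coordinate of t at a time, the
  others being frozen at those of y. The one-dimensional formula applies along each line because the
  differences already taken still vanish at its lower end by \<open>nabla_vanish\<close>.\<close>

lemma nabla_representation: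
  fixes g :: "real ^ 'n \<Rightarrow> real"
  assumes k: "0 < k" and g: "\<And>z j. z $ j < - K \<Longrightarrow> g (lat_pt k z) = 0"
    and y: "\<And>i. y $ i \<le> K" and l: "distinct l"
  shows "g (lat_pt k y) = (\<Sum>t\<in>{t. (\<forall>i\<in>set l. - K \<le> t $ i \<and> t $ i \<le> K) \<and> (\<forall>i. i \<notin> set l \<longrightarrow> t $ i = y $ i)}.
    (\<Prod>i\<in>set l. max 0 (real_of_int (y $ i - t $ i + 1))) * nabla (1 / real k) (dbl l) g (lat_pt k t))"
  using l
proof (induction l)
  case Nil
  have "{t. \<forall>i. t $ i = y $ i} = {y}" by (auto simp: vec_eq_iff)
  then show ?case by simp
next
  case (Cons i l)
  define T where "T = {t. (\<forall>i\<in>set l. - K \<le> t $ i \<and> t $ i \<le> K) \<and> (\<forall>i. i \<notin> set l \<longrightarrow> t $ i = y $ i)}"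
  define T' where "T' = {t. (\<forall>j\<in>set (i # l). - K \<le> t $ j \<and> t $ j \<le> K) \<and> (\<forall>j. j \<notin> set (i # l) \<longrightarrow> t $ j = y $ j)}"
  define N where "N = nabla (1 / real k) (dbl l) g"
  define N2 where "N2 = nabla (1 / real k) (dbl (i # l)) g"
  define p where "p l t = (\<Prod>i\<in>set l. max 0 (real_of_int (y $ i - t $ i + 1)))" for l t
  have i: "i \<notin> set l" "distinct l" using Cons.prems by auto
  have step: "N (lat_pt k t) = (\<Sum>\<tau>\<in>{- K..K}. max 0 (real_of_int (y $ i - \<tau> + 1)) * N2 (lat_pt k (vupd t i \<tau>)))"
    if t: "t \<in> T" for t
  proof -
    define \<eta> where "\<eta> \<tau> = N (lat_pt k (vupd t i \<tau>))" for \<tau>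
    have ti: "t $ i = y $ i" using t i by (simp add: T_def)
    have v0: "\<eta> \<tau> = 0" if "\<tau> < - K" for \<tau>
      unfolding \<eta>_def N_def by (rule nabla_vanish[of k K g "vupd t i \<tau>" i, OF k g]) (use that in auto)
    have N2: "N2 (lat_pt k (vupd t i \<tau>)) = \<eta> \<tau> - 2 * \<eta> (\<tau> - 1) + \<eta> (\<tau> - 2)" for \<tau>
      by (simp only: N2_def dbl.simps nabla.simps N_def[symmetric] \<eta>_def lat_pt_vupd[OF k]) simp
    have "\<eta> (y $ i) = (\<Sum>\<tau>\<in>{- K..K}. max 0 (real_of_int (y $ i - \<tau> + 1)) * (\<eta> \<tau> - 2 * \<eta> (\<tau> - 1) + \<eta> (\<tau> - 2)))"
      by (rule second_difference_sum[OF v0 y])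
    moreover have "vupd t i (y $ i) = t" using ti by (auto simp: vec_eq_iff)
    ultimately show ?thesis by (simp add: N2 \<eta>_def)
  qed
  have "g (lat_pt k y) = (\<Sum>t\<in>T. p l t * N (lat_pt k t))"
    using Cons.IH i(2) by (simp add: T_def N_def p_def)
  also have "\<dots> = (\<Sum>t\<in>T. \<Sum>\<tau>\<in>{- K..K}. p l t * (max 0 (real_of_int (y $ i - \<tau> + 1)) * N2 (lat_pt k (vupd t i \<tau>))))"
    by (rule sum.cong) (auto simp: step sum_distrib_left)
  also have "\<dots> = (\<Sum>(t, \<tau>)\<in>T \<times> {- K..K}. p l t * (max 0 (real_of_int (y $ i - \<tau> + 1)) * N2 (lat_pt k (vupd t i \<tau>))))"
    by (rule sum.cartesian_product)
  also have "\<dots> = (\<Sum>t\<in>T'. p (i # l) t * N2 (lat_pt k t))"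
  proof (rule sum.reindex_bij_witness[where i = "\<lambda>t. (vupd t i (y $ i), t $ i)" and j = "\<lambda>(t, \<tau>). vupd t i \<tau>"])
    fix a assume a: "a \<in> T \<times> {- K..K}"
    obtain t \<tau> where t: "a = (t, \<tau>)" "t \<in> T" "\<tau> \<in> {- K..K}" using a by auto
    have ti: "t $ i = y $ i" using t i by (simp add: T_def)
    show "(vupd (case a of (t, \<tau>) \<Rightarrow> vupd t i \<tau>) i (y $ i), (case a of (t, \<tau>) \<Rightarrow> vupd t i \<tau>) $ i) = a"
      using t ti by (auto simp: vec_eq_iff)
    show "(case a of (t, \<tau>) \<Rightarrow> vupd t i \<tau>) \<in> T'"
      using t by (auto simp: T_def T'_def)
    have "p (i # l) (vupd t i \<tau>) = max 0 (real_of_int (y $ i - \<tau> + 1)) * p l t"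
    proof -
      have "(\<Prod>j\<in>set l. max 0 (real_of_int (y $ j - vupd t i \<tau> $ j + 1))) = p l t"
        unfolding p_def by (rule prod.cong) (use i in auto)
      then show ?thesis using i(1) by (simp add: p_def)
    qed
    then show "p (i # l) (case a of (t, \<tau>) \<Rightarrow> vupd t i \<tau>) * N2 (lat_pt k (case a of (t, \<tau>) \<Rightarrow> vupd t i \<tau>))
        = (case a of (t, \<tau>) \<Rightarrow> p l t * (max 0 (real_of_int (y $ i - \<tau> + 1)) * N2 (lat_pt k (vupd t i \<tau>))))"
      using t by simp
  next
    fix b assume b: "b \<in> T'"
    show "(case (vupd b i (y $ i), b $ i) of (t, \<tau>) \<Rightarrow> vupd t i \<tau>) = b"
      by (auto simp: vec_eq_iff)
    show "(vupd b i (y $ i), b $ i) \<in> T \<times> {- K..K}"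
      using b i by (auto simp: T_def T'_def)
  qed
  finally show ?case by (simp add: T'_def N2_def p_def)
qed

text \<open>A function g supported in the ball of radius L is recovered on the lattice from its second backward mixed
  differences phi as the sum over t of phi t times the product of the positive parts of y_i - t_i + 1. Cutting
  off and clamping changes nothing on the support of g and makes these products uniformly Lipschitz.\<close>

definition cutoff :: "nat \<Rightarrow> real ^ 'n \<Rightarrow> real" where
  "cutoff L x = max 0 (min 1 (2 * real L - norm x))"

definition clamp01 :: "real \<Rightarrow> real" where
  "clamp01 r = max 0 (min 1 r)"

definition atom :: "nat \<Rightarrow> nat \<Rightarrow> int ^ 'n \<Rightarrow> int ^ 'n \<Rightarrow> real" where
  "atom k L t y = cutoff L (lat_pt k y) * (\<Prod>i\<in>UNIV. clamp01 (real_of_int (y $ i - t $ i + 1) / real (5 * L * k)))"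

lemma clamp01_bounds: "0 \<le> clamp01 r" "clamp01 r \<le> 1"
  by (auto simp: clamp01_def)

lemma clamp01_lipschitz: "\<bar>clamp01 r - clamp01 s\<bar> \<le> \<bar>r - s\<bar>"
  by (auto simp: clamp01_def max_def min_def)

lemma cutoff_bounds: "0 \<le> cutoff L x" "cutoff L x \<le> 1"
  by (auto simp: cutoff_def)

lemma cutoff_lipschitz: "\<bar>cutoff L x - cutoff L y\<bar> \<le> norm (x - y)"
proof -
  have "\<bar>cutoff L x - cutoff L y\<bar> \<le> \<bar>norm x - norm y\<bar>"
    by (auto simp: cutoff_def max_def min_def)
  then show ?thesis using norm_triangle_ineq3[of x y] by linarith
qed

lemma atom_bound: "\<bar>atom k L t y\<bar> \<le> 1"
proof -
  have "0 \<le> (\<Prod>i\<in>UNIV. clamp01 (real_of_int (y $ i - t $ i + 1) / real (5 * L * k)))"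
    "(\<Prod>i\<in>UNIV. clamp01 (real_of_int (y $ i - t $ i + 1) / real (5 * L * k))) \<le> 1"
    using clamp01_bounds by (auto intro: prod_nonneg prod_le_1)
  then show ?thesis unfolding atom_def
    using cutoff_bounds[of L "lat_pt k y"] by (simp add: abs_mult mult_le_one)
qed

lemma atom_support:
  assumes "0 < k" "2 * real L * real k < lnorm y"
  shows "atom k L t y = 0"
  using assms by (simp add: atom_def cutoff_def norm_lat_pt field_simps)

text \<open>The constant does not depend on t, L or k: the cutoff and each of the d clamped factors
  are bounded by 1 and have Lipschitz constant at most 1 in macroscopic units.\<close>

lemma atom_lipschitz:
  fixes y z :: "int ^ 'n"
  assumes k: "1 \<le> k" "1 \<le> L"
  shows "\<bar>atom k L t y - atom k L t z\<bar> \<le> (1 + real CARD('n)) * (lnorm (y - z) / real k)"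
proof -
  define \<pi> where "\<pi> y = (\<Prod>i\<in>UNIV. clamp01 (real_of_int (y $ i - t $ i + 1) / real (5 * L * k)))" for y :: "int ^ 'n"
  have \<pi>: "0 \<le> \<pi> y" "\<pi> y \<le> 1" for y
    unfolding \<pi>_def using clamp01_bounds by (auto intro: prod_nonneg prod_le_1)
  have c: "\<bar>cutoff L (lat_pt k y) - cutoff L (lat_pt k z)\<bar> \<le> lnorm (y - z) / real k"
    using cutoff_lipschitz[of L "lat_pt k y" "lat_pt k z"] by (simp add: lat_pt_diff norm_lat_pt)
  have "\<bar>\<pi> y - \<pi> z\<bar> \<le> (\<Sum>i\<in>(UNIV :: 'n set). lnorm (y - z) / real k)"
  proof -
    have "norm (\<pi> y - \<pi> z) \<le> (\<Sum>i\<in>UNIV. norm (clamp01 (real_of_int (y $ i - t $ i + 1) / real (5 * L * k))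
        - clamp01 (real_of_int (z $ i - t $ i + 1) / real (5 * L * k))))"
      unfolding \<pi>_def by (rule norm_prod_diff) (use clamp01_bounds in auto)
    also have "\<dots> \<le> (\<Sum>i\<in>(UNIV :: 'n set). lnorm (y - z) / real k)"
    proof (rule sum_mono)
      fix i
      have "norm (clamp01 (real_of_int (y $ i - t $ i + 1) / real (5 * L * k)) - clamp01 (real_of_int (z $ i - t $ i + 1) / real (5 * L * k)))
        \<le> \<bar>real_of_int (y $ i - t $ i + 1) / real (5 * L * k) - real_of_int (z $ i - t $ i + 1) / real (5 * L * k)\<bar>"
        using clamp01_lipschitz by simp
      also have "\<dots> = \<bar>real_of_int ((y - z) $ i)\<bar> / real (5 * L * k)"
        by (simp add: abs_divide flip: diff_divide_distrib)
      also have "\<dots> \<le> lnorm (y - z) / real k"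
      proof (rule frac_le)
        have "real k * 1 \<le> real k * real (5 * L)" using k by (intro mult_left_mono) auto
        then show "real k \<le> real (5 * L * k)" by (simp add: mult.commute)
      qed (use k component_le_lnorm[of "y - z" i] in auto)
      finally show "norm (clamp01 (real_of_int (y $ i - t $ i + 1) / real (5 * L * k))
        - clamp01 (real_of_int (z $ i - t $ i + 1) / real (5 * L * k))) \<le> lnorm (y - z) / real k" .
    qed
    finally show ?thesis by simp
  qed
  then have p: "\<bar>\<pi> y - \<pi> z\<bar> \<le> real CARD('n) * (lnorm (y - z) / real k)" by simp
  have "atom k L t y - atom k L t z = (cutoff L (lat_pt k y) - cutoff L (lat_pt k z)) * \<pi> y + cutoff L (lat_pt k z) * (\<pi> y - \<pi> z)"
    by (simp only: atom_def \<pi>_def[symmetric]) (simp add: algebra_simps)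
  then have "\<bar>atom k L t y - atom k L t z\<bar> \<le> \<bar>cutoff L (lat_pt k y) - cutoff L (lat_pt k z)\<bar> * \<pi> y + cutoff L (lat_pt k z) * \<bar>\<pi> y - \<pi> z\<bar>"
    using abs_triangle_ineq[of "(cutoff L (lat_pt k y) - cutoff L (lat_pt k z)) * \<pi> y" "cutoff L (lat_pt k z) * (\<pi> y - \<pi> z)"]
      \<pi>(1)[of y] cutoff_bounds(1)[of L "lat_pt k z"] by (simp add: abs_mult)
  also have "\<dots> \<le> (lnorm (y - z) / real k) * 1 + 1 * (real CARD('n) * (lnorm (y - z) / real k))"
    using c p \<pi> cutoff_bounds by (intro add_mono mult_mono) auto
  finally show ?thesis by (simp only: distrib_right mult_1 mult_1_right)
qed

text \<open>There are O(k^d) coefficients, each of size O(k^d k^(-2 d)), where k^d comes from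
  normalising the products and k^(-2 d) from differences of order 2 d; hence their absolute sum
  stays bounded. First differences would balance as well, but would leave indicators of orthants,
  which have no uniform Lipschitz bound.\<close>

lemma atom_decomposition:
  fixes g :: "real ^ 'n \<Rightarrow> real"
  assumes g: "g \<in> Cc_inf" and L: "1 \<le> L" "\<And>x. real L < norm x \<Longrightarrow> g x = 0"
  shows "\<exists>C\<ge>0. \<forall>k\<ge>1. \<exists>\<phi>.
    (\<forall>y. g (lat_pt k y) = (\<Sum>t\<in>lbox (- int (2 * L * k)) (int (2 * L * k)). \<phi> t * atom k L t y)) \<and>
    (\<Sum>t\<in>lbox (- int (2 * L * k)) (int (2 * L * k)). \<bar>\<phi> t\<bar>) \<le> C"
proof -
  obtain l :: "'n list" where l: "distinct l" "set l = UNIV"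
    using finite_distinct_list[OF finite] by blast
  have len: "length l = CARD('n)" using distinct_card[OF l(1)] l(2) by simp
  obtain B where B: "0 \<le> B" "\<And>h x. 0 \<le> h \<Longrightarrow> \<bar>nabla h (dbl l) g x\<bar> \<le> B * h ^ length (dbl l)"
    using nabla_bound[OF g, of "dbl l"] by blast
  define C where "C = (5 * real L) ^ CARD('n) * B * (5 * real L) ^ CARD('n)"
  have "\<exists>\<phi>. (\<forall>y. g (lat_pt k y) = (\<Sum>t\<in>lbox (- int (2 * L * k)) (int (2 * L * k)). \<phi> t * atom k L t y)) \<and>
    (\<Sum>t\<in>lbox (- int (2 * L * k)) (int (2 * L * k)). \<bar>\<phi> t\<bar>) \<le> C" if k: "1 \<le> k" for k
  proof -
    define K where "K = int (2 * L * k)"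
    \<comment> \<open>For y_i \<le> K and t_i \<ge> -K one has y_i - t_i + 1 \<le> 2 K + 1 = 4 L k +
      1 \<le> 5 L k, so division by q keeps the argument of \<open>clamp01\<close> at most 1 and the
      clamp acts as a positive part only.\<close>
    define q where "q = real (5 * L * k)"
    have k0: "0 < k" using k by simp
    have Lk: "1 \<le> int L * int k"
    proof -
      have "1 * 1 \<le> L * k" using k L(1) by (intro mult_le_mono) auto
      then have "int (1 * 1) \<le> int (L * k)" by (simp only: of_nat_mono)
      then show ?thesis by simp
    qed
    have q0: "0 < q" using k L(1) by (simp add: q_def)
    define \<phi> where "\<phi> t = q ^ CARD('n) * nabla (1 / real k) (dbl l) g (lat_pt k t)" for t
    have van: "g (lat_pt k z) = 0" if "z $ j < - K" for z j
    proof (rule L(2))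
      have "real_of_int (z $ j) < real_of_int (- K)" using that by (simp only: of_int_less_iff)
      then have "real_of_int (z $ j) < - (2 * real L * real k)" by (simp add: K_def)
      then have "2 * real L * real k < lnorm z" using component_le_lnorm[of z j] by linarith
      then have "2 * real L < norm (lat_pt k z)" using k0 by (simp add: norm_lat_pt field_simps)
      then show "real L < norm (lat_pt k z)" by linarith
    qed
    have "g (lat_pt k y) = (\<Sum>t\<in>lbox (- K) K. \<phi> t * atom k L t y)" for y
    proof (cases "2 * real L < norm (lat_pt k y)")
      case True
      then have "g (lat_pt k y) = 0" by (intro L(2)) linarith
      moreover have "atom k L t y = 0" for t using True by (simp add: atom_def cutoff_def)
      ultimately show ?thesis by simp
    next
      case False
      have yl: "lnorm y \<le> 2 * real L * real k" using False k0 by (simp add: norm_lat_pt field_simps)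
      have yK: "y $ i \<le> K" for i
      proof -
        have "real_of_int (y $ i) \<le> real_of_int K" using component_le_lnorm[of y i] yl by (simp add: K_def)
        then show ?thesis by simp
      qed
      have cl: "clamp01 (real_of_int (y $ i - t $ i + 1) / q) = max 0 (real_of_int (y $ i - t $ i + 1)) / q" if "t \<in> lbox (- K) K" for t i
      proof -
        have "y $ i - t $ i + 1 \<le> 2 * K + 1" using yK[of i] that by (auto simp: lbox_def) (smt (verit))
        also have "2 * K + 1 \<le> int (5 * L * k)" using Lk by (simp add: K_def)
        finally have "real_of_int (y $ i - t $ i + 1) \<le> q" unfolding q_def by linarith
        then have "real_of_int (y $ i - t $ i + 1) / q \<le> 1" using q0 by simp
        then show ?thesis using q0 by (auto simp: clamp01_def max_def min_def divide_simps)
      qed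
      define G where "G = (\<Sum>t\<in>lbox (- K) K. (\<Prod>i\<in>UNIV. max 0 (real_of_int (y $ i - t $ i + 1))) * nabla (1 / real k) (dbl l) g (lat_pt k t))"
      have gG: "g (lat_pt k y) = G"
        using nabla_representation[of k K g y l, OF k0 van yK l(1)] l(2) by (simp add: lbox_def G_def)
      \<comment> \<open>The cutoff is 1 on the ball of radius L, as L \<ge> 1, and g is 0 off that
        ball.\<close>
      have "g (lat_pt k y) = cutoff L (lat_pt k y) * G"
      proof (cases "real L < norm (lat_pt k y)")
        case True
        then show ?thesis unfolding gG[symmetric] by (simp add: L(2))
      next
        case False
        then have "cutoff L (lat_pt k y) = 1" using L(1) by (simp add: cutoff_def)
        then show ?thesis using gG by simp
      qed
      also have "cutoff L (lat_pt k y) * G = (\<Sum>t\<in>lbox (- K) K. \<phi> t * atom k L t y)"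
        unfolding G_def sum_distrib_left
      proof (rule sum.cong)
        fix t :: "int ^ 'n" assume t: "t \<in> lbox (- K) K"
        have e: "(\<Prod>i\<in>UNIV. clamp01 (real_of_int (y $ i - t $ i + 1) / q)) = (\<Prod>i\<in>UNIV. max 0 (real_of_int (y $ i - t $ i + 1))) / q ^ CARD('n)"
          by (simp only: cl[OF t] prod_dividef prod_constant)
        show "cutoff L (lat_pt k y) * ((\<Prod>i\<in>UNIV. max 0 (real_of_int (y $ i - t $ i + 1))) * nabla (1 / real k) (dbl l) g (lat_pt k t))
            = \<phi> t * atom k L t y"
          unfolding \<phi>_def atom_def q_def[symmetric] e using q0 by simp
      qed simp
      finally show ?thesis .
    qed
    moreover have "(\<Sum>t\<in>lbox (- K) K. \<bar>\<phi> t\<bar>) \<le> C"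
    proof -
      have "(\<Sum>t\<in>lbox (- K) K. \<bar>\<phi> t\<bar>) \<le> (\<Sum>t\<in>(lbox (- K) K :: (int ^ 'n) set). q ^ CARD('n) * (B * (1 / real k) ^ (2 * CARD('n))))"
        unfolding \<phi>_def abs_mult using B(2)[of "1 / real k"] q0
        by (intro sum_mono mult_mono) (auto simp: length_dbl len)
      also have "\<dots> = real (card (lbox (- K) K :: (int ^ 'n) set)) * (q ^ CARD('n) * (B * (1 / real k) ^ (2 * CARD('n))))"
        by simp
      also have "\<dots> \<le> q ^ CARD('n) * (q ^ CARD('n) * (B * (1 / real k) ^ (2 * CARD('n))))"
      proof (rule mult_right_mono)
        have "nat (2 * K + 1) \<le> 5 * L * k" using Lk by (simp add: K_def nat_le_iff)
        then have "real (nat (2 * K + 1)) ^ CARD('n) \<le> q ^ CARD('n)"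
          unfolding q_def by (intro power_mono of_nat_mono) auto
        moreover have "card (lbox (- K) K :: (int ^ 'n) set) = nat (2 * K + 1) ^ CARD('n)"
          by (simp add: card_lbox)
        ultimately show "real (card (lbox (- K) K :: (int ^ 'n) set)) \<le> q ^ CARD('n)" by simp
      qed (use q0 B(1) in auto)
      also have "\<dots> = C"
      proof -
        have "q * q * (1 / real k)\<^sup>2 = (5 * real L) * (5 * real L)" using k0 by (simp add: q_def power2_eq_square)
        then have "(q * q * (1 / real k)\<^sup>2) ^ CARD('n) = ((5 * real L) * (5 * real L)) ^ CARD('n)" by simp
        then have "q ^ CARD('n) * q ^ CARD('n) * (1 / real k) ^ (2 * CARD('n)) = (5 * real L) ^ CARD('n) * (5 * real L) ^ CARD('n)"
          by (simp only: power_mult_distrib power_mult)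
        then show ?thesis by (simp add: C_def mult_ac)
      qed
      finally show ?thesis .
    qed
    ultimately show ?thesis unfolding K_def by blast
  qed
  moreover have "0 \<le> C" using B(1) by (simp add: C_def)
  ultimately show ?thesis by blast
qed

section \<open>Good events\<close>

definition fluct :: "((int ^ 'n) set \<Rightarrow> 'w \<Rightarrow> real) \<Rightarrow> real \<Rightarrow> (int ^ 'n \<Rightarrow> real) \<Rightarrow> 'w \<Rightarrow> int ^ 'n \<Rightarrow> real" where
  "fluct w p e \<omega> x = (\<Sum>\<^sub>\<infinity>y. (e y - e x) * lnorm (x - y) powr (- p) * (w {x, y} \<omega> - 1))"

text \<open>The sum of the squared coefficients of \<open>fluct\<close> at x, that is, its variance
  proxy in Hoeffding's inequality.\<close>

definition vari :: "real \<Rightarrow> (int ^ 'n \<Rightarrow> real) \<Rightarrow> int ^ 'n \<Rightarrow> real" where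
  "vari p e x = (\<Sum>\<^sub>\<infinity>y. ((e y - e x) * lnorm (x - y) powr (- p))\<^sup>2)"

text \<open>One constant b for the supremum and for the Lipschitz constant in macroscopic units,
  together with a macroscopic support radius. Atoms and the restrictions of g belong to this class
  with constants independent of k.\<close>

definition lipc :: "nat \<Rightarrow> real \<Rightarrow> real \<Rightarrow> (int ^ 'n \<Rightarrow> real) \<Rightarrow> bool" where
  "lipc k b R e \<longleftrightarrow> (\<forall>y. \<bar>e y\<bar> \<le> b) \<and> (\<forall>x y. \<bar>e x - e y\<bar> \<le> b * (lnorm (x - y) / real k)) \<and>
    (\<forall>y. R * real k < lnorm y \<longrightarrow> e y = 0)"

section \<open>Kernel sums of Lipschitz functions of compact support\<close>

lemma lipc_nonneg: "lipc k b R e \<Longrightarrow> 0 \<le> b"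
  unfolding lipc_def by (meson abs_ge_zero order_trans)

lemma lipc_diff:
  assumes e: "lipc k b R e" and k: "1 \<le> k" and s: "0 \<le> s" "s \<le> real n" and n: "1 \<le> n"
  shows "\<bar>e y - e x\<bar> ^ n \<le> (2 * b) ^ n * (lnorm (x - y) / real k) powr s
    * (indicator {z. lnorm z \<le> R * real k} x + indicator {z. lnorm z \<le> R * real k} y)"
proof -
  have b: "0 \<le> b" by (rule lipc_nonneg[OF e])
  show ?thesis
  proof (cases "x = y")
    case True
    then show ?thesis using b n by (simp add: power_0_left)
  next
    case False
    define r where "r = lnorm (x - y) / real k"
    have r0: "0 < r" using lnorm_ge_1[of "x - y"] False k by (simp add: r_def)
    show ?thesis
    proof (cases "lnorm x \<le> R * real k \<or> lnorm y \<le> R * real k")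
      case True
      have "\<bar>e y\<bar> \<le> b" "\<bar>e x\<bar> \<le> b" using e unfolding lipc_def by blast+
      then have d1: "\<bar>e y - e x\<bar> \<le> 2 * b" by linarith
      have "\<bar>e y - e x\<bar> \<le> b * r"
        using e unfolding lipc_def r_def by (metis lnorm_commute)
      moreover have "0 \<le> b * r" using b r0 by simp
      ultimately have d2: "\<bar>e y - e x\<bar> \<le> 2 * b * r" by linarith
      have "\<bar>e y - e x\<bar> \<le> 2 * b * min 1 r" using d1 d2 by (simp add: min_def)
      then have "\<bar>e y - e x\<bar> ^ n \<le> (2 * b * min 1 r) ^ n" by (rule power_mono) simp
      also have "\<dots> = (2 * b) ^ n * (min 1 r) ^ n" by (simp add: power_mult_distrib)
      also have "(min 1 r) ^ n \<le> min 1 (r ^ n)"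
        using r0 by (auto simp: min_def power_le_one one_le_power)
      also have "min 1 (r ^ n) \<le> r powr s" by (rule min_power_le_powr[OF r0 s])
      finally have "\<bar>e y - e x\<bar> ^ n \<le> (2 * b) ^ n * r powr s * 1" using b by (simp add: mult_left_mono)
      also have "\<dots> \<le> (2 * b) ^ n * r powr s * (indicator {z. lnorm z \<le> R * real k} x + indicator {z. lnorm z \<le> R * real k} y)"
        using True b by (intro mult_left_mono) (auto simp: indicator_def)
      finally show ?thesis by (simp add: r_def)
    next
      case False
      then have "e x = 0" "e y = 0" using e by (auto simp: lipc_def)
      then show ?thesis using b n by (simp add: power_0_left)
    qed
  qed
qed

text \<open>Interpolating the increments to order s gains k^(-s) and costs s in the decay of the
  kernel, which must stay above the dimension. The case n = 1 serves the fluctuations, n = 2 their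
  variances.\<close>

lemma lipc_sum:
  fixes e :: "int ^ 'n \<Rightarrow> real"
  assumes e: "lipc k b R e" and k: "1 \<le> k" and s: "0 \<le> s" "s \<le> real n" and n: "1 \<le> n"
    and q: "real CARD('n) < q - s"
  shows "(\<lambda>y. \<bar>e y - e x\<bar> ^ n * lnorm (x - y) powr (- q)) summable_on UNIV"
    "(\<Sum>\<^sub>\<infinity>y. \<bar>e y - e x\<bar> ^ n * lnorm (x - y) powr (- q))
      \<le> (2 * b) ^ n * real k powr (- s) * band {z. lnorm z \<le> R * real k} (\<lambda>z. lnorm z powr (- (q - s))) x"
proof -
  define B where "B = {z :: int ^ 'n. lnorm z \<le> R * real k}"
  have fB: "finite B" by (simp add: B_def)
  define \<rho> where "\<rho> z = lnorm z powr (- (q - s))" for z :: "int ^ 'n"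
  have \<rho>: "\<rho> summable_on UNIV" "\<And>z. 0 \<le> \<rho> z"
    unfolding \<rho>_def[abs_def] using summable_lnorm_powr[OF q] by auto
  define c where "c = (2 * b) ^ n * real k powr (- s)"
  have c0: "0 \<le> c" using lipc_nonneg[OF e] by (simp add: c_def)
  define u where "u y = c * (\<rho> (x - y) * indicator B x + \<rho> (x - y) * indicator B y)" for y
  have le: "\<bar>e y - e x\<bar> ^ n * lnorm (x - y) powr (- q) \<le> u y" for y
  proof -
    have "\<bar>e y - e x\<bar> ^ n * lnorm (x - y) powr (- q)
      \<le> ((2 * b) ^ n * (lnorm (x - y) / real k) powr s * (indicator B x + indicator B y)) * lnorm (x - y) powr (- q)"
      unfolding B_def by (intro mult_right_mono lipc_diff[OF e k s n]) simp
    also have "\<dots> = u y"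
    proof -
      have "(lnorm (x - y) / real k) powr s = lnorm (x - y) powr s / real k powr s"
        by (rule powr_divide)
      then have "(lnorm (x - y) / real k) powr s = real k powr (- s) * lnorm (x - y) powr s"
        by (simp only: powr_minus divide_inverse mult.commute)
      moreover have "lnorm (x - y) powr s * lnorm (x - y) powr (- q) = \<rho> (x - y)"
        unfolding \<rho>_def powr_add[symmetric] by simp
      ultimately have "(lnorm (x - y) / real k) powr s * lnorm (x - y) powr (- q) = real k powr (- s) * \<rho> (x - y)"
        by simp
      then show ?thesis unfolding u_def c_def by (simp add: algebra_simps)
    qed
    finally show ?thesis .
  qed
  have hs: "(u has_sum c * (infsum \<rho> UNIV * indicator B x + (\<Sum>y\<in>B. \<rho> (x - y)))) UNIV"
    unfolding u_def[abs_def]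
  proof (intro has_sum_cmult_right has_sum_add has_sum_cmult_left)
    have "((\<lambda>y. \<rho> (x - y)) has_sum infsum (\<lambda>y. \<rho> (x - y)) UNIV) UNIV"
      using \<rho>(1) infsum_shift(1)[of \<rho> x] by (intro has_sum_infsum) simp
    then show "((\<lambda>y. \<rho> (x - y)) has_sum infsum \<rho> UNIV) UNIV" by (simp only: infsum_shift(2))
    show "((\<lambda>y. \<rho> (x - y) * indicator B y) has_sum (\<Sum>y\<in>B. \<rho> (x - y))) UNIV"
      by (rule has_sum_finite_neutralI[of B]) (use fB in auto)
  qed
  then have us: "u summable_on UNIV" by (auto simp: summable_on_def)
  show 1: "(\<lambda>y. \<bar>e y - e x\<bar> ^ n * lnorm (x - y) powr (- q)) summable_on UNIV"
    by (rule summable_on_comparison_test[OF us le]) simp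
  have "(\<Sum>\<^sub>\<infinity>y. \<bar>e y - e x\<bar> ^ n * lnorm (x - y) powr (- q)) \<le> infsum u UNIV"
    by (rule infsum_mono[OF 1 us le])
  also have "\<dots> = c * (infsum \<rho> UNIV * indicator B x + (\<Sum>y\<in>B. \<rho> (x - y)))"
    using hs by (rule infsumI)
  also have "\<dots> \<le> c * band B \<rho> x"
    using c0 infsum_rho_nonneg[OF fB \<rho>]
    by (intro mult_left_mono) (auto simp: band_def indicator_def)
  finally show "(\<Sum>\<^sub>\<infinity>y. \<bar>e y - e x\<bar> ^ n * lnorm (x - y) powr (- q))
      \<le> (2 * b) ^ n * real k powr (- s) * band {z. lnorm z \<le> R * real k} (\<lambda>z. lnorm z powr (- (q - s))) x"
    by (simp add: c_def B_def \<rho>_def[abs_def])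
qed

lemma vari_eq: "((e y - e x) * lnorm (x - y) powr (- p))\<^sup>2 = \<bar>e y - e x\<bar> ^ 2 * lnorm (x - y) powr (- (2 * p))"
proof -
  have "(lnorm (x - y) powr (- p))\<^sup>2 = lnorm (x - y) powr (- (2 * p))"
    by (simp add: power2_eq_square flip: powr_add)
  then show ?thesis by (simp add: power_mult_distrib)
qed

lemma vari_le:
  fixes e :: "int ^ 'n \<Rightarrow> real"
  assumes e: "lipc k b R e" and k: "1 \<le> k" and s: "0 \<le> s" "s \<le> 2" and q: "real CARD('n) < 2 * p - s"
  shows "(\<lambda>y. ((e y - e x) * lnorm (x - y) powr (- p))\<^sup>2) summable_on UNIV"
    "vari p e x \<le> 4 * b\<^sup>2 * real k powr (- s) * band {z. lnorm z \<le> R * real k} (\<lambda>z. lnorm z powr (- (2 * p - s))) x"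
proof -
  show "(\<lambda>y. ((e y - e x) * lnorm (x - y) powr (- p))\<^sup>2) summable_on UNIV"
    unfolding vari_eq by (rule lipc_sum(1)[OF e k s(1)]) (use s q in auto)
  show "vari p e x \<le> 4 * b\<^sup>2 * real k powr (- s) * band {z. lnorm z \<le> R * real k} (\<lambda>z. lnorm z powr (- (2 * p - s))) x"
    unfolding vari_def vari_eq using lipc_sum(2)[OF e k s(1), of 2 "2 * p" x] s q by (simp add: power_mult_distrib)
qed

lemma vari_nonneg: "0 \<le> vari p e x"
  unfolding vari_def by (rule infsum_nonneg) simp

text \<open>The support has O(k^d) sites, so the total variance is O(k^(d - s)). The bound is
  uniform in X because \<open>band\<close> is summable over the whole lattice.\<close>

lemma vari_sum_le:
  fixes e :: "int ^ 'n \<Rightarrow> real"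
  assumes e: "lipc k b R e" and k: "1 \<le> k" and s: "0 \<le> s" "s \<le> 2" and q: "real CARD('n) < 2 * p - s" and X: "finite X"
  shows "(\<Sum>x\<in>X. vari p e x) \<le> 4 * b\<^sup>2 * real k powr (- s) *
    (real (card {z :: int ^ 'n. lnorm z \<le> R * real k}) * (2 * (\<Sum>\<^sub>\<infinity>z::int ^ 'n. lnorm z powr (- (2 * p - s))) + 1))"
proof -
  define B where "B = {z :: int ^ 'n. lnorm z \<le> R * real k}"
  have fB: "finite B" by (simp add: B_def)
  define \<rho> where "\<rho> z = lnorm z powr (- (2 * p - s))" for z :: "int ^ 'n"
  have \<rho>: "\<rho> summable_on UNIV" "\<And>z. 0 \<le> \<rho> z"
    unfolding \<rho>_def[abs_def] using summable_lnorm_powr[OF q] by auto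
  note hs = band_has_sum[OF fB \<rho>]
  have "(\<Sum>x\<in>X. vari p e x) \<le> (\<Sum>x\<in>X. 4 * b\<^sup>2 * real k powr (- s) * band B \<rho> x)"
    using vari_le(2)[OF e k s q] by (intro sum_mono) (simp add: B_def \<rho>_def[abs_def])
  also have "\<dots> = 4 * b\<^sup>2 * real k powr (- s) * (\<Sum>x\<in>X. band B \<rho> x)" by (simp add: sum_distrib_left)
  also have "\<dots> \<le> 4 * b\<^sup>2 * real k powr (- s) * (real (card B) * (2 * infsum \<rho> UNIV + 1))"
    using band_nonneg[OF fB \<rho>] by (intro mult_left_mono finite_sum_le_has_sum[OF hs X]) auto
  finally show ?thesis by (simp add: B_def \<rho>_def[abs_def])
qed

lemma atom_lipc:
  fixes t :: "int ^ 'n"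
  assumes "1 \<le> k" "1 \<le> L"
  shows "lipc k (1 + real CARD('n)) (2 * real L) (atom k L t)"
  unfolding lipc_def
proof (intro conjI allI impI)
  show "\<bar>atom k L t y\<bar> \<le> 1 + real CARD('n)" for y
    using atom_bound[of k L t y] by linarith
  show "\<bar>atom k L t x - atom k L t y\<bar> \<le> (1 + real CARD('n)) * (lnorm (x - y) / real k)" for x y
    by (rule atom_lipschitz[OF assms])
qed (use assms in \<open>auto intro: atom_support\<close>)

context conductances
begin

text \<open>Purely deterministic: |w - 1| \<le> M + 1 off the diagonal, and the increments are
  interpolated to order s. The first part makes \<open>fluct\<close> a genuine series, so that it is
  linear in e.\<close>

lemma fluct_terms:
  assumes e: "lipc k b R e" and k: "1 \<le> k" and s: "0 \<le> s" "s \<le> 1" and p: "real CARD('n) < p - s" and \<omega>: "\<omega> \<in> space P"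
  shows "(\<lambda>y. (e y - e x) * lnorm (x - y) powr (- p) * (w {x, y} \<omega> - 1)) summable_on UNIV"
    "\<bar>fluct w p e \<omega> x\<bar> \<le> (M + 1) * (2 * b * real k powr (- s)) * band {z. lnorm z \<le> R * real k} (\<lambda>z. lnorm z powr (- (p - s))) x"
proof -
  have ls: "(\<lambda>y. \<bar>e y - e x\<bar> * lnorm (x - y) powr (- p)) summable_on UNIV"
    "(\<Sum>\<^sub>\<infinity>y. \<bar>e y - e x\<bar> * lnorm (x - y) powr (- p))
      \<le> (2 * b) * real k powr (- s) * band {z. lnorm z \<le> R * real k} (\<lambda>z. lnorm z powr (- (p - s))) x"
    using lipc_sum[OF e k s(1), of 1 p x] s p by simp_all
  have le: "\<bar>(e y - e x) * lnorm (x - y) powr (- p) * (w {x, y} \<omega> - 1)\<bar> \<le> (M + 1) * (\<bar>e y - e x\<bar> * lnorm (x - y) powr (- p))" for y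
  proof (cases "x = y")
    case False
    have "\<bar>w {x, y} \<omega> - 1\<bar> \<le> M + 1" using w_bound[OF edge[OF False] \<omega>] by linarith
    then have "\<bar>e y - e x\<bar> * lnorm (x - y) powr (- p) * \<bar>w {x, y} \<omega> - 1\<bar> \<le> \<bar>e y - e x\<bar> * lnorm (x - y) powr (- p) * (M + 1)"
      by (intro mult_left_mono) auto
    then show ?thesis by (simp add: abs_mult mult_ac)
  qed simp
  note sm = summable_on_cmult_right[OF ls(1), of "M + 1"]
  show "(\<lambda>y. (e y - e x) * lnorm (x - y) powr (- p) * (w {x, y} \<omega> - 1)) summable_on UNIV"
    by (rule summable_on_abs_comparison(1)[OF sm le])
  have "\<bar>fluct w p e \<omega> x\<bar> \<le> (\<Sum>\<^sub>\<infinity>y. (M + 1) * (\<bar>e y - e x\<bar> * lnorm (x - y) powr (- p)))"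
    unfolding fluct_def by (rule abs_infsum_le[OF sm le])
  also have "\<dots> = (M + 1) * (\<Sum>\<^sub>\<infinity>y. \<bar>e y - e x\<bar> * lnorm (x - y) powr (- p))"
    by (rule infsum_cmult_right')
  also have "\<dots> \<le> (M + 1) * ((2 * b) * real k powr (- s) * band {z. lnorm z \<le> R * real k} (\<lambda>z. lnorm z powr (- (p - s))) x)"
    using ls(2) M_pos by (intro mult_left_mono) auto
  finally show "\<bar>fluct w p e \<omega> x\<bar> \<le> (M + 1) * (2 * b * real k powr (- s)) * band {z. lnorm z \<le> R * real k} (\<lambda>z. lnorm z powr (- (p - s))) x"
    by (simp add: mult.assoc)
qed

lemma fluct_linear:
  fixes \<phi> :: "'b \<Rightarrow> real"
  assumes T: "finite T" and e: "\<And>t. t \<in> T \<Longrightarrow> lipc k b R (e t)" and k: "1 \<le> k"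
    and p: "real CARD('n) < p" and \<omega>: "\<omega> \<in> space P"
  shows "fluct w p (\<lambda>y. \<Sum>t\<in>T. \<phi> t * e t y) \<omega> x = (\<Sum>t\<in>T. \<phi> t * fluct w p (e t) \<omega> x)"
proof -
  have "((\<lambda>y. \<Sum>t\<in>T. \<phi> t * ((e t y - e t x) * lnorm (x - y) powr (- p) * (w {x, y} \<omega> - 1))) has_sum
      (\<Sum>t\<in>T. \<phi> t * fluct w p (e t) \<omega> x)) UNIV"
    unfolding fluct_def
    by (intro has_sum_sum_real T has_sum_cmult_right has_sum_infsum fluct_terms(1)[where s = 0, OF e k _ _ _ \<omega>]) (use p in auto)
  moreover have "(\<Sum>t\<in>T. \<phi> t * ((e t y - e t x) * lnorm (x - y) powr (- p) * (w {x, y} \<omega> - 1)))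
      = ((\<Sum>t\<in>T. \<phi> t * e t y) - (\<Sum>t\<in>T. \<phi> t * e t x)) * lnorm (x - y) powr (- p) * (w {x, y} \<omega> - 1)" for y
    by (simp add: sum_subtractf[symmetric] sum_distrib_right right_diff_distrib[symmetric] mult.assoc)
  ultimately show ?thesis by (simp add: fluct_def infsumI)
qed

definition good1 :: "nat \<Rightarrow> nat \<Rightarrow> 'w \<Rightarrow> bool" where
  "good1 J0 m \<omega> \<longleftrightarrow> (\<forall>J\<in>{J0..m}. \<forall>z\<in>(lam_box m :: (int ^ 'n) set). \<forall>x\<in>cube J z. \<forall>y\<in>cube J z. x \<noteq> y \<longrightarrow>
    2 ^ (J * CARD('n)) / 4 \<le> (\<Sum>v\<in>cube J z - {x, y}. w {x, v} \<omega> * w {y, v} \<omega>))"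

text \<open>All L up to k are included, so that the event does not depend on the test function.\<close>

definition good2 :: "nat \<Rightarrow> nat \<Rightarrow> real \<Rightarrow> real \<Rightarrow> 'w \<Rightarrow> bool" where
  "good2 k m p \<tau> \<omega> \<longleftrightarrow> (\<forall>L\<in>{1..k}. \<forall>t\<in>(lbox (- int (2 * L * k)) (int (2 * L * k)) :: (int ^ 'n) set). \<forall>J\<le>m. \<forall>z\<in>lam_box m.
    \<bar>\<Sum>x\<in>cube J z. fluct w p (atom k L t) \<omega> x\<bar> \<le> 3 * M * sqrt (\<tau> * (\<Sum>x\<in>cube J z. vari p (atom k L t) x)))"

lemma union_event:
  assumes I: "finite I" and ev: "\<And>i. i \<in> I \<Longrightarrow> \<exists>A\<in>events. prob A \<le> \<epsilon> \<and> (\<forall>\<omega>\<in>space P - A. Q i \<omega>)"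
  shows "\<exists>A\<in>events. prob A \<le> real (card I) * \<epsilon> \<and> (\<forall>\<omega>\<in>space P - A. \<forall>i\<in>I. Q i \<omega>)"
proof -
  obtain A where A: "\<And>i. i \<in> I \<Longrightarrow> A i \<in> events" "\<And>i. i \<in> I \<Longrightarrow> prob (A i) \<le> \<epsilon>"
    "\<And>i \<omega>. i \<in> I \<Longrightarrow> \<omega> \<in> space P - A i \<Longrightarrow> Q i \<omega>"
    using ev by metis
  have "prob (\<Union>i\<in>I. A i) \<le> (\<Sum>i\<in>I. prob (A i))"
    by (rule finite_measure_subadditive_finite) (use I A in auto)
  also have "\<dots> \<le> real (card I) * \<epsilon>" using A(2) by (intro sum_bounded_above)
  finally show ?thesis using A I by (intro bexI[of _ "\<Union>i\<in>I. A i"]) auto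
qed

text \<open>Two union bounds. The first runs over levels and triples (z, x, y) of the box, the
  second over pairs (L, t), levels and base points of cubes; both counts are polynomial in k as soon
  as 2^m is. The hypothesis on J0 guarantees the four sites per cube that
  \<open>two_path_tail\<close> requires.\<close>

lemma good_event:
  assumes k: "1 \<le> k" and J0: "2 \<le> J0 * CARD('n)" and \<tau>: "0 < \<tau>" and p: "real CARD('n) < p"
  shows "\<exists>A\<in>events. prob A \<le> real ((m + 1) * card (lam_box m :: (int ^ 'n) set) ^ 3) * exp (- (2 ^ (J0 * CARD('n))) / (8 * M ^ 4))
      + real (k * (4 * k * k + 1) ^ CARD('n) * ((m + 1) * card (lam_box m :: (int ^ 'n) set))) * (4 * exp (- \<tau>))
    \<and> (\<forall>\<omega>\<in>space P - A. good1 J0 m \<omega> \<and> good2 k m p \<tau> \<omega>)"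
proof -
  define \<Lambda> where "\<Lambda> = (lam_box m :: (int ^ 'n) set)"
  have f\<Lambda>: "finite \<Lambda>" by (simp add: \<Lambda>_def)
  define \<epsilon>1 where "\<epsilon>1 = exp (- (2 ^ (J0 * CARD('n))) / (8 * M ^ 4))"
  define I1 where "I1 = {J0..m} \<times> \<Lambda> \<times> \<Lambda> \<times> \<Lambda>"
  define Q1 where "Q1 = (\<lambda>(J, z, x, y) \<omega>. x \<in> cube J z \<longrightarrow> y \<in> cube J z \<longrightarrow> x \<noteq> y \<longrightarrow>
    2 ^ (J * CARD('n)) / 4 \<le> (\<Sum>v\<in>cube J z - {x, y}. w {x, v} \<omega> * w {y, v} \<omega>))"
  have "\<exists>A\<in>events. prob A \<le> real (card I1) * \<epsilon>1 \<and> (\<forall>\<omega>\<in>space P - A. \<forall>i\<in>I1. Q1 i \<omega>)"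
  proof (rule union_event)
    show "finite I1" by (simp add: I1_def f\<Lambda>)
    fix i assume "i \<in> I1"
    then obtain J z x y where i: "i = (J, z, x, y)" "J0 \<le> J" by (auto simp: I1_def)
    show "\<exists>A\<in>events. prob A \<le> \<epsilon>1 \<and> (\<forall>\<omega>\<in>space P - A. Q1 i \<omega>)"
    proof (cases "x \<in> cube J z \<and> y \<in> cube J z \<and> x \<noteq> y")
      case False
      then have "Q1 i \<omega>" for \<omega> by (auto simp: Q1_def i)
      then show ?thesis by (intro bexI[of _ "{}"]) (auto simp: \<epsilon>1_def)
    next
      case True
      have JJ: "J0 * CARD('n) \<le> J * CARD('n)" using i(2) by simp
      have c: "real (card (cube J z)) = 2 ^ (J * CARD('n))" by (simp add: card_cube)
      have "(2 :: nat) ^ 2 \<le> 2 ^ (J * CARD('n))" by (rule power_increasing[OF order_trans[OF J0 JJ]]) simp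
      then have "4 \<le> card (cube J z)" by (simp add: card_cube)
      from two_path_tail[OF finite_cube this, of x y] True
      obtain A where A: "A \<in> events" "prob A \<le> exp (- real (card (cube J z)) / (8 * M ^ 4))"
        "\<And>\<omega>. \<omega> \<in> space P - A \<Longrightarrow> real (card (cube J z)) / 4 \<le> (\<Sum>v\<in>cube J z - {x, y}. w {x, v} \<omega> * w {y, v} \<omega>)"
        by blast
      have "(2 :: real) ^ (J0 * CARD('n)) \<le> 2 ^ (J * CARD('n))" using JJ by (intro power_increasing) auto
      then have "exp (- real (card (cube J z)) / (8 * M ^ 4)) \<le> \<epsilon>1"
        unfolding c \<epsilon>1_def using M_pos by (simp add: divide_right_mono)
      then show ?thesis using A unfolding c by (intro bexI[of _ A]) (auto simp: Q1_def i)
    qed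
  qed
  then obtain A1 where A1: "A1 \<in> events" "prob A1 \<le> real (card I1) * \<epsilon>1" "\<And>\<omega> i. \<omega> \<in> space P - A1 \<Longrightarrow> i \<in> I1 \<Longrightarrow> Q1 i \<omega>"
    by blast
  have g1: "good1 J0 m \<omega>" if "\<omega> \<in> space P - A1" for \<omega>
    unfolding good1_def
  proof (intro ballI impI)
    fix J z x y assume h: "J \<in> {J0..m}" "z \<in> (lam_box m :: (int ^ 'n) set)" "x \<in> cube J z" "y \<in> cube J z" "x \<noteq> y"
    have "cube J z \<subseteq> lam_box m" using h by (intro cube_subset_lam_box) auto
    then have "(J, z, x, y) \<in> I1" using h by (auto simp: I1_def \<Lambda>_def)
    from A1(3)[OF that this] show "2 ^ (J * CARD('n)) / 4 \<le> (\<Sum>v\<in>cube J z - {x, y}. w {x, v} \<omega> * w {y, v} \<omega>)"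
      using h by (simp add: Q1_def)
  qed
  \<comment> \<open>Radius 2 k^2 contains the boxes of radius 2 L k for all L \<le> k.\<close>
  define I2 where "I2 = {1..k} \<times> (lbox (- int (2 * k * k)) (int (2 * k * k)) :: (int ^ 'n) set) \<times> {..m} \<times> \<Lambda>"
  define Q2 where "Q2 = (\<lambda>(L, t, J, z) \<omega>. \<bar>\<Sum>x\<in>cube J z. fluct w p (atom k L t) \<omega> x\<bar>
    \<le> 3 * M * sqrt (\<tau> * (\<Sum>x\<in>cube J z. vari p (atom k L t) x)))"
  have "\<exists>A\<in>events. prob A \<le> real (card I2) * (4 * exp (- \<tau>)) \<and> (\<forall>\<omega>\<in>space P - A. \<forall>i\<in>I2. Q2 i \<omega>)"
  proof (rule union_event)
    show "finite I2" by (simp add: I2_def f\<Lambda>)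
    fix i assume "i \<in> I2"
    then obtain L t J z where i: "i = (L, t, J, z)" "1 \<le> L" by (auto simp: I2_def)
    note la = atom_lipc[OF k i(2), of t]
    have "\<exists>A\<in>events. prob A \<le> 4 * exp (- \<tau>) \<and> (\<forall>\<omega>\<in>space P - A.
      \<bar>\<Sum>x\<in>cube J z. \<Sum>\<^sub>\<infinity>y. (atom k L t y - atom k L t x) * lnorm (x - y) powr (- p) * (w {x, y} \<omega> - 1)\<bar>
        \<le> 3 * M * sqrt (\<tau> * (\<Sum>x\<in>cube J z. \<Sum>\<^sub>\<infinity>y. ((atom k L t y - atom k L t x) * lnorm (x - y) powr (- p))\<^sup>2)))"
    proof (rule fluctuation_tail)
      fix x
      show "(\<lambda>y. \<bar>(atom k L t y - atom k L t x) * lnorm (x - y) powr (- p)\<bar>) summable_on UNIV"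
        using lipc_sum(1)[OF la k, of 0 1 p x] p by (simp add: abs_mult)
      show "(\<lambda>y. ((atom k L t y - atom k L t x) * lnorm (x - y) powr (- p))\<^sup>2) summable_on UNIV"
        by (rule vari_le(1)[OF la k, of 0]) (use p in auto)
    qed (use \<tau> in auto)
    then show "\<exists>A\<in>events. prob A \<le> 4 * exp (- \<tau>) \<and> (\<forall>\<omega>\<in>space P - A. Q2 i \<omega>)"
      by (simp add: Q2_def i fluct_def vari_def)
  qed
  then obtain A2 where A2: "A2 \<in> events" "prob A2 \<le> real (card I2) * (4 * exp (- \<tau>))" "\<And>\<omega> i. \<omega> \<in> space P - A2 \<Longrightarrow> i \<in> I2 \<Longrightarrow> Q2 i \<omega>"
    by blast
  have g2: "good2 k m p \<tau> \<omega>" if "\<omega> \<in> space P - A2" for \<omega>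
    unfolding good2_def
  proof (intro ballI allI impI)
    fix L J z and t :: "int ^ 'n"
    assume h: "L \<in> {1..k}" "t \<in> lbox (- int (2 * L * k)) (int (2 * L * k))" "J \<le> m" "z \<in> (lam_box m :: (int ^ 'n) set)"
    have "2 * L * k \<le> 2 * k * k" using h by simp
    then have le: "int (2 * L * k) \<le> int (2 * k * k)" by (simp only: of_nat_mono)
    have "- int (2 * k * k) \<le> t $ i \<and> t $ i \<le> int (2 * k * k)" for i
    proof -
      have "- int (2 * L * k) \<le> t $ i \<and> t $ i \<le> int (2 * L * k)" using h(2) unfolding lbox_def by blast
      then show ?thesis using le by linarith
    qed
    then have "t \<in> lbox (- int (2 * k * k)) (int (2 * k * k))" unfolding lbox_def by blast
    then have "(L, t, J, z) \<in> I2" using h by (simp add: I2_def \<Lambda>_def)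
    from A2(3)[OF that this] show "\<bar>\<Sum>x\<in>cube J z. fluct w p (atom k L t) \<omega> x\<bar>
        \<le> 3 * M * sqrt (\<tau> * (\<Sum>x\<in>cube J z. vari p (atom k L t) x))" by (simp add: Q2_def)
  qed
  have c1: "card I1 \<le> (m + 1) * card \<Lambda> ^ 3"
  proof -
    have "card I1 = (m + 1 - J0) * card \<Lambda> ^ 3" by (simp add: I1_def card_cartesian_product power3_eq_cube)
    also have "\<dots> \<le> (m + 1) * card \<Lambda> ^ 3" by (rule mult_le_mono1) simp
    finally show ?thesis .
  qed
  have c2: "card I2 = k * (4 * k * k + 1) ^ CARD('n) * ((m + 1) * card \<Lambda>)"
  proof -
    have "nat (int (2 * k * k) - - int (2 * k * k) + 1) = 4 * k * k + 1" by (simp add: nat_eq_iff)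
    then have "card (lbox (- int (2 * k * k)) (int (2 * k * k)) :: (int ^ 'n) set) = (4 * k * k + 1) ^ CARD('n)"
      unfolding card_lbox by (simp only:)
    then show ?thesis by (simp add: I2_def card_cartesian_product)
  qed
  have "prob (A1 \<union> A2) \<le> prob A1 + prob A2" by (rule measure_Un_le[OF A1(1) A2(1)])
  also have "\<dots> \<le> real ((m + 1) * card \<Lambda> ^ 3) * \<epsilon>1 + real (k * (4 * k * k + 1) ^ CARD('n) * ((m + 1) * card \<Lambda>)) * (4 * exp (- \<tau>))"
  proof (rule add_mono)
    have "real (card I1) * \<epsilon>1 \<le> real ((m + 1) * card \<Lambda> ^ 3) * \<epsilon>1"
      using c1 by (intro mult_right_mono of_nat_mono) (auto simp: \<epsilon>1_def)
    then show "prob A1 \<le> real ((m + 1) * card \<Lambda> ^ 3) * \<epsilon>1" using A1(2) by linarith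
    show "prob A2 \<le> real (k * (4 * k * k + 1) ^ CARD('n) * ((m + 1) * card \<Lambda>)) * (4 * exp (- \<tau>))"
      using A2(2) unfolding c2 .
  qed
  finally show ?thesis
    using A1(1) A2(1) g1 g2 unfolding \<Lambda>_def \<epsilon>1_def by (intro bexI[of _ "A1 \<union> A2"]) auto
qed

end

section \<open>The energy estimate\<close>

lemma L2_set_scale: "L2_set (\<lambda>z. c * f z) A = \<bar>c\<bar> * L2_set f A"
  by (simp add: L2_set_def power_mult_distrib sum_distrib_left[symmetric] real_sqrt_mult)

lemma L2_set_sum_le:
  assumes "finite T"
  shows "L2_set (\<lambda>z. \<Sum>t\<in>T. \<phi> t * f t z) A \<le> (\<Sum>t\<in>T. \<bar>\<phi> t\<bar> * L2_set (f t) A)"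
  using assms
proof (induction T rule: finite_induct)
  case empty
  show ?case by (simp add: L2_set_def)
next
  case (insert t T)
  have "L2_set (\<lambda>z. \<Sum>t\<in>insert t T. \<phi> t * f t z) A = L2_set (\<lambda>z. \<phi> t * f t z + (\<Sum>t\<in>T. \<phi> t * f t z)) A"
    using insert.hyps by simp
  also have "\<dots> \<le> L2_set (\<lambda>z. \<phi> t * f t z) A + L2_set (\<lambda>z. \<Sum>t\<in>T. \<phi> t * f t z) A"
    by (rule L2_set_triangle_ineq)
  also have "\<dots> \<le> \<bar>\<phi> t\<bar> * L2_set (f t) A + (\<Sum>t\<in>T. \<bar>\<phi> t\<bar> * L2_set (f t) A)"
    using insert.IH by (simp add: L2_set_scale)
  finally show ?case using insert.hyps by simp
qed

lemma geometric_tail_le: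
  fixes q :: real
  assumes "0 < q" "q < 1" "J0 \<le> m"
  shows "(\<Sum>J\<in>{J0..<m}. q ^ J) \<le> q ^ J0 / (1 - q)"
proof -
  have "(\<Sum>J\<in>{J0..<n}. q ^ J) * (1 - q) = q ^ J0 - q ^ n" if "J0 \<le> n" for n
    using that
  proof (induction n rule: dec_induct)
    case (step n)
    then show ?case by (simp add: distrib_right) (simp add: algebra_simps)
  qed simp
  then have "(\<Sum>J\<in>{J0..<m}. q ^ J) * (1 - q) \<le> q ^ J0" using assms by simp
  then show ?thesis using assms by (simp add: pos_le_divide_eq)
qed

context conductances
begin

text \<open>Hoeffding bounds a cube sum by the root of the variance inside that cube. Dividing the
  square by N^2 and summing over z counts every site N times, which leaves 1 / N and hence the
  factor 2^(-J d / 2). The passage from atoms to their combination is the triangle inequality for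
  \<open>L2_set\<close>, weighted by the coefficients.\<close>

lemma avg_fluct_L2:
  fixes \<phi> :: "int ^ 'n \<Rightarrow> real"
  assumes good: "good2 k m p \<tau> \<omega>" and \<omega>: "\<omega> \<in> space P" and k: "1 \<le> k" and L: "1 \<le> L" "L \<le> k" and J: "J \<le> m"
    and p: "real CARD('n) < p" and \<tau>: "0 \<le> \<tau>"
    and V: "\<And>t :: int ^ 'n. (\<Sum>x\<in>lam_box m. vari p (atom k L t) x) \<le> V"
    and C: "(\<Sum>t\<in>lbox (- int (2 * L * k)) (int (2 * L * k)). \<bar>\<phi> t\<bar>) \<le> C"
  shows "L2_set (avg J (fluct w p (\<lambda>y. \<Sum>t\<in>lbox (- int (2 * L * k)) (int (2 * L * k)). \<phi> t * atom k L t y) \<omega>)) (lam_box m)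
    \<le> C * (3 * M * sqrt (\<tau> * V) * 2 powr (- (real (J * CARD('n)) / 2)))"
proof -
  define T where "T = (lbox (- int (2 * L * k)) (int (2 * L * k)) :: (int ^ 'n) set)"
  define N where "N = (2 :: real) ^ (J * CARD('n))"
  have N0: "0 < N" by (simp add: N_def)
  define D where "D = 3 * M * sqrt (\<tau> * V) * 2 powr (- (real (J * CARD('n)) / 2))"
  have V0: "0 \<le> V" using V[of 0] sum_nonneg[of "lam_box m" "vari p (atom k L 0)"] vari_nonneg by (meson order_trans)
  have D0: "0 \<le> D" using M_pos V0 \<tau> by (simp add: D_def)
  have N2: "2 powr (- (real (J * CARD('n)) / 2)) = 1 / sqrt N"
  proof -
    have "sqrt N = 2 powr (real (J * CARD('n)) / 2)"
      unfolding N_def by (simp add: powr_half_sqrt[symmetric] powr_powr flip: powr_realpow)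
    then show ?thesis by (simp add: powr_minus_divide)
  qed
  have at: "L2_set (avg J (fluct w p (atom k L t) \<omega>)) (lam_box m) \<le> D" if t: "t \<in> T" for t
  proof -
    define f where "f = fluct w p (atom k L t) \<omega>"
    define v where "v = vari p (atom k L t)"
    have v0: "0 \<le> v x" for x by (simp add: v_def vari_nonneg)
    have pt: "(avg J f z)\<^sup>2 \<le> 9 * M\<^sup>2 * \<tau> / N\<^sup>2 * (\<Sum>x\<in>cube J z. v x)" if z: "z \<in> lam_box m" for z
    proof -
      have "\<bar>\<Sum>x\<in>cube J z. f x\<bar> \<le> 3 * M * sqrt (\<tau> * (\<Sum>x\<in>cube J z. v x))"
        using good L J t z unfolding good2_def T_def f_def v_def by auto
      then have "(\<Sum>x\<in>cube J z. f x)\<^sup>2 \<le> (3 * M * sqrt (\<tau> * (\<Sum>x\<in>cube J z. v x)))\<^sup>2"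
        by (metis abs_ge_zero power2_abs power_mono)
      also have "\<dots> = 9 * M\<^sup>2 * (\<tau> * (\<Sum>x\<in>cube J z. v x))"
        using \<tau> v0 by (simp add: power_mult_distrib sum_nonneg)
      finally have "(\<Sum>x\<in>cube J z. f x)\<^sup>2 / N\<^sup>2 \<le> 9 * M\<^sup>2 * (\<tau> * (\<Sum>x\<in>cube J z. v x)) / N\<^sup>2"
        by (rule divide_right_mono) simp
      then show ?thesis by (simp add: avg_def N_def[symmetric] power_divide mult.assoc)
    qed
    have "(\<Sum>z\<in>lam_box m. (avg J f z)\<^sup>2) \<le> (\<Sum>z\<in>lam_box m. 9 * M\<^sup>2 * \<tau> / N\<^sup>2 * (\<Sum>x\<in>cube J z. v x))"
      by (rule sum_mono) (rule pt)
    also have "\<dots> = 9 * M\<^sup>2 * \<tau> / N\<^sup>2 * (\<Sum>z\<in>lam_box m. \<Sum>x\<in>cube J z. v x)"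
      by (simp only: sum_distrib_left)
    also have "(\<Sum>z\<in>lam_box m. \<Sum>x\<in>cube J z. v x) = (\<Sum>x\<in>lam_box m. \<Sum>z\<in>cube J x. v x)"
      by (rule sum_cube_swap[OF J])
    also have "\<dots> = N * (\<Sum>x\<in>lam_box m. v x)"
      by (simp add: card_cube N_def sum_distrib_left)
    also have "9 * M\<^sup>2 * \<tau> / N\<^sup>2 * (N * (\<Sum>x\<in>lam_box m. v x)) = 9 * M\<^sup>2 * \<tau> / N * (\<Sum>x\<in>lam_box m. v x)"
      using N0 by (simp add: power2_eq_square)
    also have "\<dots> \<le> 9 * M\<^sup>2 * \<tau> / N * V"
      using V[of t] N0 \<tau> by (intro mult_left_mono) (auto simp: v_def)
    also have "\<dots> = D\<^sup>2"
      unfolding D_def N2 using \<tau> V0 N0 by (simp add: power_mult_distrib power_divide)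
    finally have "L2_set (avg J f) (lam_box m) \<le> sqrt (D\<^sup>2)"
      unfolding L2_set_def by (rule real_sqrt_le_mono)
    then show ?thesis using D0 by (simp add: f_def)
  qed
  have lin: "avg J (fluct w p (\<lambda>y. \<Sum>t\<in>T. \<phi> t * atom k L t y) \<omega>) z = (\<Sum>t\<in>T. \<phi> t * avg J (fluct w p (atom k L t) \<omega>) z)" for z
  proof -
    have "fluct w p (\<lambda>y. \<Sum>t\<in>T. \<phi> t * atom k L t y) \<omega> x = (\<Sum>t\<in>T. \<phi> t * fluct w p (atom k L t) \<omega> x)" for x
      by (rule fluct_linear[OF _ atom_lipc k p \<omega>]) (use k L in \<open>auto simp: T_def\<close>)
    then have "(\<Sum>x\<in>cube J z. fluct w p (\<lambda>y. \<Sum>t\<in>T. \<phi> t * atom k L t y) \<omega> x)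
        = (\<Sum>t\<in>T. \<phi> t * (\<Sum>x\<in>cube J z. fluct w p (atom k L t) \<omega> x))"
      by (simp only: sum_distrib_left) (rule sum.swap)
    then have "avg J (fluct w p (\<lambda>y. \<Sum>t\<in>T. \<phi> t * atom k L t y) \<omega>) z
        = (\<Sum>t\<in>T. \<phi> t * (\<Sum>x\<in>cube J z. fluct w p (atom k L t) \<omega> x)) / N"
      by (simp only: avg_def N_def)
    also have "\<dots> = (\<Sum>t\<in>T. \<phi> t * ((\<Sum>x\<in>cube J z. fluct w p (atom k L t) \<omega> x) / N))"
      by (subst sum_divide_distrib) simp
    finally show ?thesis by (simp only: avg_def N_def)
  qed
  have "L2_set (\<lambda>z. \<Sum>t\<in>T. \<phi> t * avg J (fluct w p (atom k L t) \<omega>) z) (lam_box m)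
      \<le> (\<Sum>t\<in>T. \<bar>\<phi> t\<bar> * L2_set (avg J (fluct w p (atom k L t) \<omega>)) (lam_box m))"
    by (rule L2_set_sum_le) (simp add: T_def)
  also have "\<dots> \<le> (\<Sum>t\<in>T. \<bar>\<phi> t\<bar> * D)" by (intro sum_mono mult_left_mono at) auto
  also have "\<dots> = (\<Sum>t\<in>T. \<bar>\<phi> t\<bar>) * D" by (simp add: sum_distrib_right)
  also have "\<dots> \<le> C * D" using C D0 by (intro mult_right_mono) (auto simp: T_def)
  finally have "L2_set (avg J (fluct w p (\<lambda>y. \<Sum>t\<in>T. \<phi> t * atom k L t y) \<omega>)) (lam_box m) \<le> C * D"
    by (simp only: lin[symmetric])
  then show ?thesis by (simp only: T_def D_def)
qed

text \<open>The kernel of \<open>Lk\<close> in lattice units: k^(-d) times k^(d + \<alpha>) leaves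
  k^\<alpha>. On the diagonal it vanishes because \<open>0 powr r = 0\<close>, whatever value
  \<open>w\<close> has at a singleton.\<close>

definition kern :: "nat \<Rightarrow> real \<Rightarrow> 'w \<Rightarrow> int ^ 'n \<Rightarrow> int ^ 'n \<Rightarrow> real" where
  "kern k \<alpha> \<omega> x y = real k powr \<alpha> * (w {x, y} \<omega> * lnorm (x - y) powr (- (real CARD('n) + \<alpha>)))"

lemma kern_dominated:
  assumes "0 < \<alpha>" "\<omega> \<in> space P"
  shows "dominated_kernel (kern k \<alpha> \<omega>) (\<lambda>z. real k powr \<alpha> * (M * lnorm z powr (- (real CARD('n) + \<alpha>))))"
proof
  fix x y
  show "0 \<le> kern k \<alpha> \<omega> x y"
  proof (cases "x = y")
    case False
    then show ?thesis using w_bound[OF edge[OF False] assms(2)] by (simp add: kern_def)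
  qed (simp add: kern_def)
  show "kern k \<alpha> \<omega> x y = kern k \<alpha> \<omega> y x"
    by (simp add: kern_def insert_commute lnorm_commute)
  show "kern k \<alpha> \<omega> x y \<le> real k powr \<alpha> * (M * lnorm (x - y) powr (- (real CARD('n) + \<alpha>)))"
  proof (cases "x = y")
    case False
    then show ?thesis unfolding kern_def using w_bound[OF edge[OF False] assms(2)]
      by (intro mult_left_mono mult_right_mono) auto
  qed (simp add: kern_def)
next
  show "(\<lambda>z :: int ^ 'n. real k powr \<alpha> * (M * lnorm z powr (- (real CARD('n) + \<alpha>)))) summable_on UNIV"
    by (intro summable_on_cmult_right summable_lnorm_powr) (use assms in simp)
qed

lemma Lk_eq_gen:
  assumes "0 < \<alpha>" "\<omega> \<in> space P" "1 \<le> k"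
  shows "Lk w k \<alpha> \<omega> u z = dominated_kernel.gen (kern k \<alpha> \<omega>) u z"
proof -
  interpret dominated_kernel "kern k \<alpha> \<omega>" "\<lambda>z. real k powr \<alpha> * (M * lnorm z powr (- (real CARD('n) + \<alpha>)))"
    by (rule kern_dominated[OF assms(1,2)])
  define p where "p = real CARD('n) + \<alpha>"
  have k0: "0 < real k" using assms(3) by simp
  have trm: "(u y - u z) * w {z, y} \<omega> / norm (lat_pt k z - lat_pt k y) powr p
      = real k powr p * ((u y - u z) * (w {z, y} \<omega> * lnorm (z - y) powr (- p)))" for y
  proof -
    have "norm (lat_pt k z - lat_pt k y) powr p = lnorm (z - y) powr p / real k powr p"
      unfolding lat_pt_diff norm_lat_pt by (rule powr_divide)
    then show ?thesis by (simp only: powr_minus divide_inverse inverse_mult_distrib inverse_inverse_eq mult_ac)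
  qed
  have kk: "1 / real k ^ CARD('n) * real k powr p = real k powr \<alpha>"
    using k0 by (simp add: p_def powr_add powr_realpow)
  have "Lk w k \<alpha> \<omega> u z = 1 / real k ^ CARD('n) * (\<Sum>\<^sub>\<infinity>y\<in>UNIV - {z}. real k powr p * ((u y - u z) * (w {z, y} \<omega> * lnorm (z - y) powr (- p))))"
    unfolding Lk_def p_def[symmetric] trm ..
  also have "(\<Sum>\<^sub>\<infinity>y\<in>UNIV - {z}. real k powr p * ((u y - u z) * (w {z, y} \<omega> * lnorm (z - y) powr (- p))))
      = (\<Sum>\<^sub>\<infinity>y. real k powr p * ((u y - u z) * (w {z, y} \<omega> * lnorm (z - y) powr (- p))))"
    by (rule infsum_cong_neutral) auto
  also have "\<dots> = real k powr p * (\<Sum>\<^sub>\<infinity>y. (u y - u z) * (w {z, y} \<omega> * lnorm (z - y) powr (- p)))"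
    by (rule infsum_cmult_right')
  also have "1 / real k ^ CARD('n) * \<dots> = real k powr \<alpha> * (\<Sum>\<^sub>\<infinity>y. (u y - u z) * (w {z, y} \<omega> * lnorm (z - y) powr (- p)))"
    unfolding mult.assoc[symmetric] kk ..
  also have "\<dots> = (\<Sum>\<^sub>\<infinity>y. real k powr \<alpha> * ((u y - u z) * (w {z, y} \<omega> * lnorm (z - y) powr (- p))))"
    by (rule infsum_cmult_right'[symmetric])
  also have "\<dots> = gen u z"
    unfolding gen_def by (rule infsum_cong) (simp add: kern_def p_def mult_ac)
  finally show ?thesis .
qed

text \<open>Within a cube of side 2^J the kernel is at least k^\<alpha> (d 2^J)^(-p) times the
  conductance. The division by the volume 2^(J d) in \<open>poincare_cubes\<close> turns 2^(J p)
  into 2^(J \<alpha>).\<close>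

lemma poincare_kern:
  fixes h :: "int ^ 'n \<Rightarrow> real"
  assumes \<alpha>: "0 < \<alpha>" and \<omega>: "\<omega> \<in> space P" and k: "1 \<le> k" and good: "good1 J0 m \<omega>" and J: "J0 \<le> J" "J \<le> m"
  shows "L2_set (\<lambda>z. h z - avg J h z) (lam_box m)
    \<le> sqrt (32 * M * real CARD('n) powr (real CARD('n) + \<alpha>)) * 2 powr (real J * \<alpha> / 2) * real k powr (- \<alpha> / 2)
      * sqrt ((\<Sum>x\<in>lam_box m. \<Sum>y\<in>lam_box m. kern k \<alpha> \<omega> x y * (h x - h y)\<^sup>2) / 2)"
proof -
  define d where "d = real CARD('n)"
  define p where "p = d + \<alpha>"
  define E where "E = (\<Sum>x\<in>lam_box m. \<Sum>y\<in>lam_box m. kern k \<alpha> \<omega> x y * (h x - h y)\<^sup>2) / 2"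
  define W where "W x y = w {x, y} \<omega>" for x y
  define N where "N = (2 :: real) ^ (J * CARD('n))"
  have N0: "0 < N" by (simp add: N_def)
  have k0: "0 < real k" using k by simp
  have p0: "0 \<le> p" using \<alpha> by (simp add: p_def d_def)
  interpret dominated_kernel "kern k \<alpha> \<omega>" "\<lambda>z. real k powr \<alpha> * (M * lnorm z powr (- (real CARD('n) + \<alpha>)))"
    by (rule kern_dominated[OF \<alpha> \<omega>])
  have E0: "0 \<le> E" unfolding E_def using nonneg by (intro divide_nonneg_nonneg sum_nonneg mult_nonneg_nonneg) auto
  have "(\<Sum>z\<in>lam_box m. (h z - avg J h z)\<^sup>2) \<le> 16 * M / N * (\<Sum>z\<in>lam_box m. \<Sum>y\<in>cube J z. W z y * (h z - h y)\<^sup>2)"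
    unfolding N_def
  proof (rule poincare_cubes[OF J(2)])
    show "0 \<le> W x y \<and> W x y \<le> M" if "x \<noteq> y" for x y
      unfolding W_def using w_bound[OF edge[OF that] \<omega>] .
    show "2 ^ (J * CARD('n)) / 4 \<le> (\<Sum>v\<in>cube J z - {x, y}. W x v * W y v)"
      if "z \<in> lam_box m" "x \<in> cube J z" "y \<in> cube J z" "x \<noteq> y" for z x y
      using good that J unfolding good1_def W_def by auto
  qed (use M_pos in simp)
  also have "\<dots> \<le> 16 * M / N * ((d * 2 ^ J) powr p * real k powr (- \<alpha>) * (2 * E))"
  proof (rule mult_left_mono)
    have "(\<Sum>z\<in>lam_box m. \<Sum>y\<in>cube J z. W z y * (h z - h y)\<^sup>2)
        \<le> (\<Sum>z\<in>lam_box m. \<Sum>y\<in>cube J z. (d * 2 ^ J) powr p * real k powr (- \<alpha>) * (kern k \<alpha> \<omega> z y * (h z - h y)\<^sup>2))"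
    proof (intro sum_mono)
      fix z y :: "int ^ 'n" assume y: "y \<in> cube J z"
      show "W z y * (h z - h y)\<^sup>2 \<le> (d * 2 ^ J) powr p * real k powr (- \<alpha>) * (kern k \<alpha> \<omega> z y * (h z - h y)\<^sup>2)"
      proof (cases "z = y")
        case False
        have l1: "0 < lnorm (z - y)" using lnorm_ge_1[of "z - y"] False by simp
        have "lnorm (z - y) \<le> d * 2 ^ J" using lnorm_cube[OF y] by (simp add: d_def)
        then have "lnorm (z - y) powr p \<le> (d * 2 ^ J) powr p" using p0 by (intro powr_mono2) auto
        then have "lnorm (z - y) powr p * lnorm (z - y) powr (- p) \<le> (d * 2 ^ J) powr p * lnorm (z - y) powr (- p)"
          by (rule mult_right_mono) simp
        moreover have "lnorm (z - y) powr p * lnorm (z - y) powr (- p) = 1"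
          using l1 False by (simp flip: powr_add)
        ultimately have ge1: "1 \<le> (d * 2 ^ J) powr p * lnorm (z - y) powr (- p)" by linarith
        have kk: "real k powr (- \<alpha>) * real k powr \<alpha> = 1" using k0 by (simp flip: powr_add)
        have W0: "0 \<le> W z y * (h z - h y)\<^sup>2" unfolding W_def using w_bound[OF edge[OF False] \<omega>] by simp
        have "(d * 2 ^ J) powr p * real k powr (- \<alpha>) * (kern k \<alpha> \<omega> z y * (h z - h y)\<^sup>2)
          = (real k powr (- \<alpha>) * real k powr \<alpha>) * ((d * 2 ^ J) powr p * lnorm (z - y) powr (- p)) * (W z y * (h z - h y)\<^sup>2)"
          by (simp add: kern_def W_def p_def d_def mult_ac)
        also have "\<dots> = ((d * 2 ^ J) powr p * lnorm (z - y) powr (- p)) * (W z y * (h z - h y)\<^sup>2)"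
          unfolding kk by simp
        also have "\<dots> \<ge> 1 * (W z y * (h z - h y)\<^sup>2)" using ge1 W0 by (rule mult_right_mono)
        finally show ?thesis by simp
      qed simp
    qed
    also have "\<dots> \<le> (\<Sum>z\<in>lam_box m. \<Sum>y\<in>lam_box m. (d * 2 ^ J) powr p * real k powr (- \<alpha>) * (kern k \<alpha> \<omega> z y * (h z - h y)\<^sup>2))"
      using cube_subset_lam_box[OF J(2)] nonneg by (intro sum_mono sum_mono2) auto
    also have "\<dots> = (d * 2 ^ J) powr p * real k powr (- \<alpha>) * (2 * E)"
    proof -
      have "2 * E = (\<Sum>x\<in>lam_box m. \<Sum>y\<in>lam_box m. kern k \<alpha> \<omega> x y * (h x - h y)\<^sup>2)" by (simp add: E_def)
      then show ?thesis by (simp only: sum_distrib_left)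
    qed
    finally show "(\<Sum>z\<in>lam_box m. \<Sum>y\<in>cube J z. W z y * (h z - h y)\<^sup>2) \<le> (d * 2 ^ J) powr p * real k powr (- \<alpha>) * (2 * E)" .
  qed (use M_pos N0 in simp)
  also have "\<dots> = (32 * M * d powr p) * 2 powr (real J * \<alpha>) * real k powr (- \<alpha>) * E"
  proof -
    have "(d * 2 ^ J) powr p = d powr p * (2 ^ J) powr p" by (rule powr_mult)
    also have "((2 :: real) ^ J) powr p = 2 powr (real J * p)" by (simp add: powr_powr flip: powr_realpow)
    also have "2 powr (real J * p) = N * 2 powr (real J * \<alpha>)"
      unfolding N_def p_def d_def by (simp add: distrib_left powr_add flip: powr_realpow)
    finally have "(d * 2 ^ J) powr p = d powr p * (N * 2 powr (real J * \<alpha>))" .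
    then show ?thesis using N0 by simp
  qed
  finally have "L2_set (\<lambda>z. h z - avg J h z) (lam_box m) \<le> sqrt ((32 * M * d powr p) * 2 powr (real J * \<alpha>) * real k powr (- \<alpha>) * E)"
    unfolding L2_set_def by (rule real_sqrt_le_mono)
  also have "\<dots> = sqrt (32 * M * d powr p) * 2 powr (real J * \<alpha> / 2) * real k powr (- \<alpha> / 2) * sqrt E"
    by (simp add: real_sqrt_mult powr_half_sqrt[symmetric] powr_powr)
  finally show ?thesis by (simp add: d_def p_def E_def)
qed

text \<open>\<open>a1\<close> collects what multiplies the root of the energy E, \<open>b1\<close>
  what multiplies the l^2 norm of h. Young's inequality absorbs the former into E entirely, and the
  latter and the pairing with r into a quarter of lam H each, so that lam H / 2 remains on the
  left.\<close>

lemma energy_estimate: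
  fixes F h r :: "int ^ 'n \<Rightarrow> real"
  assumes \<alpha>: "0 < \<alpha>" "\<alpha> < real CARD('n)" and lam: "0 < lam" and \<omega>: "\<omega> \<in> space P" and k: "1 \<le> k"
    and good: "good1 J0 m \<omega>" and J0: "J0 \<le> m"
    and h: "(\<lambda>x. (h x)\<^sup>2) summable_on UNIV" and r: "(\<lambda>x. (r x)\<^sup>2) summable_on UNIV"
    and eq: "\<And>x. lam * h x - dominated_kernel.gen (kern k \<alpha> \<omega>) h x = real k powr \<alpha> * F x * indicator (lam_box m) x + r x"
    and A: "L2_set F (lam_box m) \<le> A"
    and U: "0 \<le> U" "\<And>J. J0 \<le> J \<Longrightarrow> J \<le> m \<Longrightarrow> L2_set (avg J F) (lam_box m) \<le> U * 2 powr (- (real (J * CARD('n)) / 2))"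
    and a1: "a1 = sqrt (32 * M * real CARD('n) powr (real CARD('n) + \<alpha>)) * real k powr (\<alpha> / 2)
      * (A * 2 powr (real J0 * \<alpha> / 2)
         + U * (2 powr (\<alpha> / 2) / (1 - 2 powr (- ((real CARD('n) - \<alpha>) / 2)))) * 2 powr (- (real J0 * (real CARD('n) - \<alpha>) / 2)))"
    and b1: "b1 = real k powr \<alpha> * (U * 2 powr (- (real (m * CARD('n)) / 2)))"
  shows "(\<Sum>\<^sub>\<infinity>x. (h x)\<^sup>2) \<le> 2 / lam * (a1\<^sup>2 / 4 + b1\<^sup>2 / lam + (\<Sum>\<^sub>\<infinity>x. (r x)\<^sup>2) / lam)"
proof -
  define \<Lambda> where "\<Lambda> = (lam_box m :: (int ^ 'n) set)"
  define d where "d = real CARD('n)"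
  interpret dominated_kernel "kern k \<alpha> \<omega>" "\<lambda>z. real k powr \<alpha> * (M * lnorm z powr (- (real CARD('n) + \<alpha>)))"
    by (rule kern_dominated[OF \<alpha>(1) \<omega>])
  define E where "E = (\<Sum>x\<in>\<Lambda>. \<Sum>y\<in>\<Lambda>. kern k \<alpha> \<omega> x y * (h x - h y)\<^sup>2) / 2"
  define H where "H = (\<Sum>\<^sub>\<infinity>x. (h x)\<^sup>2)"
  define \<Phi> where "\<Phi> x = real k powr \<alpha> * F x * indicator \<Lambda> x + r x" for x
  have k0: "0 < real k" using k by simp
  have E0: "0 \<le> E" unfolding E_def using nonneg by (intro divide_nonneg_nonneg sum_nonneg mult_nonneg_nonneg) auto
  have H0: "0 \<le> H" unfolding H_def by (rule infsum_nonneg) simp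
  have fin\<Lambda>: "finite \<Lambda>" by (simp add: \<Lambda>_def)
  have hs1: "((\<lambda>x. (real k powr \<alpha> * F x * indicator \<Lambda> x)\<^sup>2) has_sum (\<Sum>x\<in>\<Lambda>. (real k powr \<alpha> * F x * indicator \<Lambda> x)\<^sup>2)) UNIV"
    by (rule has_sum_finite_neutralI[of \<Lambda>]) (use fin\<Lambda> in auto)
  have \<Phi>s: "(\<lambda>x. (\<Phi> x)\<^sup>2) summable_on UNIV"
    unfolding \<Phi>_def by (rule square_summable_add[OF _ r]) (use hs1 in \<open>auto simp: summable_on_def\<close>)
  have en: "lam * H + E \<le> (\<Sum>\<^sub>\<infinity>x. \<Phi> x * h x)"
    unfolding H_def E_def \<Lambda>_def
    by (rule energy_bound[OF h \<Phi>s]) (auto simp: \<Phi>_def \<Lambda>_def eq)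
  have hs2: "((\<lambda>x. real k powr \<alpha> * F x * indicator \<Lambda> x * h x) has_sum (real k powr \<alpha> * (\<Sum>x\<in>\<Lambda>. F x * h x))) UNIV"
    by (rule has_sum_finite_neutralI[of \<Lambda>]) (use fin\<Lambda> in \<open>auto simp: sum_distrib_left mult.assoc\<close>)
  note rh = square_summable_mult[OF r h]
  have "((\<lambda>x. real k powr \<alpha> * F x * indicator \<Lambda> x * h x + r x * h x) has_sum
      (real k powr \<alpha> * (\<Sum>x\<in>\<Lambda>. F x * h x) + (\<Sum>\<^sub>\<infinity>x. r x * h x))) UNIV"
    by (intro has_sum_add hs2 has_sum_infsum rh)
  then have split: "(\<Sum>\<^sub>\<infinity>x. \<Phi> x * h x) = real k powr \<alpha> * (\<Sum>x\<in>\<Lambda>. F x * h x) + (\<Sum>\<^sub>\<infinity>x. r x * h x)"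
    unfolding \<Phi>_def distrib_right by (rule infsumI)
  have rle: "(\<Sum>\<^sub>\<infinity>x. r x * h x) \<le> (\<Sum>\<^sub>\<infinity>x. (r x)\<^sup>2) / lam + lam / 4 * H"
  proof -
    have t: "r x * h x \<le> (r x)\<^sup>2 * (1 / lam) + (h x)\<^sup>2 * (lam / 4)" for x
    proof -
      have "0 \<le> (r x / sqrt lam - sqrt lam / 2 * h x)\<^sup>2" by simp
      also have "\<dots> = (r x)\<^sup>2 * (1 / lam) + (h x)\<^sup>2 * (lam / 4) - r x * h x"
        using lam by (simp add: power2_diff power_mult_distrib power_divide)
      finally show ?thesis by simp
    qed
    have "(\<Sum>\<^sub>\<infinity>x. r x * h x) \<le> (\<Sum>\<^sub>\<infinity>x. (r x)\<^sup>2 * (1 / lam) + (h x)\<^sup>2 * (lam / 4))"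
      by (intro infsum_mono rh summable_on_add summable_on_cmult_left r h t)
    also have "\<dots> = (\<Sum>\<^sub>\<infinity>x. (r x)\<^sup>2) * (1 / lam) + H * (lam / 4)"
      unfolding H_def infsum_cmult_left'[symmetric]
      by (intro infsum_add summable_on_cmult_left r h)
    finally show ?thesis by (simp add: mult.commute)
  qed
  define X where "X J = sqrt (32 * M * d powr (d + \<alpha>)) * 2 powr (real J * \<alpha> / 2) * real k powr (- \<alpha> / 2) * sqrt E" for J
  have X0: "0 \<le> X J" for J using E0 M_pos by (simp add: X_def)
  have poi: "L2_set (\<lambda>z. h z - avg J h z) \<Lambda> \<le> X J" if "J0 \<le> J" "J \<le> m" for J
    using poincare_kern[OF \<alpha>(1) \<omega> k good that, of h] by (simp add: X_def E_def d_def \<Lambda>_def)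
  have hL: "L2_set h \<Lambda> \<le> sqrt H"
    unfolding L2_set_def H_def by (intro real_sqrt_le_mono finite_sum_le_infsum h fin\<Lambda>) auto
  \<comment> \<open>Ratio of consecutive scales: averaging at level J gains 2^(-J d / 2), the
    Poincare inequality at level J + 1 costs 2^((J + 1) \<alpha> / 2). It is below 1 because
    \<alpha> < d; the shift by one level is the factor 2^(\<alpha> / 2) in
    \<open>a1\<close>.\<close>
  define q where "q = 2 powr (- ((d - \<alpha>) / 2))"
  have q: "0 < q" "q < 1" using \<alpha> by (auto simp: q_def d_def powr_less_one)
  have A0: "0 \<le> A" using A L2_set_nonneg order_trans by blast
  have "(\<Sum>x\<in>\<Lambda>. F x * h x) \<le> L2_set F \<Lambda> * L2_set (\<lambda>z. h z - avg J0 h z) \<Lambda>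
    + (\<Sum>J\<in>{J0..<m}. L2_set (avg J F) \<Lambda> * L2_set (\<lambda>z. h z - avg (Suc J) h z) \<Lambda>)
    + L2_set (avg m F) \<Lambda> * L2_set h \<Lambda>"
    unfolding \<Lambda>_def by (rule multiscale_chain[OF J0])
  also have "\<dots> \<le> A * X J0 + (\<Sum>J\<in>{J0..<m}. (U * 2 powr (- (real (J * CARD('n)) / 2))) * X (Suc J))
    + (U * 2 powr (- (real (m * CARD('n)) / 2))) * sqrt H"
    using A U J0 poi hL A0 by (intro add_mono sum_mono mult_mono) (auto simp: \<Lambda>_def)
  also have "(\<Sum>J\<in>{J0..<m}. (U * 2 powr (- (real (J * CARD('n)) / 2))) * X (Suc J)) = (\<Sum>J\<in>{J0..<m}. U * 2 powr (\<alpha> / 2) * X 0 * q ^ J)"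
  proof (rule sum.cong)
    fix J
    have "2 powr (- (real (J * CARD('n)) / 2)) * 2 powr (real (Suc J) * \<alpha> / 2) = 2 powr (\<alpha> / 2) * q powr (real J)"
    proof -
      have "- (real (J * CARD('n)) / 2) + real (Suc J) * \<alpha> / 2 = \<alpha> / 2 + - ((d - \<alpha>) / 2) * real J"
        by (simp add: d_def algebra_simps add_divide_distrib diff_divide_distrib)
      then show ?thesis unfolding q_def powr_powr powr_add[symmetric] by (simp only:)
    qed
    also have "q powr real J = q ^ J" using q by (simp add: powr_realpow)
    finally have e: "2 powr (- (real (J * CARD('n)) / 2)) * 2 powr (real (Suc J) * \<alpha> / 2) = 2 powr (\<alpha> / 2) * q ^ J" .
    have "(U * 2 powr (- (real (J * CARD('n)) / 2))) * X (Suc J)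
      = U * (2 powr (- (real (J * CARD('n)) / 2)) * 2 powr (real (Suc J) * \<alpha> / 2)) * X 0"
      by (simp add: X_def mult_ac)
    then show "(U * 2 powr (- (real (J * CARD('n)) / 2))) * X (Suc J) = U * 2 powr (\<alpha> / 2) * X 0 * q ^ J"
      unfolding e by (simp add: mult_ac)
  qed simp
  also have "\<dots> \<le> U * 2 powr (\<alpha> / 2) * X 0 * (q ^ J0 / (1 - q))"
    unfolding sum_distrib_left[symmetric] using U X0 by (intro mult_left_mono geometric_tail_le q J0) auto
  finally have chain: "(\<Sum>x\<in>\<Lambda>. F x * h x) \<le> A * X J0 + U * 2 powr (\<alpha> / 2) * X 0 * (q ^ J0 / (1 - q))
    + (U * 2 powr (- (real (m * CARD('n)) / 2))) * sqrt H" by simp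
  have "real k powr \<alpha> * (A * X J0 + U * 2 powr (\<alpha> / 2) * X 0 * (q ^ J0 / (1 - q))) = a1 * sqrt E"
  proof -
    have kk: "real k powr \<alpha> * real k powr (- \<alpha> / 2) = real k powr (\<alpha> / 2)" by (simp flip: powr_add)
    have qq: "q ^ J0 = 2 powr (- (real J0 * (d - \<alpha>) / 2))"
    proof -
      have "q ^ J0 = q powr real J0" using q by (simp add: powr_realpow)
      then show ?thesis by (simp add: q_def powr_powr mult_ac)
    qed
    define c where "c = sqrt (32 * M * d powr (d + \<alpha>))"
    have X: "X J = c * 2 powr (real J * \<alpha> / 2) * real k powr (- \<alpha> / 2) * sqrt E" for J by (simp add: X_def c_def)
    have "real k powr \<alpha> * (A * X J0 + U * 2 powr (\<alpha> / 2) * X 0 * (q ^ J0 / (1 - q)))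
      = c * (real k powr \<alpha> * real k powr (- \<alpha> / 2)) * (A * 2 powr (real J0 * \<alpha> / 2) + U * (2 powr (\<alpha> / 2) / (1 - q)) * q ^ J0) * sqrt E"
      unfolding X by (simp add: algebra_simps)
    also have "\<dots> = a1 * sqrt E" unfolding kk a1 qq by (simp add: c_def q_def d_def)
    finally show ?thesis .
  qed
  moreover have "real k powr \<alpha> * (\<Sum>x\<in>\<Lambda>. F x * h x) \<le> real k powr \<alpha> * (A * X J0 + U * 2 powr (\<alpha> / 2) * X 0 * (q ^ J0 / (1 - q))
    + (U * 2 powr (- (real (m * CARD('n)) / 2))) * sqrt H)"
    using chain by (rule mult_left_mono) simp
  ultimately have main: "real k powr \<alpha> * (\<Sum>x\<in>\<Lambda>. F x * h x) \<le> a1 * sqrt E + b1 * sqrt H"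
    by (simp add: b1 distrib_left mult.assoc)
  have y1: "a1 * sqrt E \<le> E + a1\<^sup>2 / 4"
  proof -
    have "0 \<le> (sqrt E - a1 / 2)\<^sup>2" by simp
    then show ?thesis using E0 by (simp add: power2_diff power_divide mult.commute)
  qed
  have y2: "b1 * sqrt H \<le> lam / 4 * H + b1\<^sup>2 / lam"
  proof -
    have "0 \<le> (sqrt lam / 2 * sqrt H - b1 / sqrt lam)\<^sup>2" by simp
    also have "\<dots> = lam / 4 * H + b1\<^sup>2 / lam - b1 * sqrt H"
      using lam H0 by (simp add: power2_diff power_mult_distrib power_divide)
    finally show ?thesis by simp
  qed
  have "lam * H + E \<le> (E + a1\<^sup>2 / 4) + (lam / 4 * H + b1\<^sup>2 / lam) + ((\<Sum>\<^sub>\<infinity>x. (r x)\<^sup>2) / lam + lam / 4 * H)"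
    using en split main y1 y2 rle by linarith
  then have "lam / 2 * H \<le> a1\<^sup>2 / 4 + b1\<^sup>2 / lam + (\<Sum>\<^sub>\<infinity>x. (r x)\<^sup>2) / lam" by linarith
  then have "2 / lam * (lam / 2 * H) \<le> 2 / lam * (a1\<^sup>2 / 4 + b1\<^sup>2 / lam + (\<Sum>\<^sub>\<infinity>x. (r x)\<^sup>2) / lam)"
    using lam by (intro mult_left_mono) auto
  then show ?thesis using lam by (simp add: H_def)
qed

end

section \<open>Comparison of rates\<close>

lemma ln_ge_1: "3 \<le> k \<Longrightarrow> 1 \<le> ln (real k)"
  using exp_le ln_ge_iff[of "real k" 1] by (simp add: order_trans[OF exp_le])

lemma powr_ln_compare:
  fixes x x' y y' :: real
  assumes "x < x' \<or> x = x' \<and> y \<le> y'"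
  shows "\<exists>C>0. \<forall>k\<ge>3. real k powr x * ln (real k) powr y \<le> C * (real k powr x' * ln (real k) powr y')"
proof (cases "x = x' \<and> y \<le> y'")
  case True
  have "real k powr x * ln (real k) powr y \<le> 1 * (real k powr x' * ln (real k) powr y')" if "3 \<le> k" for k
    using True ln_ge_1[OF that] by (auto intro!: mult_left_mono powr_mono)
  then show ?thesis by (intro exI[of _ 1]) auto
next
  case False
  then have xx: "x < x'" using assms by auto
  \<comment> \<open>The maximum keeps q positive, so that the surplus x' - x in the power of k can
    be spread over q logarithms even when y \<le> y'.\<close>
  define q where "q = max 1 (y - y')"
  define \<epsilon> where "\<epsilon> = (x' - x) / q"
  have q: "1 \<le> q" "y - y' \<le> q" by (auto simp: q_def)
  have e: "0 < \<epsilon>" using xx q by (simp add: \<epsilon>_def)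
  define C where "C = (1 / \<epsilon>) powr q"
  have "real k powr x * ln (real k) powr y \<le> C * (real k powr x' * ln (real k) powr y')" if k: "3 \<le> k" for k
  proof -
    have l: "1 \<le> ln (real k)" by (rule ln_ge_1[OF k])
    have "ln (real k) powr y = ln (real k) powr (y - y') * ln (real k) powr y'" using l by (simp flip: powr_add)
    also have "\<dots> \<le> (C * real k powr (x' - x)) * ln (real k) powr y'"
    proof (rule mult_right_mono)
      have "ln (real k) powr (y - y') \<le> ln (real k) powr q" using l q by (intro powr_mono) auto
      also have "\<dots> \<le> (real k powr \<epsilon> / \<epsilon>) powr q"
        using ln_powr_bound[of "real k" \<epsilon>] k e l q by (intro powr_mono2) auto
      also have "real k powr \<epsilon> / \<epsilon> = (1 / \<epsilon>) * real k powr \<epsilon>" by simp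
      also have "((1 / \<epsilon>) * real k powr \<epsilon>) powr q = (1 / \<epsilon>) powr q * (real k powr \<epsilon>) powr q" by (rule powr_mult)
      also have "(real k powr \<epsilon>) powr q = real k powr (x' - x)" using q by (simp add: powr_powr \<epsilon>_def)
      finally show "ln (real k) powr (y - y') \<le> C * real k powr (x' - x)" by (simp add: C_def)
    qed simp
    finally have "real k powr x * ln (real k) powr y \<le> real k powr x * ((C * real k powr (x' - x)) * ln (real k) powr y')"
      by (rule mult_left_mono) simp
    also have "\<dots> = C * ((real k powr x * real k powr (x' - x)) * ln (real k) powr y')" by simp
    also have "real k powr x * real k powr (x' - x) = real k powr x'" by (simp flip: powr_add)
    finally show ?thesis .
  qed
  moreover have "0 < C" using e by (simp add: C_def)
  ultimately show ?thesis by blast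
qed

lemma powr_square: "(a powr x * b powr y)\<^sup>2 = a powr (2 * x) * b powr (2 * y)" for a b x y :: real
  by (simp add: power2_eq_square mult_ac flip: powr_add)

text \<open>For \<alpha> < 1 the rate is a minimum, so both of its entries have to be dominated; the
  first is reached by a strictly smaller power of k, which absorbs any logarithm. For \<alpha> \<ge>
  1 there is one entry, and an equal power of k is allowed if the logarithms compare.\<close>

lemma powr_ln_le_rate:
  fixes \<alpha> \<gamma> x y :: real
  assumes \<alpha>: "0 < \<alpha>" "\<alpha> < 2" and \<gamma>: "0 < \<gamma>"
    and c1: "\<alpha> < 1 \<Longrightarrow> x < - \<alpha>"
    and c2: "\<alpha> < 1 \<Longrightarrow> x < - (2 * min (1 - \<alpha>) (real d / 2)) \<or> x = - (2 * min (1 - \<alpha>) (real d / 2)) \<and> y \<le> 1"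
    and c3: "\<alpha> = 1 \<Longrightarrow> x < - 1 \<or> x = - 1 \<and> y \<le> 2 + 2 * (1 + \<gamma>) / min (4 * (real d - 1)) (2 * real d)"
    and c4: "1 < \<alpha> \<Longrightarrow> x < \<alpha> - 2 \<or> x = \<alpha> - 2 \<and> y \<le> 2 * (\<alpha> * (1 + \<gamma>)) / min (4 * (real d - \<alpha>)) (2 * real d)"
  shows "\<exists>C>0. \<forall>k\<ge>3. real k powr x * ln (real k) powr y \<le> C * (rate d \<alpha> \<gamma> k)\<^sup>2"
proof -
  consider "\<alpha> < 1" | "\<alpha> = 1" | "1 < \<alpha>" by linarith
  then show ?thesis
  proof cases
    case 1
    define e1 where "e1 = \<alpha> * (1 + \<gamma>) / min (4 * (real d - \<alpha>)) (2 * real d)"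
    obtain C1 where C1: "0 < C1" "\<And>k. 3 \<le> k \<Longrightarrow> real k powr x * ln (real k) powr y \<le> C1 * (real k powr (- \<alpha>) * ln (real k) powr (2 * e1))"
      using powr_ln_compare[of x "- \<alpha>" y "2 * e1"] c1[OF 1] by blast
    obtain C2 where C2: "0 < C2" "\<And>k. 3 \<le> k \<Longrightarrow> real k powr x * ln (real k) powr y \<le> C2 * (real k powr (- (2 * min (1 - \<alpha>) (real d / 2))) * ln (real k) powr 1)"
      using powr_ln_compare[of x "- (2 * min (1 - \<alpha>) (real d / 2))" y 1] c2[OF 1] by blast
    define C where "C = C1 + C2"
    have "real k powr x * ln (real k) powr y \<le> C * (rate d \<alpha> \<gamma> k)\<^sup>2" if k: "3 \<le> k" for k
    proof -
      define A where "A = real k powr (- \<alpha> / 2) * ln (real k) powr e1"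
      define B where "B = real k powr (- min (1 - \<alpha>) (real d / 2)) * ln (real k) powr (1 / 2)"
      have r: "rate d \<alpha> \<gamma> k = min A B" using 1 by (simp add: rate_def A_def B_def e1_def)
      have A2: "A\<^sup>2 = real k powr (- \<alpha>) * ln (real k) powr (2 * e1)" unfolding A_def powr_square by simp
      have B2: "B\<^sup>2 = real k powr (- (2 * min (1 - \<alpha>) (real d / 2))) * ln (real k) powr 1" unfolding B_def powr_square by simp
      have "real k powr x * ln (real k) powr y \<le> C * A\<^sup>2"
      proof -
        have "C1 * A\<^sup>2 \<le> C * A\<^sup>2" using C2(1) by (intro mult_right_mono) (auto simp: C_def)
        then show ?thesis using C1(2)[OF k] unfolding A2 by linarith
      qed
      moreover have "real k powr x * ln (real k) powr y \<le> C * B\<^sup>2"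
      proof -
        have "C2 * B\<^sup>2 \<le> C * B\<^sup>2" using C1(1) by (intro mult_right_mono) (auto simp: C_def)
        then show ?thesis using C2(2)[OF k] unfolding B2 by linarith
      qed
      ultimately show ?thesis unfolding r by (simp add: min_def)
    qed
    moreover have "0 < C" using C1 C2 by (simp add: C_def)
    ultimately show ?thesis by blast
  next
    case 2
    define e2 where "e2 = 1 + (1 + \<gamma>) / min (4 * (real d - 1)) (2 * real d)"
    obtain C where C: "0 < C" "\<And>k. 3 \<le> k \<Longrightarrow> real k powr x * ln (real k) powr y \<le> C * (real k powr (- 1) * ln (real k) powr (2 * e2))"
      using powr_ln_compare[of x "- 1" y "2 * e2"] c3[OF 2] by (auto simp: e2_def)
    have "(rate d \<alpha> \<gamma> k)\<^sup>2 = real k powr (- 1) * ln (real k) powr (2 * e2)" for k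
    proof -
      have "rate d \<alpha> \<gamma> k = real k powr (- 1 / 2) * ln (real k) powr e2" using 2 by (simp add: rate_def e2_def)
      then show ?thesis by (simp only: powr_square) simp
    qed
    then show ?thesis using C by (intro exI[of _ C]) simp
  next
    case 3
    define e3 where "e3 = \<alpha> * (1 + \<gamma>) / min (4 * (real d - \<alpha>)) (2 * real d)"
    obtain C where C: "0 < C" "\<And>k. 3 \<le> k \<Longrightarrow> real k powr x * ln (real k) powr y \<le> C * (real k powr (\<alpha> - 2) * ln (real k) powr (2 * e3))"
      using powr_ln_compare[of x "\<alpha> - 2" y "2 * e3"] c4[OF 3] by (auto simp: e3_def)
    have "(rate d \<alpha> \<gamma> k)\<^sup>2 = real k powr (\<alpha> - 2) * ln (real k) powr (2 * e3)" for k
    proof -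
      have "rate d \<alpha> \<gamma> k = real k powr (- (2 - \<alpha>) / 2) * ln (real k) powr e3" using 3 by (simp add: rate_def e3_def)
      moreover have "2 * (- (2 - \<alpha>) / 2) = \<alpha> - 2" by simp
      ultimately show ?thesis by (simp only: powr_square)
    qed
    then show ?thesis using C by (intro exI[of _ C]) simp
  qed
qed

text \<open>The five terms are squared errors, in this order: the scales from J0 on, the top
  average, F outside the box, the quadrature, and the replacement of g by a step function. The
  exponent \<theta> is the order to which increments are interpolated in the variances: at most 2,
  and below d + 2 \<alpha> so that the squared kernel stays summable; 3 \<alpha> / 2 leaves a
  margin.\<close>

lemma rate_dominates:
  fixes \<alpha> \<gamma> :: real and d :: nat
  assumes \<alpha>: "0 < \<alpha>" "\<alpha> < 2" "\<alpha> < real d" and \<gamma>: "0 < \<gamma>"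
    and \<theta>: "\<theta> = min 2 (real d + 3 * \<alpha> / 2)"
  shows "\<exists>C>0. \<forall>k\<ge>3. (if 1 < \<alpha> then real k powr (\<alpha> - 2) else ln (real k) * real k powr (\<alpha> - \<theta>)) * ln (real k) powr (\<alpha> * (1 + \<gamma>) / real d)
    + ln (real k) * real k powr (2 * \<alpha> - 2 * real d - \<theta>) + real k powr (- real d) + real k powr (\<alpha> - 2) + real k powr (- 2)
    \<le> C * (rate d \<alpha> \<gamma> k)\<^sup>2"
proof -
  have d1: "1 \<le> real d" using \<alpha> by (cases d) auto
  have d2: "2 \<le> real d" if "1 \<le> \<alpha>" using \<alpha>(3) that by (cases d; cases "d - 1") auto
  have \<theta>1: "2 * \<alpha> < \<theta>" if "\<alpha> < 1" using that d1 \<alpha> by (auto simp: \<theta> min_def)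
  \<comment> \<open>An integer dimension above \<alpha> \<ge> 1 is at least 2, so the minimum in
    \<theta> is attained by 2.\<close>
  have \<theta>2: "\<theta> = 2" if "1 \<le> \<alpha>" using d2[OF that] that by (auto simp: \<theta> min_def)
  have \<theta>3: "\<alpha> + 2 * min (1 - \<alpha>) (real d / 2) < \<theta>" if "\<alpha> < 1" using that d1 \<alpha> by (auto simp: \<theta> min_def)
  define \<beta> where "\<beta> = \<alpha> * (1 + \<gamma>) / real d"
  \<comment> \<open>The minimum of 4 (d - \<alpha>) and 2 d is at most 2 d, so the stated
    logarithmic exponent is at least the one with denominator 2 d that the multiscale estimate
    yields.\<close>
  have mn: "2 * (c / (2 * real d)) \<le> 2 * c / min (4 * (real d - \<alpha>)) (2 * real d)" if "0 \<le> c" for c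
  proof -
    have "c / (2 * real d) \<le> c / min (4 * (real d - \<alpha>)) (2 * real d)"
      using that \<alpha> d1 by (intro divide_left_mono) (auto simp: min_def)
    then show ?thesis by simp
  qed
  have y0: "0 \<le> 2 * c / min (4 * (real d - \<alpha>)) (2 * real d)" if "0 \<le> c" for c
    using that \<alpha> d1 by (intro divide_nonneg_nonneg) (auto simp: min_def)
  have \<beta>1: "\<beta> \<le> 2 * (\<alpha> * (1 + \<gamma>)) / min (4 * (real d - \<alpha>)) (2 * real d)"
    using mn[of "\<alpha> * (1 + \<gamma>)"] \<alpha> \<gamma> by (simp add: \<beta>_def)
  have \<gamma>a: "0 \<le> \<alpha> * (1 + \<gamma>)" "0 \<le> 1 + \<gamma>" using \<alpha> \<gamma> by auto
  note le_rate = powr_ln_le_rate[OF \<alpha>(1,2) \<gamma>, of _ d]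
  have T1: "\<exists>C>0. \<forall>k\<ge>3. (if 1 < \<alpha> then real k powr (\<alpha> - 2) else ln (real k) * real k powr (\<alpha> - \<theta>)) * ln (real k) powr \<beta> \<le> C * (rate d \<alpha> \<gamma> k)\<^sup>2"
  proof (cases "1 < \<alpha>")
    case True
    have "\<exists>C>0. \<forall>k\<ge>3. real k powr (\<alpha> - 2) * ln (real k) powr \<beta> \<le> C * (rate d \<alpha> \<gamma> k)\<^sup>2"
      by (rule le_rate) (use True \<beta>1 in auto)
    then show ?thesis using True by simp
  next
    case False
    have "\<exists>C>0. \<forall>k\<ge>3. real k powr (\<alpha> - \<theta>) * ln (real k) powr (1 + \<beta>) \<le> C * (rate d \<alpha> \<gamma> k)\<^sup>2"
    proof (rule le_rate)
      show "\<alpha> - \<theta> < - \<alpha>" if "\<alpha> < 1" using \<theta>1[OF that] by simp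
      show "\<alpha> - \<theta> < - (2 * min (1 - \<alpha>) (real d / 2)) \<or> \<alpha> - \<theta> = - (2 * min (1 - \<alpha>) (real d / 2)) \<and> 1 + \<beta> \<le> 1" if "\<alpha> < 1"
        using \<theta>3[OF that] by simp
      show "\<alpha> - \<theta> < - 1 \<or> \<alpha> - \<theta> = - 1 \<and> 1 + \<beta> \<le> 2 + 2 * (1 + \<gamma>) / min (4 * (real d - 1)) (2 * real d)" if "\<alpha> = 1"
        using \<beta>1 \<theta>2 that by simp
    qed (use False in auto)
    then obtain C where C: "0 < C" "\<And>k. 3 \<le> k \<Longrightarrow> real k powr (\<alpha> - \<theta>) * ln (real k) powr (1 + \<beta>) \<le> C * (rate d \<alpha> \<gamma> k)\<^sup>2" by blast
    have eq: "ln (real k) * real k powr (\<alpha> - \<theta>) * ln (real k) powr \<beta> = real k powr (\<alpha> - \<theta>) * ln (real k) powr (1 + \<beta>)" if "3 \<le> k" for k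
      using ln_ge_1[OF that] by (simp add: powr_add)
    have "(if 1 < \<alpha> then real k powr (\<alpha> - 2) else ln (real k) * real k powr (\<alpha> - \<theta>)) * ln (real k) powr \<beta> \<le> C * (rate d \<alpha> \<gamma> k)\<^sup>2" if "3 \<le> k" for k
      using C(2)[OF that] False by (simp only: eq[OF that] if_False)
    then show ?thesis using C(1) by blast
  qed
  have T2: "\<exists>C>0. \<forall>k\<ge>3. real k powr (2 * \<alpha> - 2 * real d - \<theta>) * ln (real k) powr 1 \<le> C * (rate d \<alpha> \<gamma> k)\<^sup>2"
  proof (rule le_rate)
    show "2 * \<alpha> - 2 * real d - \<theta> < - \<alpha>" if "\<alpha> < 1" using \<theta>1[OF that] that d1 by linarith
    show "2 * \<alpha> - 2 * real d - \<theta> < - (2 * min (1 - \<alpha>) (real d / 2)) \<or> 2 * \<alpha> - 2 * real d - \<theta> = - (2 * min (1 - \<alpha>) (real d / 2)) \<and> 1 \<le> (1 :: real)" if "\<alpha> < 1"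
      using \<theta>1[OF that] d1 by (auto simp: min_def)
  qed (use \<theta>2 d2 \<alpha> in auto)
  have T3: "\<exists>C>0. \<forall>k\<ge>3. real k powr (- real d) * ln (real k) powr 0 \<le> C * (rate d \<alpha> \<gamma> k)\<^sup>2"
    by (rule le_rate) (use d2 d1 \<alpha> in \<open>auto simp: min_def\<close>)
  have T4: "\<exists>C>0. \<forall>k\<ge>3. real k powr (\<alpha> - 2) * ln (real k) powr 0 \<le> C * (rate d \<alpha> \<gamma> k)\<^sup>2"
  proof (rule le_rate)
    show "\<alpha> - 2 < - 1 \<or> \<alpha> - 2 = - 1 \<and> 0 \<le> 2 + 2 * (1 + \<gamma>) / min (4 * (real d - 1)) (2 * real d)" if "\<alpha> = 1"
      using y0[OF \<gamma>a(2)] that by simp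
    show "\<alpha> - 2 < \<alpha> - 2 \<or> \<alpha> - 2 = \<alpha> - 2 \<and> 0 \<le> 2 * (\<alpha> * (1 + \<gamma>)) / min (4 * (real d - \<alpha>)) (2 * real d)"
      using y0[OF \<gamma>a(1)] by simp
    show "\<alpha> - 2 < - (2 * min (1 - \<alpha>) (real d / 2)) \<or> \<alpha> - 2 = - (2 * min (1 - \<alpha>) (real d / 2)) \<and> 0 \<le> (1 :: real)" if "\<alpha> < 1"
      using \<alpha> by (auto simp: min_def)
  qed (use \<alpha> in auto)
  have T5: "\<exists>C>0. \<forall>k\<ge>3. real k powr (- 2) * ln (real k) powr 0 \<le> C * (rate d \<alpha> \<gamma> k)\<^sup>2"
    by (rule le_rate) (use d2 d1 \<alpha> in \<open>auto simp: min_def\<close>)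
  from T1 T2 T3 T4 T5 obtain C1 C2 C3 C4 C5 where C: "0 < C1" "0 < C2" "0 < C3" "0 < C4" "0 < C5"
    "\<And>k. 3 \<le> k \<Longrightarrow> (if 1 < \<alpha> then real k powr (\<alpha> - 2) else ln (real k) * real k powr (\<alpha> - \<theta>)) * ln (real k) powr \<beta> \<le> C1 * (rate d \<alpha> \<gamma> k)\<^sup>2"
    "\<And>k. 3 \<le> k \<Longrightarrow> real k powr (2 * \<alpha> - 2 * real d - \<theta>) * ln (real k) powr 1 \<le> C2 * (rate d \<alpha> \<gamma> k)\<^sup>2"
    "\<And>k. 3 \<le> k \<Longrightarrow> real k powr (- real d) * ln (real k) powr 0 \<le> C3 * (rate d \<alpha> \<gamma> k)\<^sup>2"
    "\<And>k. 3 \<le> k \<Longrightarrow> real k powr (\<alpha> - 2) * ln (real k) powr 0 \<le> C4 * (rate d \<alpha> \<gamma> k)\<^sup>2"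
    "\<And>k. 3 \<le> k \<Longrightarrow> real k powr (- 2) * ln (real k) powr 0 \<le> C5 * (rate d \<alpha> \<gamma> k)\<^sup>2"
    by metis
  show ?thesis
  proof (intro exI[of _ "C1 + C2 + C3 + C4 + C5"] conjI allI impI)
    fix k :: nat assume k: "3 \<le> k"
    have l: "1 \<le> ln (real k)" by (rule ln_ge_1[OF k])
    have "ln (real k) powr 0 = 1" "ln (real k) powr 1 = ln (real k)" using l by auto
    then show "(if 1 < \<alpha> then real k powr (\<alpha> - 2) else ln (real k) * real k powr (\<alpha> - \<theta>)) * ln (real k) powr (\<alpha> * (1 + \<gamma>) / real d)
      + ln (real k) * real k powr (2 * \<alpha> - 2 * real d - \<theta>) + real k powr (- real d) + real k powr (\<alpha> - 2) + real k powr (- 2)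
      \<le> (C1 + C2 + C3 + C4 + C5) * (rate d \<alpha> \<gamma> k)\<^sup>2"
      using C(6-10)[OF k] unfolding \<beta>_def[symmetric] distrib_right by (simp only: mult.commute[of "ln (real k)" "real k powr (2 * \<alpha> - 2 * real d - \<theta>)"] mult_1_right)
  qed (use C in simp)
qed

section \<open>The discrete resolvent\<close>

context dominated_kernel
begin

lemma gen_add:
  assumes "\<And>y. \<bar>u y\<bar> \<le> K" "\<And>y. \<bar>v y\<bar> \<le> K'"
  shows "gen (\<lambda>y. u y + v y) x = gen u x + gen v x"
proof -
  have "(\<lambda>y. a x y * (u y - u x)) summable_on UNIV" "(\<lambda>y. a x y * (v y - v x)) summable_on UNIV"
  proof -
    have "\<bar>u y - u x\<bar> \<le> 2 * K" for y using assms(1)[of y] assms(1)[of x] by linarith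
    then show "(\<lambda>y. a x y * (u y - u x)) summable_on UNIV" by (rule bounded_row_summable)
    have "\<bar>v y - v x\<bar> \<le> 2 * K'" for y using assms(2)[of y] assms(2)[of x] by linarith
    then show "(\<lambda>y. a x y * (v y - v x)) summable_on UNIV" by (rule bounded_row_summable)
  qed
  from infsum_add[OF this] show ?thesis by (simp add: gen_def algebra_simps)
qed

end

lemma Cc_inf_lipc:
  fixes g :: "real ^ 'n \<Rightarrow> real"
  assumes "g \<in> Cc_inf"
  shows "\<exists>b\<ge>0. \<exists>L\<ge>1. (\<forall>x. real L < norm x \<longrightarrow> g x = 0) \<and> (\<forall>x y. \<bar>g x - g y\<bar> \<le> b * norm (x - y)) \<and>
    (\<forall>k\<ge>1. lipc k b (real L) (\<lambda>z. g (lat_pt k z)))"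
proof -
  obtain L :: nat where L: "1 \<le> L" "\<And>x. real L < norm x \<Longrightarrow> g x = 0" using Cc_inf_support[OF assms] by blast
  obtain C where C: "0 \<le> C" "\<And>x y. \<bar>g x - g y\<bar> \<le> C * norm (x - y)" using Cc_inf_lipschitz[OF assms] by blast
  obtain B where B: "\<And>x. \<bar>g x\<bar> \<le> B" using Cc_inf_bounded[OF assms] by blast
  define b where "b = max B C"
  have lip: "\<bar>g x - g y\<bar> \<le> b * norm (x - y)" for x y
  proof -
    have "C * norm (x - y) \<le> b * norm (x - y)" by (intro mult_right_mono) (auto simp: b_def)
    then show ?thesis using C(2)[of x y] by linarith
  qed
  have "lipc k b (real L) (\<lambda>z. g (lat_pt k z))" if k: "1 \<le> k" for k
    unfolding lipc_def
  proof (intro conjI allI impI)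
    show "\<bar>g (lat_pt k y)\<bar> \<le> b" for y using B[of "lat_pt k y"] by (simp add: b_def)
    show "\<bar>g (lat_pt k x) - g (lat_pt k y)\<bar> \<le> b * (lnorm (x - y) / real k)" for x y
      using lip[of "lat_pt k x" "lat_pt k y"] by (simp add: lat_pt_diff norm_lat_pt)
    show "g (lat_pt k y) = 0" if "real L * real k < lnorm y" for y
      using that k by (intro L(2)) (simp add: norm_lat_pt field_simps)
  qed
  moreover have "0 \<le> b" using C(1) by (simp add: b_def)
  ultimately show ?thesis using L lip by blast
qed

definition psi :: "nat \<Rightarrow> real \<Rightarrow> (real ^ 'n \<Rightarrow> real) \<Rightarrow> int ^ 'n \<Rightarrow> real" where
  "psi k \<alpha> g x = real k powr \<alpha> * (\<Sum>\<^sub>\<infinity>y. (g (lat_pt k y) - g (lat_pt k x)) * lnorm (x - y) powr (- (real CARD('n) + \<alpha>)))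
    - Lbar \<alpha> g (lat_pt k x)"

lemma lipc_square_summable:
  assumes "lipc k b R e"
  shows "(\<lambda>x. (e x)\<^sup>2) summable_on UNIV"
proof -
  have "((\<lambda>x. (e x)\<^sup>2) has_sum (\<Sum>x\<in>{z. lnorm z \<le> R * real k}. (e x)\<^sup>2)) UNIV"
    by (rule has_sum_finite_neutralI[of "{z. lnorm z \<le> R * real k}"]) (use assms in \<open>auto simp: lipc_def\<close>)
  then show ?thesis by (auto simp: summable_on_def)
qed

context conductances
begin

text \<open>Each conductance is written as its mean 1 plus a centred part; the mean part minus the
  limit operator is the quadrature error.\<close>

lemma gen_split:
  fixes g :: "real ^ 'n \<Rightarrow> real"
  assumes \<alpha>: "0 < \<alpha>" and \<omega>: "\<omega> \<in> space P" and k: "1 \<le> k" and e: "lipc k b R (\<lambda>z. g (lat_pt k z))"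
  shows "dominated_kernel.gen (kern k \<alpha> \<omega>) (\<lambda>z. g (lat_pt k z)) x - Lbar \<alpha> g (lat_pt k x)
    = real k powr \<alpha> * fluct w (real CARD('n) + \<alpha>) (\<lambda>z. g (lat_pt k z)) \<omega> x + psi k \<alpha> g x"
proof -
  interpret dominated_kernel "kern k \<alpha> \<omega>" "\<lambda>z. real k powr \<alpha> * (M * lnorm z powr (- (real CARD('n) + \<alpha>)))"
    by (rule kern_dominated[OF \<alpha> \<omega>])
  define p where "p = real CARD('n) + \<alpha>"
  define G where "G z = g (lat_pt k z)" for z
  have p: "real CARD('n) < p - 0" using \<alpha> by (simp add: p_def)
  have s1: "(\<lambda>y. (G y - G x) * lnorm (x - y) powr (- p) * (w {x, y} \<omega> - 1)) summable_on UNIV"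
    using fluct_terms(1)[OF e k _ _ p \<omega>, of x] by (simp add: G_def)
  have s2: "(\<lambda>y. (G y - G x) * lnorm (x - y) powr (- p)) summable_on UNIV"
  proof (rule summable_on_abs_comparison(1))
    show "(\<lambda>y. \<bar>G y - G x\<bar> ^ 1 * lnorm (x - y) powr (- p)) summable_on UNIV"
      using lipc_sum(1)[OF e k, of 0 1 p x] p by (simp add: G_def)
  qed (simp add: abs_mult)
  have "gen G x = (\<Sum>\<^sub>\<infinity>y. real k powr \<alpha> * ((G y - G x) * lnorm (x - y) powr (- p) * (w {x, y} \<omega> - 1) + (G y - G x) * lnorm (x - y) powr (- p)))"
    unfolding gen_def by (rule infsum_cong) (simp add: kern_def p_def algebra_simps)
  also have "\<dots> = real k powr \<alpha> * (\<Sum>\<^sub>\<infinity>y. (G y - G x) * lnorm (x - y) powr (- p) * (w {x, y} \<omega> - 1) + (G y - G x) * lnorm (x - y) powr (- p))"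
    by (rule infsum_cmult_right')
  also have "\<dots> = real k powr \<alpha> * (fluct w p G \<omega> x + (\<Sum>\<^sub>\<infinity>y. (G y - G x) * lnorm (x - y) powr (- p)))"
    unfolding fluct_def by (simp only: infsum_add[OF s1 s2])
  finally show ?thesis
    by (simp add: G_def[abs_def] psi_def p_def distrib_left)
qed

text \<open>The definite description in \<open>Rk_lat\<close> is resolved by exhibiting g + h, where
  h solves the equation with right-hand side \<Phi>, and by uniqueness in l^2. The restriction of g
  is in l^2 because of its compact support.\<close>

lemma discrete_resolvent:
  fixes g :: "real ^ 'n \<Rightarrow> real"
  assumes \<alpha>: "0 < \<alpha>" and \<omega>: "\<omega> \<in> space P" and k: "1 \<le> k" and e: "lipc k b R (\<lambda>z. g (lat_pt k z))" and lam: "0 < lam"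
    and \<Phi>: "\<Phi> = (\<lambda>x. real k powr \<alpha> * fluct w (real CARD('n) + \<alpha>) (\<lambda>z. g (lat_pt k z)) \<omega> x + psi k \<alpha> g x)"
    and \<Phi>s: "(\<lambda>x. (\<Phi> x)\<^sup>2) summable_on UNIV"
  shows "\<exists>h. (\<lambda>x. (h x)\<^sup>2) summable_on UNIV \<and> (\<Sum>\<^sub>\<infinity>x. (h x)\<^sup>2) \<le> (\<Sum>\<^sub>\<infinity>x. (\<Phi> x)\<^sup>2) / lam\<^sup>2 \<and>
    (\<forall>x. lam * h x - dominated_kernel.gen (kern k \<alpha> \<omega>) h x = \<Phi> x) \<and>
    Rk_lat w k \<alpha> \<omega> lam (\<lambda>x. lam * g x - Lbar \<alpha> g x) = (\<lambda>z. g (lat_pt k z) + h z)"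
proof -
  interpret dominated_kernel "kern k \<alpha> \<omega>" "\<lambda>z. real k powr \<alpha> * (M * lnorm z powr (- (real CARD('n) + \<alpha>)))"
    by (rule kern_dominated[OF \<alpha> \<omega>])
  define G where "G z = g (lat_pt k z)" for z
  obtain h where h: "(\<lambda>x. (h x)\<^sup>2) summable_on UNIV" "(\<Sum>\<^sub>\<infinity>x. (h x)\<^sup>2) \<le> (\<Sum>\<^sub>\<infinity>x. (\<Phi> x)\<^sup>2) / lam\<^sup>2"
    "\<And>x. lam * h x - gen h x = \<Phi> x"
    using resolvent_exists[OF lam \<Phi>s] by blast
  have Gs: "(\<lambda>x. (G x)\<^sup>2) summable_on UNIV" using lipc_square_summable[OF e] by (simp add: G_def)
  have us: "(\<lambda>x. (G x + h x)\<^sup>2) summable_on UNIV" by (rule square_summable_add[OF Gs h(1)])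
  have ueq: "lam * (G x + h x) - gen (\<lambda>z. G z + h z) x = lam * g (lat_pt k x) - Lbar \<alpha> g (lat_pt k x)" for x
  proof -
    have "gen (\<lambda>z. G z + h z) x = gen G x + gen h x"
      by (rule gen_add[OF square_summable_bounded[OF Gs] square_summable_bounded[OF h(1)]])
    moreover have "gen G x - Lbar \<alpha> g (lat_pt k x) = \<Phi> x"
      using gen_split[OF \<alpha> \<omega> k e, of x] by (simp add: \<Phi> G_def[abs_def])
    ultimately show ?thesis using h(3)[of x] by (simp add: G_def algebra_simps)
  qed
  have "Rk_lat w k \<alpha> \<omega> lam (\<lambda>x. lam * g x - Lbar \<alpha> g x) = (\<lambda>z. G z + h z)"
    unfolding Rk_lat_def
  proof (rule the_equality)
    show "lat_L2 (\<lambda>z. G z + h z) \<and> (\<forall>z. lam * (G z + h z) - Lk w k \<alpha> \<omega> (\<lambda>z. G z + h z) z = lam * g (lat_pt k z) - Lbar \<alpha> g (lat_pt k z))"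
      using us ueq by (simp add: lat_L2_def Lk_eq_gen[OF \<alpha> \<omega> k])
    fix v assume v: "lat_L2 v \<and> (\<forall>z. lam * v z - Lk w k \<alpha> \<omega> v z = lam * g (lat_pt k z) - Lbar \<alpha> g (lat_pt k z))"
    show "v = (\<lambda>z. G z + h z)"
      by (rule resolvent_unique[OF lam _ _ us ueq]) (use v in \<open>auto simp: lat_L2_def Lk_eq_gen[OF \<alpha> \<omega> k]\<close>)
  qed
  then show ?thesis using h by (auto simp: G_def[abs_def])
qed

end

section \<open>From the lattice to Lebesgue measure\<close>

lemma cell_corner:
  fixes x :: "real ^ 'n"
  assumes "1 \<le> k"
  shows "norm (lat_pt k (cell_idx 1 k x) - x) \<le> real CARD('n) / real k"
proof -
  have k0: "0 < k" using assms by simp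
  have "\<bar>(lat_pt k (cell_idx 1 k x) - x) $ i\<bar> \<le> 1 / real k" for i
  proof -
    define z where "z = cell_idx 1 k x $ i"
    have "z = \<lceil>real k * x $ i - 1\<rceil>" by (simp add: z_def cell_idx_def)
    then have "\<bar>real_of_int z - real k * x $ i\<bar> \<le> 1" using ceiling_correct[of "real k * x $ i - 1"] by linarith
    then have "\<bar>real_of_int z - real k * x $ i\<bar> / real k \<le> 1 / real k" by (rule divide_right_mono) simp
    moreover have "(lat_pt k (cell_idx 1 k x) - x) $ i = (real_of_int z - real k * x $ i) / real k"
      using k0 by (simp add: z_def field_simps)
    ultimately show ?thesis by (simp add: abs_divide)
  qed
  then have "(\<Sum>i\<in>UNIV. \<bar>(lat_pt k (cell_idx 1 k x) - x) $ i\<bar>) \<le> (\<Sum>i\<in>(UNIV :: 'n set). 1 / real k)"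
    by (intro sum_mono)
  then show ?thesis using norm_le_l1_cart[of "lat_pt k (cell_idx 1 k x) - x"] by simp
qed

text \<open>The error splits into h, whose integral over cells is exact, and the oscillation of g
  over a cell, at most b d / k. The ball is enlarged from L to L + d because a point and the corner
  of its cell are at most d / k \<le> d apart.\<close>

lemma L2_dist_step:
  fixes g :: "real ^ 'n \<Rightarrow> real"
  assumes g: "continuous_on UNIV g" and k: "1 \<le> k" and b: "0 \<le> b" "\<And>x y. \<bar>g x - g y\<bar> \<le> b * norm (x - y)"
    and L: "\<And>x. real L < norm x \<Longrightarrow> g x = 0" and h: "(\<lambda>x. (h x)\<^sup>2) summable_on UNIV"
  shows "L2_dist_sq (\<lambda>x. g (lat_pt k (cell_idx 1 k x)) + h (cell_idx 1 k x)) g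
    \<le> ennreal (2 * ((\<Sum>\<^sub>\<infinity>z. (h z)\<^sup>2) / real k ^ CARD('n))
      + 2 * (b * real CARD('n))\<^sup>2 * (unit_ball_vol (real CARD('n)) * (real L + real CARD('n)) ^ CARD('n)) / (real k)\<^sup>2)"
proof -
  define d where "d = real CARD('n)"
  define R where "R = real L + d"
  have k0: "0 < k" using k by simp
  have R0: "0 \<le> R" by (simp add: R_def d_def)
  define c where "c = 2 * (b * d / real k)\<^sup>2"
  have pw: "(g (lat_pt k (cell_idx 1 k x)) + h (cell_idx 1 k x) - g x)\<^sup>2 \<le> 2 * (h (cell_idx 1 k x))\<^sup>2 + c * indicator (cball 0 R) x" for x
  proof -
    define z where "z = cell_idx 1 k x"
    define \<delta> where "\<delta> = g (lat_pt k z) - g x"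
    have nz: "norm (lat_pt k z - x) \<le> d / real k" unfolding z_def d_def by (rule cell_corner[OF k])
    have "\<delta>\<^sup>2 \<le> (b * d / real k)\<^sup>2 * indicator (cball 0 R) x"
    proof (cases "x \<in> cball 0 R")
      case True
      have "\<bar>\<delta>\<bar> \<le> b * norm (lat_pt k z - x)" unfolding \<delta>_def by (rule b(2))
      also have "\<dots> \<le> b * (d / real k)" using nz b(1) by (rule mult_left_mono)
      finally have "\<bar>\<delta>\<bar> \<le> b * d / real k" by simp
      then have "\<delta>\<^sup>2 \<le> (b * d / real k)\<^sup>2" by (metis abs_ge_zero power2_abs power_mono)
      then show ?thesis using True by simp
    next
      case False
      have "d / real k \<le> d / 1" using k by (intro divide_left_mono) (auto simp: d_def)
      then have "norm (lat_pt k z - x) \<le> d" using nz by simp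
      moreover have "R < norm x" using False by simp
      moreover have "norm x \<le> norm (lat_pt k z) + norm (lat_pt k z - x)"
        by (metis add.commute norm_minus_commute norm_triangle_sub)
      ultimately have "real L < norm (lat_pt k z)" "real L < norm x" by (auto simp: R_def d_def)
      then show ?thesis by (simp add: \<delta>_def L)
    qed
    moreover have "(\<delta> + h z)\<^sup>2 \<le> 2 * (h z)\<^sup>2 + 2 * \<delta>\<^sup>2"
      using zero_le_power2[of "\<delta> - h z"] by (simp add: power2_eq_square algebra_simps)
    ultimately show ?thesis by (simp add: \<delta>_def z_def c_def algebra_simps)
  qed
  have hm: "(\<lambda>x. 2 * (h (cell_idx 1 k x))\<^sup>2) \<in> borel_measurable borel"
    by (rule measurable_compose[OF cell_measurable[OF k0]]) simp
  have "L2_dist_sq (\<lambda>x. g (lat_pt k (cell_idx 1 k x)) + h (cell_idx 1 k x)) g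
      \<le> (\<integral>\<^sup>+ x. ennreal (2 * (h (cell_idx 1 k x))\<^sup>2) + ennreal c * indicator (cball 0 R) x \<partial>lborel)"
    unfolding L2_dist_sq_def
  proof (rule nn_integral_mono)
    fix x
    have "ennreal ((g (lat_pt k (cell_idx 1 k x)) + h (cell_idx 1 k x) - g x)\<^sup>2) \<le> ennreal (2 * (h (cell_idx 1 k x))\<^sup>2 + c * indicator (cball 0 R) x)"
      by (rule ennreal_leI[OF pw])
    also have "\<dots> = ennreal (2 * (h (cell_idx 1 k x))\<^sup>2) + ennreal c * indicator (cball 0 R) x"
      by (cases "x \<in> cball 0 R") (simp_all add: c_def)
    finally show "ennreal ((g (lat_pt k (cell_idx 1 k x)) + h (cell_idx 1 k x) - g x)\<^sup>2) \<le> ennreal (2 * (h (cell_idx 1 k x))\<^sup>2) + ennreal c * indicator (cball 0 R) x" .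
  qed
  also have "\<dots> = (\<integral>\<^sup>+ x. ennreal (2 * (h (cell_idx 1 k x))\<^sup>2) \<partial>lborel) + (\<integral>\<^sup>+ x. ennreal c * indicator (cball 0 R) x \<partial>(lborel :: (real ^ 'n) measure))"
  proof (rule nn_integral_add)
    show "(\<lambda>x. ennreal c * indicator (cball 0 R) x) \<in> borel_measurable (lborel :: (real ^ 'n) measure)"
      by (intro borel_measurable_times_ennreal borel_measurable_indicator borel_measurable_const) auto
  qed (use hm in auto)
  also have "(\<integral>\<^sup>+ x. ennreal (2 * (h (cell_idx 1 k x))\<^sup>2) \<partial>lborel) = ennreal (2 * (\<Sum>\<^sub>\<infinity>z. (h z)\<^sup>2) / real k ^ CARD('n))"
    using nn_integral_cell[OF k0 summable_on_cmult_right[OF h, of 2], of 1] by (simp add: infsum_cmult_right')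
  also have "(\<integral>\<^sup>+ x. ennreal c * indicator (cball 0 R) x \<partial>(lborel :: (real ^ 'n) measure)) = ennreal (c * (unit_ball_vol d * R ^ CARD('n)))"
    using emeasure_cball[OF R0, of "0 :: real ^ 'n"] R0
    by (subst nn_integral_cmult_indicator) (auto simp: c_def d_def ennreal_mult'[symmetric])
  also have "ennreal (2 * (\<Sum>\<^sub>\<infinity>z. (h z)\<^sup>2) / real k ^ CARD('n)) + \<dots> = ennreal (2 * (\<Sum>\<^sub>\<infinity>z. (h z)\<^sup>2) / real k ^ CARD('n) + c * (unit_ball_vol d * R ^ CARD('n)))"
    by (rule ennreal_plus[symmetric]) (use R0 in \<open>auto simp: c_def d_def intro!: divide_nonneg_nonneg mult_nonneg_nonneg infsum_nonneg\<close>)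
  finally show ?thesis by (simp add: c_def d_def R_def power_divide mult_ac)
qed

section \<open>Square sums of quadrature error and fluctuation\<close>

lemma card_ball_powr:
  fixes R :: real
  assumes "1 \<le> R" "1 \<le> k"
  shows "real (card {z :: int ^ 'n. lnorm z \<le> R * real k}) \<le> (3 * R) powr real CARD('n) * real k powr real CARD('n)"
proof -
  have "1 * 1 \<le> R * real k" using assms by (intro mult_mono) auto
  then have "real (card {z :: int ^ 'n. lnorm z \<le> R * real k}) \<le> (3 * (R * real k)) ^ CARD('n)"
    by (intro card_lnorm_ball) simp
  also have "\<dots> = (3 * R) powr real CARD('n) * real k powr real CARD('n)"
    using assms by (simp add: powr_realpow power_mult_distrib)
  finally show ?thesis .
qed

text \<open>Any \<theta> < \<alpha> with \<theta> \<le> 1 is admissible in \<open>psi_bound\<close>;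
  \<theta> = \<alpha> / 2 already gives k^(2 (\<alpha> - \<theta> - 1)) = k^(\<alpha> - 2), and the
  factor k^d counts the sites near the support.\<close>

lemma psi_square:
  fixes g :: "real ^ 'n \<Rightarrow> real"
  assumes g: "g \<in> Cc_inf" and \<alpha>: "0 < \<alpha>" "\<alpha> < 2"
  shows "\<exists>C\<ge>0. \<forall>k\<ge>1. (\<lambda>x. (psi k \<alpha> g x)\<^sup>2) summable_on UNIV \<and>
    (\<Sum>\<^sub>\<infinity>x. (psi k \<alpha> g x)\<^sup>2) \<le> C * real k powr (real CARD('n) + \<alpha> - 2)"
proof -
  define d where "d = real CARD('n)"
  define \<theta> where "\<theta> = \<alpha> / 2"
  obtain C R where C: "0 < C" "1 \<le> (R :: nat)" "\<And>k x. 1 \<le> k \<Longrightarrow> \<bar>psi k \<alpha> g x\<bar> \<le> C * real k powr (\<alpha> - \<theta> - 1)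
      * band {z. lnorm z \<le> real R * real k} (\<lambda>z. lnorm z powr (- (d + \<alpha> - \<theta>))) x"
    using psi_bound[OF g \<alpha>, of \<theta>] \<alpha> unfolding psi_def \<theta>_def d_def by auto
  define \<rho> where "\<rho> z = lnorm z powr (- (d + \<alpha> - \<theta>))" for z :: "int ^ 'n"
  have \<rho>: "\<rho> summable_on UNIV" "\<And>z. 0 \<le> \<rho> z"
    unfolding \<rho>_def[abs_def] using summable_lnorm_powr[of "d + \<alpha> - \<theta>", where 'n = 'n] \<alpha> by (auto simp: d_def \<theta>_def)
  define S where "S = (2 * infsum \<rho> UNIV + 1)\<^sup>2"
  define D where "D = C\<^sup>2 * ((3 * real R) powr d * S)"
  have "(\<lambda>x. (psi k \<alpha> g x)\<^sup>2) summable_on UNIV \<and> (\<Sum>\<^sub>\<infinity>x. (psi k \<alpha> g x)\<^sup>2) \<le> D * real k powr (d + \<alpha> - 2)" if k: "1 \<le> k" for k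
  proof -
    define B where "B = {z :: int ^ 'n. lnorm z \<le> real R * real k}"
    have fB: "finite B" by (simp add: B_def)
    define c where "c = C * real k powr (\<alpha> - \<theta> - 1)"
    have c0: "0 \<le> c" using C(1) by (simp add: c_def)
    have b: "\<bar>psi k \<alpha> g x\<bar> \<le> c * band B \<rho> x" for x
      using C(3)[OF k, of x] by (simp add: c_def B_def \<rho>_def[abs_def])
    note bs = band_square_sum[OF fB \<rho> b c0]
    have "(\<Sum>\<^sub>\<infinity>x. (psi k \<alpha> g x)\<^sup>2) \<le> c\<^sup>2 * (real (card B) * S)" using bs(2) by (simp add: S_def)
    also have "\<dots> \<le> c\<^sup>2 * (((3 * real R) powr d * real k powr d) * S)"
      using card_ball_powr[of "real R" k, where 'n = 'n] C(2) k
      by (intro mult_left_mono mult_right_mono) (auto simp: B_def d_def S_def)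
    also have "c\<^sup>2 = C\<^sup>2 * real k powr (\<alpha> - 2)"
      by (simp add: c_def power_mult_distrib power2_eq_square \<theta>_def flip: powr_add)
    also have "C\<^sup>2 * real k powr (\<alpha> - 2) * (((3 * real R) powr d * real k powr d) * S) = D * (real k powr d * real k powr (\<alpha> - 2))"
      by (simp only: D_def mult_ac power2_eq_square)
    also have "real k powr d * real k powr (\<alpha> - 2) = real k powr (d + \<alpha> - 2)"
      by (simp only: powr_add[symmetric] add_diff_eq)
    finally show ?thesis using bs(1) by simp
  qed
  moreover have "0 \<le> D" by (simp add: D_def S_def)
  ultimately show ?thesis unfolding d_def by blast
qed

context conductances
begin

text \<open>Holds for every \<omega>, by boundedness of the conductances. The choice s = 1 requires
  \<alpha> > 1 and is the bound used at the finest scale; s = 0 is the crude bound available for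
  every \<alpha>.\<close>

lemma fluct_square:
  fixes g :: "real ^ 'n \<Rightarrow> real"
  assumes e: "\<And>k. 1 \<le> k \<Longrightarrow> lipc k b (real L) (\<lambda>z. g (lat_pt k z))" and L: "1 \<le> L"
    and s: "0 \<le> s" "s \<le> 1" "s < \<alpha>"
  shows "\<exists>C\<ge>0. \<forall>k\<ge>1. \<forall>\<omega>\<in>space P.
    (\<lambda>x. (fluct w (real CARD('n) + \<alpha>) (\<lambda>z. g (lat_pt k z)) \<omega> x)\<^sup>2) summable_on UNIV \<and>
    (\<Sum>\<^sub>\<infinity>x. (fluct w (real CARD('n) + \<alpha>) (\<lambda>z. g (lat_pt k z)) \<omega> x)\<^sup>2) \<le> C * real k powr (real CARD('n) - 2 * s)"
proof -
  define d where "d = real CARD('n)"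
  define p where "p = d + \<alpha>"
  define \<rho> where "\<rho> z = lnorm z powr (- (p - s))" for z :: "int ^ 'n"
  have \<rho>: "\<rho> summable_on UNIV" "\<And>z. 0 \<le> \<rho> z"
    unfolding \<rho>_def[abs_def] using summable_lnorm_powr[of "p - s", where 'n = 'n] s by (auto simp: d_def p_def)
  define S where "S = (2 * infsum \<rho> UNIV + 1)\<^sup>2"
  have b0: "0 \<le> b" using lipc_nonneg[OF e[of 1]] by simp
  define D where "D = ((M + 1) * (2 * b))\<^sup>2 * ((3 * real L) powr d * S)"
  have "(\<lambda>x. (fluct w p (\<lambda>z. g (lat_pt k z)) \<omega> x)\<^sup>2) summable_on UNIV \<and>
    (\<Sum>\<^sub>\<infinity>x. (fluct w p (\<lambda>z. g (lat_pt k z)) \<omega> x)\<^sup>2) \<le> D * real k powr (d - 2 * s)" if k: "1 \<le> k" and \<omega>: "\<omega> \<in> space P" for k \<omega>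
  proof -
    define B where "B = {z :: int ^ 'n. lnorm z \<le> real L * real k}"
    have fB: "finite B" by (simp add: B_def)
    define c where "c = (M + 1) * (2 * b * real k powr (- s))"
    have c0: "0 \<le> c" using M_pos b0 by (simp add: c_def)
    have bd: "\<bar>fluct w p (\<lambda>z. g (lat_pt k z)) \<omega> x\<bar> \<le> c * band B \<rho> x" for x
      using fluct_terms(2)[OF e[OF k] k s(1,2) _ \<omega>, of p x] s by (simp add: c_def B_def \<rho>_def[abs_def] p_def d_def)
    note bs = band_square_sum[OF fB \<rho> bd c0]
    have "(\<Sum>\<^sub>\<infinity>x. (fluct w p (\<lambda>z. g (lat_pt k z)) \<omega> x)\<^sup>2) \<le> c\<^sup>2 * (real (card B) * S)" using bs(2) by (simp add: S_def)
    also have "\<dots> \<le> c\<^sup>2 * (((3 * real L) powr d * real k powr d) * S)"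
      using card_ball_powr[of "real L" k, where 'n = 'n] L k
      by (intro mult_left_mono mult_right_mono) (auto simp: B_def d_def S_def)
    also have "c\<^sup>2 = ((M + 1) * (2 * b))\<^sup>2 * real k powr (- 2 * s)"
    proof -
      have "(real k powr (- s))\<^sup>2 = real k powr (- 2 * s)" by (simp add: power2_eq_square flip: powr_add)
      then show ?thesis unfolding c_def mult.assoc[symmetric] by (simp only: power_mult_distrib)
    qed
    also have "((M + 1) * (2 * b))\<^sup>2 * real k powr (- 2 * s) * (((3 * real L) powr d * real k powr d) * S) = D * (real k powr d * real k powr (- 2 * s))"
      by (simp only: D_def mult_ac power2_eq_square)
    also have "real k powr d * real k powr (- 2 * s) = real k powr (d - 2 * s)" by (simp flip: powr_add)
    finally show ?thesis using bs(1) by simp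
  qed
  moreover have "0 \<le> D" by (simp add: D_def S_def)
  ultimately show ?thesis unfolding d_def p_def by blast
qed

text \<open>Outside the box every site is at distance at least k^2 / 2 from the support, so
  \<open>band\<close> is O(k^d k^(-2 p)) there. Times its total sum O(k^d) this is O(k^(-2
  \<alpha>)), which cancels the factor k^(2 \<alpha>).\<close>

lemma fluct_outside:
  fixes g :: "real ^ 'n \<Rightarrow> real"
  assumes e: "\<And>k. 1 \<le> k \<Longrightarrow> lipc k b (real L) (\<lambda>z. g (lat_pt k z))" and L: "1 \<le> L" and \<alpha>: "0 < \<alpha>"
  shows "\<exists>C\<ge>0. \<forall>k m. 2 * L \<le> k \<longrightarrow> k ^ 2 \<le> 2 ^ m \<longrightarrow> (\<forall>\<omega>\<in>space P.
    (\<lambda>x. (fluct w (real CARD('n) + \<alpha>) (\<lambda>z. g (lat_pt k z)) \<omega> x * indicator (- lam_box m) x)\<^sup>2) summable_on UNIV \<and>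
    real k powr (2 * \<alpha>) * (\<Sum>\<^sub>\<infinity>x. (fluct w (real CARD('n) + \<alpha>) (\<lambda>z. g (lat_pt k z)) \<omega> x * indicator (- lam_box m) x)\<^sup>2) \<le> C)"
proof -
  define d where "d = real CARD('n)"
  define p where "p = d + \<alpha>"
  define \<rho> where "\<rho> z = lnorm z powr (- p)" for z :: "int ^ 'n"
  have \<rho>: "\<rho> summable_on UNIV" "\<And>z. 0 \<le> \<rho> z"
    unfolding \<rho>_def[abs_def] using summable_lnorm_powr[of p, where 'n = 'n] \<alpha> by (auto simp: d_def p_def)
  define S where "S = 2 * infsum \<rho> UNIV + 1"
  have S0: "0 \<le> S" using infsum_nonneg[of UNIV \<rho>] \<rho>(2) by (simp add: S_def)
  have b0: "0 \<le> b" using lipc_nonneg[OF e[of 1]] by simp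
  have p0: "0 < p" using \<alpha> by (simp add: p_def d_def add_nonneg_pos)
  define c where "c = (M + 1) * (2 * b)"
  define D where "D = c\<^sup>2 * ((3 * real L) powr d * 2 powr p) * ((3 * real L) powr d * S)"
  have main: "(\<lambda>x. (fluct w p (\<lambda>z. g (lat_pt k z)) \<omega> x * indicator (- lam_box m) x)\<^sup>2) summable_on UNIV \<and>
    real k powr (2 * \<alpha>) * (\<Sum>\<^sub>\<infinity>x. (fluct w p (\<lambda>z. g (lat_pt k z)) \<omega> x * indicator (- lam_box m) x)\<^sup>2) \<le> D"
    if k2: "2 * L \<le> k" and m: "k ^ 2 \<le> 2 ^ m" and \<omega>: "\<omega> \<in> space P" for k m \<omega>
  proof -
    have k: "1 \<le> k" using k2 L by simp
    have k0: "0 < real k" using k by simp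
    define B where "B = {z :: int ^ 'n. lnorm z \<le> real L * real k}"
    have fB: "finite B" by (simp add: B_def)
    define T where "T x = fluct w p (\<lambda>z. g (lat_pt k z)) \<omega> x * indicator (- lam_box m) x" for x
    have c0: "0 \<le> c" using M_pos b0 by (simp add: c_def)
    have bd: "\<bar>fluct w p (\<lambda>z. g (lat_pt k z)) \<omega> x\<bar> \<le> c * band B \<rho> x" for x
      using fluct_terms(2)[OF e[OF k] k, of 0 p \<omega> x] \<alpha> \<omega> k0 by (simp add: c_def B_def \<rho>_def[abs_def] p_def d_def)
    define \<delta> where "\<delta> = real (card B) * ((real k)\<^sup>2 / 2) powr (- p)"
    have d0: "0 \<le> \<delta>" by (simp add: \<delta>_def)
    \<comment> \<open>Here k \<ge> 2 L enters: the support, of radius L k, takes up at most half of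
      the distance k^2 from the origin to the complement of the box.\<close>
    have Lk: "real L * real k \<le> (real k)\<^sup>2 / 2"
    proof -
      have "2 * real L \<le> real k" using k2 by (metis of_nat_le_iff of_nat_mult of_nat_numeral)
      then have "2 * real L * real k \<le> real k * real k" using k0 by (intro mult_right_mono) auto
      then show ?thesis by (simp add: power2_eq_square)
    qed
    have out: "band B \<rho> x \<le> \<delta>" if x: "x \<notin> lam_box m" for x
    proof -
      obtain i where "\<not> (- (2 ^ m) \<le> x $ i \<and> x $ i \<le> 2 ^ m - 1)" using x by (auto simp: lam_box_def lbox_def)
      then have "2 ^ m \<le> \<bar>x $ i\<bar>" by linarith
      then have "real_of_int (2 ^ m) \<le> real_of_int \<bar>x $ i\<bar>" by (simp only: of_int_le_iff)
      then have "2 ^ m \<le> lnorm x" using component_le_lnorm[of x i] by simp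
      moreover have "(real k)\<^sup>2 \<le> 2 ^ m" using m by (metis of_nat_le_iff of_nat_numeral of_nat_power)
      ultimately have kx: "(real k)\<^sup>2 \<le> lnorm x" by linarith
      have kp: "0 < (real k)\<^sup>2 / 2" using k0 by simp
      have "real L * real k < lnorm x" using kx Lk kp by linarith
      then have "x \<notin> B" by (simp add: B_def)
      moreover have "(\<Sum>y\<in>B. \<rho> (x - y)) \<le> (\<Sum>y\<in>B. ((real k)\<^sup>2 / 2) powr (- p))"
      proof (rule sum_mono)
        fix y assume y: "y \<in> B"
        have "lnorm x \<le> lnorm (x - y) + lnorm y" using lnorm_triangle[of "x - y" y] by simp
        moreover have "lnorm y \<le> real L * real k" using y by (simp add: B_def)
        ultimately have "(real k)\<^sup>2 / 2 \<le> lnorm (x - y)" using kx Lk by linarith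
        then show "\<rho> (x - y) \<le> ((real k)\<^sup>2 / 2) powr (- p)" unfolding \<rho>_def using kp p0 by (intro powr_mono2') auto
      qed
      ultimately show ?thesis by (simp add: band_def \<delta>_def)
    qed
    have T2: "(T x)\<^sup>2 \<le> c\<^sup>2 * \<delta> * band B \<rho> x" for x
    proof (cases "x \<in> lam_box m")
      case True
      then show ?thesis using d0 band_nonneg[OF fB \<rho>] by (simp add: T_def)
    next
      case False
      have "(T x)\<^sup>2 \<le> (c * band B \<rho> x)\<^sup>2"
        using bd[of x] False by (simp add: T_def) (metis abs_ge_zero power2_abs power_mono)
      also have "\<dots> = c\<^sup>2 * (band B \<rho> x * band B \<rho> x)" by (simp add: power2_eq_square)
      also have "\<dots> \<le> c\<^sup>2 * (\<delta> * band B \<rho> x)"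
        using out[OF False] band_nonneg[OF fB \<rho>] by (intro mult_left_mono mult_right_mono) auto
      finally show ?thesis by (simp add: mult.assoc)
    qed
    have hs: "((\<lambda>x. c\<^sup>2 * \<delta> * band B \<rho> x) has_sum c\<^sup>2 * \<delta> * (real (card B) * S)) UNIV"
      unfolding S_def by (rule has_sum_cmult_right[OF band_has_sum[OF fB \<rho>]])
    then have us: "(\<lambda>x. c\<^sup>2 * \<delta> * band B \<rho> x) summable_on UNIV" by (auto simp: summable_on_def)
    have Ts: "(\<lambda>x. (T x)\<^sup>2) summable_on UNIV" by (rule summable_on_comparison_test[OF us T2]) simp
    have "(\<Sum>\<^sub>\<infinity>x. (T x)\<^sup>2) \<le> (\<Sum>\<^sub>\<infinity>x. c\<^sup>2 * \<delta> * band B \<rho> x)" by (rule infsum_mono[OF Ts us T2])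
    also have "\<dots> = c\<^sup>2 * \<delta> * (real (card B) * S)" using hs by (rule infsumI)
    also have "\<dots> \<le> c\<^sup>2 * (((3 * real L) powr d * real k powr d) * ((real k)\<^sup>2 / 2) powr (- p)) * (((3 * real L) powr d * real k powr d) * S)"
    proof -
      have cb: "real (card B) \<le> (3 * real L) powr d * real k powr d"
        using card_ball_powr[of "real L" k, where 'n = 'n] L k by (simp add: B_def d_def)
      then show ?thesis unfolding \<delta>_def using S0 c0
        by (intro mult_mono mult_left_mono mult_right_mono) auto
    qed
    also have "((real k)\<^sup>2 / 2) powr (- p) = real k powr (- 2 * p) * 2 powr p"
    proof -
      have "((real k)\<^sup>2) powr (- p) = (real k powr 2) powr (- p)" using k0 by simp
      also have "\<dots> = real k powr (- 2 * p)" by (simp only: powr_powr) simp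
      finally have e: "((real k)\<^sup>2) powr (- p) = real k powr (- 2 * p)" .
      have "((real k)\<^sup>2 / 2) powr (- p) = ((real k)\<^sup>2) powr (- p) / 2 powr (- p)" by (rule powr_divide)
      also have "\<dots> = real k powr (- 2 * p) * 2 powr p"
        unfolding e by (simp only: powr_minus divide_inverse inverse_inverse_eq)
      finally show ?thesis .
    qed
    also have "c\<^sup>2 * (((3 * real L) powr d * real k powr d) * (real k powr (- 2 * p) * 2 powr p)) * (((3 * real L) powr d * real k powr d) * S)
      = D * (real k powr d * real k powr (- 2 * p) * real k powr d)"
      by (simp only: D_def mult_ac power2_eq_square)
    also have "real k powr d * real k powr (- 2 * p) * real k powr d = real k powr (- 2 * \<alpha>)"
      by (simp add: p_def flip: powr_add)
    finally have "real k powr (2 * \<alpha>) * (\<Sum>\<^sub>\<infinity>x. (T x)\<^sup>2) \<le> real k powr (2 * \<alpha>) * (D * real k powr (- 2 * \<alpha>))"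
      by (rule mult_left_mono) simp
    also have "\<dots> = D * (real k powr (2 * \<alpha>) * real k powr (- 2 * \<alpha>))" by simp
    also have "real k powr (2 * \<alpha>) * real k powr (- 2 * \<alpha>) = 1" using k0 by (simp flip: powr_add)
    finally show ?thesis using Ts unfolding T_def by simp
  qed
  moreover have "0 \<le> D" using S0 by (simp add: D_def)
  ultimately show ?thesis unfolding d_def p_def by blast
qed

text \<open>Combines the expansion into atoms with concentration. L \<le> k is needed because
  \<open>good2\<close> covers only these radii, and s < d + 2 \<alpha> keeps the squared kernel
  summable after the gain k^(-s).\<close>

lemma avg_fluct_bound:
  fixes g :: "real ^ 'n \<Rightarrow> real"
  assumes g: "g \<in> Cc_inf" and L: "1 \<le> L" "\<And>x. real L < norm x \<Longrightarrow> g x = 0"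
    and \<alpha>: "0 < \<alpha>" and s: "0 \<le> s" "s \<le> 2" "s < real CARD('n) + 2 * \<alpha>" and \<kappa>: "0 \<le> \<kappa>"
  shows "\<exists>C\<ge>0. \<forall>k m J. L \<le> k \<longrightarrow> J \<le> m \<longrightarrow> (\<forall>\<omega>\<in>space P. good2 k m (real CARD('n) + \<alpha>) (\<kappa> * ln (real k)) \<omega> \<longrightarrow>
    L2_set (avg J (fluct w (real CARD('n) + \<alpha>) (\<lambda>z. g (lat_pt k z)) \<omega>)) (lam_box m)
    \<le> C * sqrt (ln (real k)) * real k powr ((real CARD('n) - s) / 2) * 2 powr (- (real (J * CARD('n)) / 2)))"
proof -
  define d where "d = real CARD('n)"
  define p where "p = d + \<alpha>"
  obtain C\<phi> where C\<phi>: "0 \<le> C\<phi>" "\<And>k. 1 \<le> k \<Longrightarrow> \<exists>\<phi>.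
    (\<forall>y. g (lat_pt k y) = (\<Sum>t\<in>lbox (- int (2 * L * k)) (int (2 * L * k)). \<phi> t * atom k L t y)) \<and>
    (\<Sum>t\<in>lbox (- int (2 * L * k)) (int (2 * L * k)). \<bar>\<phi> t\<bar>) \<le> C\<phi>"
    using atom_decomposition[OF g L] by blast
  define S where "S = 2 * (\<Sum>\<^sub>\<infinity>z::int ^ 'n. lnorm z powr (- (2 * p - s))) + 1"
  have S0: "0 \<le> S" unfolding S_def by (intro add_nonneg_nonneg mult_nonneg_nonneg infsum_nonneg) auto
  define c where "c = 4 * (1 + d)\<^sup>2 * ((3 * (2 * real L)) powr d * S)"
  have c0: "0 \<le> c" using S0 by (simp add: c_def)
  define C where "C = C\<phi> * (3 * M * sqrt (\<kappa> * c))"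
  have "L2_set (avg J (fluct w p (\<lambda>z. g (lat_pt k z)) \<omega>)) (lam_box m)
    \<le> C * sqrt (ln (real k)) * real k powr ((d - s) / 2) * 2 powr (- (real (J * CARD('n)) / 2))"
    if k: "L \<le> k" and J: "J \<le> m" and \<omega>: "\<omega> \<in> space P" and good: "good2 k m p (\<kappa> * ln (real k)) \<omega>" for k m J \<omega>
  proof -
    have k1: "1 \<le> k" using k L by simp
    have l0: "0 \<le> ln (real k)" using k1 by simp
    obtain \<phi> where \<phi>: "\<And>y. g (lat_pt k y) = (\<Sum>t\<in>lbox (- int (2 * L * k)) (int (2 * L * k)). \<phi> t * atom k L t y)"
      "(\<Sum>t\<in>lbox (- int (2 * L * k)) (int (2 * L * k)). \<bar>\<phi> t\<bar>) \<le> C\<phi>" using C\<phi>(2)[OF k1] by blast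
    define V where "V = c * real k powr (d - s)"
    have V: "(\<Sum>x\<in>lam_box m. vari p (atom k L t) x) \<le> V" for t :: "int ^ 'n"
    proof -
      have "(\<Sum>x\<in>lam_box m. vari p (atom k L t) x) \<le> 4 * (1 + d)\<^sup>2 * real k powr (- s) *
          (real (card {z :: int ^ 'n. lnorm z \<le> 2 * real L * real k}) * S)"
        using vari_sum_le[OF atom_lipc[OF k1 L(1), of t] k1 s(1,2), of p "lam_box m"] s by (simp add: d_def p_def S_def)
      also have "\<dots> \<le> 4 * (1 + d)\<^sup>2 * real k powr (- s) * (((3 * (2 * real L)) powr d * real k powr d) * S)"
        using card_ball_powr[of "2 * real L" k, where 'n = 'n] L(1) k1 S0
        by (intro mult_left_mono mult_right_mono) (auto simp: d_def)
      also have "\<dots> = c * (real k powr d * real k powr (- s))" by (simp add: c_def)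
      also have "real k powr d * real k powr (- s) = real k powr (d - s)" by (simp flip: powr_add)
      finally show ?thesis by (simp add: V_def)
    qed
    have "L2_set (avg J (fluct w p (\<lambda>y. \<Sum>t\<in>lbox (- int (2 * L * k)) (int (2 * L * k)). \<phi> t * atom k L t y) \<omega>)) (lam_box m)
      \<le> C\<phi> * (3 * M * sqrt (\<kappa> * ln (real k) * V) * 2 powr (- (real (J * CARD('n)) / 2)))"
      by (rule avg_fluct_L2[OF good \<omega> k1 L(1) k J _ _ V \<phi>(2)]) (use \<alpha> \<kappa> l0 in \<open>auto simp: p_def d_def\<close>)
    also have "sqrt (\<kappa> * ln (real k) * V) = sqrt (\<kappa> * c) * sqrt (ln (real k)) * real k powr ((d - s) / 2)"
    proof -
      have "\<kappa> * ln (real k) * V = (\<kappa> * c) * ln (real k) * real k powr (d - s)" by (simp add: V_def)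
      moreover have "sqrt (real k powr (d - s)) = real k powr ((d - s) / 2)"
        by (simp add: powr_half_sqrt[symmetric] powr_powr)
      ultimately show ?thesis by (simp only: real_sqrt_mult)
    qed
    finally show ?thesis unfolding \<phi>(1)[symmetric] by (simp add: C_def mult_ac)
  qed
  moreover have "0 \<le> C" using C\<phi>(1) M_pos c0 \<kappa> by (simp add: C_def)
  ultimately show ?thesis unfolding d_def p_def by blast
qed

end

section \<open>Choice of scales\<close>

lemma nat_ceiling_log2:
  fixes s :: real
  assumes "1 \<le> s"
  shows "s \<le> 2 ^ nat \<lceil>log 2 s\<rceil>" "2 ^ nat \<lceil>log 2 s\<rceil> \<le> 2 * s"
proof -
  have l: "0 \<le> log 2 s" using assms by simp
  have r: "real (nat \<lceil>log 2 s\<rceil>) = of_int \<lceil>log 2 s\<rceil>" using l by simp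
  have b: "log 2 s \<le> real (nat \<lceil>log 2 s\<rceil>)" "real (nat \<lceil>log 2 s\<rceil>) \<le> log 2 s + 1"
    unfolding r by linarith+
  have e: "(2::real) ^ nat \<lceil>log 2 s\<rceil> = 2 powr real (nat \<lceil>log 2 s\<rceil>)" by (simp add: powr_realpow)
  have s: "2 powr log 2 s = s" using assms by simp
  show "s \<le> 2 ^ nat \<lceil>log 2 s\<rceil>" unfolding e using powr_mono[OF b(1), of 2] s by simp
  show "2 ^ nat \<lceil>log 2 s\<rceil> \<le> 2 * s" unfolding e using powr_mono[OF b(2), of 2] s by (simp add: powr_add)
qed

text \<open>Side about k^2: averages at the top level gain 2^(-m d / 2), about k^(-d), and the
  boundary is far from the support of g, while the number of cubes stays polynomial in k.\<close>

definition msc :: "nat \<Rightarrow> nat" where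
  "msc k = nat \<lceil>log 2 ((real k)\<^sup>2)\<rceil>"

text \<open>The smallest level J at which 2^(J d) reaches (log k)^(1 + \<gamma>). The excess
  \<gamma> makes exp (- c 2^(J d)) eventually smaller than any power of k.\<close>

definition jsc :: "real \<Rightarrow> nat \<Rightarrow> nat \<Rightarrow> nat" where
  "jsc \<gamma> d k = nat \<lceil>log 2 (ln (real k) powr ((1 + \<gamma>) / real d))\<rceil>"

lemma msc_bounds:
  assumes "1 \<le> k"
  shows "(real k)\<^sup>2 \<le> 2 ^ msc k" "2 ^ msc k \<le> 2 * (real k)\<^sup>2"
  unfolding msc_def by (intro nat_ceiling_log2; use assms in simp)+

lemma jsc_bounds:
  assumes "3 \<le> k" "0 < \<gamma>"
  shows "ln (real k) powr ((1 + \<gamma>) / real d) \<le> 2 ^ jsc \<gamma> d k"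
    "2 ^ jsc \<gamma> d k \<le> 2 * ln (real k) powr ((1 + \<gamma>) / real d)"
proof -
  have "1 \<le> ln (real k) powr ((1 + \<gamma>) / real d)"
    using ln_ge_1[OF assms(1)] assms(2) by (intro ge_one_powr_ge_zero) auto
  from nat_ceiling_log2[OF this]
  show "ln (real k) powr ((1 + \<gamma>) / real d) \<le> 2 ^ jsc \<gamma> d k"
    "2 ^ jsc \<gamma> d k \<le> 2 * ln (real k) powr ((1 + \<gamma>) / real d)" by (simp_all add: jsc_def)
qed

lemma card_lam_box: "card (lam_box m :: (int ^ 'n) set) = (2 * 2 ^ m) ^ CARD('n)"
proof -
  have "(2 ^ m - 1) - (- (2 ^ m)) + 1 = int (2 * 2 ^ m)" by simp
  then show ?thesis unfolding lam_box_def card_lbox by (simp only: nat_int)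
qed

context conductances
begin

text \<open>The first union has O(k^(2 + 6 d)) members and the second O(k^(3 + 4 d)). Their tails
  are made at most k^(-(4 + 6 d)) and 4 k^(-(4 d + 5)), so that a summable k^(-2) remains; this is
  the origin of \<kappa>.\<close>

lemma good_event_prob:
  assumes \<alpha>: "0 < \<alpha>" and \<gamma>: "0 < \<gamma>" and \<kappa>: "\<kappa> = 4 * real CARD('n) + 5"
  shows "\<exists>k2\<ge>3. \<exists>C::real. \<forall>k\<ge>k2. jsc \<gamma> CARD('n) k \<le> msc k \<and> (\<exists>A\<in>events. prob A \<le> C * real k powr (- 2) \<and>
    (\<forall>\<omega>\<in>space P - A. good1 (jsc \<gamma> CARD('n) k) (msc k) \<omega> \<and> good2 k (msc k) (real CARD('n) + \<alpha>) (\<kappa> * ln (real k)) \<omega>))"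
proof -
  define d where "d = CARD('n)"
  have d1: "1 \<le> d" by (simp add: d_def Suc_leI)
  \<comment> \<open>K log k is the size that 2^(J0 d) must reach for the tail exp (- 2^(J0 d) / (8
    M^4)) to be k^(-(4 + 6 d)); log k \<ge> K^(1 / \<gamma>) makes (log k)^(1 + \<gamma>) that
    large.\<close>
  define K where "K = 8 * M ^ 4 * (4 + 6 * real d)"
  have K0: "0 < K" using M_pos by (simp add: K_def)
  define X where "X = max 3 (K powr (1 / \<gamma>))"
  \<comment> \<open>Serves J0 \<le> m: the power of log k defining J0 is at most C1 k, hence at most
    k^2 once k \<ge> C1.\<close>
  obtain C1 where C1: "C1 > 0" "\<And>k. 3 \<le> k \<Longrightarrow> real k powr 0 * ln (real k) powr ((1 + \<gamma>) / real d) \<le> C1 * (real k powr 1 * ln (real k) powr 0)"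
    using powr_ln_compare[of 0 1 "(1 + \<gamma>) / real d" 0] by auto
  define k2 where "k2 = max 3 (max (nat \<lceil>exp X\<rceil>) (nat \<lceil>C1\<rceil>))"
  define C where "C = 2 * (64::real) ^ d + 8 * 20 ^ d"
  have main: "jsc \<gamma> d k \<le> msc k \<and> (\<exists>A\<in>events. prob A \<le> C * real k powr (- 2) \<and>
    (\<forall>\<omega>\<in>space P - A. good1 (jsc \<gamma> d k) (msc k) \<omega> \<and> good2 k (msc k) (real CARD('n) + \<alpha>) (\<kappa> * ln (real k)) \<omega>))"
    if k: "k2 \<le> k" for k
  proof -
    have k3: "3 \<le> k" and kX: "exp X \<le> real k" and kC: "C1 \<le> real k"
      using k by (auto simp: k2_def nat_ceiling_le_eq)
    define l where "l = ln (real k)"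
    define m where "m = msc k"
    define J0 where "J0 = jsc \<gamma> d k"
    have k0: "0 < real k" using k3 by simp
    have "ln (exp X) \<le> l" unfolding l_def using kX k0 by (subst ln_le_cancel_iff) auto
    then have lX: "3 \<le> l" "K powr (1 / \<gamma>) \<le> l" by (auto simp: X_def)
    have "(K powr (1 / \<gamma>)) powr \<gamma> \<le> l powr \<gamma>" using lX \<gamma> by (intro powr_mono2) auto
    then have lK: "K \<le> l powr \<gamma>" using \<gamma> K0 by (simp add: powr_powr)
    have l1: "K * l \<le> l powr (1 + \<gamma>)" using mult_right_mono[OF lK, of l] lX by (simp add: powr_add mult.commute)
    have "l powr ((1 + \<gamma>) / real d) \<le> 2 ^ J0" unfolding l_def J0_def by (rule jsc_bounds[OF k3 \<gamma>])
    then have "(l powr ((1 + \<gamma>) / real d)) ^ d \<le> (2 ^ J0) ^ d" by (intro power_mono) auto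
    moreover have "(l powr ((1 + \<gamma>) / real d)) ^ d = l powr (1 + \<gamma>)"
      using d1 lX by (simp add: powr_realpow[symmetric] powr_powr)
    ultimately have J: "l powr (1 + \<gamma>) \<le> 2 ^ (J0 * d)" by (simp add: power_mult)
    \<comment> \<open>log k \<ge> 3 forces 2^(J0 d) > 2 and thus at least four sites in each
      cube.\<close>
    have "l powr 1 \<le> l powr (1 + \<gamma>)" using lX \<gamma> by (intro powr_mono) auto
    then have "3 \<le> (2::real) ^ (J0 * d)" using J lX by simp
    moreover have "(2::real) ^ (J0 * d) \<le> 2 ^ 1" if "J0 * d \<le> 1" using that by (intro power_increasing) auto
    ultimately have Jd: "2 \<le> J0 * d" by (cases "J0 * d \<le> 1") auto
    have e1: "exp (- (2 ^ (J0 * d)) / (8 * M ^ 4)) \<le> real k powr (- (4 + 6 * real d))"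
    proof -
      have "8 * M ^ 4 * ((4 + 6 * real d) * l) \<le> 2 ^ (J0 * d)" using l1 J by (simp add: K_def mult_ac)
      then have "(4 + 6 * real d) * l \<le> 2 ^ (J0 * d) / (8 * M ^ 4)" using M_pos by (simp add: pos_le_divide_eq mult_ac)
      then have "exp (- (2 ^ (J0 * d)) / (8 * M ^ 4)) \<le> exp (- ((4 + 6 * real d) * l))" by simp
      also have "\<dots> = real k powr (- (4 + 6 * real d))" using k0 by (simp add: powr_def l_def algebra_simps)
      finally show ?thesis .
    qed
    have e2: "exp (- (\<kappa> * l)) = real k powr (- (4 * real d + 5))"
      using k0 by (simp add: powr_def l_def \<kappa> d_def algebra_simps)
    have jm: "J0 \<le> m"
    proof -
      have "l powr ((1 + \<gamma>) / real d) \<le> C1 * real k" using C1(2)[OF k3] k3 lX by (simp add: l_def)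
      also have "\<dots> \<le> (real k)\<^sup>2" using kC k0 by (simp add: power2_eq_square)
      finally have "log 2 (l powr ((1 + \<gamma>) / real d)) \<le> log 2 ((real k)\<^sup>2)" using lX k0 by (subst log_le_cancel_iff) auto
      then show ?thesis unfolding J0_def m_def jsc_def msc_def l_def by (intro nat_mono ceiling_mono)
    qed
    have m2: "2 ^ m \<le> 2 * (real k)\<^sup>2" unfolding m_def using k3 by (intro msc_bounds) simp
    have "real (m + 1) \<le> real (2 ^ m)" unfolding of_nat_le_iff by (metis Suc_eq_plus1 Suc_leI less_exp)
    then have m1: "real (m + 1) \<le> 2 * real k ^ 2" using m2 by simp
    have cL: "real (card (lam_box m :: (int ^ 'n) set)) \<le> (4 * real k ^ 2) ^ d"
      unfolding card_lam_box d_def of_nat_power by (rule power_mono) (use m2 in auto)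
    have c3: "(4 * real k ^ 2) ^ d = 4 ^ d * real k ^ (2 * d)" by (simp add: power_mult_distrib power_mult)
    have T1: "real ((m + 1) * card (lam_box m :: (int ^ 'n) set) ^ 3) * exp (- (2 ^ (J0 * d)) / (8 * M ^ 4)) \<le> 2 * 64 ^ d * real k powr (- 2)"
    proof -
      have "real ((m + 1) * card (lam_box m :: (int ^ 'n) set) ^ 3) \<le> 2 * real k ^ 2 * ((4 * real k ^ 2) ^ d) ^ 3"
        unfolding of_nat_mult of_nat_power by (intro mult_mono m1 power_mono cL) auto
      also have "\<dots> = 2 * 64 ^ d * real k ^ (2 + 6 * d)"
      proof -
        have "((4::real) ^ d) ^ 3 = (4 ^ 3) ^ d" by (simp only: power_mult[symmetric] mult.commute[of d])
        then have e64: "((4::real) ^ d) ^ 3 = 64 ^ d" by simp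
        have ek: "(real k ^ (2 * d)) ^ 3 = real k ^ (6 * d)" by (simp add: power_mult[symmetric])
        have "((4 * real k ^ 2) ^ d) ^ 3 = 64 ^ d * real k ^ (6 * d)"
          unfolding c3 power_mult_distrib[of "4 ^ d"] e64 ek ..
        then show ?thesis by (simp only: power_add mult_ac)
      qed
      finally have "real ((m + 1) * card (lam_box m :: (int ^ 'n) set) ^ 3) * exp (- (2 ^ (J0 * d)) / (8 * M ^ 4))
        \<le> 2 * 64 ^ d * real k ^ (2 + 6 * d) * real k powr (- (4 + 6 * real d))"
        by (intro mult_mono e1) auto
      also have "real k ^ (2 + 6 * d) = real k powr real (2 + 6 * d)" using k0 by (rule powr_realpow[symmetric])
      also have "2 * 64 ^ d * real k powr real (2 + 6 * d) * real k powr (- (4 + 6 * real d))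
        = 2 * 64 ^ d * (real k powr real (2 + 6 * d) * real k powr (- (4 + 6 * real d)))" by (simp only: mult.assoc)
      also have "real k powr real (2 + 6 * d) * real k powr (- (4 + 6 * real d)) = real k powr (- 2)"
        unfolding powr_add[symmetric] by (rule arg_cong[of _ _ "\<lambda>q. real k powr q"]) simp
      finally show ?thesis .
    qed
    have T2: "real (k * (4 * k * k + 1) ^ CARD('n) * ((m + 1) * card (lam_box m :: (int ^ 'n) set))) * (4 * exp (- (\<kappa> * l))) \<le> 8 * 20 ^ d * real k powr (- 2)"
    proof -
      have "1 \<le> real k ^ 2" using k3 by simp
      then have "real (4 * k * k + 1) \<le> 5 * real k ^ 2" by (simp add: power2_eq_square)
      then have "real (4 * k * k + 1) ^ d \<le> (5 * real k ^ 2) ^ d" by (intro power_mono) auto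
      then have "real (k * (4 * k * k + 1) ^ CARD('n) * ((m + 1) * card (lam_box m :: (int ^ 'n) set)))
        \<le> real k * (5 * real k ^ 2) ^ d * ((2 * real k ^ 2) * (4 * real k ^ 2) ^ d)"
        unfolding of_nat_mult of_nat_power d_def[symmetric] by (intro mult_mono m1 cL order_refl) auto
      also have "\<dots> = 2 * 20 ^ d * real k ^ (3 + 4 * d)"
      proof -
        have c5: "(5 * real k ^ 2) ^ d = 5 ^ d * real k ^ (2 * d)" by (simp add: power_mult_distrib power_mult)
        have "real k * (5 * real k ^ 2) ^ d * ((2 * real k ^ 2) * (4 * real k ^ 2) ^ d)
          = 2 * (5 ^ d * 4 ^ d) * ((real k * real k ^ 2) * (real k ^ (2 * d) * real k ^ (2 * d)))"
          unfolding c3 c5 by (simp only: mult_ac)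
        also have "(5::real) ^ d * 4 ^ d = 20 ^ d" by (simp flip: power_mult_distrib)
        also have "real k ^ (2 * d) * real k ^ (2 * d) = real k ^ (4 * d)" by (simp flip: power_add)
        also have "real k * real k ^ 2 = real k ^ 3" by (simp add: power2_eq_square power3_eq_cube)
        finally have "real k * (5 * real k ^ 2) ^ d * ((2 * real k ^ 2) * (4 * real k ^ 2) ^ d)
          = 2 * 20 ^ d * (real k ^ 3 * real k ^ (4 * d))" .
        then show ?thesis by (simp only: power_add)
      qed
      finally have "real (k * (4 * k * k + 1) ^ CARD('n) * ((m + 1) * card (lam_box m :: (int ^ 'n) set))) * (4 * exp (- (\<kappa> * l)))
        \<le> 2 * 20 ^ d * real k ^ (3 + 4 * d) * (4 * real k powr (- (4 * real d + 5)))"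
        unfolding e2 by (rule mult_right_mono) simp
      also have "real k ^ (3 + 4 * d) = real k powr real (3 + 4 * d)" using k0 by (rule powr_realpow[symmetric])
      also have "2 * 20 ^ d * real k powr real (3 + 4 * d) * (4 * real k powr (- (4 * real d + 5)))
        = 8 * 20 ^ d * (real k powr real (3 + 4 * d) * real k powr (- (4 * real d + 5)))" by simp
      also have "real k powr real (3 + 4 * d) * real k powr (- (4 * real d + 5)) = real k powr (- 2)"
        unfolding powr_add[symmetric] by (rule arg_cong[of _ _ "\<lambda>q. real k powr q"]) simp
      finally show ?thesis .
    qed
    have \<tau>: "0 < \<kappa> * l" using lX by (auto simp: \<kappa> intro!: mult_pos_pos add_nonneg_pos)
    have "\<exists>A\<in>events. prob A \<le> real ((m + 1) * card (lam_box m :: (int ^ 'n) set) ^ 3) * exp (- (2 ^ (J0 * CARD('n))) / (8 * M ^ 4))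
      + real (k * (4 * k * k + 1) ^ CARD('n) * ((m + 1) * card (lam_box m :: (int ^ 'n) set))) * (4 * exp (- (\<kappa> * l)))
      \<and> (\<forall>\<omega>\<in>space P - A. good1 J0 m \<omega> \<and> good2 k m (real CARD('n) + \<alpha>) (\<kappa> * l) \<omega>)"
      by (rule good_event) (use k3 Jd \<tau> \<alpha> in \<open>auto simp: d_def\<close>)
    then obtain A where A: "A \<in> events" "prob A \<le> real ((m + 1) * card (lam_box m :: (int ^ 'n) set) ^ 3) * exp (- (2 ^ (J0 * CARD('n))) / (8 * M ^ 4))
      + real (k * (4 * k * k + 1) ^ CARD('n) * ((m + 1) * card (lam_box m :: (int ^ 'n) set))) * (4 * exp (- (\<kappa> * l)))"
      "\<forall>\<omega>\<in>space P - A. good1 J0 m \<omega> \<and> good2 k m (real CARD('n) + \<alpha>) (\<kappa> * l) \<omega>" by blast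
    have "prob A \<le> C * real k powr (- 2)"
      using A(2) T1 T2 unfolding d_def[symmetric] C_def distrib_right by linarith
    then show ?thesis using A(1,3) jm unfolding J0_def m_def l_def by blast
  qed
  moreover have "3 \<le> k2" by (simp add: k2_def)
  ultimately show ?thesis unfolding d_def by blast
qed

end

lemma infsum_square_add_le:
  fixes f g :: "'a \<Rightarrow> real"
  assumes f: "(\<lambda>x. (f x)\<^sup>2) summable_on UNIV" and g: "(\<lambda>x. (g x)\<^sup>2) summable_on UNIV"
  shows "(\<lambda>x. (f x + g x)\<^sup>2) summable_on UNIV"
    "(\<Sum>\<^sub>\<infinity>x. (f x + g x)\<^sup>2) \<le> 2 * (\<Sum>\<^sub>\<infinity>x. (f x)\<^sup>2) + 2 * (\<Sum>\<^sub>\<infinity>x. (g x)\<^sup>2)"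
proof -
  have le: "(a + b)\<^sup>2 \<le> 2 * a\<^sup>2 + 2 * b\<^sup>2" for a b :: real
    using zero_le_power2[of "a - b"] by (simp add: power2_eq_square algebra_simps)
  have s: "(\<lambda>x. 2 * (f x)\<^sup>2 + 2 * (g x)\<^sup>2) summable_on UNIV"
    by (intro summable_on_add summable_on_cmult_right f g)
  show *: "(\<lambda>x. (f x + g x)\<^sup>2) summable_on UNIV"
    by (rule summable_on_comparison_test[OF s le]) simp
  have "(\<Sum>\<^sub>\<infinity>x. (f x + g x)\<^sup>2) \<le> (\<Sum>\<^sub>\<infinity>x. 2 * (f x)\<^sup>2 + 2 * (g x)\<^sup>2)"
    by (rule infsum_mono[OF * s le])
  also have "\<dots> = 2 * (\<Sum>\<^sub>\<infinity>x. (f x)\<^sup>2) + 2 * (\<Sum>\<^sub>\<infinity>x. (g x)\<^sup>2)"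
    by (subst infsum_add) (auto intro!: summable_on_cmult_right f g simp: infsum_cmult_right')
  finally show "(\<Sum>\<^sub>\<infinity>x. (f x + g x)\<^sup>2) \<le> 2 * (\<Sum>\<^sub>\<infinity>x. (f x)\<^sup>2) + 2 * (\<Sum>\<^sub>\<infinity>x. (g x)\<^sup>2)" .
qed

lemma infsum_square_scale:
  fixes f :: "'a \<Rightarrow> real"
  assumes f: "(\<lambda>x. (f x)\<^sup>2) summable_on UNIV"
  shows "(\<lambda>x. (c * f x)\<^sup>2) summable_on UNIV" "(\<Sum>\<^sub>\<infinity>x. (c * f x)\<^sup>2) = c\<^sup>2 * (\<Sum>\<^sub>\<infinity>x. (f x)\<^sup>2)"
  using f by (simp_all add: power_mult_distrib summable_on_cmult_right infsum_cmult_right')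

lemma powr_power2: "(a powr x)\<^sup>2 = a powr (2 * x)" for a x :: real
  by (simp add: power2_eq_square flip: powr_add)

lemma avg_0: "avg 0 h = (h :: int ^ 'n \<Rightarrow> real)"
proof
  fix z :: "int ^ 'n"
  have "cube 0 z = {z}" by (auto simp: cube_def vec_eq_iff)
  then show "avg 0 h z = h z" by (simp add: avg_def)
qed

context conductances
begin

text \<open>Deterministic reduction, valid for all \<omega> and k: the distance is controlled by the
  l^2 norm of h and the oscillation of g over cells. The crude bound on h serves finitely many k;
  for the others the equation for h feeds the energy estimate.\<close>

lemma resolvent_error:
  fixes g :: "real ^ 'n \<Rightarrow> real"
  assumes g: "g \<in> Cc_inf" and \<alpha>: "0 < \<alpha>" "\<alpha> < 2" and lam: "0 < lam"
  shows "\<exists>C\<ge>0. \<forall>k\<ge>1. \<forall>\<omega>\<in>space P. \<exists>h. (\<lambda>x. (h x)\<^sup>2) summable_on UNIV \<and>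
    (\<forall>x. lam * h x - dominated_kernel.gen (kern k \<alpha> \<omega>) h x
      = real k powr \<alpha> * fluct w (real CARD('n) + \<alpha>) (\<lambda>z. g (lat_pt k z)) \<omega> x + psi k \<alpha> g x) \<and>
    (\<Sum>\<^sub>\<infinity>x. (h x)\<^sup>2) \<le> C * real k powr (real CARD('n) + 2 * \<alpha>) \<and>
    L2_dist_sq (Rk w k \<alpha> \<omega> lam (\<lambda>x. lam * g x - Lbar \<alpha> g x)) (Rbar \<alpha> lam (\<lambda>x. lam * g x - Lbar \<alpha> g x))
      \<le> ennreal (2 * ((\<Sum>\<^sub>\<infinity>z. (h z)\<^sup>2) / real k powr real CARD('n)) + C * real k powr (- 2))"
proof -
  define d where "d = real CARD('n)"
  obtain b L where b: "0 \<le> b" "1 \<le> L" "\<And>x. real L < norm x \<Longrightarrow> g x = 0" "\<And>x y. \<bar>g x - g y\<bar> \<le> b * norm (x - y)"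
    "\<And>k. 1 \<le> k \<Longrightarrow> lipc k b (real L) (\<lambda>z. g (lat_pt k z))"
    using Cc_inf_lipc[OF g] by blast
  define F where "F k \<omega> = fluct w (d + \<alpha>) (\<lambda>z. g (lat_pt k z)) \<omega>" for k \<omega>
  obtain C1 where C1: "0 \<le> C1" "\<And>k \<omega>. 1 \<le> k \<Longrightarrow> \<omega> \<in> space P \<Longrightarrow> (\<lambda>x. (F k \<omega> x)\<^sup>2) summable_on UNIV \<and>
      (\<Sum>\<^sub>\<infinity>x. (F k \<omega> x)\<^sup>2) \<le> C1 * real k powr (d - 2 * 0)"
    using fluct_square[OF b(5) b(2), of 0 \<alpha>] \<alpha> unfolding F_def d_def by auto
  obtain C2 where C2: "0 \<le> C2" "\<And>k. 1 \<le> k \<Longrightarrow> (\<lambda>x. (psi k \<alpha> g x)\<^sup>2) summable_on UNIV \<and>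
      (\<Sum>\<^sub>\<infinity>x. (psi k \<alpha> g x)\<^sup>2) \<le> C2 * real k powr (d + \<alpha> - 2)"
    using psi_square[OF g \<alpha>] unfolding d_def by auto
  define c1 where "c1 = (2 * C1 + 2 * C2) / lam\<^sup>2"
  define c2 where "c2 = 2 * (b * d)\<^sup>2 * (unit_ball_vol d * (real L + d) ^ CARD('n))"
  define C where "C = c1 + c2"
  have c12: "0 \<le> c1" "0 \<le> c2" using C1(1) C2(1) b by (simp_all add: c1_def c2_def d_def)
  have "\<exists>h. (\<lambda>x. (h x)\<^sup>2) summable_on UNIV \<and>
    (\<forall>x. lam * h x - dominated_kernel.gen (kern k \<alpha> \<omega>) h x = real k powr \<alpha> * F k \<omega> x + psi k \<alpha> g x) \<and>
    (\<Sum>\<^sub>\<infinity>x. (h x)\<^sup>2) \<le> C * real k powr (d + 2 * \<alpha>) \<and>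
    L2_dist_sq (Rk w k \<alpha> \<omega> lam (\<lambda>x. lam * g x - Lbar \<alpha> g x)) (Rbar \<alpha> lam (\<lambda>x. lam * g x - Lbar \<alpha> g x))
      \<le> ennreal (2 * ((\<Sum>\<^sub>\<infinity>z. (h z)\<^sup>2) / real k powr d) + C * real k powr (- 2))"
    if k: "1 \<le> k" and \<omega>: "\<omega> \<in> space P" for k \<omega>
  proof -
    define \<Phi> where "\<Phi> x = real k powr \<alpha> * F k \<omega> x + psi k \<alpha> g x" for x
    have k0: "0 < real k" using k by simp
    note sF = infsum_square_scale[OF conjunct1[OF C1(2)[OF k \<omega>]], of "real k powr \<alpha>"]
    note s\<psi> = C2(2)[OF k]
    have s\<Phi>: "(\<lambda>x. (\<Phi> x)\<^sup>2) summable_on UNIV"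
      unfolding \<Phi>_def by (rule infsum_square_add_le(1)[OF sF(1) conjunct1[OF s\<psi>]])
    have "(\<Sum>\<^sub>\<infinity>x. (\<Phi> x)\<^sup>2) \<le> 2 * ((real k powr \<alpha>)\<^sup>2 * (\<Sum>\<^sub>\<infinity>x. (F k \<omega> x)\<^sup>2)) + 2 * (\<Sum>\<^sub>\<infinity>x. (psi k \<alpha> g x)\<^sup>2)"
      unfolding \<Phi>_def sF(2)[symmetric] by (rule infsum_square_add_le(2)[OF sF(1) conjunct1[OF s\<psi>]])
    also have "\<dots> \<le> 2 * ((real k powr \<alpha>)\<^sup>2 * (C1 * real k powr (d - 2 * 0))) + 2 * (C2 * real k powr (d + \<alpha> - 2))"
      using C1(2)[OF k \<omega>] s\<psi> by (intro add_mono mult_left_mono) auto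
    also have "\<dots> = 2 * C1 * real k powr (d + 2 * \<alpha>) + 2 * C2 * real k powr (d + \<alpha> - 2)"
      by (simp add: powr_power2 powr_add)
    also have "\<dots> \<le> 2 * C1 * real k powr (d + 2 * \<alpha>) + 2 * C2 * real k powr (d + 2 * \<alpha>)"
      using C2(1) k \<alpha> by (intro add_left_mono mult_left_mono powr_mono) auto
    finally have \<Phi>le: "(\<Sum>\<^sub>\<infinity>x. (\<Phi> x)\<^sup>2) / lam\<^sup>2 \<le> c1 * real k powr (d + 2 * \<alpha>)"
      using lam by (simp add: c1_def field_simps)
    obtain h where h: "(\<lambda>x. (h x)\<^sup>2) summable_on UNIV" "(\<Sum>\<^sub>\<infinity>x. (h x)\<^sup>2) \<le> (\<Sum>\<^sub>\<infinity>x. (\<Phi> x)\<^sup>2) / lam\<^sup>2"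
      "\<forall>x. lam * h x - dominated_kernel.gen (kern k \<alpha> \<omega>) h x = \<Phi> x"
      "Rk_lat w k \<alpha> \<omega> lam (\<lambda>x. lam * g x - Lbar \<alpha> g x) = (\<lambda>z. g (lat_pt k z) + h z)"
      using discrete_resolvent[OF \<alpha>(1) \<omega> k b(5)[OF k] lam _ s\<Phi>] unfolding \<Phi>_def F_def d_def by auto
    have Rk: "Rk w k \<alpha> \<omega> lam (\<lambda>x. lam * g x - Lbar \<alpha> g x) = (\<lambda>x. g (lat_pt k (cell_idx 1 k x)) + h (cell_idx 1 k x))"
      by (rule ext) (simp add: Rk_def h(4) cell_idx_def)
    have "L2_dist_sq (Rk w k \<alpha> \<omega> lam (\<lambda>x. lam * g x - Lbar \<alpha> g x)) (Rbar \<alpha> lam (\<lambda>x. lam * g x - Lbar \<alpha> g x))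
      \<le> ennreal (2 * ((\<Sum>\<^sub>\<infinity>z. (h z)\<^sup>2) / real k ^ CARD('n)) + c2 / (real k)\<^sup>2)"
      unfolding Rk Rbar_eq[OF g \<alpha> lam] c2_def d_def
      by (rule L2_dist_step[OF Cc_inf_continuous[OF g] k b(1,4,3) h(1)])
    also have "\<dots> \<le> ennreal (2 * ((\<Sum>\<^sub>\<infinity>z. (h z)\<^sup>2) / real k powr d) + C * real k powr (- 2))"
    proof (rule ennreal_leI)
      have "real k ^ CARD('n) = real k powr d" using k0 by (simp add: d_def powr_realpow)
      moreover have "c2 / (real k)\<^sup>2 = c2 * real k powr (- 2)"
        using k0 by (simp add: powr_minus_divide)
      moreover have "c2 * real k powr (- 2) \<le> C * real k powr (- 2)"
        using c12 by (intro mult_right_mono) (auto simp: C_def)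
      ultimately show "2 * ((\<Sum>\<^sub>\<infinity>z. (h z)\<^sup>2) / real k ^ CARD('n)) + c2 / (real k)\<^sup>2
        \<le> 2 * ((\<Sum>\<^sub>\<infinity>z. (h z)\<^sup>2) / real k powr d) + C * real k powr (- 2)" by simp
    qed
    finally have *: "L2_dist_sq (Rk w k \<alpha> \<omega> lam (\<lambda>x. lam * g x - Lbar \<alpha> g x)) (Rbar \<alpha> lam (\<lambda>x. lam * g x - Lbar \<alpha> g x))
      \<le> ennreal (2 * ((\<Sum>\<^sub>\<infinity>z. (h z)\<^sup>2) / real k powr d) + C * real k powr (- 2))" .
    have "c1 * real k powr (d + 2 * \<alpha>) \<le> C * real k powr (d + 2 * \<alpha>)"
      using c12 by (intro mult_right_mono) (auto simp: C_def)
    then have "(\<Sum>\<^sub>\<infinity>x. (h x)\<^sup>2) \<le> C * real k powr (d + 2 * \<alpha>)" using h(2) \<Phi>le by linarith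
    then show ?thesis using h(1,3) * unfolding \<Phi>_def by blast
  qed
  moreover have "0 \<le> C" using c12 by (simp add: C_def)
  ultimately show ?thesis unfolding F_def d_def by blast
qed

text \<open>Supplies a finite bound, uniform in \<omega>, for each of the finitely many k below the
  threshold that depends on g.\<close>

lemma resolvent_error_bounded:
  fixes g :: "real ^ 'n \<Rightarrow> real"
  assumes g: "g \<in> Cc_inf" and \<alpha>: "0 < \<alpha>" "\<alpha> < 2" and lam: "0 < lam" and k: "1 \<le> k"
  shows "\<exists>C\<ge>0. \<forall>\<omega>\<in>space P.
    L2_dist_sq (Rk w k \<alpha> \<omega> lam (\<lambda>x. lam * g x - Lbar \<alpha> g x)) (Rbar \<alpha> lam (\<lambda>x. lam * g x - Lbar \<alpha> g x)) \<le> ennreal C"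
proof -
  obtain C where C: "0 \<le> C" "\<And>\<omega>. \<omega> \<in> space P \<Longrightarrow> \<exists>h. (\<Sum>\<^sub>\<infinity>x. (h x)\<^sup>2) \<le> C * real k powr (real CARD('n) + 2 * \<alpha>) \<and>
    L2_dist_sq (Rk w k \<alpha> \<omega> lam (\<lambda>x. lam * g x - Lbar \<alpha> g x)) (Rbar \<alpha> lam (\<lambda>x. lam * g x - Lbar \<alpha> g x))
      \<le> ennreal (2 * ((\<Sum>\<^sub>\<infinity>z::int ^ 'n. (h z)\<^sup>2) / real k powr real CARD('n)) + C * real k powr (- 2))"
    using resolvent_error[OF g \<alpha> lam] k by meson
  define D where "D = 2 * (C * real k powr (real CARD('n) + 2 * \<alpha>) / real k powr real CARD('n)) + C * real k powr (- 2)"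
  have "L2_dist_sq (Rk w k \<alpha> \<omega> lam (\<lambda>x. lam * g x - Lbar \<alpha> g x)) (Rbar \<alpha> lam (\<lambda>x. lam * g x - Lbar \<alpha> g x)) \<le> ennreal D"
    if \<omega>: "\<omega> \<in> space P" for \<omega>
  proof -
    obtain h :: "int ^ 'n \<Rightarrow> real" where h: "(\<Sum>\<^sub>\<infinity>x. (h x)\<^sup>2) \<le> C * real k powr (real CARD('n) + 2 * \<alpha>)"
      "L2_dist_sq (Rk w k \<alpha> \<omega> lam (\<lambda>x. lam * g x - Lbar \<alpha> g x)) (Rbar \<alpha> lam (\<lambda>x. lam * g x - Lbar \<alpha> g x))
      \<le> ennreal (2 * ((\<Sum>\<^sub>\<infinity>z. (h z)\<^sup>2) / real k powr real CARD('n)) + C * real k powr (- 2))"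
      using C(2)[OF \<omega>] by blast
    show ?thesis unfolding D_def
      by (rule order_trans[OF h(2)], intro ennreal_leI add_right_mono mult_left_mono divide_right_mono h(1)) auto
  qed
  moreover have "0 \<le> D" using C(1) by (simp add: D_def)
  ultimately show ?thesis by blast
qed

end

section \<open>Rate of convergence\<close>

text \<open>The first quantity is the price of a finest scale above that of single sites. In the
  second the log k from concentration is paid by the averaging gain: log k (log k)^(-(1 + \<gamma>)
  (1 - \<alpha> / d)) is at most (log k)^(\<alpha> (1 + \<gamma>) / d) because \<gamma> > 0.\<close>

lemma jsc_powr_bounds:
  fixes \<alpha> \<gamma> :: real
  assumes k: "3 \<le> k" and \<gamma>: "0 < \<gamma>" and \<alpha>: "0 < \<alpha>" "\<alpha> < real d"
  shows "(2 powr (real (jsc \<gamma> d k) * \<alpha> / 2))\<^sup>2 \<le> 2 powr \<alpha> * ln (real k) powr (\<alpha> * (1 + \<gamma>) / real d)"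
    "ln (real k) * (2 powr (- (real (jsc \<gamma> d k) * (real d - \<alpha>) / 2)))\<^sup>2 \<le> ln (real k) powr (\<alpha> * (1 + \<gamma>) / real d)"
proof -
  define l where "l = ln (real k)"
  define J where "J = jsc \<gamma> d k"
  have l: "1 \<le> l" unfolding l_def by (rule ln_ge_1[OF k])
  have e: "(2 powr (real J * q / 2))\<^sup>2 = (2 ^ J) powr q" for q :: real
  proof -
    have "(2 powr (real J * q / 2))\<^sup>2 = 2 powr (real J * q)" by (simp add: powr_power2)
    also have "\<dots> = (2 powr real J) powr q" by (simp only: powr_powr)
    also have "2 powr real J = 2 ^ J" by (simp add: powr_realpow)
    finally show ?thesis .
  qed
  note jb = jsc_bounds[OF k \<gamma>, of d, folded l_def J_def]
  have "(2 ^ J) powr \<alpha> \<le> (2 * l powr ((1 + \<gamma>) / real d)) powr \<alpha>" using jb \<alpha> by (intro powr_mono2) auto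
  also have "\<dots> = 2 powr \<alpha> * l powr (\<alpha> * (1 + \<gamma>) / real d)" by (simp add: powr_mult powr_powr mult.commute)
  finally show "(2 powr (real (jsc \<gamma> d k) * \<alpha> / 2))\<^sup>2 \<le> 2 powr \<alpha> * ln (real k) powr (\<alpha> * (1 + \<gamma>) / real d)"
    unfolding J_def[symmetric] l_def[symmetric] e .
  have "(2 powr (real J * (- (real d - \<alpha>)) / 2))\<^sup>2 = (2 ^ J) powr (- (real d - \<alpha>))" by (rule e)
  also have "\<dots> \<le> (l powr ((1 + \<gamma>) / real d)) powr (- (real d - \<alpha>))"
    using jb \<alpha> l by (intro powr_mono2') auto
  also have "\<dots> = l powr (\<alpha> * (1 + \<gamma>) / real d - (1 + \<gamma>))"
  proof -
    have "(1 + \<gamma>) / real d * (- (real d - \<alpha>)) = \<alpha> * (1 + \<gamma>) / real d - (1 + \<gamma>)" using \<alpha> by (simp add: field_simps)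
    then show ?thesis by (simp only: powr_powr)
  qed
  also have "\<dots> \<le> l powr (\<alpha> * (1 + \<gamma>) / real d - 1)" using l \<gamma> by (intro powr_mono) auto
  finally have "l * (2 powr (real J * (- (real d - \<alpha>)) / 2))\<^sup>2 \<le> l * l powr (\<alpha> * (1 + \<gamma>) / real d - 1)"
    using l by (intro mult_left_mono) auto
  also have "\<dots> = l powr 1 * l powr (\<alpha> * (1 + \<gamma>) / real d - 1)" using l by simp
  also have "\<dots> = l powr (\<alpha> * (1 + \<gamma>) / real d)" by (simp only: powr_add[symmetric]) simp
  also have "real J * (- (real d - \<alpha>)) / 2 = - (real J * (real d - \<alpha>) / 2)"
    by (simp only: mult_minus_right minus_divide_left)
  finally show "ln (real k) * (2 powr (- (real (jsc \<gamma> d k) * (real d - \<alpha>) / 2)))\<^sup>2 \<le> ln (real k) powr (\<alpha> * (1 + \<gamma>) / real d)"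
    unfolding J_def l_def .
qed

lemma msc_powr_bound:
  assumes k: "1 \<le> k"
  shows "(2 powr (- (real (msc k * d) / 2)))\<^sup>2 \<le> real k powr (- 2 * real d)"
proof -
  have "(2 powr (- (real (msc k * d) / 2)))\<^sup>2 = 2 powr (real (msc k) * (- real d))" by (simp add: powr_power2)
  also have "\<dots> = (2 powr real (msc k)) powr (- real d)" by (simp only: powr_powr)
  also have "\<dots> = (2 ^ msc k) powr (- real d)" by (simp add: powr_realpow)
  also have "\<dots> \<le> ((real k)\<^sup>2) powr (- real d)" using msc_bounds[OF k] k by (intro powr_mono2') auto
  also have "\<dots> = (real k powr 2) powr (- real d)" using k by simp
  also have "\<dots> = real k powr (- 2 * real d)" by (simp only: powr_powr) simp
  finally show ?thesis .
qed

context conductances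
begin

text \<open>From k = 2 L + 3 on, L \<le> k, the support is well inside the box, and log k \<ge> 1.
  All squares are compared with \<open>kd\<close>, the number of sites per unit volume, so that
  dividing by it gives the squared distance in Lebesgue measure.\<close>

lemma good_event_error:
  fixes g :: "real ^ 'n \<Rightarrow> real"
  assumes g: "g \<in> Cc_inf" and \<alpha>: "0 < \<alpha>" "\<alpha> < 2" "\<alpha> < real CARD('n)" and lam: "0 < lam" and \<gamma>: "0 < \<gamma>" and \<kappa>: "0 \<le> \<kappa>"
  shows "\<exists>C>0. \<exists>K1. \<forall>k\<ge>K1. \<forall>\<omega>\<in>space P. jsc \<gamma> CARD('n) k \<le> msc k \<longrightarrow> good1 (jsc \<gamma> CARD('n) k) (msc k) \<omega> \<longrightarrow>
    good2 k (msc k) (real CARD('n) + \<alpha>) (\<kappa> * ln (real k)) \<omega> \<longrightarrow>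
    L2_dist_sq (Rk w k \<alpha> \<omega> lam (\<lambda>x. lam * g x - Lbar \<alpha> g x)) (Rbar \<alpha> lam (\<lambda>x. lam * g x - Lbar \<alpha> g x))
      \<le> ennreal (C * (rate CARD('n) \<alpha> \<gamma> k)\<^sup>2)"
proof -
  define d where "d = real CARD('n)"
  have d1: "1 \<le> d" by (simp add: d_def Suc_leI)
  \<comment> \<open>\<open>avg_fluct_bound\<close> asks for an order at most 2 and below d + 2
    \<alpha>.\<close>
  define \<theta> where "\<theta> = min 2 (d + 3 * \<alpha> / 2)"
  define \<beta> where "\<beta> = \<alpha> * (1 + \<gamma>) / d"
  obtain b L where b: "0 \<le> b" "1 \<le> L" "\<And>x. real L < norm x \<Longrightarrow> g x = 0" "\<And>x y. \<bar>g x - g y\<bar> \<le> b * norm (x - y)"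
    "\<And>k. 1 \<le> k \<Longrightarrow> lipc k b (real L) (\<lambda>z. g (lat_pt k z))"
    using Cc_inf_lipc[OF g] by blast
  define F where "F k \<omega> = fluct w (d + \<alpha>) (\<lambda>z. g (lat_pt k z)) \<omega>" for k \<omega>
  define err where "err k \<omega> = L2_dist_sq (Rk w k \<alpha> \<omega> lam (\<lambda>x. lam * g x - Lbar \<alpha> g x)) (Rbar \<alpha> lam (\<lambda>x. lam * g x - Lbar \<alpha> g x))" for k \<omega>
  obtain Cv where Cv: "0 \<le> Cv" "\<And>k \<omega>. 1 \<le> k \<Longrightarrow> \<omega> \<in> space P \<Longrightarrow> \<exists>h. (\<lambda>x. (h x)\<^sup>2) summable_on UNIV \<and>
    (\<forall>x. lam * h x - dominated_kernel.gen (kern k \<alpha> \<omega>) h x = real k powr \<alpha> * F k \<omega> x + psi k \<alpha> g x) \<and>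
    err k \<omega> \<le> ennreal (2 * ((\<Sum>\<^sub>\<infinity>z. (h z)\<^sup>2) / real k powr d) + Cv * real k powr (- 2))"
    using resolvent_error[OF g \<alpha>(1,2) lam] unfolding F_def d_def err_def by meson
  obtain C\<psi> where C\<psi>: "0 \<le> C\<psi>" "\<And>k. 1 \<le> k \<Longrightarrow> (\<lambda>x. (psi k \<alpha> g x)\<^sup>2) summable_on UNIV \<and>
      (\<Sum>\<^sub>\<infinity>x. (psi k \<alpha> g x)\<^sup>2) \<le> C\<psi> * real k powr (d + \<alpha> - 2)"
    using psi_square[OF g \<alpha>(1,2)] unfolding d_def by auto
  obtain Co where Co: "0 \<le> Co" "\<And>k m \<omega>. 2 * L \<le> k \<Longrightarrow> k ^ 2 \<le> 2 ^ m \<Longrightarrow> \<omega> \<in> space P \<Longrightarrow>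
    (\<lambda>x. (F k \<omega> x * indicator (- lam_box m) x)\<^sup>2) summable_on UNIV \<and>
    real k powr (2 * \<alpha>) * (\<Sum>\<^sub>\<infinity>x. (F k \<omega> x * indicator (- lam_box m) x)\<^sup>2) \<le> Co"
    using fluct_outside[OF b(5) b(2) \<alpha>(1)] unfolding F_def d_def by auto
  have "\<exists>C\<ge>0. \<forall>k m J. L \<le> k \<longrightarrow> J \<le> m \<longrightarrow> (\<forall>\<omega>\<in>space P. good2 k m (d + \<alpha>) (\<kappa> * ln (real k)) \<omega> \<longrightarrow>
    L2_set (avg J (F k \<omega>)) (lam_box m) \<le> C * sqrt (ln (real k)) * real k powr ((d - \<theta>) / 2) * 2 powr (- (real (J * CARD('n)) / 2)))"
    unfolding F_def d_def by (rule avg_fluct_bound[OF g b(2,3) \<alpha>(1) _ _ _ \<kappa>]) (use \<alpha> in \<open>auto simp: \<theta>_def d_def\<close>)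
  then obtain CU where CU: "0 \<le> CU" "\<And>k m J \<omega>. L \<le> k \<Longrightarrow> J \<le> m \<Longrightarrow> \<omega> \<in> space P \<Longrightarrow> good2 k m (d + \<alpha>) (\<kappa> * ln (real k)) \<omega> \<Longrightarrow>
    L2_set (avg J (F k \<omega>)) (lam_box m) \<le> CU * sqrt (ln (real k)) * real k powr ((d - \<theta>) / 2) * 2 powr (- (real (J * CARD('n)) / 2))"
    by blast
  \<comment> \<open>First-order increments are summable against the kernel only for \<alpha> > 1;
    the implication allows one constant \<open>CA\<close> in all cases.\<close>
  have "\<exists>CA\<ge>0. 1 < \<alpha> \<longrightarrow> (\<forall>k\<ge>1. \<forall>\<omega>\<in>space P. (\<lambda>x. (F k \<omega> x)\<^sup>2) summable_on UNIV \<and>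
      (\<Sum>\<^sub>\<infinity>x. (F k \<omega> x)\<^sup>2) \<le> CA * real k powr (d - 2 * 1))"
    using fluct_square[OF b(5) b(2), of 1 \<alpha>] unfolding F_def d_def by (cases "1 < \<alpha>") auto
  then obtain CA where CA: "0 \<le> CA" "\<And>k \<omega>. 1 < \<alpha> \<Longrightarrow> 1 \<le> k \<Longrightarrow> \<omega> \<in> space P \<Longrightarrow> (\<lambda>x. (F k \<omega> x)\<^sup>2) summable_on UNIV"
      "\<And>k \<omega>. 1 < \<alpha> \<Longrightarrow> 1 \<le> k \<Longrightarrow> \<omega> \<in> space P \<Longrightarrow> (\<Sum>\<^sub>\<infinity>x. (F k \<omega> x)\<^sup>2) \<le> CA * real k powr (d - 2)"
    by auto
  \<comment> \<open>Up to constants, k^(\<alpha> - d) times the square of the finest-scale bound on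
    F.\<close>
  define W where "W k = (if 1 < \<alpha> then real k powr (\<alpha> - 2) else ln (real k) * real k powr (\<alpha> - \<theta>))" for k :: nat
  obtain Cr where Cr: "0 < Cr" "\<And>k. 3 \<le> k \<Longrightarrow> W k * ln (real k) powr \<beta>
    + ln (real k) * real k powr (2 * \<alpha> - 2 * d - \<theta>) + real k powr (- d) + real k powr (\<alpha> - 2) + real k powr (- 2)
    \<le> Cr * (rate CARD('n) \<alpha> \<gamma> k)\<^sup>2"
    using rate_dominates[OF \<alpha> \<gamma> \<theta>_def[unfolded d_def]] unfolding W_def d_def \<beta>_def by auto
  define c0 where "c0 = 32 * M * d powr (d + \<alpha>)"
  \<comment> \<open>Sum of the geometric series over scales, including the shift by one
    level.\<close>
  define G where "G = 2 powr (\<alpha> / 2) / (1 - 2 powr (- ((d - \<alpha>) / 2)))"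
  define Ca where "Ca = 2 * c0 * ((CA + CU\<^sup>2) * 2 powr \<alpha> + G\<^sup>2 * CU\<^sup>2)"
  have c0: "0 \<le> c0" using M_pos by (simp add: c0_def)
  have Ca0: "0 \<le> Ca" using c0 CA(1) by (simp add: Ca_def)
  define D where "D = 2 / lam * (Ca / 4 + CU\<^sup>2 / lam + (2 * Co + 2 * C\<psi>) / lam)"
  have D0: "0 \<le> D" using Ca0 lam Co(1) C\<psi>(1) by (simp add: D_def)
  have main: "err k \<omega> \<le> ennreal ((2 * D + Cv + 1) * Cr * (rate CARD('n) \<alpha> \<gamma> k)\<^sup>2)"
    if k: "2 * L + 3 \<le> k" and \<omega>: "\<omega> \<in> space P" and jm: "jsc \<gamma> CARD('n) k \<le> msc k"
      and g1: "good1 (jsc \<gamma> CARD('n) k) (msc k) \<omega>" and g2: "good2 k (msc k) (d + \<alpha>) (\<kappa> * ln (real k)) \<omega>" for k \<omega>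
  proof -
    have k1: "1 \<le> k" and k3: "3 \<le> k" and k0: "0 < real k" and kL: "L \<le> k" "2 * L \<le> k" using k by auto
    define l where "l = ln (real k)"
    have l1: "1 \<le> l" unfolding l_def by (rule ln_ge_1[OF k3])
    define m where "m = msc k"
    define J0 where "J0 = jsc \<gamma> CARD('n) k"
    define kd where "kd = real k powr d"
    have kd0: "0 < kd" using k0 by (simp add: kd_def)
    obtain h where h: "(\<lambda>x. (h x)\<^sup>2) summable_on UNIV"
      "\<And>x. lam * h x - dominated_kernel.gen (kern k \<alpha> \<omega>) h x = real k powr \<alpha> * F k \<omega> x + psi k \<alpha> g x"
      "err k \<omega> \<le> ennreal (2 * ((\<Sum>\<^sub>\<infinity>z. (h z)\<^sup>2) / kd) + Cv * real k powr (- 2))"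
      using Cv(2)[OF k1 \<omega>] unfolding kd_def by blast
    \<comment> \<open>Localisation: F inside the box goes to the multiscale estimate, F outside
      joins the quadrature error in the remainder r.\<close>
    define T where "T x = F k \<omega> x * indicator (- lam_box m) x" for x
    define r where "r x = real k powr \<alpha> * T x + psi k \<alpha> g x" for x
    have "real (k ^ 2) \<le> real (2 ^ m)" using msc_bounds(1)[OF k1] by (simp add: m_def)
    then have km: "k ^ 2 \<le> 2 ^ m" by (simp only: of_nat_le_iff)
    note sT = Co(2)[OF kL(2) km \<omega>, folded T_def]
    note sT' = infsum_square_scale[OF conjunct1[OF sT], of "real k powr \<alpha>"]
    note s\<psi> = C\<psi>(2)[OF k1]
    have sr: "(\<lambda>x. (r x)\<^sup>2) summable_on UNIV"
      unfolding r_def by (rule infsum_square_add_le(1)[OF sT'(1) conjunct1[OF s\<psi>]])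
    have "(\<Sum>\<^sub>\<infinity>x. (r x)\<^sup>2) \<le> 2 * ((real k powr \<alpha>)\<^sup>2 * (\<Sum>\<^sub>\<infinity>x. (T x)\<^sup>2)) + 2 * (\<Sum>\<^sub>\<infinity>x. (psi k \<alpha> g x)\<^sup>2)"
      unfolding r_def sT'(2)[symmetric] by (rule infsum_square_add_le(2)[OF sT'(1) conjunct1[OF s\<psi>]])
    also have "\<dots> \<le> 2 * Co + 2 * (C\<psi> * real k powr (d + \<alpha> - 2))"
      unfolding powr_power2 using sT s\<psi> by (intro add_mono mult_left_mono) auto
    also have "\<dots> = kd * (2 * Co * real k powr (- d) + 2 * C\<psi> * real k powr (\<alpha> - 2))"
    proof -
      have e: "kd * real k powr (- d) = 1" "kd * real k powr (\<alpha> - 2) = real k powr (d + \<alpha> - 2)"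
        unfolding kd_def using k0 by (simp_all add: algebra_simps flip: powr_add)
      have "kd * (2 * Co * real k powr (- d) + 2 * C\<psi> * real k powr (\<alpha> - 2))
        = 2 * Co * (kd * real k powr (- d)) + 2 * (C\<psi> * (kd * real k powr (\<alpha> - 2)))"
        by (simp only: distrib_left mult_ac)
      then show ?thesis unfolding e by simp
    qed
    also have "\<dots> \<le> kd * ((2 * Co + 2 * C\<psi>) * (real k powr (- d) + real k powr (\<alpha> - 2)))"
      using kd0 Co(1) C\<psi>(1) by (intro mult_left_mono) (auto simp: algebra_simps)
    finally have R: "(\<Sum>\<^sub>\<infinity>x. (r x)\<^sup>2) \<le> kd * ((2 * Co + 2 * C\<psi>) * (real k powr (- d) + real k powr (\<alpha> - 2)))" .
    define U where "U = CU * sqrt l * real k powr ((d - \<theta>) / 2)"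
    have U0: "0 \<le> U" using CU(1) l1 by (simp add: U_def)
    have U: "L2_set (avg J (F k \<omega>)) (lam_box m) \<le> U * 2 powr (- (real (J * CARD('n)) / 2))" if "J \<le> m" for J
      unfolding U_def l_def m_def by (rule CU(2)[OF kL(1) _ \<omega> g2]) (use that in \<open>simp add: m_def\<close>)
    have U2: "real k powr q * U\<^sup>2 = kd * CU\<^sup>2 * (l * real k powr (q - \<theta>))" for q
    proof -
      have "U\<^sup>2 = CU\<^sup>2 * l * real k powr (d - \<theta>)" using l1 by (simp add: U_def power_mult_distrib powr_power2 diff_divide_distrib)
      moreover have e: "real k powr q * real k powr (d - \<theta>) = kd * real k powr (q - \<theta>)"
        unfolding kd_def powr_add[symmetric] by (rule arg_cong[of _ _ "\<lambda>t. real k powr t"]) simp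
      ultimately have "real k powr q * U\<^sup>2 = CU\<^sup>2 * l * (kd * real k powr (q - \<theta>))"
        by (simp only: mult_ac e[symmetric])
      then show ?thesis by (simp only: mult_ac)
    qed
    \<comment> \<open>For \<alpha> \<le> 1 the bound is the case J = 0 of the concentration
      estimate, where cubes are single sites and \<open>avg\<close> is the identity.\<close>
    define A where "A = (if 1 < \<alpha> then sqrt (CA * real k powr (d - 2)) else U)"
    have A: "L2_set (F k \<omega>) (lam_box m) \<le> A"
    proof (cases "1 < \<alpha>")
      case True
      have "(\<Sum>x\<in>lam_box m. (F k \<omega> x)\<^sup>2) \<le> (\<Sum>\<^sub>\<infinity>x. (F k \<omega> x)\<^sup>2)"
        by (rule finite_sum_le_infsum[OF CA(2)[OF True k1 \<omega>]]) auto
      then have "(\<Sum>x\<in>lam_box m. (F k \<omega> x)\<^sup>2) \<le> CA * real k powr (d - 2)" using CA(3)[OF True k1 \<omega>] by linarith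
      then show ?thesis using True by (simp add: A_def L2_set_def)
    next
      case False
      then show ?thesis using U[of 0] by (simp add: A_def avg_0)
    qed
    have W0: "real k powr (\<alpha> - \<theta>) \<le> W k"
    proof (cases "1 < \<alpha>")
      case True
      then have "1 < CARD('n)" using \<alpha>(3) by linarith
      then have "2 \<le> d" by (simp add: d_def)
      then have "\<theta> = 2" using True by (simp add: \<theta>_def)
      then show ?thesis using True by (simp add: W_def)
    next
      case False
      then show ?thesis using mult_right_mono[OF l1, of "real k powr (\<alpha> - \<theta>)"] by (simp add: W_def l_def)
    qed
    have Wn: "0 \<le> W k" using W0 powr_ge_zero[of "real k" "\<alpha> - \<theta>"] by linarith
    have A2: "real k powr \<alpha> * A\<^sup>2 \<le> kd * (CA + CU\<^sup>2) * W k"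
    proof (cases "1 < \<alpha>")
      case True
      have "real k powr \<alpha> * A\<^sup>2 = CA * (real k powr \<alpha> * real k powr (d - 2))" using True CA(1) by (simp add: A_def)
      also have "real k powr \<alpha> * real k powr (d - 2) = kd * W k"
        unfolding kd_def W_def using True by (simp add: algebra_simps flip: powr_add)
      also have "CA * (kd * W k) \<le> (CA + CU\<^sup>2) * (kd * W k)" using kd0 Wn by (intro mult_right_mono) auto
      finally show ?thesis by (simp add: mult_ac)
    next
      case False
      have "real k powr \<alpha> * A\<^sup>2 = CU\<^sup>2 * (kd * W k)" using False U2[of \<alpha>] by (simp add: A_def W_def l_def)
      also have "\<dots> \<le> (CA + CU\<^sup>2) * (kd * W k)" using kd0 Wn CA(1) by (intro mult_right_mono) auto
      finally show ?thesis by (simp add: mult_ac)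
    qed
    define Q where "Q = 2 powr (real J0 * \<alpha> / 2)"
    define q where "q = 2 powr (- (real J0 * (d - \<alpha>) / 2))"
    define a1 where "a1 = sqrt c0 * real k powr (\<alpha> / 2) * (A * Q + U * G * q)"
    define b1 where "b1 = real k powr \<alpha> * (U * 2 powr (- (real (m * CARD('n)) / 2)))"
    have Q2: "Q\<^sup>2 \<le> 2 powr \<alpha> * l powr \<beta>" and q2: "l * q\<^sup>2 \<le> l powr \<beta>"
      unfolding Q_def q_def J0_def l_def \<beta>_def d_def by (rule jsc_powr_bounds[OF k3 \<gamma> \<alpha>(1,3)])+
    have a1: "a1\<^sup>2 \<le> kd * (Ca * (W k * l powr \<beta>))"
    proof -
      have le: "(x + y)\<^sup>2 \<le> 2 * (x\<^sup>2 + y\<^sup>2)" for x y :: real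
        using zero_le_power2[of "x - y"] by (simp add: power2_eq_square algebra_simps)
      have "a1\<^sup>2 = c0 * real k powr \<alpha> * (A * Q + U * G * q)\<^sup>2"
        using c0 by (simp add: a1_def power_mult_distrib powr_power2)
      also have "\<dots> \<le> c0 * real k powr \<alpha> * (2 * ((A * Q)\<^sup>2 + (U * G * q)\<^sup>2))"
        using c0 by (intro mult_left_mono le) auto
      also have "\<dots> = 2 * c0 * ((real k powr \<alpha> * A\<^sup>2) * Q\<^sup>2 + G\<^sup>2 * ((real k powr \<alpha> * U\<^sup>2) * q\<^sup>2))"
        by (simp add: power_mult_distrib algebra_simps)
      also have "\<dots> \<le> 2 * c0 * (kd * (CA + CU\<^sup>2) * W k * (2 powr \<alpha> * l powr \<beta>) + G\<^sup>2 * (kd * CU\<^sup>2 * (W k * l powr \<beta>)))"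
      proof (intro mult_left_mono add_mono)
        show "(real k powr \<alpha> * A\<^sup>2) * Q\<^sup>2 \<le> kd * (CA + CU\<^sup>2) * W k * (2 powr \<alpha> * l powr \<beta>)"
          using kd0 CA(1) Wn by (intro mult_mono A2 Q2) auto
        have "(real k powr \<alpha> * U\<^sup>2) * q\<^sup>2 = kd * CU\<^sup>2 * (real k powr (\<alpha> - \<theta>) * (l * q\<^sup>2))"
          unfolding U2 by (simp only: mult_ac)
        also have "\<dots> \<le> kd * CU\<^sup>2 * (W k * l powr \<beta>)"
          using kd0 Wn l1 by (intro mult_left_mono mult_mono W0 q2) auto
        finally show "(real k powr \<alpha> * U\<^sup>2) * q\<^sup>2 \<le> kd * CU\<^sup>2 * (W k * l powr \<beta>)" .
      qed (use c0 in auto)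
      also have "\<dots> = kd * (Ca * (W k * l powr \<beta>))" by (simp add: Ca_def algebra_simps)
      finally show ?thesis .
    qed
    have b1: "b1\<^sup>2 \<le> kd * (CU\<^sup>2 * (l * real k powr (2 * \<alpha> - 2 * d - \<theta>)))"
    proof -
      have "b1\<^sup>2 = (real k powr (2 * \<alpha>) * U\<^sup>2) * (2 powr (- (real (m * CARD('n)) / 2)))\<^sup>2"
        by (simp only: b1_def power_mult_distrib powr_power2 mult_ac)
      also have "\<dots> \<le> (real k powr (2 * \<alpha>) * U\<^sup>2) * real k powr (- 2 * d)"
        unfolding m_def d_def by (intro mult_left_mono msc_powr_bound[OF k1]) auto
      also have "\<dots> = kd * CU\<^sup>2 * (l * (real k powr (2 * \<alpha> - \<theta>) * real k powr (- 2 * d)))"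
        unfolding U2 by (simp only: mult_ac)
      also have "real k powr (2 * \<alpha> - \<theta>) * real k powr (- 2 * d) = real k powr (2 * \<alpha> - 2 * d - \<theta>)"
        unfolding powr_add[symmetric] by (rule arg_cong[of _ _ "\<lambda>t. real k powr t"]) simp
      finally show ?thesis by (simp only: mult_ac)
    qed
    have "(\<Sum>\<^sub>\<infinity>x. (h x)\<^sup>2) \<le> 2 / lam * (a1\<^sup>2 / 4 + b1\<^sup>2 / lam + (\<Sum>\<^sub>\<infinity>x. (r x)\<^sup>2) / lam)"
    proof (rule energy_estimate[OF \<alpha>(1,3) lam \<omega> k1 g1 jm h(1) sr _ _ U0])
      show "lam * h x - dominated_kernel.gen (kern k \<alpha> \<omega>) h x = real k powr \<alpha> * F k \<omega> x * indicator (lam_box (msc k)) x + r x" for x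
        unfolding h(2) r_def T_def m_def[symmetric] by (cases "x \<in> lam_box m") auto
      show "L2_set (F k \<omega>) (lam_box (msc k)) \<le> A" using A by (simp add: m_def)
      show "L2_set (avg J (F k \<omega>)) (lam_box (msc k)) \<le> U * 2 powr (- (real (J * CARD('n)) / 2))" if "J \<le> msc k" for J
        using U[of J] that by (simp add: m_def)
    qed (simp_all add: a1_def b1_def c0_def G_def Q_def q_def J0_def m_def d_def)
    also have "\<dots> \<le> 2 / lam * (kd * (Ca * (W k * l powr \<beta>)) / 4 + kd * (CU\<^sup>2 * (l * real k powr (2 * \<alpha> - 2 * d - \<theta>))) / lam
      + kd * ((2 * Co + 2 * C\<psi>) * (real k powr (- d) + real k powr (\<alpha> - 2))) / lam)"
      using lam by (intro mult_left_mono add_mono divide_right_mono a1 b1 R) auto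
    also have "\<dots> = (2 / lam * (Ca / 4 * (W k * l powr \<beta>) + CU\<^sup>2 / lam * (l * real k powr (2 * \<alpha> - 2 * d - \<theta>))
      + (2 * Co + 2 * C\<psi>) / lam * (real k powr (- d) + real k powr (\<alpha> - 2)))) * kd"
    proof -
      have "2 / lam * (kd * (t * x) / 4 + kd * (u * y) / lam + kd * (v * z) / lam)
        = (2 / lam * (t / 4 * x + u / lam * y + v / lam * z)) * kd" for t u v x y z :: real
        by (simp add: algebra_simps add_divide_distrib)
      then show ?thesis .
    qed
    finally have H: "(\<Sum>\<^sub>\<infinity>x. (h x)\<^sup>2) / kd \<le> 2 / lam * (Ca / 4 * (W k * l powr \<beta>) + CU\<^sup>2 / lam * (l * real k powr (2 * \<alpha> - 2 * d - \<theta>))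
      + (2 * Co + 2 * C\<psi>) / lam * (real k powr (- d) + real k powr (\<alpha> - 2)))"
      using kd0 by (simp only: pos_divide_le_eq)
    define S where "S = W k * l powr \<beta> + l * real k powr (2 * \<alpha> - 2 * d - \<theta>) + real k powr (- d) + real k powr (\<alpha> - 2) + real k powr (- 2)"
    have n: "0 \<le> W k * l powr \<beta>" "0 \<le> l * real k powr (2 * \<alpha> - 2 * d - \<theta>)" using Wn l1 by auto
    have "2 / lam * (Ca / 4 * (W k * l powr \<beta>) + CU\<^sup>2 / lam * (l * real k powr (2 * \<alpha> - 2 * d - \<theta>))
      + (2 * Co + 2 * C\<psi>) / lam * (real k powr (- d) + real k powr (\<alpha> - 2)))
      \<le> 2 / lam * (Ca / 4 * S + CU\<^sup>2 / lam * S + (2 * Co + 2 * C\<psi>) / lam * S)"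
      using lam Ca0 Co(1) C\<psi>(1) n by (intro mult_left_mono add_mono) (auto simp: S_def)
    also have "\<dots> = D * S" by (simp only: D_def distrib_right mult.assoc)
    finally have HS: "(\<Sum>\<^sub>\<infinity>x. (h x)\<^sup>2) / kd \<le> D * S" using H by linarith
    have "real k powr (- 2) \<le> S" "0 \<le> S" using n by (auto simp: S_def)
    then have "Cv * real k powr (- 2) \<le> Cv * S" using Cv(1) by (intro mult_left_mono) auto
    then have "2 * ((\<Sum>\<^sub>\<infinity>z. (h z)\<^sup>2) / kd) + Cv * real k powr (- 2) \<le> (2 * D + Cv + 1) * S"
      using HS \<open>0 \<le> S\<close> by (simp add: algebra_simps)
    also have "\<dots> \<le> (2 * D + Cv + 1) * (Cr * (rate CARD('n) \<alpha> \<gamma> k)\<^sup>2)"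
      unfolding S_def l_def using D0 Cv(1) by (intro mult_left_mono Cr(2)[OF k3]) auto
    finally show ?thesis using h(3) by (auto intro!: order_trans[OF h(3)] ennreal_leI simp: mult.assoc)
  qed
  have "0 < (2 * D + Cv + 1) * Cr" using D0 Cv(1) Cr(1) by (intro mult_pos_pos) auto
  then show ?thesis using main unfolding err_def d_def by blast
qed

end

section \<open>The almost sure statement\<close>

lemma rate_pos:
  assumes "3 \<le> k"
  shows "0 < rate d \<alpha> \<gamma> k"
  using ln_ge_1[OF assms] assms by (simp add: rate_def)

theorem theorem1p1:
  fixes P :: "'w measure"
    and w :: "(int ^ 'n) set \<Rightarrow> 'w \<Rightarrow> real"
    and \<alpha> lam \<gamma> M :: real
  assumes alpha: "0 < \<alpha>" "\<alpha> < 2" "\<alpha> < real CARD('n)"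
    and prob: "prob_space P"
    and indep: "prob_space.indep_vars P (\<lambda>_. borel) w lat_edges"
    and ident: "\<exists>\<mu>. \<forall>e \<in> lat_edges. distr P borel (w e) = \<mu>"
    and mean: "\<forall>e \<in> lat_edges. prob_space.expectation P (w e) = 1"
    and bdd: "0 < M" "\<forall>e \<in> lat_edges. \<forall>\<omega> \<in> space P. 0 \<le> w e \<omega> \<and> w e \<omega> \<le> M"
    and lampos: "0 < lam" and gam: "0 < \<gamma>"
  shows "\<exists>k0 :: 'w \<Rightarrow> ereal.
           k0 \<in> borel_measurable P \<and> (\<forall>\<omega>. 1 \<le> k0 \<omega>) \<and> (AE \<omega> in P. k0 \<omega> < \<infinity>) \<and>
           (\<forall>f \<in> S0 \<alpha> lam. \<exists>C0 > 0. AE \<omega> in P. \<forall>k :: nat. ereal (real k) > k0 \<omega> \<longrightarrow>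
               L2_dist_sq (Rk w k \<alpha> \<omega> lam f) (Rbar \<alpha> lam f)
                 \<le> ennreal ((C0 * rate CARD('n) \<alpha> \<gamma> k)\<^sup>2))"
proof -
  interpret conductances P w M
    by (intro conductances.intro conductances_axioms.intro prob) (use indep mean bdd in auto)
  define \<kappa> where "\<kappa> = 4 * real CARD('n) + 5"
  define good where "good k \<omega> \<longleftrightarrow> jsc \<gamma> CARD('n) k \<le> msc k \<and> good1 (jsc \<gamma> CARD('n) k) (msc k) \<omega> \<and>
    good2 k (msc k) (real CARD('n) + \<alpha>) (\<kappa> * ln (real k)) \<omega>" for k \<omega>
  obtain k2 and C :: real where k2: "3 \<le> k2" and "\<And>k. k2 \<le> k \<Longrightarrow> \<exists>A\<in>events. prob A \<le> C * real k powr (- 2) \<and> (\<forall>\<omega>\<in>space P - A. good k \<omega>)"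
    using good_event_prob[OF alpha(1) gam \<kappa>_def] unfolding good_def by blast
  then obtain A where A: "\<And>k. k2 \<le> k \<Longrightarrow> A k \<in> events" "\<And>k. k2 \<le> k \<Longrightarrow> prob (A k) \<le> C * real k powr (- 2)"
    "\<And>k \<omega>. k2 \<le> k \<Longrightarrow> \<omega> \<in> space P - A k \<Longrightarrow> good k \<omega>"
    by metis
  define B where "B k = (if k2 \<le> k then A k else {})" for k
  have B [measurable]: "B k \<in> events" for k using A(1) by (simp add: B_def)
  have "summable (\<lambda>k. C * real k powr (- 2))" by (intro summable_mult) (simp add: summable_real_powr_iff)
  moreover have "norm (prob (B k)) \<le> C * real k powr (- 2)" if "k2 \<le> k" for k using A(2)[OF that] that by (simp add: B_def)
  ultimately have "summable (\<lambda>k. prob (B k))" by (rule summable_comparison_test')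
  then have bc: "AE \<omega> in P. eventually (\<lambda>k. \<omega> \<in> space P - B k) sequentially"
    by (intro borel_cantelli_AE1) (auto simp: emeasure_eq_measure)
  \<comment> \<open>The supremum of the bad indices, measurable as a countable supremum; no bad
    event occurs at any k above it. The maximum with k2 \<ge> 3 gives k0 \<ge> 1 and keeps the rate
    positive for k > k0.\<close>
  define k0 where "k0 \<omega> = max (ereal (real k2)) (SUP k. if \<omega> \<in> B k then ereal (real k) else 0)" for \<omega>
  have "k0 \<in> borel_measurable P" unfolding k0_def[abs_def] by measurable
  moreover have "1 \<le> k0 \<omega>" for \<omega> using k2 by (auto simp: k0_def le_max_iff_disj)
  moreover have "AE \<omega> in P. k0 \<omega> < \<infinity>"
    using bc
  proof eventually_elim
    case (elim \<omega>)
    then obtain N where N: "\<And>k. N \<le> k \<Longrightarrow> \<omega> \<notin> B k" unfolding eventually_sequentially by auto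
    have "(SUP k. if \<omega> \<in> B k then ereal (real k) else 0) \<le> ereal (real N)"
    proof (rule SUP_least)
      fix k
      show "(if \<omega> \<in> B k then ereal (real k) else 0) \<le> ereal (real N)" using N[of k] by (cases "N \<le> k") auto
    qed
    then have "k0 \<omega> \<le> max (ereal (real k2)) (ereal (real N))" unfolding k0_def by (intro max.mono order_refl)
    then show ?case by (rule order_le_less_trans) (simp add: max_def)
  qed
  moreover have "\<exists>C0>0. AE \<omega> in P. \<forall>k :: nat. ereal (real k) > k0 \<omega> \<longrightarrow>
    L2_dist_sq (Rk w k \<alpha> \<omega> lam f) (Rbar \<alpha> lam f) \<le> ennreal ((C0 * rate CARD('n) \<alpha> \<gamma> k)\<^sup>2)" if fS: "f \<in> S0 \<alpha> lam" for f
  proof -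
    obtain g where g: "g \<in> Cc_inf" and f: "f = (\<lambda>x. lam * g x - Lbar \<alpha> g x)" using fS by (auto simp: S0_def)
    have "0 \<le> \<kappa>" by (simp add: \<kappa>_def)
    obtain C1 K1 where C1: "0 < C1" "\<And>k \<omega>. K1 \<le> k \<Longrightarrow> \<omega> \<in> space P \<Longrightarrow> good k \<omega> \<Longrightarrow>
      L2_dist_sq (Rk w k \<alpha> \<omega> lam f) (Rbar \<alpha> lam f) \<le> ennreal (C1 * (rate CARD('n) \<alpha> \<gamma> k)\<^sup>2)"
      using good_event_error[OF g alpha lampos gam \<open>0 \<le> \<kappa>\<close>] unfolding f good_def by blast
    obtain c where c: "\<And>k. 1 \<le> k \<Longrightarrow> 0 \<le> c k" "\<And>k \<omega>. 1 \<le> k \<Longrightarrow> \<omega> \<in> space P \<Longrightarrow>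
      L2_dist_sq (Rk w k \<alpha> \<omega> lam f) (Rbar \<alpha> lam f) \<le> ennreal (c k)"
      using resolvent_error_bounded[OF g alpha(1,2) lampos] unfolding f by metis
    \<comment> \<open>For 3 \<le> k < K1 the deterministic bounds \<open>c k\<close> are divided by
      the squared rate, positive there; adding the quotients to C1 makes one constant valid for all
      k. K1 and c depend on g, whereas k0 does not.\<close>
    define \<Sigma> where "\<Sigma> = (\<Sum>k\<in>{3..<K1}. c k / (rate CARD('n) \<alpha> \<gamma> k)\<^sup>2)"
    have \<Sigma>0: "0 \<le> \<Sigma>" unfolding \<Sigma>_def by (intro sum_nonneg divide_nonneg_nonneg c(1)) auto
    define C0 where "C0 = sqrt (C1 + \<Sigma>)"
    have C0: "0 < C0" "C0\<^sup>2 = C1 + \<Sigma>" using C1(1) \<Sigma>0 by (simp_all add: C0_def)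
    have "L2_dist_sq (Rk w k \<alpha> \<omega> lam f) (Rbar \<alpha> lam f) \<le> ennreal ((C0 * rate CARD('n) \<alpha> \<gamma> k)\<^sup>2)"
      if \<omega>: "\<omega> \<in> space P" and k: "k0 \<omega> < ereal (real k)" for \<omega> k
    proof -
      have kk: "k2 \<le> k" "(SUP k. if \<omega> \<in> B k then ereal (real k) else 0) < ereal (real k)" using k by (auto simp: k0_def)
      have k3: "3 \<le> k" using kk(1) k2 by simp
      show ?thesis
      proof (cases "K1 \<le> k")
        case True
        have "\<omega> \<notin> B k"
        proof
          assume "\<omega> \<in> B k"
          then have "ereal (real k) \<le> (SUP k. if \<omega> \<in> B k then ereal (real k) else 0)"
            by (intro SUP_upper2[of k]) auto
          then show False using kk(2) by simp
        qed
        then have "good k \<omega>" using A(3)[OF kk(1)] \<omega> kk(1) by (simp add: B_def)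
        from C1(2)[OF True \<omega> this] show ?thesis
          by (rule order_trans) (use \<Sigma>0 in \<open>auto intro!: ennreal_leI mult_right_mono simp: power_mult_distrib C0\<close>)
      next
        case False
        have r: "0 < (rate CARD('n) \<alpha> \<gamma> k)\<^sup>2" by (rule zero_less_power[OF rate_pos[OF k3]])
        have "c k / (rate CARD('n) \<alpha> \<gamma> k)\<^sup>2 \<le> \<Sigma>" unfolding \<Sigma>_def
          by (rule member_le_sum) (use False k3 c(1) in auto)
        also have "\<dots> \<le> C0\<^sup>2" using C0(2) C1(1) by simp
        finally have "c k \<le> (C0 * rate CARD('n) \<alpha> \<gamma> k)\<^sup>2" using r by (simp add: power_mult_distrib pos_divide_le_eq)
        then show ?thesis using k3 by (intro order_trans[OF c(2)[OF _ \<omega>]] ennreal_leI) auto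
      qed
    qed
    then show ?thesis using C0(1) by (intro exI[of _ C0] conjI AE_I2) auto
  qed
  ultimately show ?thesis by blast
qed

end
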